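(* Let $m$ be a positive even integer such that $m-1$ and $m+1$ are both prime and $m^2+1$ is square-free, and let $E_m$ be the elliptic curve over $\mathbb{Q}$ given by $$E_m:\ y^2 = x\bigl(x-(m^2+1)^2\bigr)\bigl(x+(m^2-1)^2\bigr)+\bigl(2m(m^4-1)\bigr)^2 .$$ Then $E_m(\mathbb{Q})_{\mathrm{tors}}\simeq \mathbb{Z}/2\mathbb{Z}\times\mathbb{Z}/2\mathbb{Z}$ and the Mordell--Weil rank satisfies $r(E_m)\ge 2$. Moreover, $s_2(E_m)\ge w$, where $w$ denotes the number of prime factors $p$ of $m^4-1$ satisfying the following condition: (a) if $p\equiv 1 \pmod 4$, then $\left(\frac{p}{q}\right)=\left(\frac{p}{r}\right)=1$ for every prime factor $q$ of $m^4-1-4m^2$ and every prime factor $r$ of $m^4-1+4m^2$; (b) if $p\equiv 3\pmod 4$, then $\left(\frac{p}{q}\right)=\left(\frac{-p}{r}\right)=1$ for every prime factor $q$ of $m^4-1-4m^2$ and every prime factor $r$ of $m^4-1+4m^2$.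
   Context: $r(E)$ denotes the rank of the finitely generated abelian group $E(\mathbb{Q})$. The $2$-Selmer rank $s_2(E_m)$ is defined by $|\mathrm{Sel}_2(E_m)|=2^{2+s_2(E_m)}$, where $\mathrm{Sel}_2(E_m)$ is the $2$-Selmer group of $E_m$ over $\mathbb{Q}$. $\left(\frac{a}{\ell}\right)$ is the Legendre symbol. The curve can also be written $E_m: y^2=(x-(m^4-1))(x+(m^4-1))(x-4m^2)$. *)

theory Defs
  imports
    "HOL-Algebra.Algebra"
    "HOL-Algebra.Algebraic_Closure_Type"
    "HOL-Number_Theory.Number_Theory"
    "HOL-Library.Extended_Nat"
begin

text \<open>The curve $y^2 = x^3 + a_2 x^2 + a_4 x + a_6$. Its coefficients are integers so that the
  same curve can be considered over any field; an integer is sent into a ring through the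
  multiples of its unit.\<close>

record cubic_curve =
  coeff_a2 :: int
  coeff_a4 :: int
  coeff_a6 :: int

definition int_in :: "'a ring \<Rightarrow> int \<Rightarrow> 'a" where
  "int_in R k = add_pow R k \<one>\<^bsub>R\<^esub>"

datatype 'a ec_point = Infinity | Affine 'a 'a

definition ec_carrier :: "'a ring \<Rightarrow> cubic_curve \<Rightarrow> 'a ec_point set" where
  "ec_carrier R E = insert Infinity {Affine x y |x y.
     x \<in> carrier R \<and> y \<in> carrier R \<and>
     y [^]\<^bsub>R\<^esub> (2::nat) =
       x [^]\<^bsub>R\<^esub> (3::nat) \<oplus>\<^bsub>R\<^esub> int_in R (coeff_a2 E) \<otimes>\<^bsub>R\<^esub> x [^]\<^bsub>R\<^esub> (2::nat)
         \<oplus>\<^bsub>R\<^esub> int_in R (coeff_a4 E) \<otimes>\<^bsub>R\<^esub> x \<oplus>\<^bsub>R\<^esub> int_in R (coeff_a6 E)}"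

text \<open>Chord-and-tangent addition (over a field of characteristic different from 2).\<close>

definition ec_slope :: "'a ring \<Rightarrow> cubic_curve \<Rightarrow> 'a \<Rightarrow> 'a \<Rightarrow> 'a \<Rightarrow> 'a \<Rightarrow> 'a" where
  "ec_slope R E x1 y1 x2 y2 =
     (if x1 = x2
      then (int_in R 3 \<otimes>\<^bsub>R\<^esub> x1 [^]\<^bsub>R\<^esub> (2::nat) \<oplus>\<^bsub>R\<^esub> int_in R (2 * coeff_a2 E) \<otimes>\<^bsub>R\<^esub> x1
              \<oplus>\<^bsub>R\<^esub> int_in R (coeff_a4 E))
           \<otimes>\<^bsub>R\<^esub> inv\<^bsub>R\<^esub> (int_in R 2 \<otimes>\<^bsub>R\<^esub> y1)
      else (y2 \<ominus>\<^bsub>R\<^esub> y1) \<otimes>\<^bsub>R\<^esub> inv\<^bsub>R\<^esub> (x2 \<ominus>\<^bsub>R\<^esub> x1))"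

fun ec_add :: "'a ring \<Rightarrow> cubic_curve \<Rightarrow> 'a ec_point \<Rightarrow> 'a ec_point \<Rightarrow> 'a ec_point" where
  "ec_add R E Infinity Q = Q"
| "ec_add R E (Affine x1 y1) Infinity = Affine x1 y1"
| "ec_add R E (Affine x1 y1) (Affine x2 y2) =
     (if x1 = x2 \<and> y1 = \<ominus>\<^bsub>R\<^esub> y2 then Infinity
      else
        let l = ec_slope R E x1 y1 x2 y2;
            x3 = l [^]\<^bsub>R\<^esub> (2::nat) \<ominus>\<^bsub>R\<^esub> int_in R (coeff_a2 E) \<ominus>\<^bsub>R\<^esub> x1 \<ominus>\<^bsub>R\<^esub> x2
        in Affine x3 (l \<otimes>\<^bsub>R\<^esub> (x1 \<ominus>\<^bsub>R\<^esub> x3) \<ominus>\<^bsub>R\<^esub> y1))"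

definition ec_group :: "'a ring \<Rightarrow> cubic_curve \<Rightarrow> 'a ec_point monoid" where
  "ec_group R E = \<lparr>carrier = ec_carrier R E, monoid.mult = ec_add R E, one = Infinity\<rparr>"

definition torsion_part :: "'g monoid \<Rightarrow> 'g monoid" where
  "torsion_part G =
     G\<lparr>carrier := {x \<in> carrier G. \<exists>n::nat. n > 0 \<and> x [^]\<^bsub>G\<^esub> n = \<one>\<^bsub>G\<^esub>}\<rparr>"

definition torsion_kernel :: "'g monoid \<Rightarrow> nat \<Rightarrow> 'g monoid" where
  "torsion_kernel G n = G\<lparr>carrier := {x \<in> carrier G. x [^]\<^bsub>G\<^esub> n = \<one>\<^bsub>G\<^esub>}\<rparr>"

definition int_independent :: "'g monoid \<Rightarrow> 'g set \<Rightarrow> bool" where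
  "int_independent G B \<longleftrightarrow> finite B \<and> B \<subseteq> carrier G \<and>
     (\<forall>n::'g \<Rightarrow> int. (\<Otimes>\<^bsub>G\<^esub>b\<in>B. b [^]\<^bsub>G\<^esub> n b) = \<one>\<^bsub>G\<^esub> \<longrightarrow> (\<forall>b\<in>B. n b = 0))"

text \<open>The largest number of elements independent over the integers. For a finitely generated
  group this is the exponent $r$ in $G \simeq G_{tors} \times Z^r$.\<close>

definition group_rank :: "'g monoid \<Rightarrow> enat" where
  "group_rank G = Sup {enat (card B) |B. int_independent G B}"

abbreviation rat_field :: "rat ring" where
  "rat_field \<equiv> ring_of_type_algebra"

definition padic_abs :: "nat \<Rightarrow> rat \<Rightarrow> real" where
  "padic_abs p x =
     (if x = 0 then 0
      else real p powi (int (multiplicity (int p) (snd (quotient_of x)))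
                        - int (multiplicity (int p) (fst (quotient_of x)))))"

text \<open>A place is represented by its normalized absolute value.\<close>

definition rat_places :: "(rat \<Rightarrow> real) set" where
  "rat_places = insert (\<lambda>x. real_of_rat \<bar>x\<bar>) {padic_abs p |p. Factorial_Ring.prime p}"

definition cauchy_ring :: "(rat \<Rightarrow> real) \<Rightarrow> (nat \<Rightarrow> rat) ring" where
  "cauchy_ring v =
     \<lparr>carrier = {f. \<forall>e>0. \<exists>N. \<forall>i\<ge>N. \<forall>j\<ge>N. v (f i - f j) < e},
      monoid.mult = (\<lambda>f g n. f n * g n), one = (\<lambda>n. 1),
      ring.zero = (\<lambda>n. 0), add = (\<lambda>f g n. f n + g n)\<rparr>"

definition null_sequences :: "(rat \<Rightarrow> real) \<Rightarrow> (nat \<Rightarrow> rat) set" where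
  "null_sequences v = {f. (\<lambda>n. v (f n)) \<longlonglongrightarrow> 0}"

definition rat_completion :: "(rat \<Rightarrow> real) \<Rightarrow> (nat \<Rightarrow> rat) set ring" where
  "rat_completion v = cauchy_ring v Quot null_sequences v"

type_synonym 'a closure_elem = "('a list \<times> nat) multiset \<Rightarrow> 'a"

abbreviation alg_cl :: "'a ring \<Rightarrow> 'a closure_elem ring" where
  "alg_cl F \<equiv> field.alg_closure F"

text \<open>The automorphisms over \<open>F\<close> of the algebraic closure. They are made extensional because
  HOL functions also have values outside the carrier, and equal automorphisms must be equal
  as functions.\<close>

definition abs_galois :: "'a ring \<Rightarrow> ('a closure_elem \<Rightarrow> 'a closure_elem) set" where
  "abs_galois F =
     {\<sigma> \<in> ring_iso (alg_cl F) (alg_cl F) \<inter> extensional (carrier (alg_cl F)).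
        \<forall>x\<in>carrier F. \<sigma> (ring.indexed_const F x) = ring.indexed_const F x}"

text \<open>Continuity for the Krull topology on the (compact) Galois group and the discrete topology
  on the coefficients: the value depends only on the restriction to a finitely generated
  subextension.\<close>

definition krull_continuous ::
  "'a ring \<Rightarrow> (('a closure_elem \<Rightarrow> 'a closure_elem) \<Rightarrow> 'c) \<Rightarrow> bool" where
  "krull_continuous F \<xi> \<longleftrightarrow> (\<exists>S. finite S \<and> S \<subseteq> carrier (alg_cl F) \<and>
     (\<forall>\<sigma>\<in>abs_galois F. \<forall>\<tau>\<in>abs_galois F. (\<forall>s\<in>S. \<sigma> s = \<tau> s) \<longrightarrow> \<xi> \<sigma> = \<xi> \<tau>))"

text \<open>The coefficients \<open>A\<close> are a Galois stable group of points over the algebraic closure, with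
  the coordinatewise action.\<close>

definition cocycles ::
  "'a ring \<Rightarrow> 'a closure_elem ec_point monoid \<Rightarrow>
     (('a closure_elem \<Rightarrow> 'a closure_elem) \<Rightarrow> 'a closure_elem ec_point) monoid" where
  "cocycles F A =
     \<lparr>carrier = {\<xi> \<in> abs_galois F \<rightarrow>\<^sub>E carrier A. krull_continuous F \<xi> \<and>
        (\<forall>\<sigma>\<in>abs_galois F. \<forall>\<tau>\<in>abs_galois F.
           \<xi> (compose (carrier (alg_cl F)) \<sigma> \<tau>) = \<xi> \<sigma> \<otimes>\<^bsub>A\<^esub> map_ec_point \<sigma> (\<xi> \<tau>))},
      monoid.mult = (\<lambda>\<xi> \<eta>. \<lambda>\<sigma>\<in>abs_galois F. \<xi> \<sigma> \<otimes>\<^bsub>A\<^esub> \<eta> \<sigma>),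
      one = (\<lambda>\<sigma>\<in>abs_galois F. \<one>\<^bsub>A\<^esub>)\<rparr>"

definition coboundaries ::
  "'a ring \<Rightarrow> 'a closure_elem ec_point monoid \<Rightarrow>
     (('a closure_elem \<Rightarrow> 'a closure_elem) \<Rightarrow> 'a closure_elem ec_point) set" where
  "coboundaries F A =
     {(\<lambda>\<sigma>\<in>abs_galois F. map_ec_point \<sigma> P \<otimes>\<^bsub>A\<^esub> inv\<^bsub>A\<^esub> P) |P. P \<in> carrier A}"

definition H1 ::
  "'a ring \<Rightarrow> 'a closure_elem ec_point monoid \<Rightarrow>
     (('a closure_elem \<Rightarrow> 'a closure_elem) \<Rightarrow> 'a closure_elem ec_point) set monoid" where
  "H1 F A = cocycles F A Mod coboundaries F A"

text \<open>The group $\mathrm{Sel}_n(E)$ is the kernel of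
  $H^1(Q, E[n]) \to \prod_v H^1(Q_v, E)$, the product being over all places \<open>v\<close> of the rationals.
  The map at \<open>v\<close> depends on an embedding \<open>\<iota>\<close> of the algebraic closure of the rationals into that
  of the completion at \<open>v\<close>, along which automorphisms are restricted and points are mapped.
  On cohomology classes the choice of \<open>\<iota>\<close> and of the representing cocycle is irrelevant.\<close>

definition galois_restrict ::
  "(rat closure_elem \<Rightarrow> 'b closure_elem) \<Rightarrow>
     ('b closure_elem \<Rightarrow> 'b closure_elem) \<Rightarrow> rat closure_elem \<Rightarrow> rat closure_elem" where
  "galois_restrict \<iota> \<sigma> =
     (\<lambda>x\<in>carrier (alg_cl rat_field). inv_into (carrier (alg_cl rat_field)) \<iota> (\<sigma> (\<iota> x)))"

definition localize ::
  "'b ring \<Rightarrow> (rat closure_elem \<Rightarrow> 'b closure_elem) \<Rightarrow>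
     ((rat closure_elem \<Rightarrow> rat closure_elem) \<Rightarrow> rat closure_elem ec_point) \<Rightarrow>
     ('b closure_elem \<Rightarrow> 'b closure_elem) \<Rightarrow> 'b closure_elem ec_point" where
  "localize F \<iota> \<xi> = (\<lambda>\<sigma>\<in>abs_galois F. map_ec_point \<iota> (\<xi> (galois_restrict \<iota> \<sigma>)))"

definition selmer ::
  "nat \<Rightarrow> cubic_curve \<Rightarrow>
     ((rat closure_elem \<Rightarrow> rat closure_elem) \<Rightarrow> rat closure_elem ec_point) set set" where
  "selmer n E =
     {c \<in> carrier (H1 rat_field (torsion_kernel (ec_group (alg_cl rat_field) E) n)).
        \<forall>v\<in>rat_places. \<forall>\<iota>\<in>ring_hom (alg_cl rat_field) (alg_cl (rat_completion v)). \<forall>\<xi>\<in>c.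
          localize (rat_completion v) \<iota> \<xi>
            \<in> coboundaries (rat_completion v) (ec_group (alg_cl (rat_completion v)) E)}"

text \<open>The 2-Selmer rank $s_2$ given by $|\mathrm{Sel}_2(E)| = 2^{2 + s_2}$, for curves with
  full rational 2-torsion. (Selmer groups are in fact always finite.)\<close>

definition selmer_rank2 :: "cubic_curve \<Rightarrow> enat" where
  "selmer_rank2 E =
     (if finite (selmer 2 E) then enat (THE s. card (selmer 2 E) = 2 ^ (2 + s)) else \<infinity>)"

definition E_curve :: "int \<Rightarrow> cubic_curve" where
  "E_curve m =
     \<lparr>coeff_a2 = (m^2 - 1)^2 - (m^2 + 1)^2,
      coeff_a4 = - ((m^2 + 1)^2 * (m^2 - 1)^2),
      coeff_a6 = (2 * m * (m^4 - 1))^2\<rparr>"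

lemma E_curve_equation:
  fixes x :: "'a :: comm_ring_1"
  shows "x^3 + of_int (coeff_a2 (E_curve m)) * x^2 + of_int (coeff_a4 (E_curve m)) * x + of_int (coeff_a6 (E_curve m))
    = x * (x - (of_int m^2 + 1)^2) * (x + (of_int m^2 - 1)^2)
        + (2 * of_int m * (of_int m^4 - 1))^2"
  by (simp add: E_curve_def algebra_simps power2_eq_square power3_eq_cube)

end

(* The curve is y^2 = (x - N)(x + N)(x - M^2) with N = m^4 - 1 and M = 2m, so its 2-torsion is rational.

   Torsion and rank. The abscissa x of a double makes the differences x - e_i with the roots squares,
   which modulo 4 is impossible for a 2-integral x, while doubling is 2-adically expanding on the
   other points; hence all torsion is 2-torsion. For the points P = (0, MN) and
   Q = ((m^2 + 1)^2, MN), none of P, Q, P + Q becomes divisible by two after adding a 2-torsion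
   point, since the differences x - e_i would have to be squares. By descent on the coefficients
   P and Q are independent.

   Selmer group. As the Galois group acts trivially on the 2-torsion, Sel_2 consists of
   homomorphisms, and pairs (d1, d2) of nonzero integers give such homomorphisms through the signs
   by which automorphisms act on sqrt d1 and sqrt d2. The pair is in Sel_2 if at each place there is
   an x for which all d_i (x - e_i) are squares, where d1 d2 d3 is a square: the point with abscissa
   x is then the double of a point R, and R splits the cocycle. Each prime counted by w gives the
   pair (p, p) or (-p, p); the images of the 2-torsion are two further pairs. The pairs generated
   by these w + 2 pairs are distinct modulo squares. *)

theory Submission
  imports Defs
begin

subsection \<open>The group law\<close>

text \<open>The Selmer group involves algebraic closures of completions, which are records on a
  subset of a type. Polynomial identities are best decided in type classes, but no type can be
  defined for a closure that depends on a variable place. So the group law, the halving formulas and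
  the stability of algebraic numbers are proved for type-class fields and moved to all record fields
  of characteristic zero by making a type out of a potential counterexample.

  The hypotheses on m serve the primes of m^4 - 1. Square-freeness makes p divide it only once, for
  the place p. At its other primes the sign attached to p must be a square; since m - 1 and m + 1
  are prime, at most one prime factor is 3 modulo 4, so this holds. Conditions (a) and (b) take care
  of the primes of m^4 - 1 - 4 m^2 and m^4 - 1 + 4 m^2. The remaining places impose nothing:
  congruences modulo 8 at 2, signs at infinity, a count of points elsewhere.

  Distinctness of the classes requires automorphisms negating a given square root; they come from
  Zorn's lemma. As the Selmer rank is read off from a power of two, the order of the group must be
  shown to be one.\<close>

locale nonsingular_cubic =
  fixes a b c :: "'a :: field"
  assumes two_nonzero: "(2 :: 'a) \<noteq> 0"
    and nonsingular: "x^3 + a * x^2 + b * x + c = 0 \<Longrightarrow> 3 * x^2 + 2 * a * x + b \<noteq> 0"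
begin

fun on_curve :: "'a ec_point \<Rightarrow> bool" where
  "on_curve Infinity = True"
| "on_curve (Affine x y) = (y^2 = x^3 + a * x^2 + b * x + c)"

fun neg :: "'a ec_point \<Rightarrow> 'a ec_point" where
  "neg Infinity = Infinity"
| "neg (Affine x y) = Affine x (- y)"

definition slope :: "'a \<Rightarrow> 'a \<Rightarrow> 'a \<Rightarrow> 'a \<Rightarrow> 'a" where
  "slope x1 y1 x2 y2 = (if x1 = x2 then (3 * x1^2 + 2 * a * x1 + b) / (2 * y1)
     else (y2 - y1) / (x2 - x1))"

fun add :: "'a ec_point \<Rightarrow> 'a ec_point \<Rightarrow> 'a ec_point" where
  "add Infinity Q = Q"
| "add (Affine x1 y1) Infinity = Affine x1 y1"
| "add (Affine x1 y1) (Affine x2 y2) =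
     (if x1 = x2 \<and> y1 = - y2 then Infinity
      else let l = slope x1 y1 x2 y2; x3 = l^2 - a - x1 - x2 in Affine x3 (l * (x1 - x3) - y1))"

text \<open>The line $y = l x + n$ meets the curve in points with abscissas \<open>x1\<close>, \<open>x2\<close>, \<open>x3\<close>,
  counted with multiplicity: these are Vieta's formulas.\<close>

definition vieta :: "'a \<Rightarrow> 'a \<Rightarrow> 'a \<Rightarrow> 'a \<Rightarrow> 'a \<Rightarrow> bool" where
  "vieta l n x1 x2 x3 \<longleftrightarrow> x1 + x2 + x3 = l^2 - a \<and>
     x1 * x2 + x1 * x3 + x2 * x3 = b - 2 * l * n \<and> x1 * x2 * x3 = n^2 - c"

text \<open>Only lines that are not vertical occur, so triples containing \<open>Infinity\<close>
  are excluded. Multiplicities are carried by \<open>vieta\<close>, hence tangents and flexes need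
  no cases of their own.\<close>

fun collinear :: "'a ec_point \<Rightarrow> 'a ec_point \<Rightarrow> 'a ec_point \<Rightarrow> bool" where
  "collinear (Affine x1 y1) (Affine x2 y2) (Affine x3 y3) \<longleftrightarrow>
     (\<exists>l n. y1 = l * x1 + n \<and> y2 = l * x2 + n \<and> y3 = l * x3 + n \<and> vieta l n x1 x2 x3)"
| "collinear _ _ _ = False"

lemma vieta_rotate: "vieta l n x1 x2 x3 \<Longrightarrow> vieta l n x3 x1 x2"
  by (auto simp: vieta_def algebra_simps)

lemma vieta_swap: "vieta l n x1 x2 x3 \<Longrightarrow> vieta l n x2 x1 x3"
  by (auto simp: vieta_def algebra_simps)

text \<open>The derivative at x1 of f(x) - (l x + n)^2 = (x - x1) (x - x2) (x - x3), where f is the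
  cubic.\<close>

lemma vieta_tangent:
  assumes "vieta l n x1 x2 x3"
  shows "3 * x1^2 + 2 * a * x1 + b - 2 * (l * x1 + n) * l = (x1 - x2) * (x1 - x3)"
  using assms unfolding vieta_def by (elim conjE) Groebner_Basis.algebra

lemma collinear_swap: "collinear P Q R \<Longrightarrow> collinear Q P R"
  by (cases "(P, Q, R)" rule: collinear.cases) (auto dest: vieta_swap)

lemma collinear_rotate: "collinear P Q R \<Longrightarrow> collinear R P Q"
  by (cases "(P, Q, R)" rule: collinear.cases) (auto dest: vieta_rotate)

lemma collinear_on_curve: "collinear P Q R \<Longrightarrow> on_curve P"
proof (cases "(P, Q, R)" rule: collinear.cases)
  case (1 x1 y1 x2 y2 x3 y3)
  assume "collinear P Q R"
  then obtain l n where *: "y1 = l * x1 + n" "vieta l n x1 x2 x3"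
    using 1 by auto
  then have "y1^2 = x1^3 + a * x1^2 + b * x1 + c"
    unfolding vieta_def by (elim conjE) Groebner_Basis.algebra
  then show ?thesis using 1 by simp
qed auto

lemma neg_neg [simp]: "neg (neg P) = P"
  by (cases P) auto

lemma on_curve_neg [simp]: "on_curve (neg P) = on_curve P"
  by (cases P) auto

lemma collinear_neg:
  assumes "collinear P Q R"
  shows "collinear (neg P) (neg Q) (neg R)"
proof (cases "(P, Q, R)" rule: collinear.cases)
  case (1 x1 y1 x2 y2 x3 y3)
  then obtain l n where "y1 = l * x1 + n" "y2 = l * x2 + n" "y3 = l * x3 + n" "vieta l n x1 x2 x3"
    using assms by auto
  then have "- y1 = (-l) * x1 + (-n)" "- y2 = (-l) * x2 + (-n)" "- y3 = (-l) * x3 + (-n)"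
    "vieta (-l) (-n) x1 x2 x3"
    by (auto simp: vieta_def)
  then show ?thesis using 1 by (metis collinear.simps(1) ec_point.inject neg.simps(2) prod.inject)
qed (use assms in auto)

text \<open>Opposite points on a line that is not vertical would coincide with ordinate 0 and be a
  double intersection; their abscissa would then be a double root of the cubic.\<close>

lemma collinear_not_neg:
  assumes "collinear P Q R"
  shows "Q \<noteq> neg P"
proof
  assume Q: "Q = neg P"
  obtain x1 y1 x3 y3 where P: "P = Affine x1 y1" and R: "R = Affine x3 y3"
    using assms Q by (cases "(P, Q, R)" rule: collinear.cases) auto
  then obtain l n where *: "y1 = l * x1 + n" "- y1 = l * x1 + n" "vieta l n x1 x1 x3"
    using assms Q by auto
  then have "2 * y1 = 0" by (metis add.right_inverse mult_2)
  then have y: "y1 = 0" using two_nonzero by simp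
  have "on_curve P" using assms by (rule collinear_on_curve)
  then have "x1^3 + a * x1^2 + b * x1 + c = 0" using P y by simp
  moreover have "3 * x1^2 + 2 * a * x1 + b = 0"
    using vieta_tangent[OF *(3)] unfolding *(1)[symmetric] by (simp add: y)
  ultimately show False using nonsingular by blast
qed

lemma collinear_add:
  assumes "collinear P Q R"
  shows "add P Q = neg R"
proof -
  obtain x1 y1 x2 y2 x3 y3 where P: "P = Affine x1 y1" and Q: "Q = Affine x2 y2"
      and R: "R = Affine x3 y3"
    using assms by (cases "(P, Q, R)" rule: collinear.cases) auto
  then obtain l n where *: "y1 = l * x1 + n" "y2 = l * x2 + n" "y3 = l * x3 + n" "vieta l n x1 x2 x3"
    using assms by auto
  have nn: "\<not> (x1 = x2 \<and> y1 = - y2)"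
    using collinear_not_neg[OF assms] P Q by auto
  have "slope x1 y1 x2 y2 = l"
  proof (cases "x1 = x2")
    case True
    moreover have "y1 = y2" using True *(1,2) by simp
    ultimately have "y1 \<noteq> 0" using nn by auto
    then show ?thesis
      using vieta_tangent[OF *(4)] True two_nonzero unfolding *(1)[symmetric]
      by (simp add: slope_def field_simps)
  next
    case False
    then show ?thesis using * by (simp add: slope_def field_simps)
  qed
  moreover have "l^2 - a - x1 - x2 = x3" using *(4) unfolding vieta_def by (elim conjE) Groebner_Basis.algebra
  moreover have "l * (x1 - x3) - y1 = - y3" using * by Groebner_Basis.algebra
  ultimately show ?thesis using nn unfolding P Q R add.simps neg.simps Let_def by presburger
qed

lemma add_collinear:
  assumes "on_curve P" "on_curve Q" "P \<noteq> Infinity" "Q \<noteq> Infinity" "Q \<noteq> neg P"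
  shows "collinear P Q (neg (add P Q))"
proof -
  obtain x1 y1 x2 y2 where P: "P = Affine x1 y1" and Q: "Q = Affine x2 y2"
    using assms by (metis ec_point.exhaust)
  have c1: "y1^2 = x1^3 + a * x1^2 + b * x1 + c" and c2: "y2^2 = x2^3 + a * x2^2 + b * x2 + c"
    using assms P Q by auto
  have nn: "\<not> (x1 = x2 \<and> y1 = - y2)" using assms P Q by auto
  define l where "l = slope x1 y1 x2 y2"
  define n where "n = y1 - l * x1"
  define x3 where "x3 = l^2 - a - x1 - x2"
  have l1: "y2 = y1 + l * (x2 - x1)"
  proof (cases "x1 = x2")
    case True
    then have "y1^2 = y2^2" using c1 c2 by simp
    then have "(y1 - y2) * (y1 + y2) = 0" by (simp add: algebra_simps power2_eq_square)
    then show ?thesis using nn True by (auto simp: add_eq_0_iff2)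
  next
    case False
    then show ?thesis by (simp add: l_def slope_def)
  qed
  \<comment> \<open>This is the derivative relation of \<open>vieta_tangent\<close>. For x1 = x2 it
    is the definition of the tangent slope; otherwise it follows from both points lying on the
    curve, after cancelling x1 - x2. With the sum of the abscissas it gives the second Vieta
    relation.\<close>
  have l2: "3 * x1^2 + 2 * a * x1 + b - 2 * y1 * l = (x1 - x2) * (x1 - x3)"
  proof (cases "x1 = x2")
    case True
    then have "y1 \<noteq> 0" using nn l1 by auto
    then show ?thesis using True two_nonzero by (simp add: l_def slope_def)
  next
    case False
    have "(x1 - x2) * (3 * x1^2 + 2 * a * x1 + b - 2 * y1 * l - (x1 - x2) * (x1 - x3)) = 0"
      using c1 c2 l1 unfolding x3_def by Groebner_Basis.algebra
    then show ?thesis using False by simp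
  qed
  have "vieta l n x1 x2 x3"
  proof -
    have e1: "x1 + x2 + x3 = l^2 - a" by (simp add: x3_def)
    have e2: "x1 * x2 + x1 * x3 + x2 * x3 = b - 2 * l * n"
      using l2 e1 n_def by Groebner_Basis.algebra
    have "x1 * x2 * x3 = n^2 - c" using e1 e2 c1 n_def by Groebner_Basis.algebra
    then show ?thesis using e1 e2 by (simp add: vieta_def)
  qed
  moreover have "y1 = l * x1 + n" "y2 = l * x2 + n" by (simp_all add: n_def l1 algebra_simps)
  moreover have "add P Q = Affine x3 (- (l * x3 + n))"
    using nn P Q by (simp add: Let_def x3_def n_def l_def algebra_simps)
  ultimately show ?thesis unfolding P Q by (metis collinear.simps(1) neg.simps(2) minus_minus)
qed

lemma add_Infinity_right [simp]: "add P Infinity = P"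
  by (cases P) auto

lemma add_neg [simp]: "add P (neg P) = Infinity"
  by (cases P) auto

lemma neg_add_self [simp]: "add (neg P) P = Infinity"
  by (cases P) auto

lemma add_eq_Infinity: "add P Q = Infinity \<longleftrightarrow> Q = neg P"
  by (cases P; cases Q) (auto simp: Let_def)

lemma neg_eq_Infinity [simp]: "neg P = Infinity \<longleftrightarrow> P = Infinity"
  by (cases P) auto

lemma add_on_curve:
  assumes "on_curve P" "on_curve Q"
  shows "on_curve (add P Q)"
proof (cases "P = Infinity \<or> Q = Infinity \<or> Q = neg P")
  case False
  then have "collinear P Q (neg (add P Q))" using add_collinear assms by blast
  then show ?thesis using collinear_rotate collinear_on_curve on_curve_neg by blast
qed (use assms in auto)

lemma add_commute:
  assumes "on_curve P" "on_curve Q"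
  shows "add P Q = add Q P"
proof (cases "P = Infinity \<or> Q = Infinity \<or> Q = neg P")
  case False
  then have "collinear Q P (neg (add P Q))"
    using add_collinear assms collinear_swap by blast
  then show ?thesis by (simp add: collinear_add)
qed auto

lemma neg_add:
  assumes "on_curve P" "on_curve Q"
  shows "neg (add P Q) = add (neg P) (neg Q)"
proof (cases "P = Infinity \<or> Q = Infinity \<or> Q = neg P")
  case False
  then have "collinear (neg P) (neg Q) (add P Q)"
    using add_collinear assms collinear_neg by fastforce
  then show ?thesis by (simp add: collinear_add)
qed auto

lemma add_cancel:
  assumes "on_curve P" "on_curve Q"
  shows "add (add P Q) (neg Q) = P"
proof (cases "P = Infinity \<or> Q = Infinity \<or> Q = neg P")
  case False
  then have "collinear (neg P) (neg Q) (add P Q)"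
    using add_collinear assms collinear_neg by fastforce
  then have "collinear (add P Q) (neg Q) (neg P)"
    using collinear_rotate collinear_swap by blast
  then show ?thesis by (simp add: collinear_add)
qed auto

lemma add_cancel_left:
  assumes "on_curve P" "on_curve Q"
  shows "add (neg Q) (add Q P) = P"
  using add_cancel[OF assms] assms add_commute add_on_curve on_curve_neg by metis

text \<open>The product of the lines through $P_1, P_2$ and through $P_1 + P_2, P_3$ is divisible by the
  vertical line through $P_1 + P_2$. Reduced modulo the curve, the quotient is
  $(x - x_1)(x - x_2) - (l + m)(y - l x - n)$; it vanishes in $P_3$.\<close>

lemma vieta_chain:
  assumes "vieta l n x1 x2 x4" "vieta m k x4 x3 x5"
    and "l * x4 + n = - (m * x4 + k)"
  shows "(l + m) * (m - l) = x3 + x5 - x1 - x2"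
    and "(l + m) * (m * x3 + k - l * x3 - n) = (x3 - x1) * (x3 - x2)"
  using assms unfolding vieta_def by ((elim conjE), Groebner_Basis.algebra)+

text \<open>With l, l' the slopes of the inner sums and m, m' those of the outer ones, both (l + m)
  (l' - l) and (l' + m') (l' - l) equal x3 - x1, which is nonzero. Hence l + m = l' + m', and the
  first identity of \<open>vieta_chain\<close> then gives equal abscissas. The points P and Q may
  coincide, while R is kept apart from both.\<close>

lemma add_assoc_aux:
  assumes on: "on_curve P" "on_curve Q" "on_curve R"
    and S: "add P Q = Affine x4 y4" and T: "add Q R = Affine x6 y6"
    and W: "add (add P Q) R = Affine x5 y5" and W': "add P (add Q R) = Affine x7 y7"
    and P: "P = Affine x1 y1" and Q: "Q = Affine x2 y2" and R: "R = Affine x3 y3"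
    and "x1 \<noteq> x3" "x2 \<noteq> x3" "P = Q \<or> x1 \<noteq> x2"
  shows "add (add P Q) R = add P (add Q R)"
proof -
  have onS: "on_curve (add P Q)" "on_curve (add Q R)" using on add_on_curve by auto
  have "collinear P Q (neg (add P Q))"
    using add_collinear[OF on(1,2)] P Q S add_eq_Infinity by (metis ec_point.distinct(1))
  then obtain l n where l: "y1 = l * x1 + n" "y2 = l * x2 + n" "- y4 = l * x4 + n" "vieta l n x1 x2 x4"
    using P Q S by (auto simp del: add.simps)
  have "collinear Q R (neg (add Q R))"
    using add_collinear[OF on(2,3)] Q R T add_eq_Infinity by (metis ec_point.distinct(1))
  then obtain l' n' where l': "y2 = l' * x2 + n'" "y3 = l' * x3 + n'" "- y6 = l' * x6 + n'" "vieta l' n' x2 x3 x6"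
    using Q R T by (auto simp del: add.simps)
  have "collinear (add P Q) R (neg (add (add P Q) R))"
    using add_collinear[OF onS(1) on(3)] S R W add_eq_Infinity by (metis ec_point.distinct(1))
  then obtain m k where m: "y4 = m * x4 + k" "y3 = m * x3 + k" "- y5 = m * x5 + k" "vieta m k x4 x3 x5"
    using S R W by (auto simp del: add.simps)
  have "collinear P (add Q R) (neg (add P (add Q R)))"
    using add_collinear[OF on(1) onS(2)] P T W' add_eq_Infinity by (metis ec_point.distinct(1))
  then obtain m' k' where m': "y1 = m' * x1 + k'" "y6 = m' * x6 + k'" "- y7 = m' * x7 + k'" "vieta m' k' x1 x6 x7"
    using P T W' by (auto simp del: add.simps)
  have "l * x4 + n = - (m * x4 + k)" using l(3) m(1) by simp
  note c = vieta_chain[OF l(4) m(4) this]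
  have "l' * x6 + n' = - (m' * x6 + k')" using l'(3) m'(2) by simp
  note c' = vieta_chain[OF l'(4) vieta_swap[OF m'(4)] this]
  have d: "(l + m) * (y3 - l * x3 - n) = (x3 - x1) * (x3 - x2)"
    using c(2) m(2) by (simp add: algebra_simps)
  have nz: "l + m \<noteq> 0" using d assms by auto
  have D: "(l + m) * (l' - l) = x3 - x1"
  proof -
    have "(l + m) * (l' - l) * (x3 - x2) = (x3 - x1) * (x3 - x2)"
      using d l(2) l'(1,2) by Groebner_Basis.algebra
    then show ?thesis using assms(12) by simp
  qed
  \<comment> \<open>For P = Q the second identity of \<open>vieta_chain\<close> reads 0 = 0 at x1,
    so the tangent equations replace it.\<close>
  have D': "(l' + m') * (l' - l) = x3 - x1"
  proof (cases "x1 = x2")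
    case True
    then have eq: "P = Q" "y1 = y2" using assms P Q by auto
    have t: "3 * x1^2 + 2 * a * x1 + b = 2 * y1 * l"
      using vieta_tangent[OF l(4)] l(1) True by simp
    have t': "3 * x1^2 + 2 * a * x1 + b - 2 * y1 * l' = (x1 - x3) * (x1 - x6)"
      using vieta_tangent[OF l'(4)] l'(1) True eq by simp
    have "y1 = l' * x1 + n'" using l'(1) True eq by simp
    moreover have "(l' + m') * (x1 - x6) = (l' * x1 + n') + (m' * x1 + k') - ((l' * x6 + n') + (m' * x6 + k'))"
      by (simp add: algebra_simps)
    ultimately have s: "(l' + m') * (x1 - x6) = 2 * y1"
      using l'(3) m'(1,2) by (metis add.left_inverse diff_zero mult_2)
    have "y1 \<noteq> 0" using S P eq by auto
    then have "x1 \<noteq> x6" using s two_nonzero by auto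
    moreover have "(l' + m') * (l' - l) * (x1 - x6) = (x3 - x1) * (x1 - x6)"
      using t t' s by Groebner_Basis.algebra
    ultimately show ?thesis by simp
  next
    case False
    have "(l' + m') * (m' * x1 + k' - l' * x1 - n') = (x1 - x2) * (x1 - x3)" by (rule c'(2))
    then have "(l' + m') * (l' - l) * (x2 - x1) = (x3 - x1) * (x2 - x1)"
      using l(1,2) l'(1) m'(1) by Groebner_Basis.algebra
    then show ?thesis using False by simp
  qed
  have "x3 - x1 \<noteq> 0" using assms(11) by simp
  then have lam: "l + m = l' + m'" using D D' by (metis mult_cancel_right mult_zero_right)
  have x: "x5 = x7"
  proof -
    have "(l + m) * (m - l) - (l' + m') * (m' - l') = 2 * ((l + m) * (l' - l))"
      unfolding lam[symmetric] using lam by Groebner_Basis.algebra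
    then show ?thesis using c(1) c'(1) D by Groebner_Basis.algebra
  qed
  have "l' * (x3 - x2) + l * (x2 - x1) + m * (x1 - x3) + (l' - l) * (x5 - x1)
      = (m - l) * ((l + m) * (l' - l) - (x3 - x1)) - (l' - l) * ((l + m) * (m - l) - (x3 + x5 - x1 - x2))"
    by (simp add: algebra_simps)
  also have "\<dots> = 0" using c(1) D by simp
  finally have "l' * (x3 - x2) + l * (x2 - x1) + m * (x1 - x3) + (l' - l) * (x5 - x1) = 0" .
  moreover have "l' * (x3 - x2) = y3 - y2" using l'(1,2) by (simp add: algebra_simps)
  moreover have "l * (x2 - x1) = y2 - y1" using l(1,2) by (simp add: algebra_simps)
  ultimately have z: "y3 - y1 + m * (x1 - x3) + (l' - l) * (x5 - x1) = 0" by simp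
  have "m' = m + l - l'" using lam by (simp add: algebra_simps)
  then have "y7 = - (y1 + (m + l - l') * (x5 - x1))"
    using m'(1,3) x by Groebner_Basis.algebra
  moreover have "y5 = - (y3 + m * (x5 - x3))"
    using m(2,3) by Groebner_Basis.algebra
  ultimately have "y7 - y5 = y3 - y1 + m * (x1 - x3) + (l' - l) * (x5 - x1)"
    by Groebner_Basis.algebra
  then have "y5 = y7" using z by simp
  then show ?thesis using W W' x by simp
qed

text \<open>If some point or intermediate sum is \<open>Infinity\<close>, or if R is P or its
  opposite, the claim follows formally from commutativity and cancellation. The generic case and P =
  Q are left to \<open>add_assoc_aux\<close>.\<close>

lemma add_assoc:
  assumes on: "on_curve P" "on_curve Q" "on_curve R"
  shows "add (add P Q) R = add P (add Q R)"
proof -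
  have onS: "on_curve (add P Q)" "on_curve (add Q R)" using on add_on_curve by auto
  have distinct_x: "x \<noteq> x'" if "Affine x y \<noteq> Affine x' y'" "Affine x' y' \<noteq> neg (Affine x y)"
    "on_curve (Affine x y)" "on_curve (Affine x' y')" for x y x' y'
  proof
    assume "x = x'"
    then have "(y - y') * (y + y') = 0" using that(3,4) by (auto simp: algebra_simps power2_eq_square)
    then show False using that(1,2) \<open>x = x'\<close> by (auto simp: add_eq_0_iff)
  qed
  have step: "add (add P Q) R = add P (add Q R)"
    if on: "on_curve P" "on_curve Q" "on_curve R"
    and inf: "P \<noteq> Infinity" "Q \<noteq> Infinity" "R \<noteq> Infinity" "Q \<noteq> neg P" "R \<noteq> neg Q"
      "R \<noteq> neg (add P Q)" "add Q R \<noteq> neg P" "P \<noteq> R" "R \<noteq> neg P" "Q \<noteq> R" for P Q R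
  proof -
    obtain x1 y1 x2 y2 x3 y3 where P: "P = Affine x1 y1" and Q: "Q = Affine x2 y2"
      and R: "R = Affine x3 y3"
      using inf by (metis ec_point.exhaust)
    obtain x4 y4 where S: "add P Q = Affine x4 y4"
      using inf add_eq_Infinity by (metis ec_point.exhaust)
    obtain x6 y6 where T: "add Q R = Affine x6 y6"
      using inf add_eq_Infinity by (metis ec_point.exhaust)
    obtain x5 y5 where W: "add (add P Q) R = Affine x5 y5"
      using inf add_eq_Infinity by (metis ec_point.exhaust)
    obtain x7 y7 where W': "add P (add Q R) = Affine x7 y7"
      using inf add_eq_Infinity by (metis ec_point.exhaust)
    have "x1 \<noteq> x3" using distinct_x inf on P R by metis
    moreover have "x2 \<noteq> x3" using distinct_x inf on Q R by metis
    moreover have "P = Q \<or> x1 \<noteq> x2" using distinct_x inf on P Q by metis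
    ultimately show ?thesis using add_assoc_aux[OF on S T W W' P Q R] by blast
  qed
  consider "P = Infinity \<or> Q = Infinity \<or> R = Infinity" | "Q = neg P" | "R = neg Q"
    | "R = neg (add P Q)" | "add Q R = neg P" | "P = R" | "R = neg P"
    | "Q = R" "\<not> (P = Infinity \<or> Q = Infinity \<or> R = Infinity)" "Q \<noteq> neg P" "R \<noteq> neg Q"
      "R \<noteq> neg (add P Q)" "add Q R \<noteq> neg P" "P \<noteq> R"
    | "\<not> (P = Infinity \<or> Q = Infinity \<or> R = Infinity)" "Q \<noteq> neg P" "R \<noteq> neg Q"
      "R \<noteq> neg (add P Q)" "add Q R \<noteq> neg P" "P \<noteq> R" "R \<noteq> neg P" "Q \<noteq> R"
    by blast
  then show ?thesis
  proof cases
    case 1 then show ?thesis by auto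
  next
    case 2
    then show ?thesis using add_cancel_left[OF on(3), of "neg P"] on by simp
  next
    case 3
    then show ?thesis using add_cancel[OF on(1), of Q] on by simp
  next
    case 4
    have "add Q R = neg P"
      using 4 on add_cancel[of "neg P" "neg Q"] neg_add add_commute on_curve_neg
      by (metis neg_neg)
    then show ?thesis using 4 by simp
  next
    case 5
    have "P = neg (add Q R)" using 5 by (metis neg_neg)
    then have "add P Q = neg R"
      using on add_cancel[of "neg R" "neg Q"] neg_add add_commute on_curve_neg
      by (metis neg_neg)
    then show ?thesis using 5 by simp
  next
    case 6
    then show ?thesis using on add_commute add_on_curve by metis
  next
    case 7
    have "add (add P Q) R = Q" using 7 on add_cancel[of Q P] add_commute by metis
    moreover have "add P (add Q R) = Q"
      using 7 on add_cancel[of Q "neg P"] add_commute add_on_curve by (metis neg_neg on_curve_neg)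
    ultimately show ?thesis by simp
  next
    \<comment> \<open>Q = R is the mirror image of P = Q: exchanging P and R by commutativity puts
      the coincidence where \<open>add_assoc_aux\<close> admits it.\<close>
    case 8
    have "add (add R Q) P = add R (add Q P)"
      by (rule step) (use 8 on add_commute[of P Q] add_commute[of R P] in \<open>auto dest: arg_cong[of _ _ neg]\<close>)
    then show ?thesis using on onS add_commute by metis
  next
    case 9
    then show ?thesis using step[of P Q R] on by blast
  qed
qed

end

subsection \<open>Rings of a type class as records\<close>

lemma type_ring_simps [simp]:
  "carrier (ring_of_type_algebra :: 'a::field ring) = UNIV"
  "x \<oplus>\<^bsub>(ring_of_type_algebra :: 'a ring)\<^esub> y = x + y"
  "x \<otimes>\<^bsub>(ring_of_type_algebra :: 'a ring)\<^esub> y = x * y"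
  "\<zero>\<^bsub>(ring_of_type_algebra :: 'a ring)\<^esub> = 0"
  "\<one>\<^bsub>(ring_of_type_algebra :: 'a ring)\<^esub> = 1"
  by (simp_all add: ring_of_type_algebra_def)

lemma type_ring_field: "field (ring_of_type_algebra :: 'a::field ring)"
  by (rule field_from_type_algebra)

lemma type_ring_a_inv [simp]: "\<ominus>\<^bsub>(ring_of_type_algebra :: 'a::field ring)\<^esub> x = - x"
proof -
  interpret field "ring_of_type_algebra :: 'a ring" by (rule type_ring_field)
  show ?thesis using minus_equality[of "- x" x] by simp
qed

lemma type_ring_a_minus [simp]: "x \<ominus>\<^bsub>(ring_of_type_algebra :: 'a::field ring)\<^esub> y = x - y"
  by (simp add: a_minus_def)

lemma type_ring_m_inv [simp]:
  assumes "x \<noteq> 0"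
  shows "inv\<^bsub>(ring_of_type_algebra :: 'a::field ring)\<^esub> x = inverse x"
proof -
  interpret field "ring_of_type_algebra :: 'a ring" by (rule type_ring_field)
  show ?thesis using comm_inv_char[of x "inverse x"] assms by simp
qed

lemma type_ring_pow [simp]: "x [^]\<^bsub>(ring_of_type_algebra :: 'a::field ring)\<^esub> (n::nat) = x ^ n"
  by (induction n) (simp_all add: mult.commute)

lemma int_in_simps:
  assumes "ring R"
  shows "int_in R k \<in> carrier R" "int_in R 0 = \<zero>\<^bsub>R\<^esub>" "int_in R 1 = \<one>\<^bsub>R\<^esub>"
    "int_in R (k + l) = int_in R k \<oplus>\<^bsub>R\<^esub> int_in R l"
    "int_in R (k * l) = int_in R k \<otimes>\<^bsub>R\<^esub> int_in R l"
    "int_in R (- k) = \<ominus>\<^bsub>R\<^esub> int_in R k"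
    "int_in R (k - l) = int_in R k \<ominus>\<^bsub>R\<^esub> int_in R l"
proof -
  interpret ring R by fact
  show c: "int_in R k \<in> carrier R" for k by (simp add: int_in_def)
  show "int_in R 0 = \<zero>\<^bsub>R\<^esub>" "int_in R 1 = \<one>\<^bsub>R\<^esub>" using int_pow_0[of "add_monoid R" "\<one>\<^bsub>R\<^esub>"] add.int_pow_1[of "\<one>\<^bsub>R\<^esub>"]
    by (simp_all add: int_in_def add_pow_def)
  show p: "int_in R (k + l) = int_in R k \<oplus>\<^bsub>R\<^esub> int_in R l" for k l
    by (simp add: int_in_def add.int_pow_mult)
  show m: "int_in R (- k) = \<ominus>\<^bsub>R\<^esub> int_in R k" for k
    by (simp add: int_in_def add.int_pow_neg)
  show "int_in R (k - l) = int_in R k \<ominus>\<^bsub>R\<^esub> int_in R l"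
    using p[of k "- l"] m by (simp add: a_minus_def)
  show "int_in R (k * l) = int_in R k \<otimes>\<^bsub>R\<^esub> int_in R l"
    by (simp add: int_in_def add_pow_ldistr_int add.int_pow_pow mult.commute)
qed

lemma int_in_hom:
  assumes "h \<in> ring_hom R S" "ring R" "ring S"
  shows "h (int_in R k) = int_in S k"
proof -
  interpret ring_hom_ring R S h using assms by (simp add: ring_hom_ringI2)
  have n: "h (int_in R (int n)) = int_in S (int n)" for n
    by (induction n) (simp_all add: int_in_simps assms(2,3) hom_one)
  show ?thesis
  proof (cases k)
    case (nonneg n) then show ?thesis using n by simp
  next
    case (neg n)
    then show ?thesis using n[of "Suc n"] by (simp only: int_in_simps assms(2,3) hom_a_inv)
  qed
qed

lemma int_in_type [simp]: "int_in (ring_of_type_algebra :: 'a::field ring) k = of_int k"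
proof -
  interpret field "ring_of_type_algebra :: 'a ring" by (rule type_ring_field)
  note R = ring_axioms
  have n: "int_in (ring_of_type_algebra :: 'a::field ring) (int n) = of_int (int n)" for n
    by (induction n) (simp_all add: int_in_simps[OF R])
  show ?thesis
  proof (cases k)
    case (nonneg n) then show ?thesis using n by simp
  next
    case (neg n)
    then show ?thesis using n[of "Suc n"] by (simp only: int_in_simps[OF R]) simp
  qed
qed

lemma field_hom_inv:
  assumes "h \<in> ring_hom R S" "field R" "field S" "x \<in> carrier R" "x \<noteq> \<zero>\<^bsub>R\<^esub>"
  shows "h (inv\<^bsub>R\<^esub> x) = inv\<^bsub>S\<^esub> (h x)" "h x \<noteq> \<zero>\<^bsub>S\<^esub>"
proof -
  interpret R: field R by fact
  interpret S: field S by fact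
  interpret ring_hom_ring R S h using assms R.ring_axioms S.ring_axioms by (simp add: ring_hom_ringI2)
  have u: "x \<in> Units R" using assms R.field_Units by auto
  have i: "inv\<^bsub>R\<^esub> x \<in> carrier R" using u by simp
  have "h x \<otimes>\<^bsub>S\<^esub> h (inv\<^bsub>R\<^esub> x) = h (x \<otimes>\<^bsub>R\<^esub> inv\<^bsub>R\<^esub> x)" using assms i by simp
  also have "\<dots> = \<one>\<^bsub>S\<^esub>" using u by simp
  finally have e: "h x \<otimes>\<^bsub>S\<^esub> h (inv\<^bsub>R\<^esub> x) = \<one>\<^bsub>S\<^esub>" .
  then show "h (inv\<^bsub>R\<^esub> x) = inv\<^bsub>S\<^esub> (h x)"
    using S.comm_inv_char[of "h x" "h (inv\<^bsub>R\<^esub> x)"] assms i by simp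
  show "h x \<noteq> \<zero>\<^bsub>S\<^esub>" using e i by auto
qed

definition char_zero :: "'a ring \<Rightarrow> bool" where
  "char_zero R \<longleftrightarrow> (\<forall>k. int_in R k = \<zero>\<^bsub>R\<^esub> \<longrightarrow> k = 0)"

lemma char_zero_hom:
  assumes "h \<in> ring_hom R S" "field R" "field S" "char_zero R"
  shows "char_zero S"
  unfolding char_zero_def
proof (intro allI impI)
  interpret R: field R by fact
  interpret S: field S by fact
  fix k assume "int_in S k = \<zero>\<^bsub>S\<^esub>"
  then have "h (int_in R k) = \<zero>\<^bsub>S\<^esub>"
    using int_in_hom assms R.ring_axioms S.ring_axioms by metis
  then have "int_in R k = \<zero>\<^bsub>R\<^esub>"
    using field_hom_inv(2)[OF assms(1-3)] int_in_simps(1)[OF R.ring_axioms] by metis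
  then show "k = 0" using assms(4) by (simp add: char_zero_def)
qed

lemma field_char_zero_inj:
  assumes "h \<in> ring_hom R S" "field R" "field S"
  shows "inj_on h (carrier R)"
proof (rule inj_onI)
  interpret R: field R by fact
  interpret S: field S by fact
  interpret ring_hom_ring R S h using assms R.ring_axioms S.ring_axioms by (simp add: ring_hom_ringI2)
  fix x y assume xy: "x \<in> carrier R" "y \<in> carrier R" "h x = h y"
  have "h (x \<ominus>\<^bsub>R\<^esub> y) = h x \<ominus>\<^bsub>S\<^esub> h y" using xy by (simp add: a_minus_def)
  then have "h (x \<ominus>\<^bsub>R\<^esub> y) = \<zero>\<^bsub>S\<^esub>" using xy by (simp add: S.r_neg a_minus_def)
  then have "x \<ominus>\<^bsub>R\<^esub> y = \<zero>\<^bsub>R\<^esub>"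
    using field_hom_inv(2)[OF assms] xy R.minus_closed by blast
  then show "x = y" using xy by simp
qed

subsection \<open>Points and homomorphisms\<close>

lemma ec_carrierE:
  assumes "P \<in> ec_carrier R E"
  obtains "P = Infinity" | x y where "P = Affine x y" "x \<in> carrier R" "y \<in> carrier R"
    "y [^]\<^bsub>R\<^esub> (2::nat) =
       x [^]\<^bsub>R\<^esub> (3::nat) \<oplus>\<^bsub>R\<^esub> int_in R (coeff_a2 E) \<otimes>\<^bsub>R\<^esub> x [^]\<^bsub>R\<^esub> (2::nat)
         \<oplus>\<^bsub>R\<^esub> int_in R (coeff_a4 E) \<otimes>\<^bsub>R\<^esub> x \<oplus>\<^bsub>R\<^esub> int_in R (coeff_a6 E)"
  using assms by (auto simp: ec_carrier_def)

lemma ec_carrier_hom: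
  assumes "h \<in> ring_hom R S" "field R" "field S" "P \<in> ec_carrier R E"
  shows "map_ec_point h P \<in> ec_carrier S E"
proof -
  interpret R: field R by fact
  interpret S: field S by fact
  interpret ring_hom_cring R S h
    using assms by unfold_locales simp
  note [simp] = int_in_hom[OF assms(1) R.ring_axioms S.ring_axioms]
  note [simp] = int_in_simps(1)[OF R.ring_axioms]
  from assms(4) show ?thesis
  proof (cases rule: ec_carrierE)
    case (2 x y)
    have "h (y [^]\<^bsub>R\<^esub> (2::nat)) = h (x [^]\<^bsub>R\<^esub> (3::nat) \<oplus>\<^bsub>R\<^esub> int_in R (coeff_a2 E) \<otimes>\<^bsub>R\<^esub> x [^]\<^bsub>R\<^esub> (2::nat)
         \<oplus>\<^bsub>R\<^esub> int_in R (coeff_a4 E) \<otimes>\<^bsub>R\<^esub> x \<oplus>\<^bsub>R\<^esub> int_in R (coeff_a6 E))"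
      using 2(4) by simp
    then show ?thesis using 2(1-3) by (simp add: ec_carrier_def)
  qed (simp add: ec_carrier_def)
qed

lemma double_nonzero:
  assumes "field R" "char_zero R" "y \<in> carrier R" "y \<noteq> \<zero>\<^bsub>R\<^esub>"
  shows "int_in R 2 \<otimes>\<^bsub>R\<^esub> y \<noteq> \<zero>\<^bsub>R\<^esub>"
proof -
  interpret R: field R by fact
  show ?thesis using assms R.integral int_in_simps(1)[OF R.ring_axioms]
    by (metis char_zero_def zero_neq_numeral)
qed

text \<open>The hypothesis of the following lemma excludes the junk value of the inverse of zero.\<close>

lemma ec_same_abscissa:
  assumes "field R" "Affine x y1 \<in> ec_carrier R E" "Affine x y2 \<in> ec_carrier R E" "y1 \<noteq> \<ominus>\<^bsub>R\<^esub> y2"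
  shows "y2 = y1" "y1 \<noteq> \<zero>\<^bsub>R\<^esub>"
proof -
  interpret R: field R by fact
  have c: "y1 \<in> carrier R" "y2 \<in> carrier R" and "y1 [^]\<^bsub>R\<^esub> (2::nat) = y2 [^]\<^bsub>R\<^esub> (2::nat)"
    using assms(2,3) by (auto simp: ec_carrier_def)
  then have "y1 \<otimes>\<^bsub>R\<^esub> y1 = y2 \<otimes>\<^bsub>R\<^esub> y2" by (simp add: R.nat_pow_Suc numeral_2_eq_2)
  then have "(y1 \<ominus>\<^bsub>R\<^esub> y2) \<otimes>\<^bsub>R\<^esub> (y1 \<oplus>\<^bsub>R\<^esub> y2) = \<zero>\<^bsub>R\<^esub>"
    using c by algebra
  then have "y1 \<ominus>\<^bsub>R\<^esub> y2 = \<zero>\<^bsub>R\<^esub> \<or> y1 \<oplus>\<^bsub>R\<^esub> y2 = \<zero>\<^bsub>R\<^esub>"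
    by (intro R.integral) (use c in simp_all)
  moreover have "y1 \<oplus>\<^bsub>R\<^esub> y2 \<noteq> \<zero>\<^bsub>R\<^esub>"
    using assms(4) c R.minus_equality R.a_comm by metis
  ultimately show "y2 = y1" using c by auto
  then show "y1 \<noteq> \<zero>\<^bsub>R\<^esub>" using assms(4) by (metis R.minus_zero)
qed

text \<open>All inverses that occur are inverses of nonzero elements: equal abscissas without
  cancellation force a nonzero ordinate y1, and 2 y1 is then nonzero in characteristic zero. The
  default value of the inverse of zero, which homomorphisms need not respect, is never met.\<close>

lemma ec_add_hom:
  assumes h: "h \<in> ring_hom R S" "field R" "field S" "char_zero R"
    and PQ: "P \<in> ec_carrier R E" "Q \<in> ec_carrier R E"
  shows "map_ec_point h (ec_add R E P Q) = ec_add S E (map_ec_point h P) (map_ec_point h Q)"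
proof -
  interpret R: field R by fact
  interpret S: field S by fact
  interpret ring_hom_cring R S h
    using assms by unfold_locales simp
  note [simp] = int_in_hom[OF assms(1) R.ring_axioms S.ring_axioms]
  note [simp] = int_in_simps(1)[OF R.ring_axioms]
  have inj: "h x = h y \<longleftrightarrow> x = y" if "x \<in> carrier R" "y \<in> carrier R" for x y
    using field_char_zero_inj[OF h(1-3)] that by (auto simp: inj_on_def)
  have hm: "h (x \<ominus>\<^bsub>R\<^esub> y) = h x \<ominus>\<^bsub>S\<^esub> h y" if "x \<in> carrier R" "y \<in> carrier R" for x y
    using that by (simp add: a_minus_def)
  show ?thesis
  proof (cases "P = Infinity \<or> Q = Infinity")
    case True
    then show ?thesis by (cases P; cases Q) auto
  next
    case False
    then obtain x1 y1 x2 y2 where P: "P = Affine x1 y1" and Q: "Q = Affine x2 y2"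
      by (metis ec_point.exhaust)
    have c: "x1 \<in> carrier R" "y1 \<in> carrier R" "x2 \<in> carrier R" "y2 \<in> carrier R"
      using PQ P Q by (auto simp: ec_carrier_def)
    have eqs: "h x1 = h x2 \<longleftrightarrow> x1 = x2" "h y1 = \<ominus>\<^bsub>S\<^esub> h y2 \<longleftrightarrow> y1 = \<ominus>\<^bsub>R\<^esub> y2"
      using inj[of x1 x2] inj[of y1 "\<ominus>\<^bsub>R\<^esub> y2"] c by auto
    show ?thesis
    proof (cases "x1 = x2 \<and> y1 = \<ominus>\<^bsub>R\<^esub> y2")
      case True
      then show ?thesis using P Q c by simp
    next
      case nn: False
      define l where "l = ec_slope R E x1 y1 x2 y2"
      have l: "l \<in> carrier R \<and> h l = ec_slope S E (h x1) (h y1) (h x2) (h y2)"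
      proof (cases "x1 = x2")
        case True
        then have "y1 \<noteq> \<zero>\<^bsub>R\<^esub>" using ec_same_abscissa[OF h(2), of x1 y1 E y2] nn PQ P Q by auto
        then have nz: "int_in R 2 \<otimes>\<^bsub>R\<^esub> y1 \<noteq> \<zero>\<^bsub>R\<^esub>" by (rule double_nonzero[OF h(2,4) c(2)])
        then have "int_in R 2 \<otimes>\<^bsub>R\<^esub> y1 \<in> Units R" using c R.field_Units by auto
        then have "inv\<^bsub>R\<^esub> (int_in R 2 \<otimes>\<^bsub>R\<^esub> y1) \<in> carrier R" by simp
        then show ?thesis using True c field_hom_inv(1)[OF h(1-3) _ nz]
          by (simp add: l_def ec_slope_def)
      next
        case False
        then have nz: "x2 \<ominus>\<^bsub>R\<^esub> x1 \<noteq> \<zero>\<^bsub>R\<^esub>" using c by auto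
        then have "x2 \<ominus>\<^bsub>R\<^esub> x1 \<in> Units R" using c R.field_Units by auto
        then have "inv\<^bsub>R\<^esub> (x2 \<ominus>\<^bsub>R\<^esub> x1) \<in> carrier R" by simp
        then show ?thesis using False c field_hom_inv(1)[OF h(1-3) _ nz] eqs hm
          by (simp add: l_def ec_slope_def)
      qed
      show ?thesis using nn P Q c eqs l hm by (simp add: Let_def l_def[symmetric])
    qed
  qed
qed

lemma comm_group_ec_transfer:
  assumes h: "h \<in> ring_iso R S" "field R" "field S" "char_zero R"
    and G: "comm_group (ec_group R E)"
  shows "comm_group (ec_group S E)"
proof -
  interpret R: field R by fact
  interpret S: field S by fact
  have hom: "h \<in> ring_hom R S" and bij: "bij_betw h (carrier R) (carrier S)"
    using h(1) by (auto simp: ring_iso_def)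
  have inv: "inv_into (carrier R) h \<in> ring_iso S R"
    using ring_iso_set_sym[OF R.ring_axioms h(1)] .
  define g where "g = inv_into (carrier R) h"
  have ghom: "g \<in> ring_hom S R" using inv by (auto simp: ring_iso_def g_def)
  have hg: "map_ec_point h (map_ec_point g P) = P" if "P \<in> ec_carrier S E" for P
    using that bij by (cases P) (auto simp: g_def ec_carrier_def bij_betw_inv_into_right)
  have "map_ec_point h \<in> hom (ec_group R E) (ec_group S E)"
    using ec_add_hom[OF hom h(2-4)] ec_carrier_hom[OF hom h(2,3)]
    by (auto simp: hom_def ec_group_def)
  moreover have "map_ec_point h ` carrier (ec_group R E) = carrier (ec_group S E)"
    using ec_carrier_hom[OF hom h(2,3)] ec_carrier_hom[OF ghom h(3,2)] hg
    by (auto simp: ec_group_def image_iff) metis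
  moreover have "map_ec_point h \<one>\<^bsub>ec_group R E\<^esub> = \<one>\<^bsub>ec_group S E\<^esub>"
    by (simp add: ec_group_def)
  ultimately show ?thesis
    using comm_group.hom_imp_img_comm_group[OF G, of "map_ec_point h" "ec_group S E"]
    by (auto simp: ec_group_def)
qed

subsection \<open>The group law over a field of characteristic zero\<close>

definition split_curve :: "int \<Rightarrow> int \<Rightarrow> int \<Rightarrow> cubic_curve" where
  "split_curve e1 e2 e3 =
     \<lparr>coeff_a2 = - (e1 + e2 + e3), coeff_a4 = e1 * e2 + e1 * e3 + e2 * e3, coeff_a6 = - (e1 * e2 * e3)\<rparr>"

lemma split_curve_equation:
  fixes x :: "'a :: comm_ring_1"
  shows "x^3 + of_int (coeff_a2 (split_curve e1 e2 e3)) * x^2 + of_int (coeff_a4 (split_curve e1 e2 e3)) * x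
      + of_int (coeff_a6 (split_curve e1 e2 e3)) = (x - of_int e1) * (x - of_int e2) * (x - of_int e3)"
  by (simp add: split_curve_def algebra_simps power2_eq_square power3_eq_cube)

lemma split_curve_nonsingular:
  assumes "e1 \<noteq> e2" "e1 \<noteq> e3" "e2 \<noteq> e3"
  shows "nonsingular_cubic (of_int (coeff_a2 (split_curve e1 e2 e3)) :: 'a :: field_char_0)
    (of_int (coeff_a4 (split_curve e1 e2 e3))) (of_int (coeff_a6 (split_curve e1 e2 e3)))"
proof
  fix x :: 'a
  let ?d = "3 * x^2 + 2 * of_int (coeff_a2 (split_curve e1 e2 e3)) * x + of_int (coeff_a4 (split_curve e1 e2 e3))"
  have d: "?d = (x - of_int e1) * (x - of_int e2) + (x - of_int e1) * (x - of_int e3) + (x - of_int e2) * (x - of_int e3)"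
    by (simp add: split_curve_def algebra_simps power2_eq_square)
  assume "x^3 + of_int (coeff_a2 (split_curve e1 e2 e3)) * x^2 + of_int (coeff_a4 (split_curve e1 e2 e3)) * x
      + of_int (coeff_a6 (split_curve e1 e2 e3)) = 0"
  then have "x = of_int e1 \<or> x = of_int e2 \<or> x = of_int e3"
    unfolding split_curve_equation by auto
  then show "?d \<noteq> 0" unfolding d using assms by auto
qed simp

context nonsingular_cubic
begin

context
  fixes E :: cubic_curve
  assumes coeffs: "a = of_int (coeff_a2 E)" "b = of_int (coeff_a4 E)" "c = of_int (coeff_a6 E)"
begin

lemma ec_carrier_type: "ec_carrier (ring_of_type_algebra :: 'a ring) E = {P. on_curve P}"
proof -
  have "P \<in> ec_carrier (ring_of_type_algebra :: 'a ring) E \<longleftrightarrow> on_curve P" for P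
    by (cases P) (simp_all add: ec_carrier_def coeffs[symmetric])
  then show ?thesis by blast
qed

lemma ec_add_type:
  assumes "on_curve P" "on_curve Q"
  shows "ec_add (ring_of_type_algebra :: 'a ring) E P Q = add P Q"
proof (cases "P = Infinity \<or> Q = Infinity \<or> Q = neg P")
  case True
  then show ?thesis by (cases P; cases Q) auto
next
  case False
  then obtain x1 y1 x2 y2 where P: "P = Affine x1 y1" and Q: "Q = Affine x2 y2"
    by (metis ec_point.exhaust)
  have "ec_slope (ring_of_type_algebra :: 'a ring) E x1 y1 x2 y2 = slope x1 y1 x2 y2"
  proof (cases "x1 = x2")
    case True
    then have "y1 \<noteq> - y2" using False P Q by auto
    then have "y1 \<noteq> 0"
      using ec_same_abscissa(2)[OF type_ring_field, of x1 y1 E y2] assms P Q True by (simp add: ec_carrier_type)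
    then show ?thesis
      using True two_nonzero by (simp add: ec_slope_def slope_def coeffs[symmetric] field_simps)
  next
    case False
    then show ?thesis by (simp add: ec_slope_def slope_def field_simps)
  qed
  then show ?thesis using False P Q by (auto simp: coeffs[symmetric] Let_def)
qed

lemma comm_group_ec_type: "comm_group (ec_group (ring_of_type_algebra :: 'a ring) E)"
proof (rule comm_groupI)
  fix x y assume "x \<in> carrier (ec_group (ring_of_type_algebra :: 'a ring) E)"
    "y \<in> carrier (ec_group (ring_of_type_algebra :: 'a ring) E)"
  then show "x \<otimes>\<^bsub>ec_group ring_of_type_algebra E\<^esub> y = y \<otimes>\<^bsub>ec_group ring_of_type_algebra E\<^esub> x"
    using add_commute by (simp add: ec_group_def ec_carrier_type ec_add_type)
next
  fix x assume "x \<in> carrier (ec_group (ring_of_type_algebra :: 'a ring) E)"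
  then have "neg x \<in> carrier (ec_group ring_of_type_algebra E)"
    "neg x \<otimes>\<^bsub>ec_group ring_of_type_algebra E\<^esub> x = \<one>\<^bsub>ec_group ring_of_type_algebra E\<^esub>"
    by (simp_all add: ec_group_def ec_carrier_type ec_add_type)
  then show "\<exists>y\<in>carrier (ec_group ring_of_type_algebra E).
      y \<otimes>\<^bsub>ec_group ring_of_type_algebra E\<^esub> x = \<one>\<^bsub>ec_group ring_of_type_algebra E\<^esub>" by blast
qed (simp_all add: ec_group_def ec_carrier_type ec_add_type add_on_curve add_assoc)

end
end

lemma comm_group_split_type:
  assumes "e1 \<noteq> e2" "e1 \<noteq> e3" "e2 \<noteq> e3"
  shows "comm_group (ec_group (ring_of_type_algebra :: 'a::field_char_0 ring) (split_curve e1 e2 e3))"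
proof -
  interpret nonsingular_cubic "of_int (coeff_a2 (split_curve e1 e2 e3)) :: 'a"
    "of_int (coeff_a4 (split_curve e1 e2 e3))" "of_int (coeff_a6 (split_curve e1 e2 e3))"
    using split_curve_nonsingular[OF assms] .
  show ?thesis by (rule comm_group_ec_type) simp_all
qed

text \<open>If the numbers $x - e_i = a_i^2$ are squares, then the point with abscissa \<open>x\<close> is divisible by two;
  this is one of its halves. The other ones are obtained by changing signs.\<close>

definition half_point :: "'a ring \<Rightarrow> 'a \<Rightarrow> 'a \<Rightarrow> 'a \<Rightarrow> 'a \<Rightarrow> 'a ec_point" where
  "half_point R x a1 a2 a3 = Affine (x \<oplus>\<^bsub>R\<^esub> (a1 \<otimes>\<^bsub>R\<^esub> a2 \<oplus>\<^bsub>R\<^esub> a1 \<otimes>\<^bsub>R\<^esub> a3 \<oplus>\<^bsub>R\<^esub> a2 \<otimes>\<^bsub>R\<^esub> a3))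
     ((a1 \<oplus>\<^bsub>R\<^esub> a2) \<otimes>\<^bsub>R\<^esub> (a1 \<oplus>\<^bsub>R\<^esub> a3) \<otimes>\<^bsub>R\<^esub> (a2 \<oplus>\<^bsub>R\<^esub> a3))"

text \<open>Adding the 2-torsion point over e_i keeps the root a_i and negates the other two. This
  is how Galois conjugation will act on a half of the point, so it is what the descent needs to know
  about \<open>half_point\<close>.\<close>

definition halving :: "'a ring \<Rightarrow> int \<Rightarrow> int \<Rightarrow> int \<Rightarrow> bool" where
  "halving R e1 e2 e3 \<longleftrightarrow> (\<forall>x\<in>carrier R. \<forall>a1\<in>carrier R. \<forall>a2\<in>carrier R. \<forall>a3\<in>carrier R.
     a1 \<otimes>\<^bsub>R\<^esub> a1 = x \<ominus>\<^bsub>R\<^esub> int_in R e1 \<longrightarrow> a2 \<otimes>\<^bsub>R\<^esub> a2 = x \<ominus>\<^bsub>R\<^esub> int_in R e2 \<longrightarrow>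
     a3 \<otimes>\<^bsub>R\<^esub> a3 = x \<ominus>\<^bsub>R\<^esub> int_in R e3 \<longrightarrow>
     (let E = split_curve e1 e2 e3; P = half_point R x a1 a2 a3 in
        P \<in> ec_carrier R E \<and>
        ec_add R E (Affine (int_in R e1) \<zero>\<^bsub>R\<^esub>) P = half_point R x a1 (\<ominus>\<^bsub>R\<^esub> a2) (\<ominus>\<^bsub>R\<^esub> a3) \<and>
        ec_add R E (Affine (int_in R e2) \<zero>\<^bsub>R\<^esub>) P = half_point R x (\<ominus>\<^bsub>R\<^esub> a1) a2 (\<ominus>\<^bsub>R\<^esub> a3) \<and>
        ec_add R E (Affine (int_in R e3) \<zero>\<^bsub>R\<^esub>) P = half_point R x (\<ominus>\<^bsub>R\<^esub> a1) (\<ominus>\<^bsub>R\<^esub> a2) a3))"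

lemma half_point_hom:
  assumes "h \<in> ring_hom R S" "ring R" "ring S" "x \<in> carrier R" "a1 \<in> carrier R" "a2 \<in> carrier R" "a3 \<in> carrier R"
  shows "map_ec_point h (half_point R x a1 a2 a3) = half_point S (h x) (h a1) (h a2) (h a3)"
proof -
  interpret ring_hom_ring R S h using assms by (simp add: ring_hom_ringI2)
  show ?thesis using assms(4-) by (simp add: half_point_def)
qed

lemma two_torsion_in_carrier:
  assumes "field R" "e \<in> {e1, e2, e3}"
  shows "Affine (int_in R e) \<zero>\<^bsub>R\<^esub> \<in> ec_carrier R (split_curve e1 e2 e3)"
proof -
  interpret field R by fact
  have p: "int_in R e [^]\<^bsub>R\<^esub> n = int_in R (e ^ n)" for n :: nat
    by (induction n) (simp_all add: int_in_simps ring_axioms m_comm)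
  have "int_in R (e^3) \<oplus>\<^bsub>R\<^esub> int_in R (coeff_a2 (split_curve e1 e2 e3)) \<otimes>\<^bsub>R\<^esub> int_in R (e^2)
      \<oplus>\<^bsub>R\<^esub> int_in R (coeff_a4 (split_curve e1 e2 e3)) \<otimes>\<^bsub>R\<^esub> int_in R e \<oplus>\<^bsub>R\<^esub> int_in R (coeff_a6 (split_curve e1 e2 e3))
     = int_in R (e^3 + coeff_a2 (split_curve e1 e2 e3) * e^2 + coeff_a4 (split_curve e1 e2 e3) * e + coeff_a6 (split_curve e1 e2 e3))"
    by (simp add: int_in_simps ring_axioms)
  also have "e^3 + coeff_a2 (split_curve e1 e2 e3) * e^2 + coeff_a4 (split_curve e1 e2 e3) * e + coeff_a6 (split_curve e1 e2 e3) = 0"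
    using split_curve_equation[of e e1 e2 e3] assms(2) by auto
  finally show ?thesis
    by (simp add: ec_carrier_def p int_in_simps ring_axioms nat_pow_zero)
qed

text \<open>For the abscissa x' of the half point, x' - e1 = (a1 + a2) (a1 + a3), and similarly for
  e2 and e3. Hence the product of the three differences is a square, and the line to (e1, 0) has
  slope a2 + a3. The sums a1 + a2 and a1 + a3 are nonzero because the roots e_i are
  distinct.\<close>

lemma halving_aux:
  fixes x :: "'a::field_char_0"
  assumes "a1 * a1 = x - of_int e1" "a2 * a2 = x - of_int e2" "a3 * a3 = x - of_int e3"
    and "e1 \<noteq> e2" "e1 \<noteq> e3" "e2 \<noteq> e3"
  shows "half_point ring_of_type_algebra x a1 a2 a3 \<in> ec_carrier ring_of_type_algebra (split_curve e1 e2 e3)"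
    and "ec_add ring_of_type_algebra (split_curve e1 e2 e3) (Affine (of_int e1) 0) (half_point ring_of_type_algebra x a1 a2 a3)
      = half_point ring_of_type_algebra x a1 (- a2) (- a3)"
proof -
  define x' where "x' = x + (a1 * a2 + a1 * a3 + a2 * a3)"
  define y' where "y' = (a1 + a2) * (a1 + a3) * (a2 + a3)"
  have d: "x' - of_int e1 = (a1 + a2) * (a1 + a3)" "x' - of_int e2 = (a1 + a2) * (a2 + a3)"
    "x' - of_int e3 = (a1 + a3) * (a2 + a3)"
    using assms(1-3) unfolding x'_def by (simp_all add: algebra_simps)
  have "y'^2 = (x' - of_int e1) * (x' - of_int e2) * (x' - of_int e3)"
    unfolding d y'_def by (simp add: power2_eq_square)
  then show "half_point ring_of_type_algebra x a1 a2 a3 \<in> ec_carrier ring_of_type_algebra (split_curve e1 e2 e3)"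
    unfolding split_curve_equation[symmetric] by (simp add: half_point_def ec_carrier_def x'_def y'_def)
  have "(a1 + a2) * (a1 - a2) = of_int e2 - of_int e1" "(a1 + a3) * (a1 - a3) = of_int e3 - of_int e1"
    using assms(1-3) by (simp_all add: algebra_simps)
  then have nz: "a1 + a2 \<noteq> 0" "a1 + a3 \<noteq> 0" using assms(4-) by auto
  have ne: "x' \<noteq> of_int e1" using d(1) nz by auto
  have "y' = (a2 + a3) * (x' - of_int e1)" by (simp add: d y'_def)
  then have slope: "ec_slope ring_of_type_algebra (split_curve e1 e2 e3) (of_int e1) 0 x' y' = a2 + a3"
    using ne by (simp add: ec_slope_def)
  have x3: "(a2 + a3)^2 + of_int (e1 + e2 + e3) - of_int e1 - x' = x - a1 * a2 - a1 * a3 + a2 * a3"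
  proof -
    have e: "of_int e2 = x - a2 * a2" "of_int e3 = x - a3 * a3" using assms(2,3) by simp_all
    show ?thesis unfolding x'_def of_int_add e by (simp add: algebra_simps power2_eq_square)
  qed
  have y3: "(a2 + a3) * (of_int e1 - (x - a1 * a2 - a1 * a3 + a2 * a3)) = (a1 - a2) * (a1 - a3) * (- a2 - a3)"
  proof -
    have e: "of_int e1 = x - a1 * a1" using assms(1) by simp
    show ?thesis unfolding e by (simp add: algebra_simps)
  qed
  define z where "z = x - a1 * a2 - a1 * a3 + a2 * a3"
  have x3': "(a2 + a3)^2 - of_int (coeff_a2 (split_curve e1 e2 e3)) - of_int e1 - x' = z"
    using x3 by (simp add: z_def split_curve_def)
  have "half_point ring_of_type_algebra x a1 a2 a3 = Affine x' y'"
    by (simp add: half_point_def x'_def y'_def)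
  moreover have "half_point ring_of_type_algebra x a1 (- a2) (- a3) = Affine z ((a1 - a2) * (a1 - a3) * (- a2 - a3))"
    by (simp add: half_point_def z_def algebra_simps)
  moreover have "ec_add ring_of_type_algebra (split_curve e1 e2 e3) (Affine (of_int e1) 0) (Affine x' y')
      = Affine z ((a2 + a3) * (of_int e1 - z))"
    using ne[symmetric]
    by (simp only: ec_add.simps Let_def slope type_ring_pow type_ring_a_minus type_ring_simps int_in_type x3'
        simp_thms if_False diff_zero)
  ultimately show "ec_add ring_of_type_algebra (split_curve e1 e2 e3) (Affine (of_int e1) 0) (half_point ring_of_type_algebra x a1 a2 a3)
      = half_point ring_of_type_algebra x a1 (- a2) (- a3)"
    using y3 unfolding z_def by presburger
qed

lemma halving_type:
  assumes "e1 \<noteq> e2" "e1 \<noteq> e3" "e2 \<noteq> e3"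
  shows "halving (ring_of_type_algebra :: 'a::field_char_0 ring) e1 e2 e3"
  unfolding halving_def Let_def
proof (intro ballI impI)
  let ?R = "ring_of_type_algebra :: 'a::field_char_0 ring"
  fix x a1 a2 a3 :: 'a
  assume *: "a1 \<otimes>\<^bsub>?R\<^esub> a1 = x \<ominus>\<^bsub>?R\<^esub> int_in ?R e1" "a2 \<otimes>\<^bsub>?R\<^esub> a2 = x \<ominus>\<^bsub>?R\<^esub> int_in ?R e2"
    "a3 \<otimes>\<^bsub>?R\<^esub> a3 = x \<ominus>\<^bsub>?R\<^esub> int_in ?R e3"
  have sym: "half_point ?R x a2 a1 a3 = half_point ?R x a1 a2 a3"
    "half_point ?R x a3 a1 a2 = half_point ?R x a1 a2 a3"
    "half_point ?R x a2 (- a1) (- a3) = half_point ?R x (- a1) a2 (- a3)"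
    "half_point ?R x a3 (- a1) (- a2) = half_point ?R x (- a1) (- a2) a3"
    by (simp_all add: half_point_def algebra_simps)
  have swap: "split_curve e2 e1 e3 = split_curve e1 e2 e3" "split_curve e3 e1 e2 = split_curve e1 e2 e3"
    by (simp_all add: split_curve_def algebra_simps)
  show "half_point ?R x a1 a2 a3 \<in> ec_carrier ?R (split_curve e1 e2 e3) \<and>
     ec_add ?R (split_curve e1 e2 e3) (Affine (int_in ?R e1) \<zero>\<^bsub>?R\<^esub>) (half_point ?R x a1 a2 a3) =
       half_point ?R x a1 (\<ominus>\<^bsub>?R\<^esub> a2) (\<ominus>\<^bsub>?R\<^esub> a3) \<and>
     ec_add ?R (split_curve e1 e2 e3) (Affine (int_in ?R e2) \<zero>\<^bsub>?R\<^esub>) (half_point ?R x a1 a2 a3) =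
       half_point ?R x (\<ominus>\<^bsub>?R\<^esub> a1) a2 (\<ominus>\<^bsub>?R\<^esub> a3) \<and>
     ec_add ?R (split_curve e1 e2 e3) (Affine (int_in ?R e3) \<zero>\<^bsub>?R\<^esub>) (half_point ?R x a1 a2 a3) =
       half_point ?R x (\<ominus>\<^bsub>?R\<^esub> a1) (\<ominus>\<^bsub>?R\<^esub> a2) a3"
    using * assms halving_aux[of a1 x e1 a2 e2 a3 e3] halving_aux(2)[of a2 x e2 a1 e1 a3 e3]
      halving_aux(2)[of a3 x e3 a1 e1 a2 e2]
    by (simp add: swap sym)
qed

lemma halving_transfer:
  assumes h: "h \<in> ring_iso R S" "field R" "field S" "char_zero R" and H: "halving R e1 e2 e3"
  shows "halving S e1 e2 e3"
  unfolding halving_def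
proof (intro ballI impI)
  interpret R: field R by fact
  interpret S: field S by fact
  have hom: "h \<in> ring_hom R S" and bij: "bij_betw h (carrier R) (carrier S)"
    using h(1) by (auto simp: ring_iso_def)
  interpret ring_hom_ring R S h using hom R.ring_axioms S.ring_axioms by (simp add: ring_hom_ringI2)
  note i = int_in_hom[OF hom R.ring_axioms S.ring_axioms]
  have inj: "h x = h y \<longleftrightarrow> x = y" if "x \<in> carrier R" "y \<in> carrier R" for x y
    using bij that by (auto simp: bij_betw_def inj_on_def)
  fix x' a1' a2' a3' assume "x' \<in> carrier S" "a1' \<in> carrier S" "a2' \<in> carrier S" "a3' \<in> carrier S"
  then obtain x a1 a2 a3 where p: "x' = h x" "a1' = h a1" "a2' = h a2" "a3' = h a3"
    and c: "x \<in> carrier R" "a1 \<in> carrier R" "a2 \<in> carrier R" "a3 \<in> carrier R"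
    using bij unfolding bij_betw_def by blast
  have hm: "h (y \<ominus>\<^bsub>R\<^esub> z) = h y \<ominus>\<^bsub>S\<^esub> h z" if "y \<in> carrier R" "z \<in> carrier R" for y z
    using that by (simp add: a_minus_def)
  have sq: "a \<otimes>\<^bsub>R\<^esub> a = x \<ominus>\<^bsub>R\<^esub> int_in R e" if "h a \<otimes>\<^bsub>S\<^esub> h a = h x \<ominus>\<^bsub>S\<^esub> int_in S e" "a \<in> carrier R" for a e
    using that c inj[of "a \<otimes>\<^bsub>R\<^esub> a" "x \<ominus>\<^bsub>R\<^esub> int_in R e"] hm int_in_simps(1)[OF R.ring_axioms, of e] i[of e] by simp
  assume "a1' \<otimes>\<^bsub>S\<^esub> a1' = x' \<ominus>\<^bsub>S\<^esub> int_in S e1" "a2' \<otimes>\<^bsub>S\<^esub> a2' = x' \<ominus>\<^bsub>S\<^esub> int_in S e2"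
    "a3' \<otimes>\<^bsub>S\<^esub> a3' = x' \<ominus>\<^bsub>S\<^esub> int_in S e3"
  then have e: "a1 \<otimes>\<^bsub>R\<^esub> a1 = x \<ominus>\<^bsub>R\<^esub> int_in R e1" "a2 \<otimes>\<^bsub>R\<^esub> a2 = x \<ominus>\<^bsub>R\<^esub> int_in R e2"
    "a3 \<otimes>\<^bsub>R\<^esub> a3 = x \<ominus>\<^bsub>R\<^esub> int_in R e3"
    using p c sq by auto
  let ?E = "split_curve e1 e2 e3" and ?P = "half_point R x a1 a2 a3"
  have *: "?P \<in> ec_carrier R ?E"
    "ec_add R ?E (Affine (int_in R e1) \<zero>\<^bsub>R\<^esub>) ?P = half_point R x a1 (\<ominus>\<^bsub>R\<^esub> a2) (\<ominus>\<^bsub>R\<^esub> a3)"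
    "ec_add R ?E (Affine (int_in R e2) \<zero>\<^bsub>R\<^esub>) ?P = half_point R x (\<ominus>\<^bsub>R\<^esub> a1) a2 (\<ominus>\<^bsub>R\<^esub> a3)"
    "ec_add R ?E (Affine (int_in R e3) \<zero>\<^bsub>R\<^esub>) ?P = half_point R x (\<ominus>\<^bsub>R\<^esub> a1) (\<ominus>\<^bsub>R\<^esub> a2) a3"
    using H c e unfolding halving_def Let_def by blast+
  have T: "ec_add S ?E (Affine (int_in S e) \<zero>\<^bsub>S\<^esub>) (map_ec_point h ?P)
      = map_ec_point h (ec_add R ?E (Affine (int_in R e) \<zero>\<^bsub>R\<^esub>) ?P)" if "e \<in> {e1, e2, e3}" for e
    using ec_add_hom[OF hom h(2-4) two_torsion_in_carrier[OF h(2) that] *(1)] by (simp add: i)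
  have hp: "half_point S (h x) (h b1) (h b2) (h b3) = map_ec_point h (half_point R x b1 b2 b3)"
    if "b1 \<in> carrier R" "b2 \<in> carrier R" "b3 \<in> carrier R" for b1 b2 b3
    using half_point_hom[OF hom R.ring_axioms S.ring_axioms c(1) that] by simp
  have P: "half_point S x' a1' a2' a3' = map_ec_point h ?P"
    using hp[OF c(2-4)] by (simp only: p)
  have neg: "h (\<ominus>\<^bsub>R\<^esub> a) = \<ominus>\<^bsub>S\<^esub> h a" if "a \<in> carrier R" for a using that by simp
  have "ec_add S ?E (Affine (int_in S e1) \<zero>\<^bsub>S\<^esub>) (map_ec_point h ?P) = half_point S x' a1' (\<ominus>\<^bsub>S\<^esub> a2') (\<ominus>\<^bsub>S\<^esub> a3')"
    using T[of e1] hp[of a1 "\<ominus>\<^bsub>R\<^esub> a2" "\<ominus>\<^bsub>R\<^esub> a3"] c by (simp only: p *(2) neg R.a_inv_closed insert_iff simp_thms)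
  moreover have "ec_add S ?E (Affine (int_in S e2) \<zero>\<^bsub>S\<^esub>) (map_ec_point h ?P) = half_point S x' (\<ominus>\<^bsub>S\<^esub> a1') a2' (\<ominus>\<^bsub>S\<^esub> a3')"
    using T[of e2] hp[of "\<ominus>\<^bsub>R\<^esub> a1" a2 "\<ominus>\<^bsub>R\<^esub> a3"] c by (simp only: p *(3) neg R.a_inv_closed insert_iff simp_thms)
  moreover have "ec_add S ?E (Affine (int_in S e3) \<zero>\<^bsub>S\<^esub>) (map_ec_point h ?P) = half_point S x' (\<ominus>\<^bsub>S\<^esub> a1') (\<ominus>\<^bsub>S\<^esub> a2') a3'"
    using T[of e3] hp[of "\<ominus>\<^bsub>R\<^esub> a1" "\<ominus>\<^bsub>R\<^esub> a2" a3] c by (simp only: p *(4) neg R.a_inv_closed insert_iff simp_thms)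
  ultimately show "let E = ?E; P = half_point S x' a1' a2' a3' in
        P \<in> ec_carrier S E \<and>
        ec_add S E (Affine (int_in S e1) \<zero>\<^bsub>S\<^esub>) P = half_point S x' a1' (\<ominus>\<^bsub>S\<^esub> a2') (\<ominus>\<^bsub>S\<^esub> a3') \<and>
        ec_add S E (Affine (int_in S e2) \<zero>\<^bsub>S\<^esub>) P = half_point S x' (\<ominus>\<^bsub>S\<^esub> a1') a2' (\<ominus>\<^bsub>S\<^esub> a3') \<and>
        ec_add S E (Affine (int_in S e3) \<zero>\<^bsub>S\<^esub>) P = half_point S x' (\<ominus>\<^bsub>S\<^esub> a1') (\<ominus>\<^bsub>S\<^esub> a2') a3'"
    using ec_carrier_hom[OF hom h(2,3) *(1)] unfolding P Let_def by blast
qed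

subsection \<open>Conjugates of algebraic numbers\<close>

text \<open>What makes restriction of automorphisms possible: \<open>galois_restrict\<close> inverts
  the embedding with \<open>inv_into\<close>, whose value is arbitrary outside the image of the
  embedding.\<close>

definition root_stable :: "'b ring \<Rightarrow> bool" where
  "root_stable R \<longleftrightarrow> (\<forall>\<iota>\<in>ring_hom (alg_cl rat_field) R. \<forall>\<sigma>\<in>ring_hom R R.
     \<forall>x\<in>carrier (alg_cl rat_field). \<exists>y\<in>carrier (alg_cl rat_field). \<sigma> (\<iota> x) = \<iota> y)"

lemma map_poly_hom_mult:
  fixes h :: "'a::comm_ring_1 \<Rightarrow> 'b::comm_ring_1"
  assumes "h 0 = 0" "\<And>x y. h (x + y) = h x + h y" "\<And>x y. h (x * y) = h x * h y"
  shows "map_poly h (p * q) = map_poly h p * map_poly h q"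
proof -
  have s: "h (sum f A) = (\<Sum>x\<in>A. h (f x))" for f and A :: "nat set"
    by (induction A rule: infinite_finite_induct) (simp_all add: assms)
  show ?thesis by (rule poly_eqI) (simp add: coeff_map_poly coeff_mult assms s)
qed

lemma poly_map_poly_hom:
  fixes h :: "'a::comm_ring_1 \<Rightarrow> 'b::comm_ring_1"
  assumes "h 0 = 0" "\<And>x y. h (x + y) = h x + h y" "\<And>x y. h (x * y) = h x * h y"
  shows "poly (map_poly h p) (h x) = h (poly p x)"
  by (induction p) (simp_all add: assms map_poly_pCons)

lemma hom_of_rat:
  fixes h :: "'a::field_char_0 \<Rightarrow> 'b::field_char_0"
  assumes "h 0 = 0" "h 1 = 1" "\<And>x y. h (x + y) = h x + h y" "\<And>x y. h (x * y) = h x * h y"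
  shows "h (of_rat q) = of_rat q"
proof -
  have n: "h (of_nat n) = of_nat n" for n by (induction n) (simp_all add: assms)
  have m: "h (- x) = - h x" for x using assms(1) assms(3)[of x "- x"] by (simp add: add_eq_0_iff)
  have i: "h (of_int k) = of_int k" for k
    using n m by (cases k) (simp_all del: of_nat_Suc)
  obtain k l where q: "q = Rat.Fract k l" "l > 0" by (cases q) auto
  have "h (of_rat q * of_int l) = h (of_int k)"
    using q by (simp add: of_rat_rat)
  then have "h (of_rat q) * of_int l = of_int k" by (simp only: assms(4) i)
  then show ?thesis using q by (simp add: of_rat_rat field_simps)
qed

lemma to_ac_of_rat: "to_ac (q :: rat) = of_rat q"
  using hom_of_rat[of "to_ac :: rat \<Rightarrow> rat alg_closure" q] by simp

text \<open>A rational polynomial that annihilates x splits into linear factors over the algebraic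
  numbers, so the roots of its image are all of the form i a. As s fixes the rational coefficients,
  s (i x) is one of these roots.\<close>

lemma conjugate_in_range:
  fixes i :: "rat alg_closure \<Rightarrow> 'b::field_char_0" and s :: "'b \<Rightarrow> 'b"
  assumes i: "i 0 = 0" "i 1 = 1" "\<And>x y. i (x + y) = i x + i y" "\<And>x y. i (x * y) = i x * i y"
    and s: "s 0 = 0" "s 1 = 1" "\<And>x y. s (x + y) = s x + s y" "\<And>x y. s (x * y) = s x * s y"
  shows "\<exists>y. s (i x) = i y"
proof -
  obtain p :: "rat poly" where p: "p \<noteq> 0" "poly (map_poly to_ac p) x = 0"
    using alg_closure_algebraic by blast
  define P where "P = map_poly to_ac p"
  have P: "P \<noteq> 0" using p by (auto simp: P_def map_poly_eq_0_iff)
  obtain A where A: "P = smult (lead_coeff P) (\<Prod>a\<in>#A. [:- a, 1:])"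
    using alg_closed_imp_factorization[OF P] by blast
  have rat: "map_poly i P = map_poly of_rat p"
    by (simp add: P_def map_poly_map_poly i o_def to_ac_of_rat hom_of_rat[of i, OF i])
  have "poly (map_poly of_rat p) (s y) = s (poly (map_poly of_rat p) y)" for y
  proof -
    have "map_poly s (map_poly of_rat p) = map_poly of_rat p"
      by (simp add: map_poly_map_poly s o_def hom_of_rat[of s, OF s])
    then show ?thesis using poly_map_poly_hom[of s "map_poly of_rat p" y] s by simp
  qed
  moreover have "poly (map_poly i P) (i x) = 0"
    using poly_map_poly_hom[of i P x] i p(2) by (simp add: P_def)
  ultimately have z: "poly (map_poly i P) (s (i x)) = 0" by (simp add: rat s)
  have im: "i (- a) = - i a" for a using i(1) i(3)[of a "- a"] by (simp add: add_eq_0_iff)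
  have prod: "map_poly i (\<Prod>a\<in>#A. [:- a, 1:]) = (\<Prod>a\<in>#A. [:- i a, 1:])"
  proof (induction A)
    case (add a A)
    have "map_poly i [:- a, 1:] = [:- i a, 1:]" by (simp add: i map_poly_pCons im)
    then show ?case
      unfolding image_mset_add_mset prod_mset.add_mset add[symmetric]
      by (simp only: map_poly_hom_mult[of i, OF i(1,3,4)])
  qed (simp add: i)
  have "map_poly i P = smult (i (lead_coeff P)) (map_poly i (\<Prod>a\<in>#A. [:- a, 1:]))"
    by (subst A) (rule poly_eqI, simp add: coeff_map_poly i)
  moreover have "i (lead_coeff P) \<noteq> 0"
    using P i(1,2) i(4)[of "lead_coeff P" "inverse (lead_coeff P)"] by auto
  ultimately have "poly (\<Prod>a\<in>#A. [:- i a, 1:]) (s (i x)) = 0" using z prod by simp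
  then have "\<exists>a\<in>#A. s (i x) = i a" by (induction A) auto
  then show ?thesis by blast
qed

lemma Rep_alg_closure_iso:
  "Rep_alg_closure \<in> ring_iso (ring_of_type_algebra :: 'a::field alg_closure ring) (alg_cl (ring_of_type_algebra :: 'a ring))"
proof -
  have "bij_betw Rep_alg_closure (UNIV :: 'a alg_closure set) (carrier (alg_cl (ring_of_type_algebra :: 'a ring)))"
    unfolding bij_betw_def
    using type_definition.Rep_range[OF type_definition_alg_closure] type_definition.Rep_inject[OF type_definition_alg_closure]
    by (auto intro: injI)
  then show ?thesis
    by (auto simp: ring_iso_def ring_hom_def plus_alg_closure.rep_eq times_alg_closure.rep_eq
        one_alg_closure.rep_eq Rep_alg_closure)
qed

lemma root_stable_type: "root_stable (ring_of_type_algebra :: 'b::field_char_0 ring)"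
  unfolding root_stable_def
proof (intro ballI)
  let ?R = "ring_of_type_algebra :: 'b ring"
  have typed: "h 0 = 0 \<and> h 1 = 1 \<and> (\<forall>x y. h (x + y) = h x + h y) \<and> (\<forall>x y. h (x * y) = h x * h y)"
    if "h \<in> ring_hom (ring_of_type_algebra :: 'c ring) ?R" for h :: "'c::field \<Rightarrow> 'b"
    using that ring_hom_zero[OF that] field.is_ring[OF type_ring_field] by (auto simp: ring_hom_def)
  fix \<iota> \<sigma> x
  assume \<iota>: "\<iota> \<in> ring_hom (alg_cl rat_field) ?R" and \<sigma>: "\<sigma> \<in> ring_hom ?R ?R" and x: "x \<in> carrier (alg_cl rat_field)"
  have "\<iota> \<circ> Rep_alg_closure \<in> ring_hom (ring_of_type_algebra :: rat alg_closure ring) ?R"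
    by (rule ring_hom_trans[OF _ \<iota>]) (use Rep_alg_closure_iso[where 'a=rat] in \<open>simp add: ring_iso_def\<close>)
  from typed[OF this] typed[OF \<sigma>] obtain y where y: "\<sigma> ((\<iota> \<circ> Rep_alg_closure) (Abs_alg_closure x)) = (\<iota> \<circ> Rep_alg_closure) y"
    using conjugate_in_range[of "\<iota> \<circ> Rep_alg_closure" \<sigma> "Abs_alg_closure x"] by blast
  show "\<exists>y\<in>carrier (alg_cl rat_field). \<sigma> (\<iota> x) = \<iota> y"
    using y x by (auto simp: Abs_alg_closure_inverse intro: Rep_alg_closure)
qed

lemma root_stable_transfer:
  assumes "h \<in> ring_iso R S" "field R" "field S" "root_stable R"
  shows "root_stable S"
  unfolding root_stable_def
proof (intro ballI)
  interpret R: field R by fact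
  interpret S: field S by fact
  have hom: "h \<in> ring_hom R S" and bij: "bij_betw h (carrier R) (carrier S)"
    using assms(1) by (auto simp: ring_iso_def)
  define g where "g = inv_into (carrier R) h"
  have g: "g \<in> ring_hom S R"
    using ring_iso_set_sym[OF R.ring_axioms assms(1)] by (auto simp: ring_iso_def g_def)
  have hg: "h (g y) = y" if "y \<in> carrier S" for y
    using bij that by (simp add: g_def bij_betw_inv_into_right)
  fix \<iota> \<sigma> x
  assume \<iota>: "\<iota> \<in> ring_hom (alg_cl rat_field) S" and \<sigma>: "\<sigma> \<in> ring_hom S S" and x: "x \<in> carrier (alg_cl rat_field)"
  have "g \<circ> \<iota> \<in> ring_hom (alg_cl rat_field) R" "g \<circ> (\<sigma> \<circ> h) \<in> ring_hom R R"
    using ring_hom_trans[OF \<iota> g] ring_hom_trans[OF ring_hom_trans[OF hom \<sigma>] g] by simp_all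
  then obtain y where y: "y \<in> carrier (alg_cl rat_field)" "(g \<circ> (\<sigma> \<circ> h)) ((g \<circ> \<iota>) x) = (g \<circ> \<iota>) y"
    using assms(4) x unfolding root_stable_def by blast
  have "\<iota> x \<in> carrier S" "\<iota> y \<in> carrier S" "\<sigma> (\<iota> x) \<in> carrier S"
    using \<iota> \<sigma> x y(1) by (auto simp: ring_hom_def)
  moreover have "g (h (g (\<sigma> (h (g (\<iota> x)))))) = g (h (g (\<sigma> (\<iota> x))))"
    using hg calculation by simp
  moreover have "h (g (\<sigma> (h (g (\<iota> x))))) = h (g (\<iota> y))" using y(2) by simp
  ultimately have "\<sigma> (\<iota> x) = \<iota> y" using hg by simp
  then show "\<exists>y\<in>carrier (alg_cl rat_field). \<sigma> (\<iota> x) = \<iota> y" using y(1) by blast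
qed

subsection \<open>From fields of a type class to arbitrary fields\<close>

text \<open>A single predicate on records, so that one transfer along isomorphisms and one
  counterexample argument serve all three facts.\<close>

definition char_zero_facts :: "'a ring \<Rightarrow> bool" where
  "char_zero_facts R \<longleftrightarrow> root_stable R \<and>
     (\<forall>e1 e2 e3. e1 \<noteq> e2 \<longrightarrow> e1 \<noteq> e3 \<longrightarrow> e2 \<noteq> e3 \<longrightarrow>
        comm_group (ec_group R (split_curve e1 e2 e3)) \<and> halving R e1 e2 e3)"

lemma char_zero_facts_type: "char_zero_facts (ring_of_type_algebra :: 'a::field_char_0 ring)"
  by (simp add: char_zero_facts_def root_stable_type comm_group_split_type halving_type)

lemma char_zero_facts_transfer:
  assumes "h \<in> ring_iso R S" "field R" "field S" "char_zero R" "char_zero_facts R"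
  shows "char_zero_facts S"
  unfolding char_zero_facts_def
proof (intro conjI allI impI)
  show "root_stable S" using root_stable_transfer[OF assms(1-3)] assms(5) by (simp add: char_zero_facts_def)
  fix e1 e2 e3 :: int assume "e1 \<noteq> e2" "e1 \<noteq> e3" "e2 \<noteq> e3"
  then have *: "comm_group (ec_group R (split_curve e1 e2 e3))" "halving R e1 e2 e3"
    using assms(5) by (simp_all add: char_zero_facts_def)
  show "comm_group (ec_group S (split_curve e1 e2 e3))"
    by (rule comm_group_ec_transfer[OF assms(1-4) *(1)])
  show "halving S e1 e2 e3" by (rule halving_transfer[OF assms(1-4) *(2)])
qed

text \<open>The facts hold for fields that are given by a type class. To derive them for a field \<open>R\<close>
  on a subset of \<open>'a\<close>, a type is made of the field that violates them, if there is one.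
  The summand \<open>rat\<close> provides a field for the case that there is none.\<close>

definition violating :: "'a ring \<Rightarrow> bool" where
  "violating R \<longleftrightarrow> field R \<and> char_zero R \<and> \<not> char_zero_facts R"

definition test_ring :: "('a + rat) ring" where
  "test_ring = (if \<exists>R :: 'a ring. violating R
     then image_ring Inl (SOME R :: 'a ring. violating R) else image_ring Inr rat_field)"

lemma char_zero_type: "char_zero (ring_of_type_algebra :: 'a::field_char_0 ring)"
  by (simp add: char_zero_def)

lemma image_ring_Inl_Inr:
  assumes "field R" "char_zero R" "inj f"
  shows "field (image_ring f R)" "char_zero (image_ring f R)"
proof -
  have i: "inj_on f (carrier R)" using assms(3) by (simp add: inj_on_def)
  show f: "field (image_ring f R)" by (rule field.inj_imp_image_ring_is_field[OF assms(1) i])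
  have "f \<in> ring_hom R (image_ring f R)" using inj_imp_image_ring_iso[OF i] by (simp add: ring_iso_def)
  then show "char_zero (image_ring f R)" by (rule char_zero_hom[OF _ assms(1) f assms(2)])
qed

lemma test_ring: "field (test_ring :: ('a + rat) ring)" "char_zero (test_ring :: ('a + rat) ring)"
proof -
  have "field (test_ring :: ('a + rat) ring) \<and> char_zero (test_ring :: ('a + rat) ring)"
  proof (cases "\<exists>R :: 'a ring. violating R")
    case True
    define Q where "Q = (SOME R :: 'a ring. violating R)"
    have "violating Q" unfolding Q_def using True by (rule someI_ex)
    moreover have "test_ring = (image_ring Inl Q :: ('a + rat) ring)" using True by (simp add: test_ring_def Q_def)
    ultimately show ?thesis using image_ring_Inl_Inr[of Q "Inl :: 'a \<Rightarrow> 'a + rat"] by (simp add: violating_def)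
  next
    case False
    then show ?thesis using image_ring_Inl_Inr[of rat_field "Inr :: rat \<Rightarrow> 'a + rat"]
        type_ring_field[where 'a=rat] char_zero_type[where 'a=rat]
      by (simp add: test_ring_def)
  qed
  then show "field (test_ring :: ('a + rat) ring)" "char_zero (test_ring :: ('a + rat) ring)" by auto
qed

text \<open>If some field violated the facts, \<open>SOME\<close> would pick one and
  \<open>test_ring\<close> would be its copy under \<open>Inl\<close>. The copy has the facts, and
  the isomorphism carries them back to the chosen field.\<close>

lemma char_zero_facts_from_test_ring:
  assumes "char_zero_facts (test_ring :: ('a + rat) ring)" "field R" "char_zero R"
  shows "char_zero_facts (R :: 'a ring)"
proof (rule ccontr)
  assume "\<not> char_zero_facts R"
  then have ex: "\<exists>R :: 'a ring. violating R" using assms by (auto simp: violating_def)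
  define Q where "Q = (SOME R :: 'a ring. violating R)"
  have v: "violating Q" unfolding Q_def using ex by (rule someI_ex)
  have t: "test_ring = (image_ring Inl Q :: ('a + rat) ring)" using ex by (simp add: test_ring_def Q_def)
  have "inj (Inl :: 'a \<Rightarrow> 'a + rat)" by simp
  from inj_imp_image_ring_inv_iso[OF this, of Q]
  have "inv' Inl \<in> ring_iso (test_ring :: ('a + rat) ring) Q" by (simp add: t)
  then have "char_zero_facts Q"
    by (rule char_zero_facts_transfer[OF _ test_ring(1) _ test_ring(2) assms(1)])
      (use v in \<open>simp add: violating_def\<close>)
  then show False using v by (simp add: violating_def)
qed

text \<open>A type definition needs a set that depends on type variables only. This is why the
  counterexample is selected by \<open>SOME\<close> and is not a parameter.\<close>

typedef 'a test_field = "carrier (test_ring :: ('a + rat) ring)"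
  using field.is_ring[OF test_ring(1)] ring.ring_simprules(2) by blast

setup_lifting type_definition_test_field

instantiation test_field :: (type) field
begin

interpretation T: field "test_ring :: ('a + rat) ring" by (rule test_ring)

lift_definition zero_test_field :: "'a test_field" is "\<zero>\<^bsub>test_ring\<^esub>" by simp
lift_definition one_test_field :: "'a test_field" is "\<one>\<^bsub>test_ring\<^esub>" by simp
lift_definition plus_test_field :: "'a test_field \<Rightarrow> 'a test_field \<Rightarrow> 'a test_field"
  is "\<lambda>x y. x \<oplus>\<^bsub>test_ring\<^esub> y" by simp
lift_definition minus_test_field :: "'a test_field \<Rightarrow> 'a test_field \<Rightarrow> 'a test_field"
  is "\<lambda>x y. x \<ominus>\<^bsub>test_ring\<^esub> y" by simp
lift_definition times_test_field :: "'a test_field \<Rightarrow> 'a test_field \<Rightarrow> 'a test_field"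
  is "\<lambda>x y. x \<otimes>\<^bsub>test_ring\<^esub> y" by simp
lift_definition uminus_test_field :: "'a test_field \<Rightarrow> 'a test_field"
  is "\<lambda>x. \<ominus>\<^bsub>test_ring\<^esub> x" by simp
lift_definition inverse_test_field :: "'a test_field \<Rightarrow> 'a test_field"
  is "\<lambda>x. if x = \<zero>\<^bsub>test_ring\<^esub> then \<zero>\<^bsub>test_ring\<^esub> else inv\<^bsub>test_ring\<^esub> x"
  by (auto simp: T.field_Units)
definition divide_test_field :: "'a test_field \<Rightarrow> 'a test_field \<Rightarrow> 'a test_field" where
  "divide_test_field x y = x * inverse y"

instance
proof
  fix a b c :: "'a test_field"
  show "a + b + c = a + (b + c)" by transfer (rule T.a_assoc)
  show "a + b = b + a" by transfer (rule T.a_comm)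
  show "0 + a = a" by transfer simp
  show "- a + a = 0" by transfer (rule T.l_neg)
  show "a - b = a + - b" by transfer (simp add: a_minus_def)
  show "a * b * c = a * (b * c)" by transfer (rule T.m_assoc)
  show "a * b = b * a" by transfer (rule T.m_comm)
  show "1 * a = a" by transfer simp
  show "(a + b) * c = a * c + b * c" by transfer (rule T.l_distr)
  show "(0 :: 'a test_field) \<noteq> 1" by transfer simp
  show "inverse a * a = 1" if "a \<noteq> 0" using that by transfer (simp add: T.field_Units)
  show "a div b = a * inverse b" by (rule divide_test_field_def)
  show "inverse (0 :: 'a test_field) = 0" by transfer simp
qed

end

lemma Rep_test_field_iso: "Rep_test_field \<in> ring_iso ring_of_type_algebra test_ring"
proof -
  have "bij_betw Rep_test_field UNIV (carrier test_ring)"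
    unfolding bij_betw_def
    using type_definition.Rep_range[OF type_definition_test_field] type_definition.Rep_inject[OF type_definition_test_field]
    by (auto intro: injI)
  then show ?thesis
    by (auto simp: ring_iso_def ring_hom_def plus_test_field.rep_eq times_test_field.rep_eq
        one_test_field.rep_eq Rep_test_field)
qed

instance test_field :: (type) field_char_0
proof
  have "Rep_test_field \<in> ring_hom ring_of_type_algebra (test_ring :: ('a + rat) ring)"
    using Rep_test_field_iso[where 'a='a] by (simp add: ring_iso_def)
  from int_in_hom[OF this] have r: "Rep_test_field (of_int k :: 'a test_field) = int_in test_ring k" for k
    using field.is_ring[OF test_ring(1)] field.is_ring[OF type_ring_field] by simp
  have z: "k = 0" if "(of_int k :: 'a test_field) = 0" for k
    using test_ring(2)[where 'a='a] r[of k] r[of 0] that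
    by (simp add: char_zero_def int_in_simps(2)[OF field.is_ring[OF test_ring(1)]])
  show "inj (of_nat :: nat \<Rightarrow> 'a test_field)"
  proof (rule injI)
    fix m n assume "(of_nat m :: 'a test_field) = of_nat n"
    then have "(of_int (int m - int n) :: 'a test_field) = 0" by simp
    from z[OF this] show "m = n" by simp
  qed
qed

theorem char_zero_facts:
  assumes "field R" "char_zero R"
  shows "char_zero_facts R"
proof -
  have "char_zero_facts (test_ring :: ('a + rat) ring)"
    by (rule char_zero_facts_transfer[OF Rep_test_field_iso type_ring_field test_ring(1) char_zero_type
          char_zero_facts_type])
  then show ?thesis by (rule char_zero_facts_from_test_ring[OF _ assms])
qed

subsection \<open>Automorphisms of the field of algebraic numbers\<close>

type_synonym qbar = "rat alg_closure"

text \<open>Homomorphisms from subrings of the algebraic numbers, represented by their graphs.\<close>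

definition partial_hom :: "(qbar \<times> qbar) set \<Rightarrow> bool" where
  "partial_hom G \<longleftrightarrow> (\<forall>q. (of_rat q, of_rat q) \<in> G) \<and>
     (\<forall>a b c d. (a, b) \<in> G \<longrightarrow> (c, d) \<in> G \<longrightarrow> (a + c, b + d) \<in> G \<and> (a * c, b * d) \<in> G) \<and>
     (\<forall>b. (0, b) \<in> G \<longrightarrow> b = 0)"

text \<open>Negation is multiplication by the pair (- 1, - 1), and single-valuedness is the
  condition at 0 applied to a difference.\<close>

lemma partial_homD:
  assumes "partial_hom G"
  shows "(of_rat q, of_rat q) \<in> G"
    "(a, b) \<in> G \<Longrightarrow> (c, d) \<in> G \<Longrightarrow> (a + c, b + d) \<in> G"
    "(a, b) \<in> G \<Longrightarrow> (c, d) \<in> G \<Longrightarrow> (a * c, b * d) \<in> G"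
    "(0, b) \<in> G \<Longrightarrow> b = 0"
    "(a, b) \<in> G \<Longrightarrow> (- a, - b) \<in> G"
    "(a, b) \<in> G \<Longrightarrow> (a, c) \<in> G \<Longrightarrow> b = c"
    "(0, 0) \<in> G" "(1, 1) \<in> G"
proof -
  show q: "(of_rat q, of_rat q) \<in> G" for q using assms by (simp add: partial_hom_def)
  show add: "(a, b) \<in> G \<Longrightarrow> (c, d) \<in> G \<Longrightarrow> (a + c, b + d) \<in> G" for a b c d
    using assms by (simp add: partial_hom_def)
  show mul: "(a, b) \<in> G \<Longrightarrow> (c, d) \<in> G \<Longrightarrow> (a * c, b * d) \<in> G" for a b c d
    using assms by (simp add: partial_hom_def)
  show z: "(0, b) \<in> G \<Longrightarrow> b = 0" for b using assms by (simp add: partial_hom_def)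
  show neg: "(a, b) \<in> G \<Longrightarrow> (- a, - b) \<in> G" for a b using mul[OF q[of "- 1"], of a b] by simp
  show "(a, b) \<in> G \<Longrightarrow> (a, c) \<in> G \<Longrightarrow> b = c"
    using add[of a b "- a" "- c"] neg[of a c] z[of "b - c"] by simp
  show "(0, 0) \<in> G" "(1, 1) \<in> G" using q[of 0] q[of 1] by simp_all
qed

lemma rat_poly_in_partial_hom:
  assumes "partial_hom G" "(a, b) \<in> G"
  shows "(poly (map_poly of_rat p) a, poly (map_poly of_rat p) b) \<in> G"
  by (induction p) (use assms in \<open>simp_all add: map_poly_pCons partial_homD\<close>)

text \<open>Removing vanishing constant terms from an annihilating polynomial leaves c + a p(a) = 0
  with c nonzero, so the inverse of \<open>a\<close> is a rational polynomial in \<open>a\<close>.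
  Consequently the domain of a partial homomorphism, which is only assumed to be a subring, is a
  field.\<close>

lemma algebraic_inverse:
  fixes a :: qbar
  assumes "a \<noteq> 0"
  obtains p :: "rat poly" where "a * poly (map_poly of_rat p) a = 1"
proof -
  have "\<exists>p :: rat poly. a * poly (map_poly of_rat p) a = 1" if "p \<noteq> 0" "poly (map_poly of_rat p) a = 0" for p :: "rat poly"
    using that
  proof (induction p)
    case (pCons c p)
    show ?case
    proof (cases "c = 0")
      case True
      then show ?thesis using pCons assms by (auto simp: map_poly_pCons)
    next
      case False
      have "of_rat c + a * poly (map_poly of_rat p) a = 0" using pCons by (simp add: map_poly_pCons)
      then have "a * poly (map_poly of_rat p) a = - of_rat c" by (simp add: add_eq_0_iff)
      moreover have "map_poly of_rat (smult (- inverse c) p) = smult (- inverse (of_rat c) :: qbar) (map_poly of_rat p)"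
        by (rule poly_eqI) (simp add: coeff_map_poly of_rat_mult of_rat_minus of_rat_inverse)
      ultimately have "a * poly (map_poly of_rat (smult (- inverse c) p)) a = - inverse (of_rat c) * (- of_rat c)"
        by (metis mult.left_commute poly_smult)
      then have "a * poly (map_poly of_rat (smult (- inverse c) p)) a = 1" using False by simp
      then show ?thesis by blast
    qed
  qed simp
  moreover obtain p :: "rat poly" where "p \<noteq> 0" "poly (map_poly to_ac p) a = 0"
    using alg_closure_algebraic by blast
  ultimately show ?thesis using that by (auto simp: to_ac_of_rat[abs_def])
qed

lemma partial_hom_inverse:
  assumes "partial_hom G" "(a, b) \<in> G" "a \<noteq> 0"
  shows "(inverse a, inverse b) \<in> G"
proof -
  obtain p :: "rat poly" where p: "a * poly (map_poly of_rat p) a = 1"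
    using algebraic_inverse[OF assms(3)] .
  have m: "(poly (map_poly of_rat p) a, poly (map_poly of_rat p) b) \<in> G"
    using rat_poly_in_partial_hom assms by blast
  then have "(1, b * poly (map_poly of_rat p) b) \<in> G"
    using partial_homD(3)[OF assms(1,2) m] p by simp
  then have "b * poly (map_poly of_rat p) b = 1"
    using partial_homD(6,8)[OF assms(1)] by blast
  then show ?thesis using m p by (metis inverse_unique)
qed

definition poly_rel :: "(qbar \<times> qbar) set \<Rightarrow> qbar poly \<Rightarrow> qbar poly \<Rightarrow> bool" where
  "poly_rel G p q \<longleftrightarrow> (\<forall>i. (coeff p i, coeff q i) \<in> G)"

lemma poly_rel_add: "partial_hom G \<Longrightarrow> poly_rel G p q \<Longrightarrow> poly_rel G p' q' \<Longrightarrow> poly_rel G (p + p') (q + q')"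
  by (simp add: poly_rel_def partial_homD)

lemma poly_rel_minus: "partial_hom G \<Longrightarrow> poly_rel G p q \<Longrightarrow> poly_rel G (- p) (- q)"
  by (simp add: poly_rel_def partial_homD)

lemma poly_rel_mult:
  assumes "partial_hom G" "poly_rel G p q" "poly_rel G p' q'"
  shows "poly_rel G (p * p') (q * q')"
proof -
  have s: "((\<Sum>i\<in>A. f i), (\<Sum>i\<in>A. g i)) \<in> G" if "\<And>i. (f i, g i) \<in> G" for f g and A :: "nat set"
    by (induction A rule: infinite_finite_induct) (use that assms(1) in \<open>simp_all add: partial_homD\<close>)
  show ?thesis unfolding poly_rel_def coeff_mult
    using assms by (auto intro!: s partial_homD(3) simp: poly_rel_def)
qed

lemma poly_rel_monom: "partial_hom G \<Longrightarrow> (a, b) \<in> G \<Longrightarrow> poly_rel G (monom a n) (monom b n)"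
  by (simp add: poly_rel_def partial_homD)

lemma poly_rel_zero: "partial_hom G \<Longrightarrow> poly_rel G 0 q \<Longrightarrow> q = 0"
  using partial_homD(4) by (auto simp: poly_rel_def intro!: poly_eqI)

lemma poly_rel_division:
  assumes G: "partial_hom G" and f: "poly_rel G f g" "lead_coeff f = 1"
    and p: "poly_rel G p q"
  shows "\<exists>u v r s. poly_rel G u v \<and> poly_rel G r s \<and> p = u * f + r \<and> q = v * g + s \<and> (r = 0 \<or> degree r < degree f)"
  using p
proof (induction "degree p" arbitrary: p q rule: less_induct)
  case less
  show ?case
  proof (cases "p = 0 \<or> degree p < degree f")
    case True
    have "poly_rel G 0 0" using G by (simp add: poly_rel_def partial_homD)
    then show ?thesis using less(2) True by (intro exI[of _ 0] exI[of _ p] exI[of _ q]) auto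
  next
    case False
    define n where "n = degree p - degree f"
    \<comment> \<open>The division of \<open>q\<close> runs in lock step with that of
      \<open>p\<close>. Its coefficient is therefore taken at the degree of \<open>p\<close>, where
      it is the image of the leading coefficient of \<open>p\<close>.\<close>
    define m m' where "m = monom (lead_coeff p) n" and "m' = monom (coeff q (degree p)) n"
    have m: "poly_rel G m m'"
      unfolding m_def m'_def using G less(2) by (intro poly_rel_monom) (simp_all add: poly_rel_def)
    have rel: "poly_rel G (p - m * f) (q - m' * g)"
      using poly_rel_add[OF G less(2) poly_rel_minus[OF G poly_rel_mult[OF G m f(1)]]] by simp
    have "f \<noteq> 0" using f(2) by auto
    then have deg: "degree (m * f) = degree p"
      using False f(2) by (auto simp: m_def n_def degree_mult_eq degree_monom_eq monom_eq_0_iff)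
    have "lead_coeff (m * f) = lead_coeff p"
      unfolding lead_coeff_mult f(2) using False by (simp add: m_def degree_monom_eq)
    then have "coeff (p - m * f) (degree p) = 0" by (simp add: deg)
    moreover have "degree (p - m * f) \<le> degree p" by (rule degree_diff_le) (simp_all add: deg)
    ultimately have "p - m * f = 0 \<or> degree (p - m * f) < degree p"
      by (metis le_neq_implies_less leading_coeff_0_iff)
    then consider "p - m * f = 0" | "degree (p - m * f) < degree p" by blast
    then have "\<exists>u v r s. poly_rel G u v \<and> poly_rel G r s \<and> p - m * f = u * f + r \<and>
        q - m' * g = v * g + s \<and> (r = 0 \<or> degree r < degree f)"
    proof cases
      case 1
      then have "poly_rel G 0 (q - m' * g)" using rel by simp
      then have "q - m' * g = 0" by (rule poly_rel_zero[OF G])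
      moreover have "poly_rel G 0 0" using G by (simp add: poly_rel_def partial_homD)
      ultimately show ?thesis using 1 by (metis add.right_neutral mult_zero_left)
    next
      case 2
      then show ?thesis using less(1) rel by blast
    qed
    then obtain u v r s where *: "poly_rel G u v" "poly_rel G r s" "p - m * f = u * f + r"
        "q - m' * g = v * g + s" "r = 0 \<or> degree r < degree f" by blast
    have "p = (u + m) * f + r" "q = (v + m') * g + s"
      using *(3,4) by (simp_all add: algebra_simps)
    then show ?thesis using *(2,5) poly_rel_add[OF G *(1) m] by blast
  qed
qed

text \<open>Among the polynomials over the domain of \<open>G\<close> that vanish at
  \<open>a\<close>, one of least degree is made monic; its image \<open>H\<close> under
  \<open>G\<close> has a root \<open>b\<close>. Sending p(a) to q(b), where q is the image of p, is
  well defined: if p(a) = 0, the remainder of p modulo the minimal polynomial is 0, hence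
  \<open>H\<close> divides q.\<close>

lemma partial_hom_extend:
  assumes G: "partial_hom G"
  shows "\<exists>G'. partial_hom G' \<and> G \<subseteq> G' \<and> a \<in> Domain G'"
proof -
  define S where "S = {f. f \<noteq> 0 \<and> poly f a = 0 \<and> (\<exists>g. poly_rel G f g)}"
  obtain p :: "rat poly" where p: "p \<noteq> 0" "poly (map_poly of_rat p) a = 0"
    using alg_closure_algebraic[of a] by (auto simp: to_ac_of_rat[abs_def])
  have "map_poly of_rat p \<in> S"
    using p by (auto simp: S_def map_poly_eq_0_iff poly_rel_def coeff_map_poly intro!: exI[of _ "map_poly of_rat p"]
        partial_homD(1)[OF G])
  then obtain f where f: "f \<in> S" "\<And>h. h \<in> S \<Longrightarrow> degree f \<le> degree h"
    using ex_has_least_nat[of "\<lambda>f. f \<in> S" "map_poly of_rat p" degree] by blast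
  then obtain g where g: "f \<noteq> 0" "poly f a = 0" "poly_rel G f g" by (auto simp: S_def)
  define c where "c = inverse (lead_coeff f)"
  define F where "F = monom c 0 * f"
  have "lead_coeff f \<noteq> 0" using g(1) by simp
  moreover have "(lead_coeff f, coeff g (degree f)) \<in> G" using g(3) by (simp add: poly_rel_def)
  ultimately have "(c, inverse (coeff g (degree f))) \<in> G"
    unfolding c_def using partial_hom_inverse[OF G] by blast
  then obtain H where H: "poly_rel G F H"
    unfolding F_def using poly_rel_mult[OF G poly_rel_monom[OF G] g(3)] by blast
  have F: "lead_coeff F = 1" "degree F = degree f" "poly F a = 0"
    using g(1,2) by (auto simp: F_def c_def monom_0)
  have "degree f \<noteq> 0"
    using g(1,2) by (metis degree_0_id poly_const_conv pCons_eq_0_iff degree_eq_zeroE poly_pCons mult_zero_right poly_0 add.right_neutral)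
  \<comment> \<open>This coefficient shows that \<open>H\<close> is not constant, so that it has a
    root.\<close>
  have HF: "coeff H (degree F) = 1"
    using H F(1) partial_homD(6,8)[OF G] unfolding poly_rel_def by metis
  then have "degree H > 0"
    using F(2) \<open>degree f \<noteq> 0\<close> by (metis coeff_eq_0 gr0I not_less_eq zero_neq_one zero_less_Suc le_degree less_le_trans)
  then obtain b where b: "poly H b = 0"
    using alg_closed_imp_poly_has_root by blast
  define G' where "G' = {(poly p a, poly q b) | p q. poly_rel G p q}"
  have const: "poly_rel G [:x:] [:y:]" if "(x, y) \<in> G" for x y
    using poly_rel_monom[OF G that, of 0] by (simp add: monom_0)
  have "partial_hom G'"
    unfolding partial_hom_def
  proof (intro conjI allI impI)
    fix q show "(of_rat q, of_rat q) \<in> G'"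
      unfolding G'_def using const[OF partial_homD(1)[OF G, of q]] by force
  next
    fix x y z w assume "(x, y) \<in> G'" "(z, w) \<in> G'"
    then obtain p q p' q' where *: "poly_rel G p q" "poly_rel G p' q'" "x = poly p a" "y = poly q b"
      "z = poly p' a" "w = poly q' b" by (auto simp: G'_def)
    show "(x + z, y + w) \<in> G'" unfolding G'_def using poly_rel_add[OF G *(1,2)] * by (force simp: poly_add)
    show "(x * z, y * w) \<in> G'" unfolding G'_def using poly_rel_mult[OF G *(1,2)] * by (force simp: poly_mult)
  next
    fix y assume "(0, y) \<in> G'"
    then obtain p q where *: "poly_rel G p q" "poly p a = 0" "y = poly q b" by (auto simp: G'_def)
    obtain u v r s where d: "poly_rel G r s" "p = u * F + r" "q = v * H + s" "r = 0 \<or> degree r < degree F"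
      using poly_rel_division[OF G H F(1) *(1)] by blast
    have "poly r a = 0" using *(2) d(2) F(3) by simp
    have "r = 0"
    proof (rule ccontr)
      assume "r \<noteq> 0"
      then have "r \<in> S" unfolding S_def using \<open>poly r a = 0\<close> d(1) by blast
      then show False using f(2)[of r] d(4) F(2) \<open>r \<noteq> 0\<close> by auto
    qed
    then have "s = 0" using d(1) poly_rel_zero[OF G] by simp
    then show "y = 0" using * d(3) b by simp
  qed
  moreover have "G \<subseteq> G'"
  proof
    fix z assume "z \<in> G"
    moreover obtain x y where "z = (x, y)" by (cases z) auto
    ultimately show "z \<in> G'" unfolding G'_def using const[of x y] by force
  qed
  moreover have "a \<in> Domain G'"
    unfolding G'_def using poly_rel_monom[OF G partial_homD(8)[OF G], of 1] by (force simp: poly_monom)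
  ultimately show ?thesis by blast
qed

lemma partial_hom_Union:
  assumes "C \<noteq> {}" "subset.chain {G. partial_hom G} C"
  shows "partial_hom (\<Union>C)"
proof -
  have C: "partial_hom G" if "G \<in> C" for G using assms(2) that by (auto simp: subset.chain_def)
  have two: "\<exists>G\<in>C. x \<in> G \<and> y \<in> G" if xy: "x \<in> \<Union>C" "y \<in> \<Union>C" for x y
  proof -
    obtain G H where "G \<in> C" "H \<in> C" "x \<in> G" "y \<in> H" using xy by blast
    moreover have "G \<subseteq> H \<or> H \<subseteq> G" using assms(2) calculation(1,2) by (auto simp: subset.chain_def)
    ultimately show ?thesis by blast
  qed
  show ?thesis unfolding partial_hom_def
  proof (intro conjI allI impI)
    fix q show "(of_rat q, of_rat q) \<in> \<Union>C" using assms(1) C partial_homD(1) by blast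
  next
    fix a b c d assume "(a, b) \<in> \<Union>C" "(c, d) \<in> \<Union>C"
    then obtain G where G: "G \<in> C" "(a, b) \<in> G" "(c, d) \<in> G" using two by blast
    then show "(a + c, b + d) \<in> \<Union>C" "(a * c, b * d) \<in> \<Union>C" using C partial_homD(2,3) by blast+
  next
    fix b assume "(0, b) \<in> \<Union>C" then show "b = 0" using C partial_homD(4) by blast
  qed
qed

text \<open>A maximal extension is defined everywhere, since otherwise one more element could be
  adjoined. It is injective as a homomorphism of fields. It is surjective because it maps the finite
  set of roots of each nonzero rational polynomial injectively into itself.\<close>

lemma partial_hom_extends_to_automorphism:
  assumes "partial_hom G"
  obtains \<sigma> :: "qbar \<Rightarrow> qbar" where "bij \<sigma>" "\<sigma> 0 = 0" "\<sigma> 1 = 1"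
    "\<And>x y. \<sigma> (x + y) = \<sigma> x + \<sigma> y" "\<And>x y. \<sigma> (x * y) = \<sigma> x * \<sigma> y" "\<And>x y. (x, y) \<in> G \<Longrightarrow> \<sigma> x = y"
proof -
  have "\<exists>M\<in>{H. partial_hom H \<and> G \<subseteq> H}. \<forall>Y\<in>{H. partial_hom H \<and> G \<subseteq> H}. M \<subseteq> Y \<longrightarrow> Y = M"
  proof (rule subset_Zorn_nonempty)
    show "{H. partial_hom H \<and> G \<subseteq> H} \<noteq> {}" using assms by blast
    fix C assume C: "C \<noteq> {}" "subset.chain {H. partial_hom H \<and> G \<subseteq> H} C"
    have sub: "C \<subseteq> {H. partial_hom H \<and> G \<subseteq> H}" using C(2) by (simp add: subset.chain_def)
    have "subset.chain {G. partial_hom G} C" using C(2) by (auto simp: subset.chain_def)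
    then have "partial_hom (\<Union>C)" by (rule partial_hom_Union[OF C(1)])
    moreover have "G \<subseteq> \<Union>C" using C(1) sub by blast
    ultimately show "\<Union>C \<in> {H. partial_hom H \<and> G \<subseteq> H}" by simp
  qed
  then obtain M where M0: "M \<in> {H. partial_hom H \<and> G \<subseteq> H}"
    and M1: "\<forall>Y\<in>{H. partial_hom H \<and> G \<subseteq> H}. M \<subseteq> Y \<longrightarrow> Y = M" by (elim bexE)
  then have M: "partial_hom M" "G \<subseteq> M" by simp_all
  have max: "Y = M" if "partial_hom Y" "M \<subseteq> Y" for Y
    using M1 M(2) that by (metis (mono_tags, lifting) mem_Collect_eq order_trans)
  have dom: "a \<in> Domain M" for a
  proof -
    obtain Y where "partial_hom Y" "M \<subseteq> Y" "a \<in> Domain Y"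
      using partial_hom_extend[OF M(1), of a] by (elim exE conjE)
    then show ?thesis using max[of Y] by simp
  qed
  define \<sigma> where "\<sigma> a = (SOME b. (a, b) \<in> M)" for a
  have \<sigma>: "(a, \<sigma> a) \<in> M" for a
  proof -
    obtain b where "(a, b) \<in> M" using dom[of a] by (rule DomainE)
    then show ?thesis unfolding \<sigma>_def by (rule someI)
  qed
  have eq: "\<sigma> a = b" if "(a, b) \<in> M" for a b
    by (rule partial_homD(6)[OF M(1) \<sigma> that])
  have hom: "\<sigma> 0 = 0" "\<sigma> 1 = 1" "\<And>x y. \<sigma> (x + y) = \<sigma> x + \<sigma> y" "\<And>x y. \<sigma> (x * y) = \<sigma> x * \<sigma> y"
    by (rule eq, rule partial_homD[OF M(1)], (rule \<sigma>)?, (rule \<sigma>)?)+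
  have "inj \<sigma>"
  proof (rule injI)
    fix x y assume e: "\<sigma> x = \<sigma> y"
    have "\<sigma> (x - y) + \<sigma> y = \<sigma> x" using hom(3)[of "x - y" y] by simp
    then have "\<sigma> (x - y) = 0" using e by simp
    then show "x = y" using hom(2) hom(4)[of "x - y" "inverse (x - y)"] by (cases "x - y = 0") auto
  qed
  have "surj \<sigma>"
    unfolding surj_def
  proof
    fix y :: qbar
    obtain p :: "rat poly" where p: "p \<noteq> 0" "poly (map_poly of_rat p) y = 0"
      using alg_closure_algebraic[of y] by (auto simp: to_ac_of_rat[abs_def])
    define A where "A = {z :: qbar. poly (map_poly of_rat p) z = 0}"
    have "finite A" unfolding A_def using p(1) by (intro poly_roots_finite) (simp add: map_poly_eq_0_iff)
    moreover have "\<sigma> ` A \<subseteq> A"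
    proof -
      have "map_poly \<sigma> (map_poly of_rat p) = map_poly of_rat p"
        by (simp add: map_poly_map_poly hom o_def hom_of_rat[of \<sigma>, OF hom])
      then show ?thesis
        using poly_map_poly_hom[of \<sigma> "map_poly of_rat p", OF hom(1,3,4)] hom(1) by (auto simp: A_def)
    qed
    ultimately have "\<sigma> ` A = A" using endo_inj_surj[of A \<sigma>] \<open>inj \<sigma>\<close> by (simp add: inj_on_subset)
    moreover have "y \<in> A" using p(2) by (simp add: A_def)
    ultimately show "\<exists>x. y = \<sigma> x" by blast
  qed
  then have "bij \<sigma>" using \<open>inj \<sigma>\<close> by (simp add: bij_def)
  moreover have "\<sigma> x = y" if "(x, y) \<in> G" for x y using that M(2) eq by blast
  ultimately show ?thesis using that hom by blast
qed

text \<open>Conjugation of the quadratic field generated by s. As \<open>d\<close> is not a square,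
  u + v s = 0 forces u = v = 0, which is the condition at 0.\<close>

lemma partial_hom_sqrt:
  fixes s :: qbar
  assumes s: "s * s = of_rat d" and "\<nexists>q. q * q = d"
  shows "partial_hom {(of_rat u + of_rat v * s, of_rat u - of_rat v * s) | u v. True}"
  unfolding partial_hom_def
proof (intro conjI allI impI)
  let ?G = "{(of_rat u + of_rat v * s, of_rat u - of_rat v * s) | u v. True}"
  fix q show "(of_rat q, of_rat q) \<in> ?G" by (rule CollectI, rule exI[of _ q], rule exI[of _ 0]) simp
next
  let ?G = "{(of_rat u + of_rat v * s, of_rat u - of_rat v * s) | u v. True}"
  fix a b c e assume "(a, b) \<in> ?G" "(c, e) \<in> ?G"
  then obtain u v u' v' where *: "a = of_rat u + of_rat v * s" "b = of_rat u - of_rat v * s"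
    "c = of_rat u' + of_rat v' * s" "e = of_rat u' - of_rat v' * s" by blast
  have "a + c = of_rat (u + u') + of_rat (v + v') * s" "b + e = of_rat (u + u') - of_rat (v + v') * s"
    unfolding * by (simp_all add: of_rat_add algebra_simps)
  then show "(a + c, b + e) \<in> ?G" by blast
  have sw: "of_rat v * s * (of_rat v' * s) = of_rat (v * v' * d)"
    by (simp add: of_rat_mult s[symmetric] algebra_simps)
  have "a * c = of_rat (u * u' + v * v' * d) + of_rat (u * v' + v * u') * s"
    "b * e = of_rat (u * u' + v * v' * d) - of_rat (u * v' + v * u') * s"
    using sw unfolding * by (simp_all add: of_rat_add of_rat_mult algebra_simps)
  then show "(a * c, b * e) \<in> ?G" by blast
next
  fix b assume "(0, b) \<in> {(of_rat u + of_rat v * s, of_rat u - of_rat v * s) | u v. True}"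
  then obtain u v where *: "0 = of_rat u + of_rat v * s" "b = of_rat u - of_rat v * s" by blast
  have "v = 0"
  proof (rule ccontr)
    assume "v \<noteq> 0"
    then have "s = of_rat (- u / v)" using *(1) by (simp add: of_rat_divide of_rat_minus field_simps eq_neg_iff_add_eq_0)
    then have "of_rat ((- u / v) * (- u / v)) = (of_rat d :: qbar)" using s by (simp only: of_rat_mult)
    then show False using assms(2) by (metis of_rat_eq_iff)
  qed
  then show "b = 0" using * by simp
qed

text \<open>Kummer theory in the form needed here: the Galois group detects nontrivial square
  classes. It separates the cocycles of pairs that differ modulo squares.\<close>

lemma exists_galois_neg_sqrt:
  assumes s: "s \<in> carrier (alg_cl rat_field)" "s \<otimes>\<^bsub>alg_cl rat_field\<^esub> s = ring.indexed_const rat_field d"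
    and "\<nexists>q. q * q = d"
  obtains \<sigma> where "\<sigma> \<in> abs_galois rat_field" "\<sigma> s = \<ominus>\<^bsub>alg_cl rat_field\<^esub> s"
proof -
  define S where "S = (Abs_alg_closure s :: qbar)"
  have S: "Rep_alg_closure S = s" using s(1) by (simp add: S_def Abs_alg_closure_inverse)
  have "Rep_alg_closure (S * S) = Rep_alg_closure (to_ac d)"
    by (simp add: times_alg_closure.rep_eq S s(2) to_ac.rep_eq)
  then have SS: "S * S = of_rat d" by (simp add: Rep_alg_closure_inject to_ac_of_rat)
  obtain t where t: "bij t" "t 0 = 0" "t 1 = 1" "\<And>x y. t (x + y) = t x + t y" "\<And>x y. t (x * y) = t x * t y"
    and tG: "\<And>x y. (x, y) \<in> {(of_rat u + of_rat v * S, of_rat u - of_rat v * S) | u v. True} \<Longrightarrow> t x = y"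
    by (rule partial_hom_extends_to_automorphism[OF partial_hom_sqrt[OF SS assms(3)]]) (rule that; assumption)
  have "t (of_rat 0 + of_rat 1 * S) = of_rat 0 - of_rat 1 * S" by (rule tG) blast
  then have tS: "t S = - S" by simp
  define \<sigma> where "\<sigma> = (\<lambda>x\<in>carrier (alg_cl rat_field). Rep_alg_closure (t (Abs_alg_closure x)))"
  have R: "Rep_alg_closure x \<in> carrier (alg_cl rat_field)" for x :: qbar by (rule Rep_alg_closure)
  have hom: "Abs_alg_closure (x \<oplus>\<^bsub>alg_cl rat_field\<^esub> y) = (Abs_alg_closure x + Abs_alg_closure y :: qbar)"
    "Abs_alg_closure (x \<otimes>\<^bsub>alg_cl rat_field\<^esub> y) = (Abs_alg_closure x * Abs_alg_closure y :: qbar)"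
    if "x \<in> carrier (alg_cl rat_field)" "y \<in> carrier (alg_cl rat_field)" for x y
    using that by (metis plus_alg_closure.rep_eq times_alg_closure.rep_eq Abs_alg_closure_inverse Rep_alg_closure_inverse)+
  have A1: "Abs_alg_closure (\<one>\<^bsub>alg_cl rat_field\<^esub>) = (1 :: qbar)"
    by (metis one_alg_closure.rep_eq Rep_alg_closure_inverse)
  interpret F: field "alg_cl rat_field"
    using field.alg_closureE(1)[OF type_ring_field[where 'a=rat]] by (simp add: algebraic_closure_def)
  have "\<sigma> \<in> ring_hom (alg_cl rat_field) (alg_cl rat_field)"
    by (auto simp: ring_hom_def \<sigma>_def R hom t A1 times_alg_closure.rep_eq plus_alg_closure.rep_eq one_alg_closure.rep_eq)
  moreover have "bij_betw \<sigma> (carrier (alg_cl rat_field)) (carrier (alg_cl rat_field))"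
  proof (rule bij_betwI[where g = "\<lambda>x. Rep_alg_closure (inv_into UNIV t (Abs_alg_closure x))"])
    show "Rep_alg_closure (inv_into UNIV t (Abs_alg_closure (\<sigma> x))) = x" if "x \<in> carrier (alg_cl rat_field)" for x
      using that t(1) by (simp add: \<sigma>_def Rep_alg_closure_inverse bij_is_inj Abs_alg_closure_inverse)
    show "\<sigma> (Rep_alg_closure (inv_into UNIV t (Abs_alg_closure x))) = x" if "x \<in> carrier (alg_cl rat_field)" for x
      using that t(1) R by (simp add: \<sigma>_def Rep_alg_closure_inverse bij_is_surj surj_f_inv_f Abs_alg_closure_inverse)
  qed (auto simp: \<sigma>_def R)
  moreover have "\<sigma> (ring.indexed_const rat_field q) = ring.indexed_const rat_field q" for q
  proof -
    have e: "ring.indexed_const rat_field q = Rep_alg_closure (to_ac q)" by (rule to_ac.rep_eq[symmetric])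
    have "t (to_ac q) = to_ac q" by (simp add: to_ac_of_rat hom_of_rat[of t, OF t(2-5)])
    then show ?thesis unfolding e using R[of "to_ac q"] by (simp add: \<sigma>_def Rep_alg_closure_inverse)
  qed
  ultimately have "\<sigma> \<in> abs_galois rat_field"
    by (auto simp: abs_galois_def ring_iso_def \<sigma>_def)
  moreover have "\<sigma> s = \<ominus>\<^bsub>alg_cl rat_field\<^esub> s"
    using s(1) tS by (simp add: \<sigma>_def S_def[symmetric] uminus_alg_closure.rep_eq S)
  ultimately show ?thesis by (rule that)
qed

subsection \<open>Completions of the rationals\<close>

locale abs_value =
  fixes v :: "rat \<Rightarrow> real"
  assumes v_eq_0 [simp]: "v x = 0 \<longleftrightarrow> x = 0"
    and v_nonneg [simp]: "v x \<ge> 0"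
    and v_mult: "v (x * y) = v x * v y"
    and v_add: "v (x + y) \<le> v x + v y"
begin

lemma v_0 [simp]: "v 0 = 0"
  by simp

lemma v_1 [simp]: "v 1 = 1"
  using v_mult[of 1 1] v_eq_0[of 1] by (metis mult_cancel_right1 mult_1 one_neq_zero)

lemma v_minus [simp]: "v (- x) = v x"
proof -
  have "v (- 1) * v (- 1) = 1" by (simp flip: v_mult)
  then have "v (- 1) = 1" using v_nonneg[of "- 1"] by (metis abs_of_nonneg abs_1 abs_mult_self_eq power2_eq_square power2_eq_1_iff
        v_1 v_eq_0 less_eq_real_def not_le neg_less_0_iff_less zero_less_one)
  then show ?thesis using v_mult[of "- 1" x] by simp
qed

lemma v_inverse: "v (inverse x) = inverse (v x)"
proof (cases "x = 0")
  case False
  then have "v x * v (inverse x) = 1" by (simp flip: v_mult)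
  then show ?thesis by (metis inverse_unique)
qed simp

definition cauchy :: "(nat \<Rightarrow> rat) \<Rightarrow> bool" where
  "cauchy f \<longleftrightarrow> (\<forall>e>0. \<exists>N. \<forall>i\<ge>N. \<forall>j\<ge>N. v (f i - f j) < e)"

lemma cauchyD: "cauchy f \<Longrightarrow> e > 0 \<Longrightarrow> \<exists>N. \<forall>i\<ge>N. \<forall>j\<ge>N. v (f i - f j) < e"
  by (simp add: cauchy_def)

lemma null_iff: "f \<in> null_sequences v \<longleftrightarrow> (\<forall>e>0. \<exists>N. \<forall>n\<ge>N. v (f n) < e)"
  unfolding null_sequences_def by (simp add: LIMSEQ_iff)

lemma cauchy_const [simp]: "cauchy (\<lambda>_. q)"
  by (simp add: cauchy_def)

lemma null_cauchy:
  assumes "f \<in> null_sequences v"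
  shows "cauchy f"
  unfolding cauchy_def
proof (intro allI impI)
  fix e :: real assume "e > 0"
  then obtain N where N: "\<And>n. n \<ge> N \<Longrightarrow> v (f n) < e / 2"
    using assms unfolding null_iff by (meson half_gt_zero)
  have "v (f i - f j) < e" if "i \<ge> N" "j \<ge> N" for i j
    using N[OF that(1)] N[OF that(2)] v_add[of "f i" "- f j"] by simp
  then show "\<exists>N. \<forall>i\<ge>N. \<forall>j\<ge>N. v (f i - f j) < e" by blast
qed

lemma cauchy_add:
  assumes "cauchy f" "cauchy g"
  shows "cauchy (\<lambda>n. f n + g n)"
  unfolding cauchy_def
proof (intro allI impI)
  fix e :: real assume "e > 0"
  then obtain N M where N: "\<And>i j. i \<ge> N \<Longrightarrow> j \<ge> N \<Longrightarrow> v (f i - f j) < e / 2"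
    and M: "\<And>i j. i \<ge> M \<Longrightarrow> j \<ge> M \<Longrightarrow> v (g i - g j) < e / 2"
    using assms by (meson cauchyD half_gt_zero)
  have "v (f i + g i - (f j + g j)) < e" if "i \<ge> max N M" "j \<ge> max N M" for i j
    using N[of i j] M[of i j] that v_add[of "f i - f j" "g i - g j"] by (simp add: algebra_simps)
  then show "\<exists>N. \<forall>i\<ge>N. \<forall>j\<ge>N. v (f i + g i - (f j + g j)) < e" by blast
qed

lemma cauchy_bounded:
  assumes "cauchy f"
  obtains B where "B > 0" "\<And>n. v (f n) \<le> B"
proof -
  obtain N where N: "\<And>i j. i \<ge> N \<Longrightarrow> j \<ge> N \<Longrightarrow> v (f i - f j) < 1"
    using assms cauchyD[of f 1] by auto
  define B where "B = 1 + (\<Sum>i\<le>N. v (f i))"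
  have "v (f n) \<le> B" for n
  proof (cases "n \<le> N")
    case True
    then have "v (f n) \<le> (\<Sum>i\<le>N. v (f i))" by (intro member_le_sum) auto
    then show ?thesis by (simp add: B_def)
  next
    case False
    then have "v (f n - f N) < 1" using N by simp
    moreover have "v (f N) \<le> (\<Sum>i\<le>N. v (f i))" by (intro member_le_sum) auto
    moreover have "v (f n) \<le> v (f n - f N) + v (f N)" using v_add[of "f n - f N" "f N"] by simp
    ultimately show ?thesis by (simp add: B_def)
  qed
  moreover have "B > 0" unfolding B_def by (intro add_pos_nonneg sum_nonneg) auto
  ultimately show ?thesis using that by blast
qed

lemma cauchy_mult:
  assumes "cauchy f" "cauchy g"
  shows "cauchy (\<lambda>n. f n * g n)"
  unfolding cauchy_def
proof (intro allI impI)
  fix e :: real assume e: "e > 0"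
  obtain B where B: "B > 0" "\<And>n. v (f n) \<le> B" using cauchy_bounded[OF assms(1)] by blast
  obtain C where C: "C > 0" "\<And>n. v (g n) \<le> C" using cauchy_bounded[OF assms(2)] by blast
  have "e / (2 * C) > 0" "e / (2 * B) > 0" using e B C by simp_all
  then obtain N M where N: "\<And>i j. i \<ge> N \<Longrightarrow> j \<ge> N \<Longrightarrow> v (f i - f j) < e / (2 * C)"
    and M: "\<And>i j. i \<ge> M \<Longrightarrow> j \<ge> M \<Longrightarrow> v (g i - g j) < e / (2 * B)"
    using assms by (meson cauchyD)
  have "v (f i * g i - f j * g j) < e" if "i \<ge> max N M" "j \<ge> max N M" for i j
  proof -
    have "f i * g i - f j * g j = f i * (g i - g j) + (f i - f j) * g j" by (simp add: algebra_simps)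
    then have "v (f i * g i - f j * g j) \<le> v (f i) * v (g i - g j) + v (f i - f j) * v (g j)"
      by (metis v_add v_mult)
    also have "\<dots> \<le> B * v (g i - g j) + v (f i - f j) * C"
      by (intro add_mono mult_right_mono mult_left_mono B C v_nonneg)
    also have "\<dots> < B * (e / (2 * B)) + e / (2 * C) * C"
      by (intro add_strict_mono mult_strict_left_mono mult_strict_right_mono N M B C) (use that in auto)
    also have "\<dots> = e" using B C by simp
    finally show ?thesis .
  qed
  then show "\<exists>N. \<forall>i\<ge>N. \<forall>j\<ge>N. v (f i * g i - f j * g j) < e" by blast
qed

lemma null_add:
  assumes "f \<in> null_sequences v" "g \<in> null_sequences v"
  shows "(\<lambda>n. f n + g n) \<in> null_sequences v"
proof -
  have l: "(\<lambda>n. v (f n) + v (g n)) \<longlonglongrightarrow> 0"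
    using assms tendsto_add[of "\<lambda>n. v (f n)" 0 sequentially "\<lambda>n. v (g n)" 0] by (simp add: null_sequences_def)
  show ?thesis unfolding null_sequences_def
    by (rule CollectI, rule tendsto_sandwich[OF _ _ tendsto_const l]) (simp_all add: v_add)
qed

lemma null_mult:
  assumes "f \<in> null_sequences v" "cauchy g"
  shows "(\<lambda>n. f n * g n) \<in> null_sequences v"
proof -
  obtain C where C: "C > 0" "\<And>n. v (g n) \<le> C" using cauchy_bounded[OF assms(2)] by blast
  have l: "(\<lambda>n. v (f n) * C) \<longlonglongrightarrow> 0"
    using assms tendsto_mult_right[of "\<lambda>n. v (f n)" 0 sequentially C] by (simp add: null_sequences_def)
  show ?thesis unfolding null_sequences_def
    by (rule CollectI, rule tendsto_sandwich[OF _ _ tendsto_const l]) (simp_all add: v_mult C mult_left_mono)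
qed

lemma cauchy_ring_simps [simp]:
  "f \<in> carrier (cauchy_ring v) \<longleftrightarrow> cauchy f"
  "f \<otimes>\<^bsub>cauchy_ring v\<^esub> g = (\<lambda>n. f n * g n)"
  "f \<oplus>\<^bsub>cauchy_ring v\<^esub> g = (\<lambda>n. f n + g n)"
  "\<one>\<^bsub>cauchy_ring v\<^esub> = (\<lambda>n. 1)" "\<zero>\<^bsub>cauchy_ring v\<^esub> = (\<lambda>n. 0)"
  by (simp_all add: cauchy_ring_def cauchy_def)

lemma cauchy_minus: "cauchy f \<Longrightarrow> cauchy (\<lambda>n. - f n)"
  using cauchy_mult[of "\<lambda>_. - 1" f] by simp

lemma cring_cauchy: "cring (cauchy_ring v)"
proof (rule cringI)
  show "abelian_group (cauchy_ring v)"
  proof (rule abelian_groupI)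
    fix f assume "f \<in> carrier (cauchy_ring v)"
    then show "\<exists>g\<in>carrier (cauchy_ring v). g \<oplus>\<^bsub>cauchy_ring v\<^esub> f = \<zero>\<^bsub>cauchy_ring v\<^esub>"
      by (intro bexI[of _ "\<lambda>n. - f n"]) (simp_all add: cauchy_minus)
  qed (simp_all add: cauchy_add algebra_simps)
  show "comm_monoid (cauchy_ring v)"
    by (rule comm_monoidI) (simp_all add: cauchy_mult algebra_simps)
qed (simp add: algebra_simps)

sublocale CR: cring "cauchy_ring v" by (rule cring_cauchy)

lemma cauchy_a_inv [simp]: "cauchy f \<Longrightarrow> \<ominus>\<^bsub>cauchy_ring v\<^esub> f = (\<lambda>n. - f n)"
  using CR.minus_equality[of "\<lambda>n. - f n" f] by (simp add: cauchy_minus)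

lemma null_ideal: "ideal (null_sequences v) (cauchy_ring v)"
proof (rule idealI)
  show "ring (cauchy_ring v)" by (rule CR.ring_axioms)
  show "subgroup (null_sequences v) (add_monoid (cauchy_ring v))"
  proof (rule group.subgroupI)
    show "group (add_monoid (cauchy_ring v))" by (rule CR.a_group)
    show "null_sequences v \<subseteq> carrier (add_monoid (cauchy_ring v))" using null_cauchy by auto
    have "(\<lambda>_. 0) \<in> null_sequences v" by (simp add: null_sequences_def)
    then show "null_sequences v \<noteq> {}" by blast
    fix f assume f: "f \<in> null_sequences v"
    have "inv\<^bsub>add_monoid (cauchy_ring v)\<^esub> f = \<ominus>\<^bsub>cauchy_ring v\<^esub> f" by (simp add: a_inv_def)
    then show "inv\<^bsub>add_monoid (cauchy_ring v)\<^esub> f \<in> null_sequences v"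
      using f null_cauchy[OF f] by (simp add: null_sequences_def)
    fix g assume "g \<in> null_sequences v"
    then show "f \<otimes>\<^bsub>add_monoid (cauchy_ring v)\<^esub> g \<in> null_sequences v" using null_add f by simp
  qed
  fix f g assume *: "f \<in> null_sequences v" "g \<in> carrier (cauchy_ring v)"
  then show "g \<otimes>\<^bsub>cauchy_ring v\<^esub> f \<in> null_sequences v" "f \<otimes>\<^bsub>cauchy_ring v\<^esub> g \<in> null_sequences v"
    using null_mult[of f g] by (simp_all add: mult.commute)
qed

lemma not_null_bounded_below:
  assumes f: "cauchy f" "f \<notin> null_sequences v"
  obtains c N where "c > 0" "\<And>n. n \<ge> N \<Longrightarrow> v (f n) \<ge> c"
proof -
  obtain e where e: "e > 0" "\<And>N. \<exists>n\<ge>N. v (f n) \<ge> e"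
    using f(2) unfolding null_iff by (meson not_le)
  obtain N where N: "\<And>i j. i \<ge> N \<Longrightarrow> j \<ge> N \<Longrightarrow> v (f i - f j) < e / 2"
    using f(1) e(1) by (meson cauchyD half_gt_zero)
  obtain k where k: "k \<ge> N" "v (f k) \<ge> e" using e(2) by blast
  have "v (f n) \<ge> e / 2" if "n \<ge> N" for n
    using N[OF k(1) that] k(2) v_add[of "f k - f n" "f n"] by simp
  then show ?thesis using that[of "e / 2" N] e(1) by simp
qed

lemma cauchy_inverse:
  assumes f: "cauchy f" "f \<notin> null_sequences v"
  shows "\<exists>g. cauchy g \<and> (\<lambda>n. g n * f n - 1) \<in> null_sequences v"
proof -
  obtain c N where c: "c > 0" "\<And>n. n \<ge> N \<Longrightarrow> v (f n) \<ge> c" using not_null_bounded_below[OF f] by blast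
  \<comment> \<open>Finitely many terms of \<open>f\<close> may be 0, and there
    \<open>inverse\<close> gives 0. Both the Cauchy property and the limit are checked only from
    \<open>N\<close> on, where the terms are bounded away from 0.\<close>
  define g where "g n = inverse (f n)" for n
  have nz: "f n \<noteq> 0" if "n \<ge> N" for n using c(1) c(2)[OF that] by auto
  have "cauchy g" unfolding cauchy_def
  proof (intro allI impI)
    fix e :: real assume "e > 0"
    then have "e * c * c > 0" using c(1) by simp
    then obtain M where M: "\<And>i j. i \<ge> M \<Longrightarrow> j \<ge> M \<Longrightarrow> v (f i - f j) < e * c * c"
      using f(1) by (meson cauchyD)
    have "v (g i - g j) < e" if ij: "i \<ge> max N M" "j \<ge> max N M" for i j
    proof -
      have b: "v (f i) \<ge> c" "v (f j) \<ge> c" "v (f j - f i) < e * c * c" using c(2) M ij by auto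
      have "c * c \<le> v (f i) * v (f j)" by (intro mult_mono) (use b c in auto)
      then have "e * c * c \<le> e * (v (f i) * v (f j))" using \<open>e > 0\<close> by (simp add: mult.assoc)
      then have "v (f j - f i) < e * (v (f i) * v (f j))" using b(3) by linarith
      moreover have "v (f i) > 0" "v (f j) > 0" using b(1,2) c(1) by linarith+
      moreover have "g i - g j = (f j - f i) * inverse (f i * f j)"
        using nz[of i] nz[of j] ij by (simp add: g_def field_simps)
      then have "v (g i - g j) = v (f j - f i) / (v (f i) * v (f j))"
        by (simp add: v_mult v_inverse divide_inverse)
      ultimately show ?thesis by (simp add: pos_divide_less_eq)
    qed
    then show "\<exists>N. \<forall>i\<ge>N. \<forall>j\<ge>N. v (g i - g j) < e" by blast
  qed
  moreover have "(\<lambda>n. g n * f n - 1) \<in> null_sequences v"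
    unfolding null_iff using nz by (auto simp: g_def intro!: exI[of _ N])
  ultimately show ?thesis by blast
qed

lemma null_maximal: "maximalideal (null_sequences v) (cauchy_ring v)"
proof (rule maximalidealI[OF null_ideal])
  have "(\<lambda>_. 1) \<notin> null_sequences v" by (simp add: null_sequences_def LIMSEQ_const_iff)
  moreover have "(\<lambda>_. 1) \<in> carrier (cauchy_ring v)" by simp
  ultimately show "carrier (cauchy_ring v) \<noteq> null_sequences v" by metis
  fix J assume J: "ideal J (cauchy_ring v)" "null_sequences v \<subseteq> J" "J \<subseteq> carrier (cauchy_ring v)"
  show "J = null_sequences v \<or> J = carrier (cauchy_ring v)"
  proof (cases "J = null_sequences v")
    case False
    interpret J: ideal J "cauchy_ring v" by (rule J)
    obtain f where f: "f \<in> J" "f \<notin> null_sequences v" using False J(2) by blast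
    then have fc: "cauchy f" using J(3) by auto
    obtain g where g: "cauchy g" "(\<lambda>n. g n * f n - 1) \<in> null_sequences v"
      using cauchy_inverse[OF fc f(2)] by blast
    have gf: "(\<lambda>n. g n * f n) \<in> J" using J.I_l_closed[OF f(1), of g] g(1) by simp
    have "(\<lambda>n. - (g n * f n - 1)) \<in> null_sequences v" using g(2) unfolding null_sequences_def mem_Collect_eq v_minus .
    then have "(\<lambda>n. g n * f n) \<oplus>\<^bsub>cauchy_ring v\<^esub> (\<lambda>n. - (g n * f n - 1)) \<in> J"
      using gf J(2) J.a_closed by blast
    then have "\<one>\<^bsub>cauchy_ring v\<^esub> \<in> J" by simp
    then show ?thesis using J.one_imp_carrier by blast
  qed simp
qed

lemma field_completion: "field (rat_completion v)"
  unfolding rat_completion_def using maximalideal.quotient_is_field[OF null_maximal cring_cauchy] .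

definition emb :: "rat \<Rightarrow> (nat \<Rightarrow> rat) set" where
  "emb q = null_sequences v +>\<^bsub>cauchy_ring v\<^esub> (\<lambda>_. q)"

lemma emb_hom: "emb \<in> ring_hom rat_field (rat_completion v)"
proof -
  have "(\<lambda>q _. q) \<in> ring_hom rat_field (cauchy_ring v)" by (auto simp: ring_hom_def)
  from ring_hom_trans[OF this ideal.rcos_ring_hom[OF null_ideal]] show ?thesis
    by (simp add: rat_completion_def emb_def[abs_def] o_def)
qed

lemma char_zero_completion: "char_zero (rat_completion v)"
  by (rule char_zero_hom[OF emb_hom type_ring_field field_completion char_zero_type])

definition is_sq :: "rat \<Rightarrow> bool" where
  "is_sq d \<longleftrightarrow> (\<exists>t\<in>carrier (rat_completion v). t \<otimes>\<^bsub>rat_completion v\<^esub> t = emb d)"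

text \<open>The class of the Cauchy sequence of approximate roots is an exact root in the
  completion.\<close>

lemma is_sq_limit:
  assumes "cauchy f" "(\<lambda>n. f n * f n - d) \<in> null_sequences v"
  shows "is_sq d"
proof -
  let ?t = "null_sequences v +>\<^bsub>cauchy_ring v\<^esub> f"
  note h = ideal.rcos_ring_hom[OF null_ideal]
  have t: "?t \<in> carrier (rat_completion v)"
    using ring_hom_closed[OF h, of f] assms(1) by (simp add: rat_completion_def)
  have "?t \<otimes>\<^bsub>rat_completion v\<^esub> ?t = null_sequences v +>\<^bsub>cauchy_ring v\<^esub> (\<lambda>n. f n * f n)"
    using ring_hom_mult[OF h, of f f] assms(1) by (simp add: rat_completion_def)
  also have "\<dots> = emb d"
    unfolding emb_def using CR.quotient_eq_iff_same_a_r_cos[OF null_ideal, of "\<lambda>n. f n * f n" "\<lambda>_. d"] assms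
    by (simp add: cauchy_mult a_minus_def)
  finally show ?thesis unfolding is_sq_def using t by blast
qed

lemma is_sq_square: "is_sq (q * q)"
  by (rule is_sq_limit[of "\<lambda>_. q"]) (simp_all add: null_sequences_def)

lemma is_sq_mult:
  assumes "is_sq a" "is_sq b"
  shows "is_sq (a * b)"
proof -
  interpret K: field "rat_completion v" by (rule field_completion)
  obtain s t where s: "s \<in> carrier (rat_completion v)" "s \<otimes>\<^bsub>rat_completion v\<^esub> s = emb a"
    and t: "t \<in> carrier (rat_completion v)" "t \<otimes>\<^bsub>rat_completion v\<^esub> t = emb b"
    using assms unfolding is_sq_def by blast
  have "(s \<otimes>\<^bsub>rat_completion v\<^esub> t) \<otimes>\<^bsub>rat_completion v\<^esub> (s \<otimes>\<^bsub>rat_completion v\<^esub> t)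
      = (s \<otimes>\<^bsub>rat_completion v\<^esub> s) \<otimes>\<^bsub>rat_completion v\<^esub> (t \<otimes>\<^bsub>rat_completion v\<^esub> t)"
    using s(1) t(1) by (simp add: K.m_ac)
  also have "\<dots> = emb (a * b)" using ring_hom_mult[OF emb_hom, of a b] s t by simp
  finally show ?thesis unfolding is_sq_def using s t by blast
qed

lemma is_sq_times_square: "is_sq a \<Longrightarrow> is_sq (a * (q * q))"
  by (rule is_sq_mult[OF _ is_sq_square])

end

lemma abs_value_infinite: "abs_value (\<lambda>x. real_of_rat \<bar>x\<bar>)"
  by unfold_locales (simp_all add: abs_mult of_rat_mult of_rat_less_eq flip: of_rat_add)

lemma padic_abs_frac:
  assumes "Factorial_Ring.prime p" "a \<noteq> 0" "b \<noteq> 0"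
  shows "padic_abs p (of_int a / of_int b) = real p powi (int (multiplicity (int p) b) - int (multiplicity (int p) a))"
proof -
  define x where "x = (of_int a / of_int b :: rat)"
  obtain c d where cd: "quotient_of x = (c, d)" by (cases "quotient_of x") auto
  have x: "x = of_int c / of_int d" and d: "d > 0" using quotient_of_div[OF cd] quotient_of_denom_pos[OF cd] by auto
  have "x \<noteq> 0" using assms by (simp add: x_def)
  then have c: "c \<noteq> 0" using x by auto
  have "of_int (a * d) = (of_int (c * b) :: rat)"
    using x d assms unfolding x_def by (simp add: field_simps)
  then have "a * d = c * b" by (simp only: of_int_eq_iff)
  moreover have "prime_elem (int p)" using assms(1) by simp
  ultimately have "multiplicity (int p) a + multiplicity (int p) d = multiplicity (int p) c + multiplicity (int p) b"
    using assms c d by (metis less_irrefl prime_elem_multiplicity_mult_distrib)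
  then have "int (multiplicity (int p) d) - int (multiplicity (int p) c) = int (multiplicity (int p) b) - int (multiplicity (int p) a)"
    by linarith
  then show ?thesis using \<open>x \<noteq> 0\<close> cd unfolding padic_abs_def x_def[symmetric] by simp
qed

lemma padic_abs_add_max:
  assumes p: "Factorial_Ring.prime p"
  shows "padic_abs p (x + y) \<le> max (padic_abs p x) (padic_abs p y)"
proof (cases "x = 0 \<or> y = 0 \<or> x + y = 0")
  case True
  then show ?thesis by (auto simp: padic_abs_def intro: max.coboundedI1)
next
  case False
  define a b c d where "a = fst (quotient_of x)" and "b = snd (quotient_of x)"
    and "c = fst (quotient_of y)" and "d = snd (quotient_of y)"
  have bd: "b > 0" "d > 0" by (simp_all add: b_def d_def quotient_of_denom_pos')
  have x: "x = of_int (a * d) / of_int (b * d)" and y: "y = of_int (c * b) / of_int (b * d)"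
    using bd quotient_of_div[of x a b] quotient_of_div[of y c d] by (simp_all add: a_def b_def c_def d_def)
  have xy: "x + y = of_int (a * d + c * b) / of_int (b * d)"
    unfolding x y by (simp add: add_divide_distrib)
  have nz: "a * d \<noteq> 0" "c * b \<noteq> 0" "a * d + c * b \<noteq> 0" "b * d \<noteq> 0"
    using False x y xy bd by (metis div_0 of_int_0)+ (use bd in auto)
  let ?m = "multiplicity (int p)"
  have "int p ^ min (?m (a * d)) (?m (c * b)) dvd a * d + c * b"
    by (intro dvd_add multiplicity_dvd') simp_all
  then have "min (?m (a * d)) (?m (c * b)) \<le> ?m (a * d + c * b)"
    using nz(3) p prime_gt_1_nat[OF p] by (intro multiplicity_geI) simp_all
  moreover have "real p > 1" using p prime_gt_1_nat by simp
  moreover have "padic_abs p x = real p powi (int (?m (b * d)) - int (?m (a * d)))"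
    by (subst x) (rule padic_abs_frac[OF p nz(1,4)])
  moreover have "padic_abs p y = real p powi (int (?m (b * d)) - int (?m (c * b)))"
    by (subst y) (rule padic_abs_frac[OF p nz(2,4)])
  moreover have "padic_abs p (x + y) = real p powi (int (?m (b * d)) - int (?m (a * d + c * b)))"
    by (subst xy) (rule padic_abs_frac[OF p nz(3,4)])
  ultimately show ?thesis
    by (auto simp: le_max_iff_disj min_le_iff_disj intro!: power_int_increasing)
qed

lemma abs_value_padic:
  assumes p: "Factorial_Ring.prime p"
  shows "abs_value (padic_abs p)"
proof
  fix x y
  have p0: "real p > 0" using p prime_gt_0_nat by simp
  show z: "padic_abs p x = 0 \<longleftrightarrow> x = 0" using p0 by (simp add: padic_abs_def)
  show nn: "padic_abs p x \<ge> 0" for x using p0 by (simp add: padic_abs_def)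
  show "padic_abs p (x + y) \<le> padic_abs p x + padic_abs p y"
    using padic_abs_add_max[OF p, of x y] nn[of x] nn[of y] by linarith
  show "padic_abs p (x * y) = padic_abs p x * padic_abs p y"
  proof (cases "x = 0 \<or> y = 0")
    case True then show ?thesis by (auto simp: padic_abs_def)
  next
    case False
    define a b c d where "a = fst (quotient_of x)" and "b = snd (quotient_of x)"
      and "c = fst (quotient_of y)" and "d = snd (quotient_of y)"
    have bd: "b \<noteq> 0" "d \<noteq> 0" using quotient_of_denom_pos'[of x] quotient_of_denom_pos'[of y] by (auto simp: b_def d_def)
    have x: "x = of_int a / of_int b" and y: "y = of_int c / of_int d"
      using quotient_of_div[of x a b] quotient_of_div[of y c d] by (simp_all add: a_def b_def c_def d_def)
    have nz: "a \<noteq> 0" "c \<noteq> 0" using False x y by auto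
    have xy: "x * y = of_int (a * c) / of_int (b * d)" unfolding x y by simp
    have pe: "prime_elem (int p)" using p by simp
    have "a * c \<noteq> 0" "b * d \<noteq> 0" using nz bd by simp_all
    from padic_abs_frac[OF p this] show ?thesis
      unfolding xy unfolding x y padic_abs_frac[OF p nz(1) bd(1)] padic_abs_frac[OF p nz(2) bd(2)]
      using p0 nz bd by (simp add: prime_elem_multiplicity_mult_distrib[OF pe] algebra_simps flip: power_int_add)
  qed
qed

lemma padic_abs_int_le:
  assumes p: "Factorial_Ring.prime p" and "int p ^ n dvd k"
  shows "padic_abs p (of_int k) \<le> inverse (real p ^ n)"
proof (cases "k = 0")
  case True then show ?thesis by (simp add: padic_abs_def)
next
  case False
  have "n \<le> multiplicity (int p) k"
    using assms(2) False prime_gt_1_nat[OF p] by (intro multiplicity_geI) simp_all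
  moreover have "real p > 1" using p prime_gt_1_nat by simp
  moreover have "padic_abs p (of_int k) = real p powi (- int (multiplicity (int p) k))"
    using padic_abs_frac[OF p False, of 1] by simp
  ultimately show ?thesis by (simp add: power_int_minus le_imp_inverse_le)
qed

subsection \<open>Squares in the completions\<close>

lemma is_sq_infinite:
  assumes "d \<ge> 0"
  shows "abs_value.is_sq (\<lambda>x. real_of_rat \<bar>x\<bar>) d"
proof -
  interpret abs_value "\<lambda>x. real_of_rat \<bar>x\<bar>" by (rule abs_value_infinite)
  define r where "r = sqrt (real_of_rat d)"
  have r: "r \<ge> 0" "r * r = real_of_rat d" using assms by (simp_all add: r_def)
  have "\<exists>q. r < real_of_rat q \<and> real_of_rat q < r + 1 / real (Suc n)" for n
    by (rule of_rat_dense) simp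
  then obtain f where f: "\<And>n. r < real_of_rat (f n)" "\<And>n. real_of_rat (f n) < r + 1 / real (Suc n)"
    by metis
  have lim: "(\<lambda>n. real_of_rat (f n)) \<longlonglongrightarrow> r"
  proof (rule tendsto_sandwich[OF _ _ tendsto_const])
    show "(\<lambda>n. r + 1 / real (Suc n)) \<longlonglongrightarrow> r"
      using tendsto_add[OF tendsto_const[of r] LIMSEQ_inverse_real_of_nat] by (simp add: inverse_eq_divide)
  qed (use f in \<open>auto intro!: always_eventually less_imp_le\<close>)
  then have "Cauchy (\<lambda>n. real_of_rat (f n))" by (simp add: LIMSEQ_imp_Cauchy)
  then have "cauchy f"
    unfolding cauchy_def Cauchy_def dist_real_def by (simp add: abs_of_rat[symmetric] of_rat_diff del: abs_of_rat)
  moreover have "(\<lambda>n. real_of_rat (f n) * real_of_rat (f n) - r * r) \<longlonglongrightarrow> r * r - r * r"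
    by (intro tendsto_diff tendsto_mult lim tendsto_const)
  then have "(\<lambda>n. \<bar>real_of_rat (f n) * real_of_rat (f n) - r * r\<bar>) \<longlonglongrightarrow> 0"
    by (simp add: tendsto_rabs_zero)
  then have "(\<lambda>n. f n * f n - d) \<in> null_sequences (\<lambda>x. real_of_rat \<bar>x\<bar>)"
    unfolding null_sequences_def r(2) by (simp add: of_rat_mult[symmetric] of_rat_diff[symmetric] del: of_rat_mult of_rat_diff)
  ultimately show ?thesis by (rule is_sq_limit)
qed

section \<open>Square roots in the p-adic completions by lifting\<close>

lemma is_sq_padic_sequence:
  fixes n :: int and s :: "nat \<Rightarrow> int"
  assumes p: "Factorial_Ring.prime p"
    and "\<And>k. int p ^ k dvd s (Suc k) - s k" "\<And>k. int p ^ k dvd s k * s k - n"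
  shows "abs_value.is_sq (padic_abs p) (of_int n)"
proof -
  interpret abs_value "padic_abs p" by (rule abs_value_padic[OF p])
  have p1: "real p > 1" using prime_gt_1_nat[OF p] by simp
  have step: "int p ^ k dvd s (k + i) - s k" for k i
  proof (induction i)
    case (Suc i)
    have "int p ^ k dvd int p ^ (k + i)" by (simp add: le_imp_power_dvd)
    then have "int p ^ k dvd s (Suc (k + i)) - s (k + i)" using assms(2) dvd_trans by blast
    from dvd_add[OF this Suc] show ?case by simp
  qed simp
  have small: "\<exists>k. inverse (real p ^ k) < e" if "e > 0" for e
    using real_arch_pow_inv[OF that, of "inverse (real p)"] p1 by (auto simp: power_inverse inverse_less_1_iff)
  have mono: "inverse (real p ^ j) \<le> inverse (real p ^ k)" if "k \<le> j" for j k
    using that p1 by (intro le_imp_inverse_le power_increasing) auto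
  have "cauchy (\<lambda>k. of_int (s k))"
    unfolding cauchy_def
  proof (intro allI impI)
    fix e :: real assume "e > 0"
    then obtain k where k: "inverse (real p ^ k) < e" using small by blast
    have "padic_abs p (of_int (s i) - of_int (s j)) < e" if "i \<ge> k" "j \<ge> k" for i j
    proof -
      have "int p ^ k dvd s i - s k" "int p ^ k dvd s j - s k" using step[of k "i - k"] step[of k "j - k"] that by auto
      from dvd_diff[OF this] have "int p ^ k dvd s i - s j" by simp
      from padic_abs_int_le[OF p this] k show ?thesis by simp
    qed
    then show "\<exists>N. \<forall>i\<ge>N. \<forall>j\<ge>N. padic_abs p (of_int (s i) - of_int (s j)) < e" by blast
  qed
  moreover have "(\<lambda>k. of_int (s k) * of_int (s k) - of_int n) \<in> null_sequences (padic_abs p)"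
    unfolding null_iff
  proof (intro allI impI)
    fix e :: real assume "e > 0"
    then obtain k where k: "inverse (real p ^ k) < e" using small by blast
    have "padic_abs p (of_int (s j) * of_int (s j) - of_int n) < e" if "j \<ge> k" for j
      using padic_abs_int_le[OF p assms(3), of j] mono[OF that] k by simp
    then show "\<exists>N. \<forall>j\<ge>N. padic_abs p (of_int (s j) * of_int (s j) - of_int n) < e" by blast
  qed
  ultimately show ?thesis by (rule is_sq_limit)
qed

text \<open>Hensel lifting. If s^2 - n = p^(k+1) b, then s + p^(k+1) t is a root modulo the next
  power as soon as b + 2 s t vanishes modulo p, and 2 s is invertible there because p is odd and n
  is a unit.\<close>

lemma is_sq_padic_QuadRes:
  assumes p: "Factorial_Ring.prime p" "p > 2" and n: "Legendre n (int p) = 1"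
  shows "abs_value.is_sq (padic_abs p) (of_int n)"
proof -
  have pi: "Factorial_Ring.prime (int p)" using p by simp
  have nd: "\<not> [n = 0] (mod int p)" and "QuadRes (int p) n"
    using n by (auto simp: Legendre_def split: if_splits)
  then obtain y where y: "[y^2 = n] (mod int p)" by (auto simp: QuadRes_def)
  define Q where "Q k s \<longleftrightarrow> int p ^ Suc k dvd s * s - n \<and> coprime s (int p)" for k s
  have c: "coprime s (int p)" if "int p dvd s * s - n" for s
  proof -
    have "\<not> int p dvd s"
      using nd that by (metis cong_0_iff dvd_diff_right_iff dvd_mult2)
    then show ?thesis using pi prime_imp_coprime coprime_commute by blast
  qed
  have "\<exists>s. \<forall>k. Q k (s k) \<and> int p ^ Suc k dvd s (Suc k) - s k"
  proof (rule dependent_nat_choice)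
    show "\<exists>s. Q 0 s"
      using y c[of y] by (auto simp: Q_def cong_iff_dvd_diff power2_eq_square)
    fix s k assume "Q k s"
    then obtain b where b: "s * s - n = int p ^ Suc k * b" and cs: "coprime s (int p)" by (auto simp: Q_def)
    have "odd (int p)" using p prime_odd_nat by simp
    then have "coprime (2 * s) (int p)" using cs by simp
    then obtain z where z: "[2 * s * z = 1] (mod int p)" using cong_solve_coprime_int by blast
    define t where "t = - b * z"
    have "[b + 2 * s * t = b - b * (2 * s * z)] (mod int p)" by (simp add: t_def algebra_simps)
    also have "[b - b * (2 * s * z) = b - b * 1] (mod int p)" by (intro cong_diff cong_mult z cong_refl)
    finally have d: "int p dvd b + 2 * s * t" by (simp add: cong_0_iff)
    define s' where "s' = s + int p ^ Suc k * t"
    have "s' * s' - n = int p ^ Suc k * (b + 2 * s * t) + int p ^ Suc k * int p ^ Suc k * (t * t)"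
      using b by (simp add: s'_def algebra_simps)
    moreover have "int p ^ Suc (Suc k) dvd int p ^ Suc k * (b + 2 * s * t)"
      using d by (simp add: mult_dvd_mono mult.commute)
    moreover have "int p ^ Suc (Suc k) dvd int p ^ Suc k * int p ^ Suc k * (t * t)"
    proof -
      have "int p ^ Suc (Suc k) dvd int p ^ (Suc k + Suc k)" by (rule le_imp_power_dvd) simp
      then show ?thesis unfolding power_add by (rule dvd_mult2)
    qed
    ultimately have "int p ^ Suc (Suc k) dvd s' * s' - n" by (metis dvd_add)
    moreover from this have "int p dvd s' * s' - n" by (metis dvd_mult_left power_Suc)
    ultimately have "Q (Suc k) s'" using c by (simp add: Q_def)
    then show "\<exists>s'. Q (Suc k) s' \<and> int p ^ Suc k dvd s' - s"
      by (intro exI[of _ s']) (simp add: s'_def)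
  qed
  then obtain s where s: "\<And>k. int p ^ Suc k dvd s k * s k - n" "\<And>k. int p ^ Suc k dvd s (Suc k) - s k"
    by (auto simp: Q_def)
  show ?thesis
    by (rule is_sq_padic_sequence[OF p(1), of s]) (meson s dvd_trans le_imp_power_dvd le_SucI order_refl)+
qed

text \<open>The derivative 2 s costs a factor 2: a root modulo 2^(k+3) is corrected by a multiple of
  2^(k+2) only. The correction 2^(k+2) b works because s is odd, so that b + s b is even.\<close>

lemma is_sq_2adic:
  assumes "[n = 1] (mod 8)"
  shows "abs_value.is_sq (padic_abs 2) (of_int n)"
proof -
  define Q where "Q k s \<longleftrightarrow> (2::int) ^ (k + 3) dvd s * s - n \<and> odd s" for k :: nat and s
  have "\<exists>s. \<forall>k. Q k (s k) \<and> (2::int) ^ (k + 2) dvd s (Suc k) - s k"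
  proof (rule dependent_nat_choice)
    show "\<exists>s. Q 0 s"
      using assms by (intro exI[of _ 1]) (simp add: Q_def cong_iff_dvd_diff dvd_diff_commute)
    fix s k assume "Q k s"
    then obtain b where b: "s * s - n = 2 ^ (k + 3) * b" and s: "odd s" by (auto simp: Q_def)
    define s' where "s' = s + 2 ^ (k + 2) * b"
    have "s' * s' - n = 2 ^ (k + 3) * (b + s * b) + 2 ^ (k + 4) * (2 ^ k * (b * b))"
      using b by (simp add: s'_def algebra_simps power_add)
    moreover have "even (b + s * b)" using s by simp
    then obtain c where "b + s * b = 2 * c" by (rule evenE)
    then have "2 ^ (k + 3) * (b + s * b) = 2 ^ (k + 4) * c" by (simp add: power_add)
    then have "(2::int) ^ (k + 4) dvd 2 ^ (k + 3) * (b + s * b)" by simp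
    ultimately have "(2::int) ^ (k + 4) dvd s' * s' - n" by simp
    moreover have "odd s'" using s by (simp add: s'_def)
    ultimately have "Q (Suc k) s'" by (simp add: Q_def add.commute)
    then show "\<exists>s'. Q (Suc k) s' \<and> 2 ^ (k + 2) dvd s' - s"
      by (intro exI[of _ s']) (simp add: s'_def)
  qed
  then obtain s where s: "\<And>k. (2::int) ^ (k + 3) dvd s k * s k - n" "\<And>k. (2::int) ^ (k + 2) dvd s (Suc k) - s k"
    by (auto simp: Q_def)
  have "(2::int) ^ k dvd 2 ^ (k + 3)" "(2::int) ^ k dvd 2 ^ (k + 2)" for k by (simp_all add: le_imp_power_dvd)
  then have "(2::int) ^ k dvd s k * s k - n" "(2::int) ^ k dvd s (Suc k) - s k" for k
    using s dvd_trans by blast+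
  then show ?thesis using is_sq_padic_sequence[of 2 s n] by simp
qed

subsection \<open>Legendre symbols\<close>

locale odd_prime =
  fixes p :: nat
  assumes prime_p: "Factorial_Ring.prime p" and p_gt_2: "p > 2"
begin

abbreviation chi :: "int \<Rightarrow> int" where "chi a \<equiv> Legendre a (int p)"

lemma prime_int_p: "Factorial_Ring.prime (int p)" using prime_p by simp

lemma chi_cong: "[a = b] (mod int p) \<Longrightarrow> chi a = chi b"
proof -
  assume ab: "[a = b] (mod int p)"
  have "[a = 0] (mod int p) \<longleftrightarrow> [b = 0] (mod int p)" using ab by (metis cong_sym cong_trans)
  moreover have "QuadRes (int p) a \<longleftrightarrow> QuadRes (int p) b"
    unfolding QuadRes_def using ab by (metis cong_sym cong_trans)
  ultimately show ?thesis by (simp add: Legendre_def)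
qed

lemma chi_values: "chi a \<in> {-1, 0, 1}" by (auto simp: Legendre_def)

lemma chi_0_iff: "chi a = 0 \<longleftrightarrow> int p dvd a" by (auto simp: Legendre_def cong_0_iff)

lemma chi_0 [simp]: "chi 0 = 0" by (simp add: chi_0_iff)

lemma small_cong:
  assumes "[a = b] (mod int p)" "a \<in> {-1, 0, 1}" "b \<in> {-1, 0, 1}"
  shows "a = b"
proof -
  have "int p dvd a - b" using assms by (simp add: cong_iff_dvd_diff)
  moreover have "\<bar>a - b\<bar> < int p" using assms(2,3) p_gt_2 by auto
  ultimately show ?thesis using zdvd_imp_le[of "int p" "\<bar>a - b\<bar>"] by (cases "a = b") auto
qed

lemma chi_mult: "chi (a * b) = chi a * chi b"
proof (rule small_cong)
  note E = euler_criterion[OF prime_p p_gt_2]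
  have "[chi (a * b) = a ^ ((p - 1) div 2) * b ^ ((p - 1) div 2)] (mod int p)"
    using E[of "a * b"] by (simp add: power_mult_distrib)
  also have "[a ^ ((p - 1) div 2) * b ^ ((p - 1) div 2) = chi a * chi b] (mod int p)"
    using cong_mult[OF E[of a] E[of b]] by (rule cong_sym)
  finally show "[chi (a * b) = chi a * chi b] (mod int p)" .
  show "chi a * chi b \<in> {-1, 0, 1}" using chi_values[of a] chi_values[of b] by auto
qed (rule chi_values)

lemma chi_square: "\<not> int p dvd a \<Longrightarrow> chi (a * a) = 1"
  using chi_values[of a] by (auto simp: chi_mult chi_0_iff)

lemma chi_1 [simp]: "chi 1 = 1"
  using chi_square[of 1] p_gt_2 by auto

lemma chi_minus_1: "chi (- 1) = (if [int p = 1] (mod 4) then 1 else - 1)"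
proof (rule small_cong)
  have "odd p" using prime_p p_gt_2 prime_odd_nat by simp
  then have "p mod 4 = 1 \<or> p mod 4 = 3" by presburger
  then consider "p mod 4 = 1" | "p mod 4 = 3" by blast
  then have "(- 1 :: int) ^ ((p - 1) div 2) = (if [int p = 1] (mod 4) then 1 else - 1)"
  proof cases
    case 1
    then have "p = 4 * (p div 4) + 1" by presburger
    then have "(p - 1) div 2 = 2 * (p div 4)" by simp
    moreover have "int p mod 4 = 1" using arg_cong[OF 1, of int] by (simp add: zmod_int)
    ultimately show ?thesis by (simp add: cong_def)
  next
    case 2
    then have "p = 4 * (p div 4) + 3" by presburger
    then have "(p - 1) div 2 = Suc (2 * (p div 4))" by simp
    moreover have "int p mod 4 = 3" using arg_cong[OF 2, of int] by (simp add: zmod_int)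
    ultimately show ?thesis by (simp add: cong_def)
  qed
  then show "[chi (- 1) = (if [int p = 1] (mod 4) then 1 else - 1)] (mod int p)"
    using euler_criterion[OF prime_p p_gt_2, of "- 1"] by simp
qed (use chi_values in auto)

text \<open>Otherwise squaring would be a surjection of the residues onto themselves, hence
  injective, although 1 and p - 1 have the same square.\<close>

lemma nonresidue_exists: "\<exists>a. chi a = - 1"
proof (rule ccontr)
  assume no: "\<nexists>a. chi a = - 1"
  let ?A = "{0..<int p}"
  define f where "f y = (y * y) mod int p" for y
  have "f ` ?A = ?A"
  proof
    show "f ` ?A \<subseteq> ?A" using p_gt_2 by (auto simp: f_def)
    show "?A \<subseteq> f ` ?A"
    proof
      fix a assume a: "a \<in> ?A"
      have "chi a = 0 \<or> chi a = 1" using no chi_values[of a] by auto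
      then have "\<exists>y. [y * y = a] (mod int p)"
      proof
        assume "chi a = 0" then show ?thesis
          by (intro exI[of _ 0]) (simp add: chi_0_iff cong_0_iff cong_sym_eq[of 0])
      next
        assume "chi a = 1" then show ?thesis
          by (auto simp: Legendre_def QuadRes_def power2_eq_square split: if_splits)
      qed
      then obtain y where "[y * y = a] (mod int p)" by blast
      then have "f (y mod int p) = a" using a by (simp add: f_def cong_def mod_mult_eq)
      moreover have "y mod int p \<in> ?A" using p_gt_2 by simp
      ultimately show "a \<in> f ` ?A" by blast
    qed
  qed
  then have "inj_on f ?A" by (simp add: eq_card_imp_inj_on)
  moreover have "f 1 = f (int p - 1)"
  proof -
    have "(int p - 1) * (int p - 1) = 1 + int p * (int p - 2)" by (simp add: algebra_simps)
    then show ?thesis by (simp add: f_def)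
  qed
  ultimately have "1 = int p - 1" using p_gt_2 by (auto dest: inj_onD)
  then show False using p_gt_2 by simp
qed

text \<open>Otherwise the squares would be closed under adding 1, and every residue would be a
  square.\<close>

lemma sum_square_plus_1_nonresidue: "\<exists>a. chi (a * a + 1) = - 1"
proof (rule ccontr)
  assume no: "\<nexists>a. chi (a * a + 1) = - 1"
  have sq: "\<exists>y. [y * y = int n] (mod int p)" for n
  proof (induction n)
    case 0 show ?case by (intro exI[of _ 0]) simp
  next
    case (Suc n)
    then obtain y where y: "[y * y = int n] (mod int p)" by blast
    then have "[y * y + 1 = int (Suc n)] (mod int p)" using cong_add[OF y cong_refl[of 1]] by (simp add: add.commute)
    moreover have "chi (y * y + 1) = 0 \<or> chi (y * y + 1) = 1" using no chi_values[of "y * y + 1"] by auto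
    then have "\<exists>z. [z * z = y * y + 1] (mod int p)"
      by (auto simp: Legendre_def QuadRes_def power2_eq_square cong_sym_eq[of 0] split: if_splits
          intro: exI[of _ 0])
    ultimately show ?case using cong_trans by blast
  qed
  obtain a where a: "chi a = - 1" using nonresidue_exists by blast
  obtain y where "[y * y = int (nat (a mod int p))] (mod int p)" using sq by blast
  then have "[y * y = a] (mod int p)" using p_gt_2 by (simp add: cong_def)
  then have "chi a = chi y * chi y" using chi_cong chi_mult by metis
  then show False using a chi_values[of y] by auto
qed

section \<open>Sums of Legendre symbols\<close>

lemma sum_shift:
  fixes f :: "int \<Rightarrow> int"
  assumes "\<And>a b. [a = b] (mod int p) \<Longrightarrow> f a = f b"
  shows "(\<Sum>x\<in>{0..<int p}. f (x + c)) = (\<Sum>x\<in>{0..<int p}. f x)"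
proof -
  have "inj_on (\<lambda>x. (x + c) mod int p) {0..<int p}"
  proof (rule inj_onI)
    fix x y assume *: "x \<in> {0..<int p}" "y \<in> {0..<int p}" "(x + c) mod int p = (y + c) mod int p"
    then have "[x = y] (mod int p)" by (simp add: cong_def[symmetric] cong_add_rcancel)
    then show "x = y" using * by (simp add: cong_def)
  qed
  moreover have "(\<lambda>x. (x + c) mod int p) ` {0..<int p} \<subseteq> {0..<int p}" using p_gt_2 by auto
  ultimately have "bij_betw (\<lambda>x. (x + c) mod int p) {0..<int p} {0..<int p}"
    by (simp add: bij_betw_def endo_inj_surj)
  then have "(\<Sum>x\<in>{0..<int p}. f ((x + c) mod int p)) = (\<Sum>x\<in>{0..<int p}. f x)"
    by (rule sum.reindex_bij_betw)
  moreover have "f ((x + c) mod int p) = f (x + c)" for x by (rule assms) (simp add: cong_def)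
  ultimately show ?thesis by simp
qed

lemma sum_scale:
  fixes f :: "int \<Rightarrow> int"
  assumes "\<And>a b. [a = b] (mod int p) \<Longrightarrow> f a = f b" and u: "\<not> int p dvd u"
  shows "(\<Sum>x\<in>{0..<int p}. f (u * x)) = (\<Sum>x\<in>{0..<int p}. f x)"
proof -
  have cop: "coprime u (int p)" using u prime_int_p prime_imp_coprime coprime_commute by blast
  have "inj_on (\<lambda>x. (u * x) mod int p) {0..<int p}"
  proof (rule inj_onI)
    fix x y assume *: "x \<in> {0..<int p}" "y \<in> {0..<int p}" "(u * x) mod int p = (u * y) mod int p"
    then have "[x = y] (mod int p)" using cop by (simp add: cong_def[symmetric] cong_mult_lcancel)
    then show "x = y" using * by (simp add: cong_def)
  qed
  moreover have "(\<lambda>x. (u * x) mod int p) ` {0..<int p} \<subseteq> {0..<int p}" using p_gt_2 by auto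
  ultimately have "bij_betw (\<lambda>x. (u * x) mod int p) {0..<int p} {0..<int p}"
    by (simp add: bij_betw_def endo_inj_surj)
  then have "(\<Sum>x\<in>{0..<int p}. f ((u * x) mod int p)) = (\<Sum>x\<in>{0..<int p}. f x)"
    by (rule sum.reindex_bij_betw)
  moreover have "f ((u * x) mod int p) = f (u * x)" for x by (rule assms) (simp add: cong_def)
  ultimately show ?thesis by simp
qed

text \<open>Multiplying the variable by a nonresidue permutes the residues and changes the sign of
  the sum.\<close>

lemma sum_chi: "(\<Sum>x\<in>{0..<int p}. chi (x + c)) = 0"
proof -
  obtain u where u: "chi u = - 1" using nonresidue_exists by blast
  then have "\<not> int p dvd u" using chi_0_iff[of u] by auto
  then have "(\<Sum>x\<in>{0..<int p}. chi (u * x)) = (\<Sum>x\<in>{0..<int p}. chi x)"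
    using chi_cong by (intro sum_scale)
  then have "(\<Sum>x\<in>{0..<int p}. chi x) = 0" by (simp add: chi_mult u sum_negf)
  then show ?thesis using sum_shift[of chi c] chi_cong by simp
qed

text \<open>By scaling, J c is the same for all c prime to p, while J 0 = p - 1. The sum of all J c
  vanishes by \<open>sum_chi\<close>, whence J 1 = - 1; a shift of the variable gives the
  assertion.\<close>

lemma sum_chi_chi:
  assumes "\<not> int p dvd a - b"
  shows "(\<Sum>x\<in>{0..<int p}. chi (x - a) * chi (x - b)) = - 1"
proof -
  let ?A = "{0..<int p}"
  define J where "J c = (\<Sum>x\<in>?A. chi x * chi (x + c))" for c
  have cong: "chi a' * chi (a' + c) = chi b' * chi (b' + c)" if "[a' = b'] (mod int p)" for a' b' c
    using chi_cong[OF that] chi_cong[OF cong_add[OF that cong_refl[of c]]] by simp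
  have J: "J c = J 1" if "\<not> int p dvd c" for c
  proof -
    have "J c = (\<Sum>x\<in>?A. chi (c * x) * chi (c * x + c))"
      unfolding J_def using sum_scale[of "\<lambda>x. chi x * chi (x + c)" c] cong that by simp
    also have "chi (c * x) * chi (c * x + c) = chi (c * c) * (chi x * chi (x + 1))" for x
    proof -
      have "c * x + c = c * (x + 1)" by (simp add: algebra_simps)
      then show ?thesis by (simp add: chi_mult)
    qed
    then have "(\<Sum>x\<in>?A. chi (c * x) * chi (c * x + c)) = J 1"
      using chi_square[OF that] by (simp add: J_def)
    finally show ?thesis .
  qed
  have A: "?A = insert 0 {1..<int p}" using p_gt_2 by auto
  have nd: "\<not> int p dvd x" if "x \<in> {1..<int p}" for x using that zdvd_imp_le[of "int p" x] by auto
  have "J 0 = (\<Sum>x\<in>{1..<int p}. chi x * chi x)" unfolding J_def A by simp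
  also have "\<dots> = (\<Sum>x\<in>{1..<int p}. 1)" by (rule sum.cong) (use nd chi_square chi_mult in auto)
  finally have J0: "J 0 = int p - 1" using p_gt_2 by simp
  have "(\<Sum>c\<in>?A. J c) = (\<Sum>x\<in>?A. chi x * (\<Sum>c\<in>?A. chi (c + x)))"
    unfolding J_def sum_distrib_left by (subst sum.swap) (simp add: add.commute)
  then have "(\<Sum>c\<in>?A. J c) = 0" by (simp add: sum_chi)
  moreover have "(\<Sum>c\<in>?A. J c) = J 0 + (\<Sum>c\<in>{1..<int p}. J c)"
    unfolding A by simp
  moreover have "(\<Sum>c\<in>{1..<int p}. J c) = (\<Sum>c\<in>{1..<int p}. J 1)"
    by (rule sum.cong[OF refl], rule J, rule nd)
  ultimately have "(int p - 1) * (1 + J 1) = 0" using J0 p_gt_2 by (simp add: algebra_simps)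
  then have "J 1 = - 1" using p_gt_2 by auto
  then have "J (a - b) = - 1" using J[OF assms] by simp
  moreover have "J (a - b) = (\<Sum>x\<in>?A. chi (x - a) * chi (x - b))"
  proof -
    have "(\<Sum>x\<in>?A. chi (x + - a) * chi (x + - a + (a - b))) = (\<Sum>x\<in>?A. chi x * chi (x + (a - b)))"
      by (rule sum_shift[of "\<lambda>x. chi x * chi (x + (a - b))"]) (rule cong)
    then show ?thesis by (simp add: J_def)
  qed
  ultimately show ?thesis by simp
qed

text \<open>This is the count of the points of the reduced torsor: expanding the product, the sum
  becomes $p + 1 + \sum_x \chi((x - e_1)(x - e_2)(x - e_3)) \ge 1$.\<close>

lemma exists_prescribed_symbols:
  assumes e: "\<not> int p dvd e1 - e2" "\<not> int p dvd e1 - e3" "\<not> int p dvd e2 - e3"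
    and s: "s1 \<in> {-1, 1}" "s2 \<in> {-1, 1}" "s3 \<in> {-1, 1 :: int}" "s1 * s2 * s3 = 1" "\<not> (s1 = 1 \<and> s2 = 1 \<and> s3 = 1)"
  shows "\<exists>x. chi (x - e1) \<in> {0, s1} \<and> chi (x - e2) \<in> {0, s2} \<and> chi (x - e3) \<in> {0, s3}"
proof (rule ccontr)
  assume no: "\<not> ?thesis"
  let ?A = "{0..<int p}"
  let ?c1 = "\<lambda>x. chi (x - e1)" and ?c2 = "\<lambda>x. chi (x - e2)" and ?c3 = "\<lambda>x. chi (x - e3)"
  \<comment> \<open>Since no x is as required, for every x some symbol is the opposite of the
    prescribed sign, and this kills a factor.\<close>
  have z: "(1 + s1 * ?c1 x) * (1 + s2 * ?c2 x) * (1 + s3 * ?c3 x) = 0" for x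
    using no s(1-3) chi_values[of "x - e1"] chi_values[of "x - e2"] chi_values[of "x - e3"] by auto
  \<comment> \<open>Exactly two of the signs are - 1. Each double sum is - 1, so together they
    contribute 1; for three signs equal to 1 they would contribute - 3, which is why that triple is
    excluded.\<close>
  have ss: "s1 * s2 + s1 * s3 + s2 * s3 = - 1" using s by auto
  have "(1 + s1 * ?c1 x) * (1 + s2 * ?c2 x) * (1 + s3 * ?c3 x) = 1 + s1 * ?c1 x + s2 * ?c2 x + s3 * ?c3 x
     + s1 * s2 * (?c1 x * ?c2 x) + s1 * s3 * (?c1 x * ?c3 x) + s2 * s3 * (?c2 x * ?c3 x)
     + s1 * s2 * s3 * (?c1 x * ?c2 x * ?c3 x)" for x
    by (simp add: algebra_simps)
  then have "0 = (\<Sum>x\<in>?A. 1 + s1 * ?c1 x + s2 * ?c2 x + s3 * ?c3 x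
     + s1 * s2 * (?c1 x * ?c2 x) + s1 * s3 * (?c1 x * ?c3 x) + s2 * s3 * (?c2 x * ?c3 x)
     + s1 * s2 * s3 * (?c1 x * ?c2 x * ?c3 x))" using z by simp
  also have "\<dots> = int p + s1 * (\<Sum>x\<in>?A. ?c1 x) + s2 * (\<Sum>x\<in>?A. ?c2 x) + s3 * (\<Sum>x\<in>?A. ?c3 x)
     + s1 * s2 * (\<Sum>x\<in>?A. ?c1 x * ?c2 x) + s1 * s3 * (\<Sum>x\<in>?A. ?c1 x * ?c3 x)
     + s2 * s3 * (\<Sum>x\<in>?A. ?c2 x * ?c3 x) + (\<Sum>x\<in>?A. ?c1 x * ?c2 x * ?c3 x)"
    by (simp add: sum.distrib sum_distrib_left s(4))
  also have "\<dots> = int p - (s1 * s2 + s1 * s3 + s2 * s3) + (\<Sum>x\<in>?A. ?c1 x * ?c2 x * ?c3 x)"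
    using sum_chi[of "- e1"] sum_chi[of "- e2"] sum_chi[of "- e3"]
    by (simp add: sum_chi_chi[OF e(1)] sum_chi_chi[OF e(2)] sum_chi_chi[OF e(3)])
  finally have "0 = int p + 1 + (\<Sum>x\<in>?A. ?c1 x * ?c2 x * ?c3 x)" using ss by simp
  moreover have "(\<Sum>x\<in>?A. - 1) \<le> (\<Sum>x\<in>?A. ?c1 x * ?c2 x * ?c3 x)"
  proof (rule sum_mono)
    fix x show "- 1 \<le> ?c1 x * ?c2 x * ?c3 x"
      using chi_values[of "x - e1"] chi_values[of "x - e2"] chi_values[of "x - e3"] by auto
  qed
  ultimately show False by simp
qed

end

subsection \<open>Local solvability\<close>

text \<open>The torsor $x - e_i = d_i t_i^2$ has a point over the completion at \<open>v\<close>, and even one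
  with a rational abscissa \<open>x\<close> or at infinity.\<close>

definition locally_solvable :: "(rat \<Rightarrow> real) \<Rightarrow> int \<Rightarrow> int \<Rightarrow> int \<Rightarrow> int \<Rightarrow> int \<Rightarrow> int \<Rightarrow> bool" where
  "locally_solvable v e1 e2 e3 d1 d2 d3 \<longleftrightarrow>
     (abs_value.is_sq v (of_int d1) \<and> abs_value.is_sq v (of_int d2) \<and> abs_value.is_sq v (of_int d3)) \<or>
     (\<exists>x. abs_value.is_sq v (of_int d1 * (x - of_int e1)) \<and> abs_value.is_sq v (of_int d2 * (x - of_int e2)) \<and>
        abs_value.is_sq v (of_int d3 * (x - of_int e3)))"

lemma locally_solvable_int:
  assumes "abs_value.is_sq v (of_int (d1 * (x - e1)))" "abs_value.is_sq v (of_int (d2 * (x - e2)))"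
    "abs_value.is_sq v (of_int (d3 * (x - e3)))"
  shows "locally_solvable v e1 e2 e3 d1 d2 d3"
  unfolding locally_solvable_def by (rule disjI2, rule exI[of _ "of_int x"]) (use assms in simp)

lemma abs_value_place: "v \<in> rat_places \<Longrightarrow> abs_value v"
  using abs_value_infinite abs_value_padic by (auto simp: rat_places_def)

lemma is_sq_int_square: "v \<in> rat_places \<Longrightarrow> abs_value.is_sq v (of_int (k * k))"
  using abs_value.is_sq_square[OF abs_value_place, of v "of_int k"] by simp

lemma is_sq_int_times_square:
  "v \<in> rat_places \<Longrightarrow> abs_value.is_sq v (of_int n) \<Longrightarrow> abs_value.is_sq v (of_int (n * (k * k)))"
  using abs_value.is_sq_times_square[OF abs_value_place, of v "of_int n" "of_int k"] by simp

lemma padic_place: "Factorial_Ring.prime p \<Longrightarrow> padic_abs p \<in> rat_places"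
  by (auto simp: rat_places_def)

context odd_prime
begin

lemma is_sq_chi: "chi n = 1 \<Longrightarrow> abs_value.is_sq (padic_abs p) (of_int n)"
  by (rule is_sq_padic_QuadRes[OF prime_p p_gt_2])

lemma chi_square_values: "chi (a * a) = 0 \<or> chi (a * a) = 1"
  using chi_values[of a] by (auto simp: chi_mult)

lemma is_sq_zero: "abs_value.is_sq (padic_abs p) (of_int (n * (x - x)))"
  using is_sq_int_square[OF padic_place[OF prime_p], of 0] by simp

text \<open>At a place of good reduction every unramified class is locally soluble.\<close>

lemma solvable_good:
  assumes e: "\<not> int p dvd e1 - e2" "\<not> int p dvd e1 - e3" "\<not> int p dvd e2 - e3"
    and d: "chi d1 * chi d2 * chi d3 = 1"
  shows "locally_solvable (padic_abs p) e1 e2 e3 d1 d2 d3"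
proof (cases "chi d1 = 1 \<and> chi d2 = 1 \<and> chi d3 = 1")
  case True
  then show ?thesis using is_sq_chi by (auto simp: locally_solvable_def)
next
  case False
  have nz: "chi d1 \<in> {-1, 1}" "chi d2 \<in> {-1, 1}" "chi d3 \<in> {-1, 1}"
    using d chi_values[of d1] chi_values[of d2] chi_values[of d3] by auto
  obtain x where x: "chi (x - e1) \<in> {0, chi d1}" "chi (x - e2) \<in> {0, chi d2}" "chi (x - e3) \<in> {0, chi d3}"
    using exists_prescribed_symbols[OF e nz d False] by blast
  have mult: "chi (di * (y - ei)) = 1" if "chi (y - ei) = chi di" "chi di \<in> {-1, 1}" for y ei di
    using that by (auto simp: chi_mult)
  have near: "chi (ei - ej) = chi (x - ej)" if "chi (x - ei) = 0" for ei ej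
  proof (rule chi_cong)
    show "[ei - ej = x - ej] (mod int p)"
      using that cong_iff_dvd_diff[of x ei] by (intro cong_diff cong_refl) (simp add: chi_0_iff cong_sym)
  qed
  have nzd: "chi (ei - ej) \<noteq> 0" if "\<not> int p dvd ei - ej" for ei ej using that by (simp add: chi_0_iff)
  have e': "\<not> int p dvd e2 - e1" "\<not> int p dvd e3 - e1" "\<not> int p dvd e3 - e2"
    using e by (simp_all add: dvd_diff_commute)
  \<comment> \<open>If x reduces to a root e_i, the exact root is taken as abscissa: there d_i (x -
    e_i) is 0, and the other differences keep their symbols. Otherwise x itself works, since all
    three products are nonzero squares modulo p.\<close>
  consider "chi (x - e1) = 0" | "chi (x - e2) = 0" | "chi (x - e3) = 0"
    | "chi (x - e1) = chi d1" "chi (x - e2) = chi d2" "chi (x - e3) = chi d3" using x by blast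
  then show ?thesis
  proof cases
    case 1
    then have "chi (e1 - e2) = chi d2" "chi (e1 - e3) = chi d3"
      using near[OF 1] nzd[OF e(1)] nzd[OF e(2)] x by auto
    then show ?thesis
      by (intro locally_solvable_int[where x = e1] is_sq_zero is_sq_chi mult nz)
  next
    case 2
    then have "chi (e2 - e1) = chi d1" "chi (e2 - e3) = chi d3"
      using near[OF 2] nzd[OF e'(1)] nzd[OF e(3)] x by auto
    then show ?thesis
      by (intro locally_solvable_int[where x = e2] is_sq_zero is_sq_chi mult nz)
  next
    case 3
    then have "chi (e3 - e1) = chi d1" "chi (e3 - e2) = chi d2"
      using near[OF 3] nzd[OF e'(2)] nzd[OF e'(3)] x by auto
    then show ?thesis
      by (intro locally_solvable_int[where x = e3] is_sq_zero is_sq_chi mult nz)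
  next
    case 4
    then show ?thesis by (intro locally_solvable_int[where x = x] is_sq_chi mult nz)
  qed
qed

text \<open>The reduction has a node at the origin; \<open>s\<close> is 1 or $-1$ and a square modulo \<open>p\<close>.\<close>

lemma solvable_node:
  assumes N: "int p dvd N" and s: "chi s = 1" and d: "\<not> int p dvd d" and c: "\<not> int p dvd c"
  shows "locally_solvable (padic_abs p) N (- N) (c * c) (s * d) d s"
proof (cases "chi d = 1")
  case True
  then show ?thesis using s is_sq_chi[of "s * d"] is_sq_chi[of d] is_sq_chi[of s]
    by (simp add: locally_solvable_def chi_mult del: of_int_mult)
next
  case False
  then have d1: "chi d = - 1" using chi_values[of d] d chi_0_iff by auto
  obtain a where a: "chi (a * a + 1) = - 1" using sum_square_plus_1_nonresidue by blast
  have na: "\<not> int p dvd a"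
  proof
    assume "int p dvd a"
    then have "[a * a + 1 = 0 * 0 + 1] (mod int p)"
      by (intro cong_add cong_mult cong_refl) (simp_all add: cong_0_iff)
    then have "chi (a * a + 1) = 1" using chi_cong by fastforce
    then show False using a by simp
  qed
  \<comment> \<open>Modulo p both roots N and - N vanish, so x - N and x + N have the symbol of x,
    which has to be - 1 like that of d. This choice achieves it and makes x - c^2 the square of a
    c.\<close>
  define x where "x = (c * c) * (a * a + 1)"
  have x: "chi x = - 1" using a chi_square[OF c] by (simp add: x_def chi_mult)
  have "[x - N = x - 0] (mod int p)" "[x - - N = x - 0] (mod int p)"
    using N by (simp_all add: cong_iff_dvd_diff)
  then have xN: "chi (x - N) = - 1" "chi (x - - N) = - 1" using chi_cong[of _ "x - 0"] x by auto
  have "x - c * c = (c * c) * (a * a)" by (simp add: x_def algebra_simps)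
  then have xc: "chi (x - c * c) = 1" using chi_square[OF c] chi_square[OF na] by (simp add: chi_mult)
  have "chi (s * d * (x - N)) = 1" "chi (d * (x - - N)) = 1" "chi (s * (x - c * c)) = 1"
    unfolding chi_mult xN d1 s xc by simp_all
  then show ?thesis by (intro locally_solvable_int[where x = x] is_sq_chi)
qed

text \<open>If p divides x, then x - c^2 reduces to minus a square, and s times it to a square since
  s is the symbol of - 1. With N = p N' there are two candidates. For x = N, the product p (x + N)
  is 2 N' p^2. For x = p t, what remains is that t + N' and s (t - N') be squares, which amounts to
  w^2 - s u^2 = 2 N' modulo p.\<close>

lemma solvable_ramified:
  assumes N: "N = int p * N'" "\<not> int p dvd N'" and c: "\<not> int p dvd c"
    and s: "s = chi (- 1)"
  shows "locally_solvable (padic_abs p) N (- N) (c * c) (s * int p) (int p) s"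
proof -
  note pl = padic_place[OF prime_p]
  have s_val: "s = 1 \<or> s = - 1" using s by (simp add: chi_minus_1)
  have ss: "s * s = 1" "chi s = s" using s_val s by auto
  have e3: "chi (s * (x - c * c)) = 1" if "int p dvd x" for x
  proof -
    have "[x - c * c = 0 - c * c] (mod int p)" using that by (intro cong_diff cong_refl) (simp add: cong_0_iff)
    then have "chi (x - c * c) = chi ((- 1) * (c * c))" using chi_cong by simp
    then have "chi (x - c * c) = s" using chi_square[OF c] s by (simp only: chi_mult)
    then show ?thesis using ss by (simp add: chi_mult)
  qed
  have two: "\<not> int p dvd 2 * N'"
  proof -
    have "\<not> int p dvd 2" using p_gt_2 zdvd_imp_le[of "int p" 2] by auto
    then show ?thesis using N(2) prime_int_p prime_dvd_multD by blast
  qed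
  show ?thesis
  proof (cases "chi (2 * N') = 1")
    case True
    have "int p * (N - - N) = (2 * N') * (int p * int p)" using N by (simp add: algebra_simps)
    then have "abs_value.is_sq (padic_abs p) (of_int (int p * (N - - N)))"
      using is_sq_int_times_square[OF pl is_sq_chi[OF True]] by metis
    moreover have "chi (s * (N - c * c)) = 1" using e3 N by simp
    ultimately show ?thesis by (intro locally_solvable_int[OF is_sq_zero _ is_sq_chi])
  next
    case False
    then have k: "chi (2 * N') = - 1" using two chi_values[of "2 * N'"] chi_0_iff by auto
    obtain u w where uw: "[w * w - s * (u * u) = 2 * N'] (mod int p)"
    proof (cases "s = 1")
      case True
      have "odd (int p)" using prime_odd_nat[OF prime_p] p_gt_2 by simp
      then have "coprime 2 (int p)" by simp
      then obtain h where h: "[2 * h = 1] (mod int p)" using cong_solve_coprime_int by blast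
      \<comment> \<open>The factors w - u and w + u are to be 1 and 2 N'; \<open>h\<close> stands
        for one half.\<close>
      define w u where "w = h * (1 + 2 * N')" and "u = h * (2 * N' - 1)"
      have "w * w - 1 * (u * u) = (2 * h) * (2 * h) * (2 * N')" by (simp add: w_def u_def algebra_simps)
      moreover have "[(2 * h) * (2 * h) * (2 * N') = 1 * 1 * (2 * N')] (mod int p)"
        by (intro cong_mult h cong_refl)
      ultimately show ?thesis using that[of w u] True by simp
    next
      case False
      then have s1: "s = - 1" using s_val by simp
      obtain a where a: "chi (a * a + 1) = - 1" using sum_square_plus_1_nonresidue by blast
      have "\<not> int p dvd a * a + 1" using a chi_0_iff[of "a * a + 1"] by auto
      then have "coprime (a * a + 1) (int p)" using prime_int_p prime_imp_coprime coprime_commute by blast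
      then obtain h where h: "[(a * a + 1) * h = 1] (mod int p)" using cong_solve_coprime_int by blast
      have "chi ((a * a + 1) * h) = 1" using chi_cong[OF h] by simp
      then have "chi (h * (2 * N')) = 1" using a k by (simp add: chi_mult)
      \<comment> \<open>Both 2 N' and a^2 + 1 are nonresidues, so their quotient is a square b^2,
        and w = b, u = a b solve the equation w^2 + u^2 = 2 N'.\<close>
      then obtain b where b: "[b * b = h * (2 * N')] (mod int p)"
        by (auto simp: Legendre_def QuadRes_def power2_eq_square split: if_splits)
      have "[(a * a + 1) * (b * b) = (a * a + 1) * (h * (2 * N'))] (mod int p)" by (intro cong_mult b cong_refl)
      also have "(a * a + 1) * (h * (2 * N')) = ((a * a + 1) * h) * (2 * N')" by (simp add: algebra_simps)
      also have "[((a * a + 1) * h) * (2 * N') = 1 * (2 * N')] (mod int p)" by (intro cong_mult h cong_refl)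
      finally have "[b * b - s * ((a * b) * (a * b)) = 2 * N'] (mod int p)" using s1 by (simp add: algebra_simps)
      then show ?thesis by (rule that)
    qed
    \<comment> \<open>A root can be lifted only from a nonzero residue. If p divided u, then 2 N'
      would be the square w^2, against the case assumption.\<close>
    have nu: "\<not> int p dvd u"
    proof
      assume "int p dvd u"
      then have "[w * w - s * (u * u) = w * w - s * (0 * 0)] (mod int p)"
        by (intro cong_diff cong_mult cong_refl) (simp_all add: cong_0_iff)
      from chi_cong[OF this] chi_cong[OF uw] have "chi (2 * N') = chi (w * w)" by simp
      then show False using k chi_values[of w] by (auto simp: chi_mult)
    qed
    define t where "t = w * w - N'"
    have "[s * (t - N') = s * (s * (u * u))] (mod int p)"
    proof -
      have e: "t - N' = w * w - 2 * N'" by (simp add: t_def)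
      have "[w * w - 2 * N' = w * w - (w * w - s * (u * u))] (mod int p)"
        using uw by (intro cong_diff cong_refl) (rule cong_sym)
      then have "[t - N' = s * (u * u)] (mod int p)" unfolding e by simp
      then show ?thesis by (intro cong_mult cong_refl)
    qed
    also have "s * (s * (u * u)) = u * u" using ss by (simp add: mult.assoc[symmetric])
    finally have "chi (s * (t - N')) = 1" using chi_cong chi_square[OF nu] by simp
    moreover have "s * int p * (int p * t - N) = s * (t - N') * (int p * int p)" using N by (simp add: algebra_simps)
    ultimately have "abs_value.is_sq (padic_abs p) (of_int (s * int p * (int p * t - N)))"
      using is_sq_int_times_square[OF pl is_sq_chi] by metis
    moreover have "int p * (int p * t - - N) = (w * int p) * (w * int p)" using N by (simp add: t_def algebra_simps)
    then have "abs_value.is_sq (padic_abs p) (of_int (int p * (int p * t - - N)))"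
      using is_sq_int_square[OF pl] by metis
    moreover have "chi (s * (int p * t - c * c)) = 1" using e3 by simp
    ultimately show ?thesis by (intro locally_solvable_int[OF _ _ is_sq_chi])
  qed
qed

end

section \<open>Arithmetic of N = m^4 - 1 and local solubility of the classes of the counted
  primes\<close>

locale twin_primes =
  fixes m :: int
  assumes m_pos: "m > 0" and m_even: "even m"
    and prime_m1: "Factorial_Ring.prime (m - 1)" and prime_p1: "Factorial_Ring.prime (m + 1)"
    and sqfree: "squarefree (m^2 + 1)"
begin

abbreviation N :: int where "N \<equiv> m^4 - 1"
abbreviation M :: int where "M \<equiv> 2 * m"

lemma N_factors: "N = (m - 1) * ((m + 1) * (m^2 + 1))"
  by (simp add: algebra_simps power2_eq_square power4_eq_xxxx)

lemma M_square: "M * M = 4 * m^2" by (simp add: power2_eq_square)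

lemma m_ge_4: "m \<ge> 4"
proof -
  have "m - 1 \<noteq> 1" using prime_m1 by auto
  moreover have "m - 1 \<ge> 0" using m_pos by simp
  ultimately have "m \<ge> 3" using m_even m_pos by presburger
  then show ?thesis using m_even by presburger
qed

lemma N_mod_16: "[N = - 1] (mod 16)"
proof -
  obtain k where "m = 2 * k" using m_even by blast
  then have "m^4 = 16 * k^4" by (simp add: power_mult_distrib)
  then show ?thesis by (simp add: cong_iff_dvd_diff)
qed

lemma M_square_mod_16: "[M * M = 0] (mod 16)"
proof -
  obtain k where "m = 2 * k" using m_even by blast
  then have "M * M = 16 * (k * k)" by simp
  then show ?thesis by (simp add: cong_iff_dvd_diff)
qed

lemma N_gt_M: "N - M * M > 0" "N + M * M > 0"
proof -
  have "m * m \<ge> 4 * 4" using m_ge_4 by (intro mult_mono) auto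
  then have a: "m^2 \<ge> 16" by (simp add: power2_eq_square)
  then have "m^2 * m^2 \<ge> 16 * m^2" by (intro mult_right_mono) auto
  then have "m^4 \<ge> 16 * m^2" by (simp add: power2_eq_square power4_eq_xxxx)
  then show "N - M * M > 0" "N + M * M > 0" using a M_square by auto
qed

lemma N_pos: "N > 0"
  using N_gt_M(1) by (smt (verit) zero_le_square)

lemma coprime_N_M: "coprime N M"
proof -
  have "coprime (m^4 - 1) (m^4)" by (metis coprime_diff_one_left)
  then have "coprime N m" by (simp add: coprime_power_right_iff)
  moreover have "odd N" using m_even by simp
  ultimately show ?thesis by (simp add: coprime_mult_right_iff)
qed

lemma prime_dvd_N_not_M: "Factorial_Ring.prime p \<Longrightarrow> p dvd N \<Longrightarrow> \<not> p dvd M"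
  using coprime_N_M coprime_common_divisor not_prime_unit by blast

lemma prime_dvd_N_odd: "Factorial_Ring.prime p \<Longrightarrow> p dvd N \<Longrightarrow> p > 2"
proof -
  assume p: "Factorial_Ring.prime p" "p dvd N"
  have "p \<noteq> 2" using p(2) m_even by auto
  then show "p > 2" using prime_ge_2_int[OF p(1)] by simp
qed

text \<open>m - 1 and m + 1 are different primes, and a common divisor of the odd numbers m^2 - 1
  and m^2 + 1 divides 2.\<close>

lemma squarefree_N: "squarefree N"
proof -
  have "coprime (m - 1) (m + 1)"
  proof (rule primes_coprime[OF prime_m1 prime_p1]) qed simp
  moreover have c: "coprime (m^2 - 1) (m^2 + 1)"
  proof (rule coprimeI)
    fix d assume d: "d dvd m^2 - 1" "d dvd m^2 + 1"
    from dvd_diff[OF d(2,1)] have "d dvd 2" by simp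
    have "odd (m^2 - 1)" using m_even by simp
    then have "odd d" using d(1) dvd_trans by blast
    then have "coprime 2 d" by simp
    then show "is_unit d" using \<open>d dvd 2\<close> by (rule coprime_common_divisor) simp
  qed
  moreover have e: "m^2 - 1 = (m - 1) * (m + 1)" by (simp add: algebra_simps power2_eq_square)
  ultimately have "squarefree ((m - 1) * (m + 1))" "squarefree ((m^2 - 1) * (m^2 + 1))"
    using squarefree_prime[OF prime_m1] squarefree_prime[OF prime_p1] sqfree
    by (simp_all add: squarefree_mult_coprime)
  moreover have "N = (m^2 - 1) * (m^2 + 1)" by (simp add: algebra_simps power2_eq_square power4_eq_xxxx)
  ultimately show ?thesis by simp
qed

text \<open>Modulo a prime factor of m^2 + 1 the number - 1 is a square, so such a prime is not 3
  modulo 4. There remain m - 1 and m + 1, and these cannot both be 3 modulo 4.\<close>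

lemma prime_3_mod_4_unique:
  assumes p: "Factorial_Ring.prime p" "p dvd N" "[p = 3] (mod 4)"
    and q: "Factorial_Ring.prime q" "q dvd N" "[q = 3] (mod 4)"
  shows "p = q"
proof -
  have cases: "r = m - 1 \<or> r = m + 1" if r: "Factorial_Ring.prime r" "r dvd N" "[r = 3] (mod 4)" for r
  proof -
    have "\<not> r dvd m^2 + 1"
    proof
      assume d: "r dvd m^2 + 1"
      have r2: "r > 2" by (rule prime_dvd_N_odd[OF r(1,2)])
      have pr: "Factorial_Ring.prime (nat r)" using r(1) by (subst (asm) prime_int_nat_transfer) simp
      interpret odd_prime "nat r" by (rule odd_prime.intro[OF pr]) (use r2 in simp)
      have ir: "int (nat r) = r" using r2 by simp
      have "[m * m = - 1] (mod r)" using d by (simp add: cong_iff_dvd_diff power2_eq_square)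
      then have "chi (m * m) = chi (- 1)" using chi_cong ir by simp
      moreover have "chi (- 1) = - 1" using chi_minus_1 r(3) by (simp only: ir) (simp add: cong_def)
      ultimately have "chi m * chi m = - 1" using chi_mult[of m m] by simp
      then show False using zero_le_square[of "chi m"] by linarith
    qed
    then have "r dvd m - 1 \<or> r dvd m + 1"
      using r(1,2) unfolding N_factors by (auto simp: prime_dvd_mult_iff)
    then show ?thesis using primes_dvd_imp_eq[OF r(1)] prime_m1 prime_p1 by blast
  qed
  have "\<not> ([m - 1 = 3] (mod 4) \<and> [m + 1 = 3] (mod 4))" unfolding cong_def by presburger
  then show ?thesis using cases[OF p] cases[OF q] p(3) q(3) by auto
qed

text \<open>For an odd prime this is the Legendre symbol of - 1. It is the third component of the
  class attached to the prime, and it makes the first component \<open>sgn4 p * p\<close>.\<close>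

definition sgn4 :: "int \<Rightarrow> int" where "sgn4 p = (if [p = 1] (mod 4) then 1 else - 1)"

text \<open>Conditions (a) and (b) merged into one by means of the sign
  \<open>sgn4 p\<close>.\<close>

definition good_prime :: "int \<Rightarrow> bool" where
  "good_prime p \<longleftrightarrow> Factorial_Ring.prime p \<and> p dvd N \<and>
     (\<forall>q. Factorial_Ring.prime q \<and> q dvd N - M * M \<longrightarrow> Legendre p q = 1) \<and>
     (\<forall>r. Factorial_Ring.prime r \<and> r dvd N + M * M \<longrightarrow> Legendre (sgn4 p * p) r = 1)"

text \<open>A number that is 1 modulo 8 is a square. As N is - 1 and M^2 is 0 modulo 8, suitable
  abscissas for p = 1, 5, 7, 3 modulo 8 are infinity, 1/4, 0 and M^2 - 4.\<close>

lemma solvable_2: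
  assumes p: "odd p"
  shows "locally_solvable (padic_abs 2) N (- N) (M * M) (sgn4 p * p) p (sgn4 p)"
proof -
  have pl: "padic_abs 2 \<in> rat_places" by (rule padic_place) simp
  note sq = is_sq_2adic
  have N8: "[N = - 1] (mod 8)" using N_mod_16 cong_dvd_modulus[of N "- 1" 16 8] by simp
  have N8': "[- N = - (- 1)] (mod 8)" using N8 by (simp only: cong_minus_minus_iff)
  have M8: "[M * M = 0] (mod 8)" using M_square_mod_16 cong_dvd_modulus[of "M * M" 0 16 8] by simp
  have "p mod 8 = 1 \<or> p mod 8 = 5 \<or> p mod 8 = 7 \<or> p mod 8 = 3" using p by presburger
  then consider "[p = 1] (mod 8)" | "[p = 5] (mod 8)" | "[p = 7] (mod 8)" | "[p = 3] (mod 8)"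
    by (auto simp: cong_def)
  then show ?thesis
  proof cases
    case 1
    then have "sgn4 p = 1" using cong_dvd_modulus[OF 1, of 4] by (simp add: sgn4_def)
    then show ?thesis using sq[OF 1] sq[of 1] by (simp add: locally_solvable_def)
  next
    case 2
    have "[p = 5] (mod 4)" using cong_dvd_modulus[OF 2, of 4] by simp
    then have s: "sgn4 p = 1" by (simp add: sgn4_def cong_def)
    have scale: "abs_value.is_sq (padic_abs 2) (of_int d * (1/4 - of_int e))" if "[d * (1 - 4 * e) = 1] (mod 8)" for d e
    proof -
      have "of_int d * (1/4 - of_int e) = of_int (d * (1 - 4 * e)) * (1/2 * (1/2 :: rat))" by (simp add: algebra_simps)
      then show ?thesis using abs_value.is_sq_times_square[OF abs_value_place[OF pl] sq[OF that]] by metis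
    qed
    have "[p * (1 - 4 * N) = 5 * (1 - 4 * - 1)] (mod 8)" by (intro cong_mult cong_diff 2 N8 cong_refl)
    then have a: "[p * (1 - 4 * N) = 1] (mod 8)" by (simp add: cong_def)
    have "[p * (1 - 4 * - N) = 5 * (1 - 4 * - (- 1))] (mod 8)"
      by (intro cong_mult cong_diff 2 N8' cong_refl)
    then have b: "[p * (1 - 4 * - N) = 1] (mod 8)" by (simp add: cong_def)
    have "[1 * (1 - 4 * (M * M)) = 1 * (1 - 4 * 0)] (mod 8)" by (intro cong_mult cong_diff M8 cong_refl)
    then have c: "[1 * (1 - 4 * (M * M)) = 1] (mod 8)" by simp
    show ?thesis unfolding locally_solvable_def s
      using scale[OF a] scale[OF b] scale[OF c] by (intro disjI2 exI[of _ "1/4"]) simp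
  next
    case 3
    have "[p = 7] (mod 4)" using cong_dvd_modulus[OF 3, of 4] by simp
    then have s: "sgn4 p = - 1" by (simp add: sgn4_def cong_def)
    have "[p * N = 7 * - 1] (mod 8)" by (intro cong_mult 3 N8)
    then have "[p * N = 1] (mod 8)" by (simp add: cong_def)
    from sq[OF this] is_sq_int_square[OF pl, of M] show ?thesis
      unfolding s by (intro locally_solvable_int[where x = 0]) (simp_all add: algebra_simps)
  next
    case 4
    have "[p = 3] (mod 4)" using cong_dvd_modulus[OF 4, of 4] by simp
    then have s: "sgn4 p = - 1" by (simp add: sgn4_def cong_def)
    have "[- 1 * p * (M * M - 4 - N) = - 1 * 3 * (0 - 4 - - 1)] (mod 8)"
      by (intro cong_mult cong_diff 4 N8 M8 cong_refl)
    then have a: "[- 1 * p * (M * M - 4 - N) = 1] (mod 8)" by (simp add: cong_def)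
    have "[p * (M * M - 4 - - N) = 3 * (0 - 4 - - (- 1))] (mod 8)"
      by (intro cong_mult cong_diff 4 M8 N8' cong_refl)
    then have b: "[p * (M * M - 4 - - N) = 1] (mod 8)" by (simp add: cong_def)
    show ?thesis unfolding s
      using sq[OF a] sq[OF b] is_sq_int_square[OF pl, of 2]
      by (intro locally_solvable_int[where x = "M * M - 4"]) simp_all
  qed
qed

text \<open>At 2, at p, at the other primes of N and at the primes of good reduction the preceding
  lemmas apply. Modulo a prime of N - M^2 or N + M^2 the number N is a square or minus a square;
  there \<open>good_prime\<close> makes all components squares if \<open>sgn4 p\<close> is 1, and
  makes the abscissa 0 work if it is - 1. The real place is treated by the same two choices.\<close>

lemma solvable_good_prime:
  assumes p: "good_prime p" and v: "v \<in> rat_places"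
  shows "locally_solvable v N (- N) (M * M) (sgn4 p * p) p (sgn4 p)"
proof -
  have pp: "Factorial_Ring.prime p" "p dvd N" using p by (auto simp: good_prime_def)
  have p2: "p > 2" by (rule prime_dvd_N_odd[OF pp])
  have podd: "odd p" using prime_odd_int[OF pp(1)] p2 by simp
  have p4: "[p = 1] (mod 4) \<or> [p = 3] (mod 4)" using podd unfolding cong_def by presburger
  have s_val: "sgn4 p = 1 \<or> sgn4 p = - 1" by (simp add: sgn4_def)
  consider "v = (\<lambda>x. real_of_rat \<bar>x\<bar>)" | l where "v = padic_abs l" "Factorial_Ring.prime l"
    using v by (auto simp: rat_places_def)
  then show ?thesis
  proof cases
    case 1
    show ?thesis
    proof (cases "sgn4 p = 1")
      case True
      then show ?thesis using p2 unfolding locally_solvable_def 1 by (auto intro!: is_sq_infinite)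
    next
      case False
      then have s: "sgn4 p = - 1" using s_val by simp
      have "p * N > 0" using p2 N_pos by (intro mult_pos_pos) auto
      then have "rat_of_int (p * N) > 0" by (simp only: of_int_0_less_iff)
      moreover have "rat_of_int (M * M) \<ge> 0" by (simp only: of_int_0_le_iff zero_le_square)
      ultimately show ?thesis unfolding 1 s
        by (intro locally_solvable_int[where x = 0] is_sq_infinite) (simp_all add: algebra_simps)
    qed
  next
    case (2 l)
    show ?thesis
    proof (cases "l = 2")
      case True then show ?thesis using solvable_2[OF podd] 2 by simp
    next
      case False
      then have l2: "l > 2" using prime_ge_2_nat[OF 2(2)] by simp
      interpret odd_prime l using 2(2) l2 by unfold_locales
      note pl = padic_place[OF prime_p]
      have zero: ?thesis if a: "chi (p * N) = 1" and s: "sgn4 p = - 1"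
      proof -
        have "sgn4 p * p * (0 - N) = p * N" "p * (0 - - N) = p * N" "sgn4 p * (0 - M * M) = M * M"
          using s by (simp_all add: algebra_simps)
        then show ?thesis unfolding 2(1)
          using is_sq_chi[OF a] is_sq_int_square[OF pl, of M] by (intro locally_solvable_int[where x = 0]) metis+
      qed
      have triv: ?thesis if a: "chi p = 1" and s: "sgn4 p = 1"
        unfolding 2(1) using is_sq_chi[OF a] is_sq_int_square[OF pl, of 1] s by (simp add: locally_solvable_def)
      consider (ram) "int l = p" | (node) "int l dvd N" "int l \<noteq> p" | (q) "int l dvd N - M * M" "\<not> int l dvd N"
        | (r) "int l dvd N + M * M" "\<not> int l dvd N"
        | (good) "\<not> int l dvd N" "\<not> int l dvd N - M * M" "\<not> int l dvd N + M * M" by blast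
      then show ?thesis
      proof cases
        case ram
        obtain N' where N': "N = int l * N'" using pp(2) ram by blast
        have "\<not> int l dvd N'"
        proof
          assume "int l dvd N'"
          then have "p^2 dvd N" using N' ram by (auto simp: power2_eq_square)
          then have "is_unit p" using squarefree_N by (simp add: squarefree_def)
          then show False using pp(1) not_prime_unit by blast
        qed
        moreover have "\<not> int l dvd M" using prime_dvd_N_not_M pp ram by simp
        moreover have "sgn4 p = chi (- 1)" unfolding sgn4_def ram[symmetric] by (rule chi_minus_1[symmetric])
        ultimately show ?thesis unfolding 2(1) ram[symmetric] by (rule solvable_ramified[OF N'])
      next
        case node
        have cm: "\<not> int l dvd M" using prime_dvd_N_not_M prime_int_p node(1) by blast
        have lp: "\<not> int l dvd p" using node(2) primes_dvd_imp_eq[OF prime_int_p pp(1)] by blast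
        \<comment> \<open>The sign - 1 occurs only if p is the prime factor of N that is 3 modulo 4.
          The different prime l is then 1 modulo 4, and - 1 is a square modulo l.\<close>
        have "chi (sgn4 p) = 1"
        proof (cases "sgn4 p = 1")
          case True then show ?thesis by simp
        next
          case False
          then have "sgn4 p = - 1" "[p = 3] (mod 4)" using s_val p4 by (auto simp: sgn4_def)
          moreover have "odd l" using prime_odd_nat[OF prime_p] p_gt_2 by simp
          then have "[int l = 1] (mod 4) \<or> [int l = 3] (mod 4)" unfolding cong_def by presburger
          ultimately have "[int l = 1] (mod 4)"
            using prime_3_mod_4_unique[OF prime_int_p node(1) _ pp] node(2) by blast
          then show ?thesis using chi_minus_1 \<open>sgn4 p = - 1\<close> by simp
        qed
        then show ?thesis unfolding 2(1) by (rule solvable_node[OF node(1) _ lp cm])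
      next
        case q
        have "Legendre p (int l) = 1" using p q(1) prime_int_p by (auto simp: good_prime_def)
        moreover have "[N = M * M] (mod int l)" using q(1) by (simp add: cong_iff_dvd_diff)
        then have "chi N = chi (M * M)" by (rule chi_cong)
        then have cN: "chi N = 1" using q(2) chi_square_values[of M] chi_0_iff[of N] by metis
        ultimately have "chi p = 1" "chi (p * N) = 1" by (simp_all only: chi_mult)
        then show ?thesis using triv zero s_val by blast
      next
        case r
        have c: "Legendre (sgn4 p * p) (int l) = 1" using p r(1) prime_int_p by (auto simp: good_prime_def)
        have "[N = - 1 * (M * M)] (mod int l)" using r(1) by (simp add: cong_iff_dvd_diff)
        then have "chi N = chi (- 1) * chi (M * M)" unfolding chi_mult[symmetric] by (rule chi_cong)
        then have cN: "chi N = chi (- 1)"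
          using r(2) chi_0_iff[of N] chi_square_values[of M] by (metis mult.right_neutral mult_zero_right)
        have "chi (p * N) = chi (- 1 * p)" unfolding chi_mult cN by (rule mult.commute)
        then show ?thesis using c triv zero s_val by fastforce
      next
        case good
        have lp: "\<not> int l dvd p" using good(1) pp(2) dvd_trans by blast
        have "\<not> int l dvd N - - N"
        proof
          assume "int l dvd N - - N"
          then have "int l dvd 2 * N" by simp
          then have "int l dvd 2" using good(1) prime_int_p prime_dvd_multD by blast
          then show False using p_gt_2 zdvd_imp_le[of "int l" 2] by auto
        qed
        moreover have "- N - M * M = - (N + M * M)" by simp
        then have "\<not> int l dvd - N - M * M" using good(3) by (simp only: dvd_minus_iff not_False_eq_True)
        moreover have "chi (sgn4 p * p) * chi p * chi (sgn4 p) = 1"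
        proof -
          have "chi (sgn4 p) * chi (sgn4 p) = 1" using chi_mult[of "sgn4 p" "sgn4 p"] s_val by auto
          moreover have "chi p * chi p = 1" using chi_square[OF lp] chi_mult by simp
          ultimately show ?thesis by (simp add: chi_mult mult.assoc mult.left_commute mult.commute)
        qed
        ultimately show ?thesis unfolding 2(1) using good(2) by (intro solvable_good)
      qed
    qed
  qed
qed

text \<open>The image of the torsion point (N, 0) under the descent map: two components are the
  differences of N with the other roots, and the component at N, whose difference vanishes, is their
  product. \<open>solvable_T2\<close> does the same for (- N, 0). The torsion abscissa itself is a
  witness at every place.\<close>

lemma solvable_T1:
  assumes "v \<in> rat_places"
  shows "locally_solvable v N (- N) (M * M) (2 * N * (N - M * M)) (2 * N) (N - M * M)"
proof (rule locally_solvable_int[where x = N])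
  show "abs_value.is_sq v (of_int (2 * N * (N - M * M) * (N - N)))"
    using is_sq_int_square[OF assms, of 0] by simp
  show "abs_value.is_sq v (of_int (2 * N * (N - - N)))"
    using is_sq_int_square[OF assms, of "2 * N"] by simp
qed (rule is_sq_int_square[OF assms])

lemma solvable_T2:
  assumes "v \<in> rat_places"
  shows "locally_solvable v N (- N) (M * M) (- (2 * N)) (2 * N * (N + M * M)) (- (N + M * M))"
proof (rule locally_solvable_int[where x = "- N"])
  show "abs_value.is_sq v (of_int (2 * N * (N + M * M) * (- N - - N)))"
    using is_sq_int_square[OF assms, of 0] by simp
  show "abs_value.is_sq v (of_int (- (2 * N) * (- N - N)))"
    using is_sq_int_square[OF assms, of "2 * N"] by (simp add: algebra_simps)
  have e: "- (N + M * M) * (- N - M * M) = (N + M * M) * (N + M * M)" by (simp add: algebra_simps)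
  show "abs_value.is_sq v (of_int (- (N + M * M) * (- N - M * M)))"
    unfolding e by (rule is_sq_int_square[OF assms])
qed

end

subsection \<open>Rational points\<close>

lemma E_curve_split: "E_curve m = split_curve (m^4 - 1) (- (m^4 - 1)) (2 * m * (2 * m))"
  by (simp add: E_curve_def split_curve_def algebra_simps power2_eq_square power4_eq_xxxx)

lemma split_curve_point:
  fixes x y :: rat
  shows "Affine x y \<in> ec_carrier rat_field (split_curve e1 e2 e3) \<longleftrightarrow>
    y^2 = (x - of_int e1) * (x - of_int e2) * (x - of_int e3)"
  unfolding split_curve_equation[symmetric] by (simp add: ec_carrier_def)

text \<open>The duplication formula shifted by a root. With f the cubic, f'^2 - 4 f (2 x - e2 - e3)
  is a perfect square, and division by 4 y^2 exhibits the difference of the double with e1 as a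
  square. Besides the descent, the explicit root serves for estimating 2-adic size.\<close>

lemma double_abscissa:
  fixes x y :: rat
  assumes y: "y^2 = (x - of_int e1) * (x - of_int e2) * (x - of_int e3)" "y \<noteq> 0"
  shows "\<exists>x' y'. ec_add rat_field (split_curve e1 e2 e3) (Affine x y) (Affine x y) = Affine x' y' \<and>
    x' - of_int e1 = (((x - of_int e1)^2 - of_int ((e1 - e2) * (e1 - e3))) / (2 * y))^2"
proof -
  define f' where "f' = 3 * x^2 + of_int (2 * coeff_a2 (split_curve e1 e2 e3)) * x + of_int (coeff_a4 (split_curve e1 e2 e3))"
  define l where "l = f' / (2 * y)"
  have slope: "ec_slope rat_field (split_curve e1 e2 e3) x y x y = l"
  proof -
    have nz: "2 * y \<noteq> 0" using y(2) by simp
    show ?thesis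
      by (simp only: ec_slope_def refl if_True type_ring_simps type_ring_pow int_in_type
          type_ring_m_inv[OF nz] l_def f'_def divide_inverse of_int_numeral)
  qed
  have ny: "y \<noteq> - y" using y(2) by simp
  define x' where "x' = l^2 - of_int (coeff_a2 (split_curve e1 e2 e3)) - x - x"
  have "f'^2 - 4 * ((x - of_int e1) * (x - of_int e2) * (x - of_int e3)) * (2 * x - of_int e2 - of_int e3)
      = ((x - of_int e1)^2 - of_int ((e1 - e2) * (e1 - e3)))^2"
    by (simp add: f'_def split_curve_def algebra_simps power2_eq_square)
  then have k: "f'^2 - 4 * y^2 * (2 * x - of_int e2 - of_int e3) = ((x - of_int e1)^2 - of_int ((e1 - e2) * (e1 - e3)))^2"
    unfolding y(1) .
  have "x' - of_int e1 = l^2 - (2 * x - of_int e2 - of_int e3)" by (simp add: x'_def split_curve_def)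
  also have "\<dots> = (f'^2 - 4 * y^2 * (2 * x - of_int e2 - of_int e3)) / (4 * y^2)"
    using y(2) by (simp add: l_def power_divide power_mult_distrib diff_divide_distrib)
  also have "\<dots> = (((x - of_int e1)^2 - of_int ((e1 - e2) * (e1 - e3))) / (2 * y))^2"
    unfolding k by (simp add: power_divide power_mult_distrib)
  finally have "x' - of_int e1 = (((x - of_int e1)^2 - of_int ((e1 - e2) * (e1 - e3))) / (2 * y))^2" .
  moreover have "ec_add rat_field (split_curve e1 e2 e3) (Affine x y) (Affine x y) = Affine x' (l * (x - x') - y)"
    using ny by (simp add: Let_def slope x'_def)
  ultimately show ?thesis by blast
qed

lemma double_minus_root_square:
  fixes x' y' :: rat
  assumes P: "P \<in> ec_carrier rat_field (split_curve e1 e2 e3)"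
    and D: "ec_add rat_field (split_curve e1 e2 e3) P P = Affine x' y'"
  shows "\<exists>t. x' - of_int e1 = t * t" "\<exists>t. x' - of_int e2 = t * t" "\<exists>t. x' - of_int e3 = t * t"
proof -
  obtain x y where xy: "P = Affine x y" using D by (cases P) auto
  have y: "y^2 = (x - of_int e1) * (x - of_int e2) * (x - of_int e3)" using P xy split_curve_point by simp
  have "y \<noteq> 0" using D xy by auto
  have swap: "split_curve e2 e1 e3 = split_curve e1 e2 e3" "split_curve e3 e1 e2 = split_curve e1 e2 e3"
    by (simp_all add: split_curve_def algebra_simps)
  have y2: "y^2 = (x - of_int e2) * (x - of_int e1) * (x - of_int e3)"
    and y3: "y^2 = (x - of_int e3) * (x - of_int e1) * (x - of_int e2)" unfolding y by simp_all
  show "\<exists>t. x' - of_int e1 = t * t" using double_abscissa[OF y \<open>y \<noteq> 0\<close>] D xy by (metis ec_point.inject power2_eq_square)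
  show "\<exists>t. x' - of_int e2 = t * t"
    using double_abscissa[OF y2 \<open>y \<noteq> 0\<close>] D xy unfolding swap by (metis ec_point.inject power2_eq_square)
  show "\<exists>t. x' - of_int e3 = t * t"
    using double_abscissa[OF y3 \<open>y \<noteq> 0\<close>] D xy unfolding swap by (metis ec_point.inject power2_eq_square)
qed

text \<open>On abscissas, adding (e1, 0) is the fractional linear involution that exchanges e1 with
  infinity and e2 with e3. The three products give the square classes of the new
  differences.\<close>

lemma add_two_torsion:
  fixes x y :: rat
  assumes y: "y^2 = (x - of_int e1) * (x - of_int e2) * (x - of_int e3)" and ne: "x \<noteq> of_int e1"
  shows "\<exists>x' y'. ec_add rat_field (split_curve e1 e2 e3) (Affine x y) (Affine (of_int e1) 0) = Affine x' y' \<and>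
    (x' - of_int e1) * (x - of_int e1) = of_int ((e1 - e2) * (e1 - e3)) \<and>
    (x' - of_int e2) * (x - of_int e1) = of_int (e1 - e2) * (x - of_int e3) \<and>
    (x' - of_int e3) * (x - of_int e1) = of_int (e1 - e3) * (x - of_int e2)"
proof -
  define u where "u = x - of_int e1"
  have u: "u \<noteq> 0" using ne by (simp add: u_def)
  define l where "l = y / u"
  have slope: "ec_slope rat_field (split_curve e1 e2 e3) x y (of_int e1) 0 = l"
  proof -
    have "(0 - y) * inverse (of_int e1 - x) = y / u" using u by (simp add: u_def field_simps)
    then show ?thesis using ne by (simp add: ec_slope_def l_def)
  qed
  define x' where "x' = l^2 - of_int (coeff_a2 (split_curve e1 e2 e3)) - x - of_int e1"
  have l2: "l^2 * u = (x - of_int e2) * (x - of_int e3)"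
    using y u by (simp add: l_def u_def power_divide power2_eq_square)
  have x': "x' * u = (x - of_int e2) * (x - of_int e3) + (of_int e2 + of_int e3 - x) * u"
    unfolding l2[symmetric] by (simp add: x'_def split_curve_def algebra_simps)
  have "ec_add rat_field (split_curve e1 e2 e3) (Affine x y) (Affine (of_int e1) 0) = Affine x' (l * (x - x') - y)"
    using ne by (simp add: Let_def slope x'_def)
  moreover have "(x' - of_int e1) * u = of_int ((e1 - e2) * (e1 - e3))"
    "(x' - of_int e2) * u = of_int (e1 - e2) * (x - of_int e3)"
    "(x' - of_int e3) * u = of_int (e1 - e3) * (x - of_int e2)"
    using x' by (simp_all add: left_diff_distrib) (simp_all add: u_def algebra_simps)
  ultimately show ?thesis unfolding u_def by blast
qed

lemma rat_square_int:
  assumes "of_int k = (t :: rat) * t"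
  shows "\<exists>s. k = s * s"
proof -
  obtain a b where ab: "quotient_of t = (a, b)" by (cases "quotient_of t") auto
  have b: "b > 0" "coprime a b" "t = of_int a / of_int b"
    using quotient_of_denom_pos[OF ab] quotient_of_coprime[OF ab] quotient_of_div[OF ab] by auto
  have "of_int (k * (b * b)) = (of_int (a * a) :: rat)" using assms b by (simp add: field_simps)
  then have e: "k * (b * b) = a * a" by (simp only: of_int_eq_iff)
  have "b dvd a * a" unfolding e[symmetric] by simp
  then have "is_unit b" using b(2) by (metis coprime_commute coprime_common_divisor coprime_mult_right_iff dvd_refl)
  then have "b = 1" using b(1) by (simp add: zdvd1_eq)
  then show ?thesis using e by auto
qed

lemma rat_square_factor:
  assumes "(z :: rat) * (r * r) = of_int k" "r \<noteq> 0" "z = t * t"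
  shows "\<exists>s. k = s * s"
proof (rule rat_square_int)
  show "of_int k = (t * r) * (t * r)" unfolding assms(1)[symmetric] assms(3) by simp
qed

lemma square_mod_4: "\<not> (s * s :: int) mod 4 = 3" "\<not> (s * s :: int) mod 4 = 2"
proof -
  have "s mod 4 = 0 \<or> s mod 4 = 1 \<or> s mod 4 = 2 \<or> s mod 4 = 3" by presburger
  then have "(s mod 4) * (s mod 4) mod 4 = 0 \<or> (s mod 4) * (s mod 4) mod 4 = 1" by auto
  then show "\<not> (s * s :: int) mod 4 = 3" "\<not> (s * s :: int) mod 4 = 2" by (auto simp: mod_mult_eq)
qed

text \<open>Squares of 2-adic integers are 0 or 1 modulo 4, phrased with the absolute value. If t^2
  has value at most 1, the denominator of t is odd, and the parity of the numerator decides between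
  the two cases.\<close>

lemma dyadic_square:
  assumes "padic_abs 2 (t * t) \<le> 1"
  shows "padic_abs 2 (t * t) \<le> 1/4 \<or> padic_abs 2 (t * t - 1) \<le> 1/4"
proof -
  interpret abs_value "padic_abs 2" by (rule abs_value_padic) simp
  have p2: "Factorial_Ring.prime (2::nat)" by simp
  obtain a b where ab: "quotient_of t = (a, b)" by (cases "quotient_of t") auto
  have b: "b > 0" "coprime a b" "t = of_int a / of_int b"
    using quotient_of_denom_pos[OF ab] quotient_of_coprime[OF ab] quotient_of_div[OF ab] by auto
  have half: "padic_abs 2 (of_int k) \<le> 1/2" if "even k" for k
    using padic_abs_int_le[OF p2, of 1 k] that by simp
  have unit: "padic_abs 2 (of_int k) = 1" if "odd k" for k
    using padic_abs_frac[OF p2, of k 1] that by (cases "k = 0") (simp_all add: not_dvd_imp_multiplicity_0)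
  have tb: "padic_abs 2 t * padic_abs 2 (of_int b) = padic_abs 2 (of_int a)"
    using b by (simp flip: v_mult)
  have le1: "padic_abs 2 t \<le> 1"
    using assms v_nonneg[of t] unfolding v_mult by (metis mult_le_one mult_less_cancel_left2 not_le one_less_mult less_eq_real_def mult_strict_mono mult_1 zero_less_one le_less_trans less_irrefl)
  have odd_b: "odd b"
  proof
    assume "even b"
    moreover from this have "odd a" using b(2) by (meson coprime_common_divisor odd_one)
    ultimately have "padic_abs 2 t * padic_abs 2 (of_int b) = 1" "padic_abs 2 (of_int b) \<le> 1/2"
      using tb unit half by auto
    moreover have "padic_abs 2 t * padic_abs 2 (of_int b) \<le> 1 * (1/2)"
      using le1 calculation(2) by (intro mult_mono) auto
    ultimately show False by simp
  qed
  show ?thesis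
  proof (cases "even a")
    case True
    then have "padic_abs 2 t \<le> 1/2" using tb half[OF True] unit[OF odd_b] by simp
    then have "padic_abs 2 t * padic_abs 2 t \<le> 1/2 * (1/2)" by (intro mult_mono) auto
    then show ?thesis by (simp add: v_mult)
  next
    case False
    have "4 dvd a * a - b * b"
    proof -
      have "even (a - b)" "even (a + b)" using False odd_b by auto
      then have "2 * 2 dvd (a - b) * (a + b)" by (rule mult_dvd_mono)
      then show ?thesis by (simp add: algebra_simps)
    qed
    then have "padic_abs 2 (of_int (a * a - b * b)) \<le> 1/4"
      using padic_abs_int_le[OF p2, of 2 "a * a - b * b"] by simp
    moreover have "(t * t - 1) * of_int (b * b) = of_int (a * a - b * b)"
      using b by (simp add: field_simps)
    then have "padic_abs 2 (t * t - 1) * padic_abs 2 (of_int (b * b)) = padic_abs 2 (of_int (a * a - b * b))"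
      by (metis v_mult)
    moreover have "padic_abs 2 (of_int (b * b)) = 1" using odd_b by (intro unit) simp
    ultimately show ?thesis by simp
  qed
qed

lemma padic_add_dominant:
  assumes p: "Factorial_Ring.prime p" and less: "padic_abs p y < padic_abs p x"
  shows "padic_abs p (x + y) = padic_abs p x"
proof -
  interpret abs_value "padic_abs p" by (rule abs_value_padic[OF p])
  have "padic_abs p (x + y) \<le> padic_abs p x" using padic_abs_add_max[OF p, of x y] less by simp
  moreover have "padic_abs p x \<le> max (padic_abs p (x + y)) (padic_abs p y)"
    using padic_abs_add_max[OF p, of "x + y" "- y"] by simp
  ultimately show ?thesis using less by linarith
qed

text \<open>All differences x - e_i have the same absolute value as x, so that of y^2 is its cube.
  In the duplication formula the numerator has the fourth power of the value of x and the
  denominator 4 y^2 a quarter of its cube.\<close>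

lemma double_not_2_integral:
  fixes x y :: rat
  assumes P: "Affine x y \<in> ec_carrier rat_field (split_curve e1 e2 e3)" and x: "padic_abs 2 x > 1"
  shows "\<exists>x' y'. ec_add rat_field (split_curve e1 e2 e3) (Affine x y) (Affine x y) = Affine x' y' \<and>
    padic_abs 2 x' = 4 * padic_abs 2 x"
proof -
  have p2: "Factorial_Ring.prime (2::nat)" by simp
  interpret abs_value "padic_abs 2" by (rule abs_value_padic[OF p2])
  let ?v = "padic_abs 2"
  have int: "?v (of_int k) \<le> 1" for k using padic_abs_int_le[OF p2, of 0 k] by simp
  have y: "y^2 = (x - of_int e1) * (x - of_int e2) * (x - of_int e3)" using P split_curve_point by simp
  have d: "?v (x - of_int e) = ?v x" for e
    using padic_add_dominant[OF p2, of "- of_int e" x] int[of e] x by simp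
  have v2: "?v 2 = 1/2"
    using padic_abs_frac[OF p2, of 2 1] by (simp add: multiplicity_same_power[of 2 1, simplified] power_int_minus)
  have vy: "?v y * ?v y = ?v x * ?v x * ?v x"
    using arg_cong[OF y, of ?v] by (simp add: power2_eq_square v_mult d)
  then have "y \<noteq> 0" using x by auto
  then obtain x' y' where *: "ec_add rat_field (split_curve e1 e2 e3) (Affine x y) (Affine x y) = Affine x' y'"
    "x' - of_int e1 = (((x - of_int e1)^2 - of_int ((e1 - e2) * (e1 - e3))) / (2 * y))^2"
    using double_abscissa[OF y] by blast
  have big: "?v x * ?v x > 1" using x by (simp add: less_1_mult)
  have "?v ((x - of_int e1)^2 - of_int ((e1 - e2) * (e1 - e3))) = ?v ((x - of_int e1)^2)"
    using padic_add_dominant[OF p2, of "- of_int ((e1 - e2) * (e1 - e3))" "(x - of_int e1)^2"]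
      int[of "(e1 - e2) * (e1 - e3)"] big
    by (simp add: power2_eq_square v_mult[of "x - of_int e1" "x - of_int e1"] d del: of_int_mult)
  then have n: "?v ((x - of_int e1)^2 - of_int ((e1 - e2) * (e1 - e3))) = ?v x * ?v x"
    by (simp add: power2_eq_square v_mult d)
  have "(x' - of_int e1) * ((2 * y) * (2 * y)) = ((x - of_int e1)^2 - of_int ((e1 - e2) * (e1 - e3))) *
      ((x - of_int e1)^2 - of_int ((e1 - e2) * (e1 - e3)))"
    unfolding *(2) using \<open>y \<noteq> 0\<close> by (simp add: power2_eq_square)
  from arg_cong[OF this, of ?v] have "?v (x' - of_int e1) * (?v 2 * ?v 2 * (?v y * ?v y)) = (?v x * ?v x) * (?v x * ?v x)"
    unfolding v_mult n by (simp add: mult_ac)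
  then have "?v (x' - of_int e1) * (?v x * (?v x * ?v x)) = (4 * ?v x) * (?v x * (?v x * ?v x))"
    unfolding vy v2 by (simp add: algebra_simps)
  moreover have "?v x * (?v x * ?v x) \<noteq> 0" using x by auto
  ultimately have e: "?v (x' - of_int e1) = 4 * ?v x" by (metis mult_cancel_right)
  have "?v x' = ?v (x' - of_int e1 + of_int e1)" by simp
  also have "\<dots> = ?v (x' - of_int e1)"
    by (rule padic_add_dominant[OF p2]) (use int[of e1] e x in linarith)
  finally show ?thesis using * e by auto
qed

section \<open>Torsion of the group of rational points\<close>

locale dyadic_curve =
  fixes N M :: int
  assumes N_mod_16: "[N = - 1] (mod 16)" and M_square_mod_16: "[M * M = 0] (mod 16)"
    and N_gt_M: "N - M * M > 0" and M_nonzero: "M \<noteq> 0"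
begin

lemma N_pos: "N > 0"
  using N_gt_M zero_le_square[of M] by linarith

abbreviation curve :: cubic_curve where "curve \<equiv> split_curve N (- N) (M * M)"
abbreviation G :: "rat ec_point monoid" where "G \<equiv> ec_group rat_field curve"

lemma roots_distinct: "N \<noteq> - N" "N \<noteq> M * M" "- N \<noteq> M * M"
  using N_pos N_gt_M zero_le_square[of M] by linarith+

lemma comm_group_G: "comm_group G"
  by (rule comm_group_split_type[OF roots_distinct])

sublocale G: comm_group G by (rule comm_group_G)

lemma G_simps: "carrier G = ec_carrier rat_field curve" "x \<otimes>\<^bsub>G\<^esub> y = ec_add rat_field curve x y" "\<one>\<^bsub>G\<^esub> = Infinity"
  by (simp_all add: ec_group_def)

text \<open>Otherwise the abscissas of the multiples by 2^k would have the pairwise different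
  absolute values 4^k |x|, whereas a torsion point has only finitely many multiples.\<close>

lemma torsion_2_integral:
  assumes P: "Affine x y \<in> carrier G" and n: "n > 0" "Affine x y [^]\<^bsub>G\<^esub> (n::nat) = \<one>\<^bsub>G\<^esub>"
  shows "padic_abs 2 x \<le> 1"
proof (rule ccontr)
  assume "\<not> ?thesis"
  then have x: "padic_abs 2 x > 1" by simp
  let ?P = "Affine x y"
  have d: "\<exists>x' y'. ?P [^]\<^bsub>G\<^esub> ((2::nat) ^ k) = Affine x' y' \<and> padic_abs 2 x' = 4 ^ k * padic_abs 2 x" for k
  proof (induction k)
    case 0 show ?case using G.nat_pow_eone[OF P] by simp
  next
    case (Suc k)
    then obtain x' y' where *: "?P [^]\<^bsub>G\<^esub> ((2::nat) ^ k) = Affine x' y'" "padic_abs 2 x' = 4 ^ k * padic_abs 2 x" by blast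
    have "(1::real) \<le> 4 ^ k" by simp
    then have "1 * padic_abs 2 x \<le> 4 ^ k * padic_abs 2 x" using x by (intro mult_right_mono) auto
    then have "padic_abs 2 x' > 1" using * x by linarith
    moreover have "Affine x' y' \<in> ec_carrier rat_field curve" using *(1) G.nat_pow_closed[OF P] by (metis G_simps(1))
    ultimately obtain x'' y'' where **: "ec_add rat_field curve (Affine x' y') (Affine x' y') = Affine x'' y''"
      "padic_abs 2 x'' = 4 * padic_abs 2 x'" using double_not_2_integral by blast
    have "?P [^]\<^bsub>G\<^esub> ((2::nat) ^ Suc k) = ?P [^]\<^bsub>G\<^esub> ((2::nat) ^ k) \<otimes>\<^bsub>G\<^esub> ?P [^]\<^bsub>G\<^esub> ((2::nat) ^ k)"
      using G.nat_pow_mult[OF P, of "2 ^ k" "2 ^ k"] by (simp add: mult_2)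
    then show ?case using * ** by (simp add: G_simps)
  qed
  have "inj (\<lambda>k::nat. ?P [^]\<^bsub>G\<^esub> ((2::nat) ^ k))"
  proof (rule injI)
    fix j k :: nat assume "?P [^]\<^bsub>G\<^esub> ((2::nat) ^ j) = ?P [^]\<^bsub>G\<^esub> ((2::nat) ^ k)"
    then have "(4::real) ^ j * padic_abs 2 x = 4 ^ k * padic_abs 2 x" using d[of j] d[of k] by (metis ec_point.inject)
    then show "j = k" using x by simp
  qed
  moreover have "range (\<lambda>k::nat. ?P [^]\<^bsub>G\<^esub> ((2::nat) ^ k)) \<subseteq> (\<lambda>i::nat. ?P [^]\<^bsub>G\<^esub> i) ` {..<n}"
  proof safe
    fix k :: nat
    have "?P [^]\<^bsub>G\<^esub> ((2::nat) ^ k) = ?P [^]\<^bsub>G\<^esub> (n * (2 ^ k div n)) \<otimes>\<^bsub>G\<^esub> ?P [^]\<^bsub>G\<^esub> ((2::nat) ^ k mod n)"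
      using G.nat_pow_mult[OF P, of "n * (2 ^ k div n)" "2 ^ k mod n"] by simp
    also have "?P [^]\<^bsub>G\<^esub> (n * (2 ^ k div n)) = \<one>\<^bsub>G\<^esub>"
      using G.nat_pow_pow[OF P, of n "2 ^ k div n"] n(2) by simp
    finally have "?P [^]\<^bsub>G\<^esub> ((2::nat) ^ k) = ?P [^]\<^bsub>G\<^esub> ((2::nat) ^ k mod n)" using G.nat_pow_closed[OF P] by simp
    then show "?P [^]\<^bsub>G\<^esub> ((2::nat) ^ k) \<in> (\<lambda>i::nat. ?P [^]\<^bsub>G\<^esub> i) ` {..<n}" using n(1) by auto
  qed
  ultimately show False using finite_imageI[of "{..<n}"] finite_subset finite_imageD infinite_UNIV_nat by (metis finite_lessThan)
qed

text \<open>The roots are - 1, 1 and 0 modulo 4, so the differences are x + 1, x - 1 and x. As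
  squares they would all be 0 or 1 modulo 4; but x = 0 gives x - 1 = 3, and x = 1 gives x + 1 =
  2.\<close>

lemma double_not_integral:
  assumes P: "P \<in> carrier G" "P \<otimes>\<^bsub>G\<^esub> P = Affine x y"
  shows "padic_abs 2 x > 1"
proof (rule ccontr)
  assume "\<not> ?thesis"
  then have x: "padic_abs 2 x \<le> 1" by simp
  have p2: "Factorial_Ring.prime (2::nat)" by simp
  let ?v = "padic_abs 2"
  interpret abs_value ?v by (rule abs_value_padic[OF p2])
  have int: "?v (of_int k) \<le> 1" for k using padic_abs_int_le[OF p2, of 0 k] by simp
  have small: "?v (of_int k) \<le> 1/4" if "[k = 0] (mod 4)" for k
    using padic_abs_int_le[OF p2, of 2 k] that by (simp add: cong_0_iff)
  obtain t1 t2 t3 where t: "x - of_int N = t1 * t1" "x - of_int (- N) = t2 * t2" "x - of_int (M * M) = t3 * t3"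
    using double_minus_root_square[of P N "- N" "M * M" x y] P unfolding G_simps by blast
  have "?v (x - of_int k) \<le> 1" for k
    using padic_abs_add_max[OF p2, of x "- of_int k"] x int[of k] by simp
  then have i: "?v (t1 * t1) \<le> 1" "?v (t2 * t2) \<le> 1" "?v (t3 * t3) \<le> 1" using t by metis+
  have add: "?v (a + b) \<le> 1/4" if "?v a \<le> 1/4" "?v b \<le> 1/4" for a b
    using padic_abs_add_max[OF p2, of a b] that by simp
  have neg: "?v (- a) \<le> 1/4" if "?v a \<le> 1/4" for a using that by simp
  have v1: "\<not> ?v 1 \<le> 1/4" "\<not> ?v 2 \<le> 1/4"
    using padic_abs_frac[OF p2, of 2 1] by (simp_all add: multiplicity_same_power[of 2 1, simplified] power_int_minus)
  have N4: "[N = - 1] (mod 4)" using N_mod_16 cong_dvd_modulus[of N "- 1" 16 4] by simp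
  have M4: "[M * M = 0] (mod 4)" using M_square_mod_16 cong_dvd_modulus[of "M * M" 0 16 4] by simp
  have s1: "?v (of_int (M * M - N - 1)) \<le> 1/4"
    by (rule small) (use cong_diff[OF cong_diff[OF M4 N4] cong_refl[of 1]] in simp)
  have s2: "?v (of_int (M * M + N + 1)) \<le> 1/4"
    by (rule small) (use cong_add[OF cong_add[OF M4 N4] cong_refl[of 1]] in simp)
  have e1: "t1 * t1 = t3 * t3 + of_int (M * M - N - 1) + 1" and e2: "t2 * t2 = t3 * t3 + of_int (M * M + N + 1) - 1"
    unfolding t[symmetric] by simp_all
  from dyadic_square[OF i(3)] show False
  proof
    assume a: "?v (t3 * t3) \<le> 1/4"
    note b = add[OF a s2]
    from dyadic_square[OF i(2)] show False
    proof
      assume "?v (t2 * t2) \<le> 1/4"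
      from add[OF b neg[OF this]] show False using v1(1) unfolding e2 by simp
    next
      assume "?v (t2 * t2 - 1) \<le> 1/4"
      from add[OF b neg[OF this]] show False using v1(2) unfolding e2 by simp
    qed
  next
    assume a: "?v (t3 * t3 - 1) \<le> 1/4"
    note b = add[OF a s1]
    from dyadic_square[OF i(1)] show False
    proof
      assume "?v (t1 * t1) \<le> 1/4"
      from add[OF neg[OF b] this] show False using v1(2) unfolding e1 by simp
    next
      assume "?v (t1 * t1 - 1) \<le> 1/4"
      from add[OF neg[OF b] this] show False using v1(1) unfolding e1 by simp
    qed
  qed
qed

lemma torsion_double:
  assumes P: "P \<in> carrier G" and n: "n > 0" "P [^]\<^bsub>G\<^esub> (n::nat) = \<one>\<^bsub>G\<^esub>"
  shows "P \<otimes>\<^bsub>G\<^esub> P = \<one>\<^bsub>G\<^esub>"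
proof (cases "P \<otimes>\<^bsub>G\<^esub> P")
  case (Affine x y)
  have D: "Affine x y \<in> carrier G" using G.m_closed[OF P P] Affine by simp
  have "Affine x y [^]\<^bsub>G\<^esub> n = P [^]\<^bsub>G\<^esub> n \<otimes>\<^bsub>G\<^esub> P [^]\<^bsub>G\<^esub> n"
    unfolding Affine[symmetric] by (rule G.pow_mult_distrib[OF _ P P]) simp
  then have "Affine x y [^]\<^bsub>G\<^esub> n = \<one>\<^bsub>G\<^esub>" unfolding n(2) by simp
  then have "padic_abs 2 x \<le> 1" by (rule torsion_2_integral[OF D n(1)])
  then show ?thesis using double_not_integral[OF P Affine] by simp
qed (simp add: G_simps)

abbreviation T1 :: "rat ec_point" where "T1 \<equiv> Affine (of_int N) 0"
abbreviation T2 :: "rat ec_point" where "T2 \<equiv> Affine (- of_int N) 0"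
abbreviation T3 :: "rat ec_point" where "T3 \<equiv> Affine (of_int M * of_int M) 0"

lemma two_torsion_cases:
  assumes P: "P \<in> carrier G" "P \<otimes>\<^bsub>G\<^esub> P = \<one>\<^bsub>G\<^esub>"
  shows "P \<in> {Infinity, T1, T2, T3}"
proof (cases P)
  case (Affine x y)
  then have "y = 0" using P(2) by (auto simp: G_simps Let_def split: if_splits)
  moreover have "y^2 = (x - of_int N) * (x - of_int (- N)) * (x - of_int (M * M))"
    using P(1) Affine split_curve_point by (simp only: G_simps)
  ultimately have "x = of_int N \<or> x = - of_int N \<or> x = of_int M * of_int M" by auto
  then show ?thesis using Affine \<open>y = 0\<close> by blast
qed simp

lemma two_torsion_points: "Infinity \<in> carrier G" "T1 \<in> carrier G" "T2 \<in> carrier G" "T3 \<in> carrier G"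
  unfolding G_simps split_curve_point by (simp_all add: ec_carrier_def)

lemma torsion_carrier: "carrier (torsion_part G) = {Infinity, T1, T2, T3}"
proof -
  have "P \<otimes>\<^bsub>G\<^esub> P = \<one>\<^bsub>G\<^esub>" if "P \<in> {Infinity, T1, T2, T3}" for P
    using that by (auto simp: G_simps)
  then have two: "P \<in> carrier G \<and> P [^]\<^bsub>G\<^esub> (2::nat) = \<one>\<^bsub>G\<^esub>" if "P \<in> {Infinity, T1, T2, T3}" for P
    using that two_torsion_points by (auto simp: numeral_2_eq_2)
  show ?thesis
  proof (intro equalityI subsetI)
    fix P assume "P \<in> carrier (torsion_part G)"
    then obtain n :: nat where "P \<in> carrier G" "n > 0" "P [^]\<^bsub>G\<^esub> n = \<one>\<^bsub>G\<^esub>"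
      unfolding torsion_part_def by auto
    then show "P \<in> {Infinity, T1, T2, T3}" using torsion_double two_torsion_cases by blast
  next
    fix P assume "P \<in> {Infinity, T1, T2, T3}"
    from two[OF this] show "P \<in> carrier (torsion_part G)"
      unfolding torsion_part_def by (auto intro: exI[of _ "2::nat"])
  qed
qed

lemma two_torsion_sums:
  "ec_add rat_field curve T1 T2 = T3" "ec_add rat_field curve T2 T1 = T3"
  "ec_add rat_field curve T1 T3 = T2" "ec_add rat_field curve T3 T1 = T2"
  "ec_add rat_field curve T2 T3 = T1" "ec_add rat_field curve T3 T2 = T1"
proof -
  \<comment> \<open>The line through two of the points is the axis y = 0, of slope 0, so the third
    abscissa completes the sum of the roots.\<close>
  have a: "ec_add rat_field (split_curve e1 e2 e3) (Affine (of_int a) 0) (Affine (of_int b) 0) = Affine (of_int c) 0"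
    if "a \<noteq> b" "a + b + c = e1 + e2 + e3" for a b c e1 e2 e3
    using that by (simp add: Let_def ec_slope_def split_curve_def flip: of_int_add)
  show "ec_add rat_field curve T1 T2 = T3" "ec_add rat_field curve T2 T1 = T3"
    "ec_add rat_field curve T1 T3 = T2" "ec_add rat_field curve T3 T1 = T2"
    "ec_add rat_field curve T2 T3 = T1" "ec_add rat_field curve T3 T2 = T1"
    using a[of N "- N" "M * M" N "- N" "M * M"] a[of "- N" N "M * M" N "- N" "M * M"]
      a[of N "M * M" "- N" N "- N" "M * M"] a[of "M * M" N "- N" N "- N" "M * M"]
      a[of "- N" "M * M" N N "- N" "M * M"] a[of "M * M" "- N" N N "- N" "M * M"] roots_distinct
    by (simp_all del: ec_add.simps)
qed

lemma torsion_iso: "torsion_part G \<cong> integer_mod_group 2 \<times>\<times> integer_mod_group 2"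
proof -
  have "rat_of_int N \<noteq> of_int (- N)" "rat_of_int N \<noteq> of_int (M * M)" "rat_of_int (- N) \<noteq> of_int (M * M)"
    using roots_distinct by (simp_all only: of_int_eq_iff not_False_eq_True)
  then have ne: "T1 \<noteq> T2" "T1 \<noteq> T3" "T2 \<noteq> T3" by simp_all
  define h :: "rat ec_point \<Rightarrow> int \<times> int" where
    "h P = (if P = T1 then (1, 0) else if P = T2 then (0, 1) else if P = T3 then (1, 1) else (0, 0))" for P
  have h: "h Infinity = (0, 0)" "h T1 = (1, 0)" "h T2 = (0, 1)" "h T3 = (1, 1)"
    using ne ne[symmetric] by (simp_all only: h_def if_True if_False ec_point.distinct simp_thms)
  have Z: "carrier (integer_mod_group 2 \<times>\<times> integer_mod_group 2) = {(0, 0), (1, 0), (0, 1), (1, 1)}"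
    by (auto simp: carrier_integer_mod_group DirProd_def)
  have m: "monoid.mult (torsion_part G) = ec_add rat_field curve" by (simp add: torsion_part_def ec_group_def)
  have self: "ec_add rat_field curve T1 T1 = Infinity" "ec_add rat_field curve T2 T2 = Infinity"
    "ec_add rat_field curve T3 T3 = Infinity" by simp_all
  have z: "(x, y) \<otimes>\<^bsub>integer_mod_group 2 \<times>\<times> integer_mod_group 2\<^esub> (x', y') = ((x + x') mod 2, (y + y') mod 2)"
    for x y x' y' by (simp add: DirProd_def mult_integer_mod_group)
  have "h \<in> hom (torsion_part G) (integer_mod_group 2 \<times>\<times> integer_mod_group 2)"
  proof (rule homI)
    fix P assume "P \<in> carrier (torsion_part G)"
    then show "h P \<in> carrier (integer_mod_group 2 \<times>\<times> integer_mod_group 2)"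
      unfolding torsion_carrier Z by (elim insertE emptyE) (simp_all only: h insert_iff simp_thms)
    fix Q assume "Q \<in> carrier (torsion_part G)"
    with \<open>P \<in> carrier (torsion_part G)\<close>
    show "h (P \<otimes>\<^bsub>torsion_part G\<^esub> Q) = h P \<otimes>\<^bsub>integer_mod_group 2 \<times>\<times> integer_mod_group 2\<^esub> h Q"
      unfolding torsion_carrier m
      by (elim insertE emptyE)
        (simp_all only: h two_torsion_sums self ec_add.simps(1,2) z, simp_all)
  qed
  moreover have "inj_on h {Infinity, T1, T2, T3}"
    by (rule inj_onI, elim insertE emptyE) (simp_all only: h, simp_all)
  then have "bij_betw h (carrier (torsion_part G)) (carrier (integer_mod_group 2 \<times>\<times> integer_mod_group 2))"
    unfolding bij_betw_def torsion_carrier Z by (simp only: image_insert image_empty h simp_thms)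
  ultimately show ?thesis by (auto simp: is_iso_def iso_def)
qed

end

section \<open>Two independent points of infinite order\<close>

lemma between_squares:
  assumes "j \<ge> 0" "j * j < k" "k < (j + 1) * (j + 1)"
  shows "s * s \<noteq> (k :: int)"
proof
  assume e: "s * s = k"
  then have "\<bar>s\<bar> * \<bar>s\<bar> = k" by simp
  then have "j < \<bar>s\<bar>" "\<bar>s\<bar> < j + 1"
    using assms mult_mono[of "\<bar>s\<bar>" j "\<bar>s\<bar>" j] mult_mono[of "j + 1" "\<bar>s\<bar>" "j + 1" "\<bar>s\<bar>"] by (auto simp: not_less[symmetric])
  then show False by simp
qed

text \<open>This is the curve of the theorem, with $m$ called \<open>c\<close>. The two points have ordinate \<open>M N\<close>, hence
  their sum is the opposite of the third point with that ordinate.\<close>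

locale rank_curve = dyadic_curve +
  fixes c :: int
  assumes c_ge_4: "c \<ge> 4" and c_even: "even c"
    and N_eq: "N = (c * c - 1) * (c * c + 1)" and M_eq: "M = 2 * c"
begin

lemma c_sq: "c * c \<ge> 16"
  using mult_mono[of 4 c 4 c] c_ge_4 by simp

lemma mod_4: "N mod 4 = 3" "(N - M * M) mod 4 = 3" "(N + M * M) mod 4 = 3" "(c * c) mod 4 = 0"
proof -
  have N: "[N = - 1] (mod 4)" using N_mod_16 cong_dvd_modulus[of N "- 1" 16 4] by simp
  have M: "[M * M = 0] (mod 4)" using M_square_mod_16 cong_dvd_modulus[of "M * M" 0 16 4] by simp
  show "N mod 4 = 3" using N by (simp add: cong_def)
  show "(N - M * M) mod 4 = 3" using cong_diff[OF N M] by (simp add: cong_def)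
  show "(N + M * M) mod 4 = 3" using cong_add[OF N M] by (simp add: cong_def)
  obtain k where "c = 2 * k" using c_even by blast
  then show "(c * c) mod 4 = 0" by simp
qed

lemma negative_not_square:
  assumes "(z :: rat) * w = k" "k < 0 \<and> w > 0 \<or> k > 0 \<and> w < 0" "z = t * t"
  shows False
proof -
  have "z \<ge> 0" using assms(3) by simp
  then have "w > 0 \<Longrightarrow> z * w \<ge> 0" "w < 0 \<Longrightarrow> z * w \<le> 0"
    by (simp_all add: mult_nonneg_nonpos)
  then show False using assms(1,2) by auto
qed

lemma curve_equation:
  assumes "Affine x y \<in> carrier G"
  shows "y^2 = (x - of_int N) * (x - of_int (- N)) * (x - of_int (M * M))"
  using assms split_curve_point by (simp only: G_simps)

lemma add_T1:
  assumes P: "Affine x y \<in> carrier G" and ne: "x \<noteq> of_int N"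
  shows "\<exists>x' y'. Affine x y \<otimes>\<^bsub>G\<^esub> T1 = Affine x' y' \<and>
      (x' - of_int N) * (x - of_int N) = 2 * of_int N * of_int (N - M * M) \<and>
      (x' - of_int (M * M)) * (x - of_int N) = of_int (N - M * M) * (x + of_int N)"
proof -
  have y: "y^2 = (x - of_int N) * (x - of_int (- N)) * (x - of_int (M * M))" using curve_equation[OF P] by simp
  have "x \<noteq> of_int N" using ne by simp
  from add_two_torsion[OF y this] obtain x' y' where *:
    "ec_add rat_field curve (Affine x y) (Affine (of_int N) 0) = Affine x' y'" "(x' - of_int N) * (x - of_int N) = of_int ((N - - N) * (N - M * M))"
    "(x' - of_int (M * M)) * (x - of_int N) = of_int (N - M * M) * (x - of_int (- N))"
    by (elim exE conjE) (rule that; assumption)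
  have "Affine x y \<otimes>\<^bsub>G\<^esub> T1 = Affine x' y'" using *(1) unfolding G_simps of_int_minus of_int_mult .
  moreover have "(x' - of_int N) * (x - of_int N) = 2 * of_int N * of_int (N - M * M) \<and>
      (x' - of_int (M * M)) * (x - of_int N) = of_int (N - M * M) * (x + of_int N)"
    using *(2-) by (simp add: algebra_simps)
  ultimately show ?thesis by blast
qed

lemma add_T2:
  assumes P: "Affine x y \<in> carrier G" and ne: "x \<noteq> - of_int N"
  shows "\<exists>x' y'. Affine x y \<otimes>\<^bsub>G\<^esub> T2 = Affine x' y' \<and>
      (x' - of_int N) * (x + of_int N) = - 2 * of_int N * (x - of_int (M * M)) \<and>
      (x' - of_int (M * M)) * (x + of_int N) = - of_int (N + M * M) * (x - of_int N)"
proof -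
  have swap: "split_curve (- N) N (M * M) = curve" by (simp add: split_curve_def algebra_simps)
  have y: "y^2 = (x - of_int (- N)) * (x - of_int N) * (x - of_int (M * M))" using curve_equation[OF P] by simp
  have "x \<noteq> of_int (- N)" using ne by simp
  from add_two_torsion[OF y this] obtain x' y' where *:
    "ec_add rat_field curve (Affine x y) (Affine (of_int (- N)) 0) = Affine x' y'" "(x' - of_int N) * (x - of_int (- N)) = of_int (- N - N) * (x - of_int (M * M))"
    "(x' - of_int (M * M)) * (x - of_int (- N)) = of_int (- N - M * M) * (x - of_int N)"
    unfolding swap by (elim exE conjE) (rule that; assumption)
  have "Affine x y \<otimes>\<^bsub>G\<^esub> T2 = Affine x' y'" using *(1) unfolding G_simps of_int_minus of_int_mult .
  moreover have "(x' - of_int N) * (x + of_int N) = - 2 * of_int N * (x - of_int (M * M)) \<and>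
      (x' - of_int (M * M)) * (x + of_int N) = - of_int (N + M * M) * (x - of_int N)"
    using *(2-) by (simp add: algebra_simps)
  ultimately show ?thesis by blast
qed

lemma add_T3:
  assumes P: "Affine x y \<in> carrier G" and ne: "x \<noteq> of_int (M * M)"
  shows "\<exists>x' y'. Affine x y \<otimes>\<^bsub>G\<^esub> T3 = Affine x' y' \<and>
      (x' - of_int N) * (x - of_int (M * M)) = - of_int (N - M * M) * (x + of_int N)"
proof -
  have swap: "split_curve (M * M) N (- N) = curve" by (simp add: split_curve_def algebra_simps)
  have y: "y^2 = (x - of_int (M * M)) * (x - of_int N) * (x - of_int (- N))" using curve_equation[OF P] by simp
  have "x \<noteq> of_int (M * M)" using ne by simp
  from add_two_torsion[OF y this] obtain x' y' where *:
    "ec_add rat_field curve (Affine x y) (Affine (of_int (M * M)) 0) = Affine x' y'" "(x' - of_int N) * (x - of_int (M * M)) = of_int (M * M - N) * (x - of_int (- N))"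
    unfolding swap by (elim exE conjE) (rule that; assumption)
  have "Affine x y \<otimes>\<^bsub>G\<^esub> T3 = Affine x' y'" using *(1) unfolding G_simps of_int_minus of_int_mult .
  moreover have "(x' - of_int N) * (x - of_int (M * M)) = - of_int (N - M * M) * (x + of_int N)"
    using *(2-) by (simp add: algebra_simps)
  ultimately show ?thesis by blast
qed

lemma double_roots:
  assumes "V \<in> carrier G" "V \<otimes>\<^bsub>G\<^esub> V = Affine x' y'"
  obtains t1 t3 where "x' - of_int N = t1 * t1" "x' - of_int (M * M) = t3 * t3"
  using double_minus_root_square[of V N "- N" "M * M" x' y'] assms unfolding G_simps by blast

abbreviation "gen_P \<equiv> Affine 0 (of_int (M * N)) :: rat ec_point"
abbreviation "gen_Q \<equiv> Affine (of_int ((c * c + 1) * (c * c + 1))) (of_int (M * N)) :: rat ec_point"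
abbreviation "gen_PQ \<equiv> Affine (of_int (- ((c * c - 1) * (c * c - 1)))) (of_int (- (M * N))) :: rat ec_point"

lemma abscissas:
  "(c * c + 1) * (c * c + 1) - N = 2 * (c * c + 1)" "(c * c + 1) * (c * c + 1) + N = 2 * (c * c) * (c * c + 1)"
  "(c * c + 1) * (c * c + 1) - M * M = (c * c - 1) * (c * c - 1)"
  "- ((c * c - 1) * (c * c - 1)) - N = - (2 * (c * c) * (c * c - 1))"
  "- ((c * c - 1) * (c * c - 1)) + N = 2 * (c * c - 1)"
  "- ((c * c - 1) * (c * c - 1)) - M * M = - ((c * c + 1) * (c * c + 1))"
  by (simp_all add: N_eq M_eq algebra_simps)

lemma gens_in_carrier: "gen_P \<in> carrier G" "gen_Q \<in> carrier G"
proof -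
  show "gen_P \<in> carrier G" unfolding G_simps split_curve_point by (simp add: power2_eq_square)
  have "(M * N)^2 = ((c * c + 1) * (c * c + 1) - N) * ((c * c + 1) * (c * c + 1) - - N) * ((c * c + 1) * (c * c + 1) - M * M)"
    by (simp add: N_eq M_eq algebra_simps power2_eq_square)
  then show "gen_Q \<in> carrier G" unfolding G_simps split_curve_point
    by (metis of_int_mult of_int_diff of_int_power)
qed

lemma gens_add: "gen_P \<otimes>\<^bsub>G\<^esub> gen_Q = gen_PQ"
proof -
  have "(c * c + 1) * (c * c + 1) \<noteq> 0" using c_sq by simp
  then have ne: "0 \<noteq> rat_of_int ((c * c + 1) * (c * c + 1))" by (metis of_int_eq_0_iff)
  have "ec_slope rat_field curve 0 (of_int (M * N)) (of_int ((c * c + 1) * (c * c + 1))) (of_int (M * N)) = 0"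
    using ne by (simp add: ec_slope_def del: of_int_mult of_int_add)
  moreover have "- coeff_a2 curve - (c * c + 1) * (c * c + 1) = - ((c * c - 1) * (c * c - 1))"
    using abscissas(6) by (simp add: split_curve_def M_eq algebra_simps)
  then have "- rat_of_int (coeff_a2 curve) - of_int ((c * c + 1) * (c * c + 1)) = of_int (- ((c * c - 1) * (c * c - 1)))"
    by (metis of_int_diff of_int_minus)
  ultimately show ?thesis using ne unfolding G_simps
    by (simp add: Let_def del: of_int_mult of_int_add of_int_minus of_int_diff)
qed

lemma gen_PQ_in_carrier: "gen_PQ \<in> carrier G"
  using G.m_closed[OF gens_in_carrier] unfolding gens_add .

text \<open>Each torsion point has its own obstruction. For \<open>Infinity\<close> and
  \<open>T1\<close> the difference with N is negative. For \<open>T2\<close> the difference with M^2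
  is N + M^2, which is 3 modulo 4. For \<open>T3\<close> the difference with N has the square class
  of (N - M^2) N, which lies strictly between consecutive squares.\<close>

lemma gen_P_not_double:
  assumes V: "V \<in> carrier G" "V \<otimes>\<^bsub>G\<^esub> V = gen_P \<otimes>\<^bsub>G\<^esub> T" and T: "T \<in> {Infinity, T1, T2, T3}"
  shows False
proof -
  have N0: "rat_of_int N > 0" using N_pos by simp
  have D0: "rat_of_int (N - M * M) > 0" using N_gt_M by (simp only: of_int_0_less_iff)
  have M0: "rat_of_int M \<noteq> 0" using M_nonzero by simp
  from T consider "T = Infinity" | "T = T1" | "T = T2" | "T = T3" by blast
  then show False
  proof cases
    case 1
    then have e: "V \<otimes>\<^bsub>G\<^esub> V = gen_P" using V(2) by (simp add: G_simps)
    obtain t1 where "0 - of_int N = t1 * (t1 :: rat)" by (rule double_roots[OF V(1) e])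
    then show False using N0 by (metis diff_0 neg_less_0_iff_less not_le zero_le_square)
  next
    case 2
    obtain x' y' where *: "gen_P \<otimes>\<^bsub>G\<^esub> T1 = Affine x' y'"
      "(x' - of_int N) * (0 - of_int N) = 2 * of_int N * of_int (N - M * M)"
      using add_T1[OF gens_in_carrier(1)] N0 by auto
    obtain t1 where "x' - of_int N = t1 * t1" by (rule double_roots[OF V(1)]) (use V(2) 2 *(1) in simp)
    from negative_not_square[OF *(2) _ this] show False using N0 D0 by simp
  next
    case 3
    obtain x' y' where *: "gen_P \<otimes>\<^bsub>G\<^esub> T2 = Affine x' y'"
      "(x' - of_int (M * M)) * (0 + of_int N) = - of_int (N + M * M) * (0 - of_int N)"
      using add_T2[OF gens_in_carrier(1)] N0 by auto
    obtain t1 t3 where t: "x' - of_int N = t1 * t1" "x' - of_int (M * M) = t3 * t3"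
      by (rule double_roots[OF V(1)]) (use V(2) 3 *(1) in simp)
    have "(x' - of_int (M * M)) * of_int N = of_int (N + M * M) * of_int N"
      using *(2) by (simp add: algebra_simps)
    then have "x' - of_int (M * M) = of_int (N + M * M)"
      using N0 by (simp only: mult_cancel_right) (metis less_irrefl)
    then obtain s where "N + M * M = s * s" using rat_square_int[of "N + M * M" t3] t(2) by auto
    then show False using mod_4(3) square_mod_4(1) by metis
  next
    case 4
    obtain x' y' where *: "gen_P \<otimes>\<^bsub>G\<^esub> T3 = Affine x' y'"
      "(x' - of_int N) * (0 - of_int (M * M)) = - of_int (N - M * M) * (0 + of_int N)"
      using add_T3[OF gens_in_carrier(1)] M0 by auto
    obtain t1 where t: "x' - of_int N = t1 * t1" by (rule double_roots[OF V(1)]) (use V(2) 4 *(1) in simp)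
    have "(x' - of_int N) * (of_int M * of_int M) = of_int ((N - M * M) * N)"
      using *(2) by (simp add: algebra_simps)
    from rat_square_factor[OF this M0 t] obtain s where s: "(N - M * M) * N = s * s" by blast
    \<comment> \<open>With d = c^2 one has (N - M^2) N = (N - 2 d)^2 - 4 d^2 and 4 d^2 = 4 N + 4,
      which places the square root just below N - 2 d - 2 = j + 1.\<close>
    define j where "j = N - 2 * (c * c) - 3"
    have "c * c * (c * c) \<ge> 16 * (c * c)" using c_sq by (intro mult_right_mono) auto
    moreover have "N = c * c * (c * c) - 1" "M * M = 4 * (c * c)" by (simp_all add: N_eq M_eq algebra_simps)
    moreover define d where "d = c * c"
    ultimately have d: "d \<ge> 16" "d * d \<ge> 16 * d" "N = d * d - 1" "M * M = 4 * d" "j = N - 2 * d - 3"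
      using c_sq by (simp_all add: j_def)
    have "s * s \<noteq> (N - M * M) * N"
    proof (rule between_squares)
      show "j \<ge> 0" using d by linarith
      have "(N - M * M) * N - j * j = 2 * (d * d) - 12 * d - 15" unfolding d by (simp add: algebra_simps)
      then show "j * j < (N - M * M) * N" using d(1,2) by linarith
      have "(j + 1) * (j + 1) - (N - M * M) * N = 8 * d + 8" unfolding d by (simp add: algebra_simps)
      then show "(N - M * M) * N < (j + 1) * (j + 1)" using d(1) by linarith
    qed
    then show False using s by simp
  qed
qed

text \<open>For \<open>Infinity\<close> the difference with N is 2 (c^2 + 1), which is 2 modulo 4.
  For \<open>T1\<close> the difference with M^2 is c^2 (N - M^2), and N - M^2 is 3 modulo 4. For
  \<open>T2\<close> and \<open>T3\<close> a difference is negative.\<close>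

lemma gen_Q_not_double:
  assumes V: "V \<in> carrier G" "V \<otimes>\<^bsub>G\<^esub> V = gen_Q \<otimes>\<^bsub>G\<^esub> T" and T: "T \<in> {Infinity, T1, T2, T3}"
  shows False
proof -
  let ?x = "rat_of_int ((c * c + 1) * (c * c + 1))"
  have xs: "?x - of_int N = of_int (2 * (c * c + 1))" "?x + of_int N = of_int (2 * (c * c) * (c * c + 1))"
    "?x - of_int (M * M) = of_int ((c * c - 1) * (c * c - 1))"
    unfolding abscissas(1-3)[symmetric] by simp_all
  have b0: "rat_of_int (2 * (c * c + 1)) > 0" and cb0: "rat_of_int (2 * (c * c) * (c * c + 1)) > 0"
    and a0: "rat_of_int ((c * c - 1) * (c * c - 1)) > 0"
    unfolding of_int_0_less_iff using c_sq by (auto intro!: mult_pos_pos)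
  have D0: "rat_of_int (N - M * M) > 0" using N_gt_M by (simp only: of_int_0_less_iff)
  have "N + M * M > 0" using N_pos zero_le_square[of M] by linarith
  then have S0: "rat_of_int (N + M * M) > 0" by (simp only: of_int_0_less_iff)
  have ne: "?x \<noteq> of_int N" "?x \<noteq> - of_int N" "?x \<noteq> of_int (M * M)"
    using xs b0 cb0 a0 by (metis diff_self less_irrefl, metis add.left_inverse less_irrefl, metis diff_self less_irrefl)
  from T consider "T = Infinity" | "T = T1" | "T = T2" | "T = T3" by blast
  then show False
  proof cases
    case 1
    then have e: "V \<otimes>\<^bsub>G\<^esub> V = gen_Q" using V(2) by (simp add: G_simps)
    obtain t1 where "?x - of_int N = t1 * t1" by (rule double_roots[OF V(1) e])
    then obtain s where "2 * (c * c + 1) = s * s" using rat_square_int[of "2 * (c * c + 1)" t1] xs(1) by auto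
    moreover have "(2 * (c * c + 1)) mod 4 = 2" using mod_4(4) by presburger
    ultimately show False using square_mod_4(2) by metis
  next
    case 2
    obtain x' y' where *: "gen_Q \<otimes>\<^bsub>G\<^esub> T1 = Affine x' y'"
      "(x' - of_int (M * M)) * (?x - of_int N) = of_int (N - M * M) * (?x + of_int N)"
      using add_T1[OF gens_in_carrier(2) ne(1)] by blast
    obtain t1 t3 where t: "x' - of_int N = t1 * t1" "x' - of_int (M * M) = t3 * t3"
      by (rule double_roots[OF V(1)]) (use V(2) 2 *(1) in simp)
    have c0: "rat_of_int c \<noteq> 0" using c_ge_4 by simp
    have "(x' - of_int (M * M)) * of_int (2 * (c * c + 1)) = (of_int (N - M * M) * (of_int c * of_int c)) * of_int (2 * (c * c + 1))"
      using *(2) unfolding xs by simp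
    then have "x' - of_int (M * M) = of_int (N - M * M) * (of_int c * of_int c)"
      using b0 by (metis mult_cancel_right less_irrefl)
    then have "(x' - of_int (M * M)) * ((1 / of_int c) * (1 / of_int c)) = of_int (N - M * M)" using c0 by simp
    from rat_square_factor[OF this _ t(2)] obtain s where "N - M * M = s * s" using c0 by auto
    then show False using mod_4(2) square_mod_4(1) by metis
  next
    case 3
    obtain x' y' where *: "gen_Q \<otimes>\<^bsub>G\<^esub> T2 = Affine x' y'"
      "(x' - of_int (M * M)) * (?x + of_int N) = - of_int (N + M * M) * (?x - of_int N)"
      using add_T2[OF gens_in_carrier(2) ne(2)] by blast
    obtain t1 t3 where t: "x' - of_int N = t1 * t1" "x' - of_int (M * M) = t3 * t3"
      by (rule double_roots[OF V(1)]) (use V(2) 3 *(1) in simp)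
    show False
      by (rule negative_not_square[OF *(2) _ t(2)]) (unfold xs, use b0 cb0 S0 in \<open>simp add: mult_neg_pos del: of_int_mult of_int_add\<close>)
  next
    case 4
    obtain x' y' where *: "gen_Q \<otimes>\<^bsub>G\<^esub> T3 = Affine x' y'"
      "(x' - of_int N) * (?x - of_int (M * M)) = - of_int (N - M * M) * (?x + of_int N)"
      using add_T3[OF gens_in_carrier(2) ne(3)] by blast
    obtain t1 where t: "x' - of_int N = t1 * t1" by (rule double_roots[OF V(1)]) (use V(2) 4 *(1) in simp)
    show False
      by (rule negative_not_square[OF *(2) _ t]) (unfold xs, use a0 cb0 D0 in \<open>simp add: mult_neg_pos del: of_int_mult of_int_add of_int_diff\<close>)
  qed
qed

text \<open>For \<open>Infinity\<close> and \<open>T1\<close> the difference with N is negative. For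
  \<open>T2\<close> it is the cube of c^2 + 1, and c^2 + 1 lies between c^2 and (c + 1)^2. For
  \<open>T3\<close> it has the square class of 2 (N - M^2) (c^2 - 1), which is 2 modulo 4.\<close>

lemma gen_PQ_not_double:
  assumes V: "V \<in> carrier G" "V \<otimes>\<^bsub>G\<^esub> V = gen_PQ \<otimes>\<^bsub>G\<^esub> T" and T: "T \<in> {Infinity, T1, T2, T3}"
  shows False
proof -
  let ?x = "rat_of_int (- ((c * c - 1) * (c * c - 1)))"
  have xs: "?x - of_int N = - of_int (2 * (c * c) * (c * c - 1))" "?x + of_int N = of_int (2 * (c * c - 1))"
    "?x - of_int (M * M) = - of_int ((c * c + 1) * (c * c + 1))"
    unfolding of_int_minus[symmetric] abscissas(4-6)[symmetric] by simp_all
  have a0: "rat_of_int (2 * (c * c - 1)) > 0" and ca0: "rat_of_int (2 * (c * c) * (c * c - 1)) > 0"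
    and b0: "rat_of_int ((c * c + 1) * (c * c + 1)) > 0"
    unfolding of_int_0_less_iff using c_sq by (auto intro!: mult_pos_pos)
  have N0: "rat_of_int N > 0" using N_pos by simp
  have D0: "rat_of_int (N - M * M) > 0" using N_gt_M by (simp only: of_int_0_less_iff)
  have ne: "?x \<noteq> of_int N" "?x \<noteq> - of_int N" "?x \<noteq> of_int (M * M)"
    using xs b0 ca0 a0 by (metis diff_self less_irrefl neg_equal_0_iff_equal, metis add.left_inverse less_irrefl,
        metis diff_self less_irrefl neg_equal_0_iff_equal)
  from T consider "T = Infinity" | "T = T1" | "T = T2" | "T = T3" by blast
  then show False
  proof cases
    case 1
    then have e: "V \<otimes>\<^bsub>G\<^esub> V = gen_PQ" using V(2) by (simp add: G_simps)
    obtain t1 where "?x - of_int N = t1 * t1" by (rule double_roots[OF V(1) e])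
    then show False using xs(1) ca0 by (metis neg_less_0_iff_less not_le zero_le_square)
  next
    case 2
    obtain x' y' where *: "gen_PQ \<otimes>\<^bsub>G\<^esub> T1 = Affine x' y'"
      "(x' - of_int N) * (?x - of_int N) = 2 * of_int N * of_int (N - M * M)"
      using add_T1[OF gen_PQ_in_carrier ne(1)] by blast
    obtain t1 where t: "x' - of_int N = t1 * t1" by (rule double_roots[OF V(1)]) (use V(2) 2 *(1) in simp)
    show False
      by (rule negative_not_square[OF *(2) _ t]) (unfold xs, use ca0 N0 D0 in \<open>simp del: of_int_mult of_int_add of_int_diff\<close>)
  next
    case 3
    obtain x' y' where *: "gen_PQ \<otimes>\<^bsub>G\<^esub> T2 = Affine x' y'"
      "(x' - of_int N) * (?x + of_int N) = - 2 * of_int N * (?x - of_int (M * M))"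
      using add_T2[OF gen_PQ_in_carrier ne(2)] by blast
    obtain t1 where t: "x' - of_int N = t1 * t1" by (rule double_roots[OF V(1)]) (use V(2) 3 *(1) in simp)
    let ?b = "rat_of_int (c * c + 1)"
    have "c * c + 1 \<noteq> 0" using c_sq by simp
    then have bn: "?b \<noteq> 0" by (simp only: of_int_eq_0_iff not_False_eq_True)
    have "(x' - of_int N) * of_int (2 * (c * c - 1)) = (?b * (?b * ?b)) * of_int (2 * (c * c - 1))"
      using *(2) unfolding xs by (simp add: N_eq algebra_simps)
    then have "x' - of_int N = ?b * (?b * ?b)" using a0 by (metis mult_cancel_right less_irrefl)
    then have "(x' - of_int N) * ((1 / ?b) * (1 / ?b)) = ?b" using bn by simp
    from rat_square_factor[OF this _ t] obtain s where s: "c * c + 1 = s * s" using bn by auto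
    have "s * s \<noteq> c * c + 1" by (rule between_squares[of c]) (use c_ge_4 in \<open>simp_all add: algebra_simps\<close>)
    then show False using s by simp
  next
    case 4
    obtain x' y' where *: "gen_PQ \<otimes>\<^bsub>G\<^esub> T3 = Affine x' y'"
      "(x' - of_int N) * (?x - of_int (M * M)) = - of_int (N - M * M) * (?x + of_int N)"
      using add_T3[OF gen_PQ_in_carrier ne(3)] by blast
    obtain t1 where t: "x' - of_int N = t1 * t1" by (rule double_roots[OF V(1)]) (use V(2) 4 *(1) in simp)
    have "(x' - of_int N) * (of_int (c * c + 1) * of_int (c * c + 1)) = of_int ((N - M * M) * (2 * (c * c - 1)))"
      using *(2) unfolding xs of_int_mult[of "N - M * M"] of_int_mult[of "c * c + 1"] by (metis minus_mult_left minus_mult_right neg_equal_iff_equal)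
    moreover have "c * c + 1 \<noteq> 0" using c_sq by simp
    then have "rat_of_int (c * c + 1) \<noteq> 0" by (simp only: of_int_eq_0_iff not_False_eq_True)
    ultimately obtain s where s: "(N - M * M) * (2 * (c * c - 1)) = s * s" using rat_square_factor t by blast
    have "[(N - M * M) * (2 * (c * c - 1)) = 3 * (2 * (0 - 1))] (mod 4)"
      using mod_4(2,4) by (intro cong_mult cong_diff cong_refl) (simp_all add: cong_def)
    then have "((N - M * M) * (2 * (c * c - 1))) mod 4 = 2" by (simp add: cong_def)
    then show False using s square_mod_4(2) by metis
  qed
qed

text \<open>Descent on |k| + |l|. An odd coefficient would make one of P, Q, P + Q a double up to
  2-torsion. If both are even, the halved combination is known only to be torsion, hence 2-torsion;
  therefore the induction is about combinations in the torsion group and not only about vanishing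
  ones.\<close>

lemma combination_torsion_imp_zero:
  assumes "gen_P [^]\<^bsub>G\<^esub> (k::int) \<otimes>\<^bsub>G\<^esub> gen_Q [^]\<^bsub>G\<^esub> (l::int) \<in> {Infinity, T1, T2, T3}"
  shows "k = 0 \<and> l = 0"
  using assms
proof (induction "nat \<bar>k\<bar> + nat \<bar>l\<bar>" arbitrary: k l rule: less_induct)
  case less
  note PQ = gens_in_carrier
  define T where "T = gen_P [^]\<^bsub>G\<^esub> k \<otimes>\<^bsub>G\<^esub> gen_Q [^]\<^bsub>G\<^esub> l"
  have T: "T \<in> {Infinity, T1, T2, T3}" using less(2) by (simp only: T_def)
  have Tc: "T \<in> carrier G" using PQ by (simp add: T_def)
  have TT: "T \<otimes>\<^bsub>G\<^esub> T = \<one>\<^bsub>G\<^esub>" using T by (auto simp: G_simps)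
  define k' l' where "k' = k div 2" and "l' = l div 2"
  define W where "W = gen_P [^]\<^bsub>G\<^esub> k' \<otimes>\<^bsub>G\<^esub> gen_Q [^]\<^bsub>G\<^esub> l'"
  define U where "U = gen_P [^]\<^bsub>G\<^esub> (k mod 2) \<otimes>\<^bsub>G\<^esub> gen_Q [^]\<^bsub>G\<^esub> (l mod 2)"
  have Wc: "W \<in> carrier G" and Uc: "U \<in> carrier G" using PQ by (simp_all add: W_def U_def)
  have "gen_P [^]\<^bsub>G\<^esub> k = gen_P [^]\<^bsub>G\<^esub> k' \<otimes>\<^bsub>G\<^esub> gen_P [^]\<^bsub>G\<^esub> k' \<otimes>\<^bsub>G\<^esub> gen_P [^]\<^bsub>G\<^esub> (k mod 2)"
    using PQ(1) by (simp add: k'_def flip: G.int_pow_mult)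
  moreover have "gen_Q [^]\<^bsub>G\<^esub> l = gen_Q [^]\<^bsub>G\<^esub> l' \<otimes>\<^bsub>G\<^esub> gen_Q [^]\<^bsub>G\<^esub> l' \<otimes>\<^bsub>G\<^esub> gen_Q [^]\<^bsub>G\<^esub> (l mod 2)"
    using PQ(2) by (simp add: l'_def flip: G.int_pow_mult)
  ultimately have TWU: "T = W \<otimes>\<^bsub>G\<^esub> W \<otimes>\<^bsub>G\<^esub> U"
    unfolding T_def W_def U_def using PQ by (simp add: G.m_ac)
  \<comment> \<open>From T = 2 W + U and 2 T = 0 it follows that 2 V = U - T = U + T for V = -
    W.\<close>
  define V where "V = inv\<^bsub>G\<^esub> W"
  have Vc: "V \<in> carrier G" using Wc by (simp add: V_def)
  have VV: "V \<otimes>\<^bsub>G\<^esub> V = U \<otimes>\<^bsub>G\<^esub> T"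
  proof -
    have "V \<otimes>\<^bsub>G\<^esub> V \<otimes>\<^bsub>G\<^esub> T = (V \<otimes>\<^bsub>G\<^esub> W) \<otimes>\<^bsub>G\<^esub> (V \<otimes>\<^bsub>G\<^esub> W) \<otimes>\<^bsub>G\<^esub> U"
      unfolding TWU using Vc Wc Uc by (simp add: G.m_ac)
    also have "\<dots> = U" using Wc Uc by (simp add: V_def)
    finally have "V \<otimes>\<^bsub>G\<^esub> V \<otimes>\<^bsub>G\<^esub> (T \<otimes>\<^bsub>G\<^esub> T) = U \<otimes>\<^bsub>G\<^esub> T"
      using Vc Tc by (simp add: G.m_assoc[symmetric])
    then show ?thesis unfolding TT using Vc by simp
  qed
  have even: "k mod 2 = 0 \<and> l mod 2 = 0"
  proof (rule ccontr)
    assume "\<not> (k mod 2 = 0 \<and> l mod 2 = 0)"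
    then consider "k mod 2 = 1" "l mod 2 = 0" | "k mod 2 = 0" "l mod 2 = 1" | "k mod 2 = 1" "l mod 2 = 1" by linarith
    then show False
    proof cases
      case 1
      then have "U = gen_P" using PQ by (simp add: U_def)
      then show False using gen_P_not_double[OF Vc _ T] VV by simp
    next
      case 2
      then have "U = gen_Q" using PQ by (simp add: U_def)
      then show False using gen_Q_not_double[OF Vc _ T] VV by simp
    next
      case 3
      then have "U = gen_P \<otimes>\<^bsub>G\<^esub> gen_Q" using PQ by (simp add: U_def)
      then show False using gen_PQ_not_double[OF Vc _ T] VV gens_add by simp
    qed
  qed
  then have "U = \<one>\<^bsub>G\<^esub>" using PQ by (simp add: U_def)
  then have "T = W \<otimes>\<^bsub>G\<^esub> W" using TWU Wc by simp
  then have "W [^]\<^bsub>G\<^esub> (4::nat) = \<one>\<^bsub>G\<^esub>"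
    using TT Wc by (simp add: numeral_eq_Suc G.m_assoc)
  then have "W \<otimes>\<^bsub>G\<^esub> W = \<one>\<^bsub>G\<^esub>" using torsion_double[OF Wc, of 4] by simp
  then have Wt: "W \<in> {Infinity, T1, T2, T3}" by (rule two_torsion_cases[OF Wc])
  show ?case
  proof (cases "k = 0 \<and> l = 0")
    case False
    have k: "k = 2 * k'" "l = 2 * l'" using even by (auto simp: k'_def l'_def)
    then have "nat \<bar>k'\<bar> + nat \<bar>l'\<bar> < nat \<bar>k\<bar> + nat \<bar>l\<bar>" using False by (auto simp: abs_mult nat_mult_distrib)
    then have "k' = 0 \<and> l' = 0" by (rule less(1)) (use Wt in \<open>simp only: W_def\<close>)
    then show ?thesis using k by simp
  qed
qed

lemma rank_ge_2: "group_rank G \<ge> 2"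
proof -
  have ne: "gen_P \<noteq> gen_Q"
  proof
    assume "gen_P = gen_Q"
    then have "(c * c + 1) * (c * c + 1) = 0" by (metis ec_point.inject of_int_eq_0_iff)
    then show False using c_sq by simp
  qed
  have "int_independent G {gen_P, gen_Q}"
    unfolding int_independent_def
  proof (intro conjI allI impI)
    fix n :: "rat ec_point \<Rightarrow> int"
    assume "(\<Otimes>\<^bsub>G\<^esub>b\<in>{gen_P, gen_Q}. b [^]\<^bsub>G\<^esub> n b) = \<one>\<^bsub>G\<^esub>"
    then have "gen_P [^]\<^bsub>G\<^esub> n gen_P \<otimes>\<^bsub>G\<^esub> gen_Q [^]\<^bsub>G\<^esub> n gen_Q = \<one>\<^bsub>G\<^esub>"
      using ne gens_in_carrier by (simp add: G.finprod_insert)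
    then have "n gen_P = 0 \<and> n gen_Q = 0"
      by (intro combination_torsion_imp_zero) (simp add: G_simps)
    then show "\<forall>b\<in>{gen_P, gen_Q}. n b = 0" by blast
  qed (use gens_in_carrier in auto)
  then have "enat (card {gen_P, gen_Q}) \<le> group_rank G"
    unfolding group_rank_def by (intro Sup_upper) blast
  moreover have "card {gen_P, gen_Q} = 2" using ne by simp
  ultimately show ?thesis by (simp add: numeral_eq_enat)
qed

end

subsection \<open>The Selmer group\<close>

lemma alg_cl_field: "field F \<Longrightarrow> field (alg_cl F)"
  using field.alg_closureE(1)[of F] by (simp add: algebraic_closure_def)

lemma alg_cl_char_zero: "field F \<Longrightarrow> char_zero F \<Longrightarrow> char_zero (alg_cl F)"
  using char_zero_hom[OF field.alg_closureE(2) _ alg_cl_field] by blast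

text \<open>Rational numbers reach the closure of a completion in two ways, through the algebraic
  numbers and through the completion. This identifies the two.\<close>

lemma hom_rat_unique:
  fixes R :: "'a ring"
  assumes "g \<in> ring_hom rat_field R" "h \<in> ring_hom rat_field R" "field R"
  shows "g q = h q"
proof -
  interpret R: field R by fact
  obtain k l where q: "q = Rat.Fract k l" "l > 0" by (cases q) auto
  then have e: "q * of_int l = of_int k" by (simp add: Fract_of_int_quotient)
  have i: "f (of_int n) = int_in R n" if "f \<in> ring_hom rat_field R" for f n
    using int_in_hom[OF that field.is_ring[OF type_ring_field] R.ring_axioms, of n] by simp
  have p: "f q \<otimes>\<^bsub>R\<^esub> int_in R l = int_in R k" if f: "f \<in> ring_hom rat_field R" for f
    using ring_hom_mult[OF f, of q "of_int l"] i[OF f] e by simp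
  have c: "f q \<in> carrier R" if "f \<in> ring_hom rat_field R" for f using ring_hom_closed[OF that] by simp
  have "char_zero R" using char_zero_hom[OF assms(1) type_ring_field assms(3) char_zero_type] .
  then have "int_in R l \<noteq> \<zero>\<^bsub>R\<^esub>" using q(2) by (auto simp: char_zero_def)
  moreover have "g q \<otimes>\<^bsub>R\<^esub> int_in R l = h q \<otimes>\<^bsub>R\<^esub> int_in R l" using p assms by simp
  ultimately show ?thesis
    using R.m_rcancel[of "int_in R l" "g q" "h q"] int_in_simps(1)[OF R.ring_axioms] c assms(1,2) by blast
qed

abbreviation Qb :: "rat closure_elem ring" where "Qb \<equiv> alg_cl rat_field"
abbreviation Gal :: "(rat closure_elem \<Rightarrow> rat closure_elem) set" where "Gal \<equiv> abs_galois rat_field"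
abbreviation const :: "rat \<Rightarrow> rat closure_elem" where "const \<equiv> ring.indexed_const rat_field"

lemma Qb_field: "field Qb" by (rule alg_cl_field[OF type_ring_field])

lemma Qb_char_zero: "char_zero Qb" by (rule alg_cl_char_zero[OF type_ring_field char_zero_type])

lemma const_hom: "const \<in> ring_hom rat_field Qb" by (rule field.alg_closureE(2)[OF type_ring_field])

lemma Qb_ring: "ring Qb" by (rule field.is_ring[OF Qb_field])

lemma GalD:
  assumes "\<sigma> \<in> abs_galois F"
  shows "\<sigma> \<in> ring_hom (alg_cl F) (alg_cl F)" "bij_betw \<sigma> (carrier (alg_cl F)) (carrier (alg_cl F))"
    "\<sigma> \<in> ring_iso (alg_cl F) (alg_cl F)" "\<sigma> \<in> extensional (carrier (alg_cl F))"
    "x \<in> carrier F \<Longrightarrow> \<sigma> (ring.indexed_const F x) = ring.indexed_const F x"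
    "y \<in> carrier (alg_cl F) \<Longrightarrow> \<sigma> y \<in> carrier (alg_cl F)"
  using assms by (auto simp: abs_galois_def ring_iso_def ring_hom_def)

lemma compose_Gal:
  assumes "\<sigma> \<in> Gal" "\<tau> \<in> Gal"
  shows "compose (carrier Qb) \<sigma> \<tau> \<in> Gal"
proof -
  interpret Qb: field Qb by (rule Qb_field)
  have c: "const q \<in> carrier Qb" for q using ring_hom_closed[OF const_hom] by simp
  have "compose (carrier Qb) \<sigma> \<tau> \<in> ring_hom Qb Qb"
    using GalD(1,6)[OF assms(1)] GalD(1,6)[OF assms(2)] by (auto simp: ring_hom_def compose_def)
  moreover have "bij_betw (compose (carrier Qb) \<sigma> \<tau>) (carrier Qb) (carrier Qb)"
    using bij_betw_compose[OF GalD(2)[OF assms(2)] GalD(2)[OF assms(1)]] .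
  ultimately show ?thesis
    using GalD(5)[OF assms(1)] GalD(5)[OF assms(2)] c
    by (auto simp: abs_galois_def ring_iso_def compose_def)
qed

context
  fixes K :: "'b ring" and \<iota> :: "rat closure_elem \<Rightarrow> 'b closure_elem"
    and \<sigma> :: "'b closure_elem \<Rightarrow> 'b closure_elem"
  assumes K: "field K" "char_zero K"
    and \<iota>: "\<iota> \<in> ring_hom Qb (alg_cl K)" and \<sigma>: "\<sigma> \<in> abs_galois K"
begin

text \<open>By \<open>root_stable\<close> the automorphism maps the image of the embedding into
  itself, so the inverse taken in \<open>galois_restrict\<close> is a genuine one.\<close>

lemma galois_restrict_eq:
  assumes "x \<in> carrier Qb"
  shows "galois_restrict \<iota> \<sigma> x \<in> carrier Qb" "\<iota> (galois_restrict \<iota> \<sigma> x) = \<sigma> (\<iota> x)"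
proof -
  have "root_stable (alg_cl K)"
    using char_zero_facts[OF alg_cl_field alg_cl_char_zero] K by (auto simp: char_zero_facts_def)
  then obtain y where y: "y \<in> carrier Qb" "\<sigma> (\<iota> x) = \<iota> y"
    using \<iota> GalD(1)[OF \<sigma>] assms unfolding root_stable_def by blast
  have "inj_on \<iota> (carrier Qb)" by (rule field_char_zero_inj[OF \<iota> Qb_field alg_cl_field[OF K(1)]])
  then have "galois_restrict \<iota> \<sigma> x = y" using y assms by (simp add: galois_restrict_def inv_into_f_f)
  then show "galois_restrict \<iota> \<sigma> x \<in> carrier Qb" "\<iota> (galois_restrict \<iota> \<sigma> x) = \<sigma> (\<iota> x)" using y by simp_all
qed

lemma galois_restrict_Gal: "galois_restrict \<iota> \<sigma> \<in> Gal"
proof -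
  interpret Kb: field "alg_cl K" by (rule alg_cl_field[OF K(1)])
  interpret Qb: field Qb by (rule Qb_field)
  let ?r = "galois_restrict \<iota> \<sigma>"
  have inj: "inj_on \<iota> (carrier Qb)" by (rule field_char_zero_inj[OF \<iota> Qb_field alg_cl_field[OF K(1)]])
  have \<iota>c: "\<iota> x \<in> carrier (alg_cl K)" if "x \<in> carrier Qb" for x using ring_hom_closed[OF \<iota> that] .
  have eqI: "x = y" if "\<iota> x = \<iota> y" "x \<in> carrier Qb" "y \<in> carrier Qb" for x y
    using inj that by (auto dest: inj_onD)
  note r = galois_restrict_eq
  have "?r \<in> ring_hom Qb Qb"
  proof (rule ring_hom_memI)
    fix x y assume xy: "x \<in> carrier Qb" "y \<in> carrier Qb"
    show "?r x \<in> carrier Qb" using r xy by simp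
    show "?r (x \<otimes>\<^bsub>Qb\<^esub> y) = ?r x \<otimes>\<^bsub>Qb\<^esub> ?r y"
      by (rule eqI) (simp_all add: r xy \<iota>c ring_hom_mult[OF \<iota>] ring_hom_mult[OF GalD(1)[OF \<sigma>]])
    show "?r (x \<oplus>\<^bsub>Qb\<^esub> y) = ?r x \<oplus>\<^bsub>Qb\<^esub> ?r y"
      by (rule eqI) (simp_all add: r xy \<iota>c ring_hom_add[OF \<iota>] ring_hom_add[OF GalD(1)[OF \<sigma>]])
  next
    show "?r \<one>\<^bsub>Qb\<^esub> = \<one>\<^bsub>Qb\<^esub>"
      by (rule eqI) (simp_all add: r ring_hom_one[OF \<iota>] ring_hom_one[OF GalD(1)[OF \<sigma>]])
  qed
  moreover have "bij_betw ?r (carrier Qb) (carrier Qb)"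
    unfolding bij_betw_def
  proof
    have "inj_on \<sigma> (carrier (alg_cl K))" using GalD(2)[OF \<sigma>] by (simp add: bij_betw_def)
    then show "inj_on ?r (carrier Qb)"
      using r \<iota>c eqI by (intro inj_onI) (metis inj_onD)
    show "?r ` carrier Qb = carrier Qb"
    proof
      show "?r ` carrier Qb \<subseteq> carrier Qb" using r by auto
      show "carrier Qb \<subseteq> ?r ` carrier Qb"
      proof
        fix y assume y: "y \<in> carrier Qb"
        \<comment> \<open>Surjectivity comes from applying \<open>root_stable\<close> to the inverse
          automorphism.\<close>
        define \<sigma>' where "\<sigma>' = inv_into (carrier (alg_cl K)) \<sigma>"
        have "\<sigma>' \<in> ring_hom (alg_cl K) (alg_cl K)"
          using ring_iso_set_sym[OF Kb.ring_axioms GalD(3)[OF \<sigma>]] by (auto simp: ring_iso_def \<sigma>'_def)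
        moreover have "root_stable (alg_cl K)"
          using char_zero_facts[OF alg_cl_field alg_cl_char_zero] K by (auto simp: char_zero_facts_def)
        ultimately obtain x where x: "x \<in> carrier Qb" "\<sigma>' (\<iota> y) = \<iota> x"
          using \<iota> y unfolding root_stable_def by blast
        have "\<sigma> (\<sigma>' (\<iota> y)) = \<iota> y"
          using GalD(2)[OF \<sigma>] \<iota>c[OF y] by (simp add: \<sigma>'_def bij_betw_inv_into_right)
        then have "\<iota> (?r x) = \<iota> y" using r x by simp
        then have "?r x = y" using eqI r x y by blast
        then show "y \<in> ?r ` carrier Qb" using x by blast
      qed
    qed
  qed
  moreover have "?r (const q) = const q" for q
  proof (rule eqI)
    have c: "const q \<in> carrier Qb" using ring_hom_closed[OF const_hom] by simp
    have "\<sigma> \<circ> (\<iota> \<circ> const) \<in> ring_hom rat_field (alg_cl K)" "\<iota> \<circ> const \<in> ring_hom rat_field (alg_cl K)"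
      using ring_hom_trans[OF ring_hom_trans[OF const_hom \<iota>] GalD(1)[OF \<sigma>]] ring_hom_trans[OF const_hom \<iota>] by auto
    from hom_rat_unique[OF this Kb.field_axioms, of q] show "\<iota> (?r (const q)) = \<iota> (const q)" using r c by simp
    show "?r (const q) \<in> carrier Qb" "const q \<in> carrier Qb" using r c by auto
  qed
  ultimately show ?thesis by (auto simp: abs_galois_def ring_iso_def galois_restrict_def)
qed

end

section \<open>Cocycles with values in rational 2-torsion\<close>

locale split_selmer =
  fixes e1 e2 e3 :: int
  assumes distinct: "e1 \<noteq> e2" "e1 \<noteq> e3" "e2 \<noteq> e3"
begin

abbreviation E :: cubic_curve where "E \<equiv> split_curve e1 e2 e3"
abbreviation A :: "rat closure_elem ec_point monoid" where "A \<equiv> torsion_kernel (ec_group Qb E) 2"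

text \<open>The 2-torsion point by which signs of the square roots of $x - e_1$ and $x - e_2$ are changed.\<close>

definition tor :: "'a ring \<Rightarrow> bool \<Rightarrow> bool \<Rightarrow> 'a ec_point" where
  "tor R f1 f2 = (if f1 then Affine (int_in R (if f2 then e3 else e2)) \<zero>\<^bsub>R\<^esub>
     else if f2 then Affine (int_in R e1) \<zero>\<^bsub>R\<^esub> else Infinity)"

lemma tor_hom:
  assumes "h \<in> ring_hom R S" "field R" "field S"
  shows "map_ec_point h (tor R f1 f2) = tor S f1 f2"
proof -
  have R: "ring R" "ring S" using assms field.is_ring by auto
  show ?thesis by (simp add: tor_def int_in_hom[OF assms(1) R] ring_hom_zero[OF assms(1) R])
qed

lemma tor_carrier: "field R \<Longrightarrow> tor R f1 f2 \<in> ec_carrier R E"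
  using two_torsion_in_carrier[of R _ e1 e2 e3] by (auto simp: tor_def ec_carrier_def[of R E])

lemma tor_add_rat: "ec_add rat_field E (tor rat_field f1 f2) (tor rat_field g1 g2) = tor rat_field (f1 \<noteq> g1) (f2 \<noteq> g2)"
proof -
  have a: "ec_add rat_field E (Affine (of_int a) 0) (Affine (of_int b) 0) = Affine (of_int c) 0"
    if "a \<noteq> b" "a + b + c = e1 + e2 + e3" for a b c
    using that by (simp add: Let_def ec_slope_def split_curve_def flip: of_int_add)
  have s: "ec_add rat_field E (Affine (of_int a) 0) (Affine (of_int a) 0) = Infinity" for a by simp
  show ?thesis
    using a[of e1 e2 e3] a[of e2 e1 e3] a[of e1 e3 e2] a[of e3 e1 e2] a[of e2 e3 e1] a[of e3 e2 e1] s distinct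
    by (cases f1; cases f2; cases g1; cases g2)
      (simp_all add: tor_def del: ec_add.simps(3))
qed

lemma tor_add:
  assumes "field R" "h \<in> ring_hom rat_field R"
  shows "ec_add R E (tor R f1 f2) (tor R g1 g2) = tor R (f1 \<noteq> g1) (f2 \<noteq> g2)"
  using ec_add_hom[OF assms(2) type_ring_field assms(1) char_zero_type tor_carrier[OF type_ring_field]
      tor_carrier[OF type_ring_field], of f1 f2 g1 g2]
  by (simp add: tor_add_rat tor_hom[OF assms(2) type_ring_field assms(1)])

lemma tor_Qb_add: "ec_add Qb E (tor Qb f1 f2) (tor Qb g1 g2) = tor Qb (f1 \<noteq> g1) (f2 \<noteq> g2)"
  by (rule tor_add[OF Qb_field const_hom])

lemma comm_group_E: "field R \<Longrightarrow> char_zero R \<Longrightarrow> comm_group (ec_group R E)"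
  using char_zero_facts[of R] distinct by (auto simp: char_zero_facts_def)

sublocale EQ: comm_group "ec_group Qb E" by (rule comm_group_E[OF Qb_field Qb_char_zero])

lemma EQ_simps: "carrier (ec_group R E) = ec_carrier R E" "x \<otimes>\<^bsub>ec_group R E\<^esub> y = ec_add R E x y"
  "\<one>\<^bsub>ec_group R E\<^esub> = Infinity"
  by (simp_all add: ec_group_def)

text \<open>The point is carried to the type \<open>qbar\<close>, where the cubic can be factored by
  ring arithmetic, and the root found there is carried back.\<close>

lemma zero_ordinate_cases:
  assumes "Affine x \<zero>\<^bsub>Qb\<^esub> \<in> ec_carrier Qb E"
  shows "x \<in> {int_in Qb e1, int_in Qb e2, int_in Qb e3}"
proof -
  let ?T = "ring_of_type_algebra :: qbar ring"
  have T: "ring ?T" "field ?T" using type_ring_field field.is_ring by auto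
  have iso: "Rep_alg_closure \<in> ring_iso ?T Qb" by (rule Rep_alg_closure_iso)
  have rep: "Rep_alg_closure \<in> ring_hom ?T Qb" using iso by (simp add: ring_iso_def)
  define g where "g = inv_into (carrier ?T) Rep_alg_closure"
  have g: "g \<in> ring_hom Qb ?T"
    using ring_iso_set_sym[OF T(1) iso] by (simp add: ring_iso_def g_def)
  have x: "x \<in> carrier Qb" using assms by (auto simp: ec_carrier_def)
  have rg: "Rep_alg_closure (g x) = x"
    using bij_betw_inv_into_right[of Rep_alg_closure "carrier ?T" "carrier Qb" x] iso x
    by (simp add: g_def ring_iso_def)
  have "Affine (g x) 0 \<in> ec_carrier ?T E"
    using ec_carrier_hom[OF g Qb_field T(2) assms] ring_hom_zero[OF g Qb_ring T(1)] by simp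
  then have "(g x - of_int e1) * (g x - of_int e2) * (g x - of_int e3) = 0"
    unfolding split_curve_equation[symmetric] by (simp add: ec_carrier_def)
  then have "g x = of_int e1 \<or> g x = of_int e2 \<or> g x = of_int e3" by auto
  moreover have "Rep_alg_closure (of_int k :: qbar) = int_in Qb k" for k
    using int_in_hom[OF rep T(1) Qb_ring, of k] by simp
  ultimately show ?thesis using rg by (metis insertCI)
qed

text \<open>Doubling to \<open>Infinity\<close> forces y = - y, hence y = 0 in characteristic zero.
  Through \<open>tor\<close> the 2-torsion becomes the pairs of booleans under exclusive or, and the
  laws of \<open>A\<close> are read off from there.\<close>

lemma A_carrier: "carrier A = range (\<lambda>(f1, f2). tor Qb f1 f2)"
proof -
  interpret Qb: field Qb by (rule Qb_field)
  have "carrier A = {P \<in> ec_carrier Qb E. ec_add Qb E P P = Infinity}"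
  proof -
    have "P [^]\<^bsub>ec_group Qb E\<^esub> (2::nat) = ec_add Qb E P P" if "P \<in> ec_carrier Qb E" for P
      using that by (simp add: numeral_2_eq_2 EQ_simps)
    then show ?thesis by (auto simp: torsion_kernel_def EQ_simps)
  qed
  also have "\<dots> = range (\<lambda>(f1, f2). tor Qb f1 f2)"
  proof (intro equalityI subsetI)
    fix P assume P: "P \<in> {P \<in> ec_carrier Qb E. ec_add Qb E P P = Infinity}"
    show "P \<in> range (\<lambda>(f1, f2). tor Qb f1 f2)"
    proof (cases P)
      case Infinity
      then have "P = (\<lambda>(f1, f2). tor Qb f1 f2) (False, False)" by (simp add: tor_def)
      then show ?thesis by (rule range_eqI)
    next
      case (Affine x y)
      have c: "y \<in> carrier Qb" using P Affine by (auto simp: ec_carrier_def)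
      have "y = \<ominus>\<^bsub>Qb\<^esub> y" using P Affine by (auto simp: Let_def split: if_splits)
      then have "y \<oplus>\<^bsub>Qb\<^esub> y = \<zero>\<^bsub>Qb\<^esub>" using Qb.r_neg[OF c] by simp
      moreover have "int_in Qb 2 \<otimes>\<^bsub>Qb\<^esub> y = y \<oplus>\<^bsub>Qb\<^esub> y"
        using int_in_simps(4)[OF Qb_ring, of 1 1] int_in_simps(3)[OF Qb_ring] c by (simp add: Qb.l_distr)
      ultimately have "y = \<zero>\<^bsub>Qb\<^esub>" using double_nonzero[OF Qb_field Qb_char_zero c] by metis
      then have "x \<in> {int_in Qb e1, int_in Qb e2, int_in Qb e3}"
        using zero_ordinate_cases P Affine by blast
      then have "P = (\<lambda>(f1, f2). tor Qb f1 f2) (False, True) \<or> P = (\<lambda>(f1, f2). tor Qb f1 f2) (True, False)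
         \<or> P = (\<lambda>(f1, f2). tor Qb f1 f2) (True, True)"
        using Affine \<open>y = \<zero>\<^bsub>Qb\<^esub>\<close> by (auto simp: tor_def)
      then show ?thesis by blast
    qed
  next
    fix P assume "P \<in> range (\<lambda>(f1, f2). tor Qb f1 f2)"
    then obtain f1 f2 where P: "P = tor Qb f1 f2" by auto
    have "tor Qb False False = Infinity" by (simp add: tor_def)
    then show "P \<in> {P \<in> ec_carrier Qb E. ec_add Qb E P P = Infinity}"
      using tor_carrier[OF Qb_field] tor_Qb_add[of f1 f2 f1 f2] by (simp add: P)
  qed
  finally show ?thesis .
qed

lemma A_ops: "P \<otimes>\<^bsub>A\<^esub> Q = ec_add Qb E P Q" "\<one>\<^bsub>A\<^esub> = Infinity"
  by (simp_all add: torsion_kernel_def ec_group_def)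

lemma A_cases:
  assumes "P \<in> carrier A"
  obtains f1 f2 where "P = tor Qb f1 f2"
  using assms unfolding A_carrier by auto

lemma tor_in_A: "tor Qb f1 f2 \<in> carrier A"
  unfolding A_carrier by (rule range_eqI[of _ _ "(f1, f2)"]) simp

lemma A_one: "Infinity = tor Qb False False"
  by (simp add: tor_def)

lemma A_closed: "P \<in> carrier A \<Longrightarrow> Q \<in> carrier A \<Longrightarrow> P \<otimes>\<^bsub>A\<^esub> Q \<in> carrier A"
  by (elim A_cases) (simp add: A_ops tor_Qb_add tor_in_A)

lemma A_self: "P \<in> carrier A \<Longrightarrow> P \<otimes>\<^bsub>A\<^esub> P = Infinity"
  by (elim A_cases) (simp add: A_ops tor_Qb_add A_one)

lemma A_comm: "P \<in> carrier A \<Longrightarrow> Q \<in> carrier A \<Longrightarrow> P \<otimes>\<^bsub>A\<^esub> Q = Q \<otimes>\<^bsub>A\<^esub> P"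
  by (elim A_cases) (simp add: A_ops tor_Qb_add eq_commute[of "_ :: bool"])

lemma A_assoc: "P \<in> carrier A \<Longrightarrow> Q \<in> carrier A \<Longrightarrow> R \<in> carrier A \<Longrightarrow> P \<otimes>\<^bsub>A\<^esub> Q \<otimes>\<^bsub>A\<^esub> R = P \<otimes>\<^bsub>A\<^esub> (Q \<otimes>\<^bsub>A\<^esub> R)"
proof (elim A_cases)
  fix f1 f2 g1 g2 h1 h2
  have "((f1 \<noteq> g1) \<noteq> h1) = (f1 \<noteq> (g1 \<noteq> h1))" "((f2 \<noteq> g2) \<noteq> h2) = (f2 \<noteq> (g2 \<noteq> h2))" by auto
  moreover assume "P = tor Qb f1 f2" "Q = tor Qb g1 g2" "R = tor Qb h1 h2"
  ultimately show ?thesis by (simp only: A_ops tor_Qb_add)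
qed

lemma A_Infinity: "P \<in> carrier A \<Longrightarrow> Infinity \<otimes>\<^bsub>A\<^esub> P = P" "P \<in> carrier A \<Longrightarrow> P \<otimes>\<^bsub>A\<^esub> Infinity = P"
  by (cases P; simp add: A_ops)+

lemma A_inv: "P \<in> carrier A \<Longrightarrow> inv\<^bsub>A\<^esub> P = P"
proof -
  assume P: "P \<in> carrier A"
  have "Q = P" if "Q \<in> carrier A" "P \<otimes>\<^bsub>A\<^esub> Q = Infinity" for Q
    using A_assoc[OF P P that(1)] that A_self[OF P] A_Infinity P by metis
  then show ?thesis unfolding m_inv_def A_ops(2) using P A_self by (intro the_equality) auto
qed

lemma Gal_tor: "\<sigma> \<in> Gal \<Longrightarrow> map_ec_point \<sigma> (tor Qb f1 f2) = tor Qb f1 f2"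
  by (rule tor_hom[OF GalD(1) Qb_field Qb_field])

lemma Gal_A: "\<sigma> \<in> Gal \<Longrightarrow> P \<in> carrier A \<Longrightarrow> map_ec_point \<sigma> P = P"
  by (elim A_cases) (simp add: Gal_tor)

abbreviation Z1 where "Z1 \<equiv> carrier (cocycles rat_field A)"
abbreviation cocycle_mult (infixl "\<oslash>" 70) where "\<xi> \<oslash> \<eta> \<equiv> \<xi> \<otimes>\<^bsub>cocycles rat_field A\<^esub> \<eta>"
abbreviation cocycle_one where "cocycle_one \<equiv> \<one>\<^bsub>cocycles rat_field A\<^esub>"

lemma Z1_iff: "\<xi> \<in> Z1 \<longleftrightarrow> \<xi> \<in> Gal \<rightarrow>\<^sub>E carrier A \<and> krull_continuous rat_field \<xi> \<and>
    (\<forall>\<sigma>\<in>Gal. \<forall>\<tau>\<in>Gal. \<xi> (compose (carrier Qb) \<sigma> \<tau>) = \<xi> \<sigma> \<otimes>\<^bsub>A\<^esub> \<xi> \<tau>)"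
  (is "?l \<longleftrightarrow> ?r")
proof -
  have "\<xi> \<sigma> \<otimes>\<^bsub>A\<^esub> map_ec_point \<sigma> (\<xi> \<tau>) = \<xi> \<sigma> \<otimes>\<^bsub>A\<^esub> \<xi> \<tau>" if "\<xi> \<in> Gal \<rightarrow>\<^sub>E carrier A" "\<sigma> \<in> Gal" "\<tau> \<in> Gal" for \<sigma> \<tau>
    by (simp only: Gal_A[OF that(2) PiE_mem[OF that(1,3)]])
  then have "(\<forall>\<sigma>\<in>Gal. \<forall>\<tau>\<in>Gal. \<xi> (compose (carrier Qb) \<sigma> \<tau>) = \<xi> \<sigma> \<otimes>\<^bsub>A\<^esub> map_ec_point \<sigma> (\<xi> \<tau>)) \<longleftrightarrow>
      (\<forall>\<sigma>\<in>Gal. \<forall>\<tau>\<in>Gal. \<xi> (compose (carrier Qb) \<sigma> \<tau>) = \<xi> \<sigma> \<otimes>\<^bsub>A\<^esub> \<xi> \<tau>)"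
    if "\<xi> \<in> Gal \<rightarrow>\<^sub>E carrier A" using that by simp
  then show ?thesis unfolding cocycles_def by (simp cong: conj_cong)
qed

lemma cocycle_ops:
  "\<xi> \<oslash> \<eta> = (\<lambda>\<sigma>\<in>Gal. \<xi> \<sigma> \<otimes>\<^bsub>A\<^esub> \<eta> \<sigma>)" "cocycle_one = (\<lambda>\<sigma>\<in>Gal. Infinity)"
  by (simp_all add: cocycles_def A_ops)

lemma Z1_value: "\<xi> \<in> Z1 \<Longrightarrow> \<sigma> \<in> Gal \<Longrightarrow> \<xi> \<sigma> \<in> carrier A"
  unfolding Z1_iff by (elim conjE) (erule (1) PiE_mem)

lemma Z1_eqI:
  assumes "\<xi> \<in> Gal \<rightarrow>\<^sub>E carrier A" "\<eta> \<in> Gal \<rightarrow>\<^sub>E carrier A" "\<And>\<sigma>. \<sigma> \<in> Gal \<Longrightarrow> \<xi> \<sigma> = \<eta> \<sigma>"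
  shows "\<xi> = \<eta>"
  using assms by (intro PiE_ext)

lemma Z1_mult:
  assumes "\<xi> \<in> Z1" "\<eta> \<in> Z1"
  shows "\<xi> \<oslash> \<eta> \<in> Z1"
proof -
  have v: "\<xi> \<sigma> \<in> carrier A" "\<eta> \<sigma> \<in> carrier A" if "\<sigma> \<in> Gal" for \<sigma> using assms Z1_value that by auto
  have hom: "\<xi> (compose (carrier Qb) \<sigma> \<tau>) = \<xi> \<sigma> \<otimes>\<^bsub>A\<^esub> \<xi> \<tau>" "\<eta> (compose (carrier Qb) \<sigma> \<tau>) = \<eta> \<sigma> \<otimes>\<^bsub>A\<^esub> \<eta> \<tau>"
    if "\<sigma> \<in> Gal" "\<tau> \<in> Gal" for \<sigma> \<tau> using assms that by (auto simp: Z1_iff)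
  obtain S where S: "finite S" "S \<subseteq> carrier Qb" "\<And>\<sigma> \<tau>. \<sigma> \<in> Gal \<Longrightarrow> \<tau> \<in> Gal \<Longrightarrow> (\<forall>s\<in>S. \<sigma> s = \<tau> s) \<Longrightarrow> \<xi> \<sigma> = \<xi> \<tau>"
    using assms(1) unfolding Z1_iff krull_continuous_def by blast
  obtain S' where S': "finite S'" "S' \<subseteq> carrier Qb" "\<And>\<sigma> \<tau>. \<sigma> \<in> Gal \<Longrightarrow> \<tau> \<in> Gal \<Longrightarrow> (\<forall>s\<in>S'. \<sigma> s = \<tau> s) \<Longrightarrow> \<eta> \<sigma> = \<eta> \<tau>"
    using assms(2) unfolding Z1_iff krull_continuous_def by blast
  have "krull_continuous rat_field (\<xi> \<oslash> \<eta>)"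
    unfolding krull_continuous_def
  proof (intro exI[of _ "S \<union> S'"] conjI ballI impI)
    fix \<sigma> \<tau> assume "\<sigma> \<in> Gal" "\<tau> \<in> Gal" "\<forall>s\<in>S \<union> S'. \<sigma> s = \<tau> s"
    then show "(\<xi> \<oslash> \<eta>) \<sigma> = (\<xi> \<oslash> \<eta>) \<tau>" using S(3)[of \<sigma> \<tau>] S'(3)[of \<sigma> \<tau>] by (simp add: cocycle_ops)
  qed (use S S' in auto)
  moreover have "(\<xi> \<oslash> \<eta>) (compose (carrier Qb) \<sigma> \<tau>) = (\<xi> \<oslash> \<eta>) \<sigma> \<otimes>\<^bsub>A\<^esub> (\<xi> \<oslash> \<eta>) \<tau>" if "\<sigma> \<in> Gal" "\<tau> \<in> Gal" for \<sigma> \<tau>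
  proof -
    have "\<xi> \<sigma> \<otimes>\<^bsub>A\<^esub> \<xi> \<tau> \<otimes>\<^bsub>A\<^esub> (\<eta> \<sigma> \<otimes>\<^bsub>A\<^esub> \<eta> \<tau>) = \<xi> \<sigma> \<otimes>\<^bsub>A\<^esub> \<eta> \<sigma> \<otimes>\<^bsub>A\<^esub> (\<xi> \<tau> \<otimes>\<^bsub>A\<^esub> \<eta> \<tau>)"
      using v[OF that(1)] v[OF that(2)] A_assoc A_comm A_closed by metis
    then show ?thesis using that compose_Gal[OF that] by (simp add: cocycle_ops hom)
  qed
  ultimately show ?thesis unfolding Z1_iff using v by (auto simp: cocycle_ops A_closed)
qed

lemma Z1_one: "cocycle_one \<in> Z1"
  unfolding Z1_iff krull_continuous_def
  using tor_in_A[of False False] by (auto simp: cocycle_ops A_one[symmetric] compose_Gal A_self intro: exI[of _ "{}"])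

lemma coboundaries_trivial: "coboundaries rat_field A = {cocycle_one}"
proof -
  have *: "(\<lambda>\<sigma>\<in>Gal. map_ec_point \<sigma> P \<otimes>\<^bsub>A\<^esub> inv\<^bsub>A\<^esub> P) = cocycle_one" if "P \<in> carrier A" for P
    unfolding cocycle_ops by (rule restrict_ext) (simp only: Gal_A that A_inv A_self)
  show ?thesis
  proof (intro equalityI subsetI)
    fix \<xi> assume "\<xi> \<in> coboundaries rat_field A"
    then obtain P where "P \<in> carrier A" "\<xi> = (\<lambda>\<sigma>\<in>Gal. map_ec_point \<sigma> P \<otimes>\<^bsub>A\<^esub> inv\<^bsub>A\<^esub> P)"
      unfolding coboundaries_def by (elim CollectE exE conjE)
    then show "\<xi> \<in> {cocycle_one}" using * by (simp only: singleton_iff)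
  next
    fix \<xi> assume "\<xi> \<in> {cocycle_one}"
    then have "\<xi> = (\<lambda>\<sigma>\<in>Gal. map_ec_point \<sigma> (tor Qb False False) \<otimes>\<^bsub>A\<^esub> inv\<^bsub>A\<^esub> (tor Qb False False))"
      using *[OF tor_in_A] by (simp only: singleton_iff)
    then show "\<xi> \<in> coboundaries rat_field A"
      unfolding coboundaries_def using tor_in_A by (intro CollectI exI conjI)
  qed
qed

lemma cocycle_one_left: "\<xi> \<in> Z1 \<Longrightarrow> cocycle_one \<oslash> \<xi> = \<xi>"
proof (rule Z1_eqI)
  assume \<xi>: "\<xi> \<in> Z1"
  show "cocycle_one \<oslash> \<xi> \<in> Gal \<rightarrow>\<^sub>E carrier A" using Z1_mult[OF Z1_one \<xi>] by (simp only: Z1_iff)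
  show "\<xi> \<in> Gal \<rightarrow>\<^sub>E carrier A" using \<xi> by (simp only: Z1_iff)
  show "(cocycle_one \<oslash> \<xi>) \<sigma> = \<xi> \<sigma>" if "\<sigma> \<in> Gal" for \<sigma>
    using that by (simp add: cocycle_ops A_Infinity(1)[OF Z1_value[OF \<xi> that]])
qed

text \<open>As there is just one coboundary, cohomology classes are singletons. The Selmer group can
  therefore be counted on cocycles, as the set \<open>sel\<close> does.\<close>

lemma H1_carrier: "carrier (H1 rat_field A) = (\<lambda>\<xi>. {\<xi>}) ` Z1"
  unfolding H1_def FactGroup_def RCOSETS_def r_coset_def coboundaries_trivial
  using cocycle_one_left by auto

definition locally_trivial where
  "locally_trivial v \<xi> \<longleftrightarrow> (\<forall>\<iota>\<in>ring_hom Qb (alg_cl (rat_completion v)).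
     localize (rat_completion v) \<iota> \<xi> \<in> coboundaries (rat_completion v) (ec_group (alg_cl (rat_completion v)) E))"

definition sel :: "((rat closure_elem \<Rightarrow> rat closure_elem) \<Rightarrow> rat closure_elem ec_point) set" where
  "sel = {\<xi> \<in> Z1. \<forall>v\<in>rat_places. locally_trivial v \<xi>}"

lemma selmer_eq: "selmer 2 E = (\<lambda>\<xi>. {\<xi>}) ` sel"
  unfolding selmer_def H1_carrier sel_def locally_trivial_def by auto

end

subsection \<open>Kummer classes\<close>

lemma field_square_eq:
  assumes "field R" "a \<in> carrier R" "b \<in> carrier R" "a \<otimes>\<^bsub>R\<^esub> a = b \<otimes>\<^bsub>R\<^esub> b"
  shows "a = b \<or> a = \<ominus>\<^bsub>R\<^esub> b"
proof -
  interpret R: field R by fact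
  have "(a \<ominus>\<^bsub>R\<^esub> b) \<otimes>\<^bsub>R\<^esub> (a \<oplus>\<^bsub>R\<^esub> b) = \<zero>\<^bsub>R\<^esub>" using assms by algebra
  then have "a \<ominus>\<^bsub>R\<^esub> b = \<zero>\<^bsub>R\<^esub> \<or> a \<oplus>\<^bsub>R\<^esub> b = \<zero>\<^bsub>R\<^esub>"
    by (intro R.integral) (use assms in simp_all)
  then show ?thesis
    using assms(2,3) R.minus_equality[of a b] by auto
qed

lemma field_minus_neq:
  assumes "field R" "char_zero R" "a \<in> carrier R" "a \<noteq> \<zero>\<^bsub>R\<^esub>"
  shows "a \<noteq> \<ominus>\<^bsub>R\<^esub> a"
proof
  interpret R: field R by fact
  assume "a = \<ominus>\<^bsub>R\<^esub> a"
  then have "a \<oplus>\<^bsub>R\<^esub> a = \<zero>\<^bsub>R\<^esub>" using R.r_neg[OF assms(3)] by simp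
  moreover have "int_in R 2 \<otimes>\<^bsub>R\<^esub> a = a \<oplus>\<^bsub>R\<^esub> a"
    using int_in_simps(4)[OF R.ring_axioms, of 1 1] int_in_simps(3)[OF R.ring_axioms] assms(3) by (simp add: R.l_distr)
  ultimately show False using double_nonzero[OF assms] by metis
qed

text \<open>The condition that d be nonzero makes s different from its negative, so that a change of
  sign is visible as \<sigma> s \<noteq> s.\<close>

definition rat_sqrt :: "rat closure_elem \<Rightarrow> rat \<Rightarrow> bool" where
  "rat_sqrt s d \<longleftrightarrow> s \<in> carrier Qb \<and> s \<otimes>\<^bsub>Qb\<^esub> s = const d \<and> d \<noteq> 0"

lemma const_closed [simp]: "const q \<in> carrier Qb"
  using ring_hom_closed[OF const_hom] by simp

lemma const_mult: "const (a * b) = const a \<otimes>\<^bsub>Qb\<^esub> const b"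
  using ring_hom_mult[OF const_hom, of a b] by simp

lemma const_inj: "const a = const b \<longleftrightarrow> a = b"
  using field_char_zero_inj[OF const_hom type_ring_field Qb_field] by (auto simp: inj_on_def)

lemma const_zero: "const 0 = \<zero>\<^bsub>Qb\<^esub>"
  using ring_hom_zero[OF const_hom field.is_ring[OF type_ring_field] Qb_ring] by simp

lemma rat_sqrt_exists:
  assumes "d \<noteq> 0"
  shows "\<exists>s. rat_sqrt s d"
proof -
  obtain x :: qbar where "poly [:- to_ac d, 0, 1:] x = 0"
    using alg_closed_imp_poly_has_root[of "[:- to_ac d, 0, 1:] :: qbar poly"] by auto
  then have "x * x = to_ac d" by simp
  then have "Rep_alg_closure x \<otimes>\<^bsub>Qb\<^esub> Rep_alg_closure x = const d"
    by (simp flip: times_alg_closure.rep_eq to_ac.rep_eq)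
  then show ?thesis using assms Rep_alg_closure unfolding rat_sqrt_def by blast
qed

lemma rat_sqrtD:
  assumes "rat_sqrt s d"
  shows "s \<in> carrier Qb" "s \<otimes>\<^bsub>Qb\<^esub> s = const d" "s \<noteq> \<zero>\<^bsub>Qb\<^esub>" "d \<noteq> 0" "s \<noteq> \<ominus>\<^bsub>Qb\<^esub> s"
proof -
  interpret Qb: field Qb by (rule Qb_field)
  show s: "s \<in> carrier Qb" "s \<otimes>\<^bsub>Qb\<^esub> s = const d" "d \<noteq> 0" using assms by (auto simp: rat_sqrt_def)
  show nz: "s \<noteq> \<zero>\<^bsub>Qb\<^esub>" using s const_inj[of d 0] const_zero by auto
  show "s \<noteq> \<ominus>\<^bsub>Qb\<^esub> s" by (rule field_minus_neq[OF Qb_field Qb_char_zero s(1) nz])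
qed

lemma rat_sqrt_mult:
  assumes "rat_sqrt s d" "rat_sqrt t e"
  shows "rat_sqrt (s \<otimes>\<^bsub>Qb\<^esub> t) (d * e)"
proof -
  interpret Qb: field Qb by (rule Qb_field)
  note s = rat_sqrtD[OF assms(1)] and t = rat_sqrtD[OF assms(2)]
  have "(s \<otimes>\<^bsub>Qb\<^esub> t) \<otimes>\<^bsub>Qb\<^esub> (s \<otimes>\<^bsub>Qb\<^esub> t) = (s \<otimes>\<^bsub>Qb\<^esub> s) \<otimes>\<^bsub>Qb\<^esub> (t \<otimes>\<^bsub>Qb\<^esub> t)"
    using s(1) t(1) by (simp add: Qb.m_ac)
  then show ?thesis using s t by (simp add: rat_sqrt_def const_mult)
qed

lemma Gal_sqrt:
  assumes "\<sigma> \<in> Gal" "rat_sqrt s d"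
  shows "\<sigma> s = s \<or> \<sigma> s = \<ominus>\<^bsub>Qb\<^esub> s"
proof -
  note s = rat_sqrtD[OF assms(2)]
  have "\<sigma> s \<otimes>\<^bsub>Qb\<^esub> \<sigma> s = \<sigma> (const d)"
    using ring_hom_mult[OF GalD(1)[OF assms(1)] s(1,1)] s(2) by simp
  also have "\<dots> = s \<otimes>\<^bsub>Qb\<^esub> s" using GalD(5)[OF assms(1), of d] s(2) by simp
  finally show ?thesis using field_square_eq[OF Qb_field GalD(6)[OF assms(1) s(1)] s(1)] by blast
qed

lemma Gal_minus:
  assumes "\<sigma> \<in> Gal" "x \<in> carrier Qb"
  shows "\<sigma> (\<ominus>\<^bsub>Qb\<^esub> x) = \<ominus>\<^bsub>Qb\<^esub> \<sigma> x"
proof -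
  interpret ring_hom_ring Qb Qb \<sigma> by (rule ring_hom_ringI2[OF Qb_ring Qb_ring GalD(1)[OF assms(1)]])
  show ?thesis using assms(2) by simp
qed

lemma flip_mult:
  assumes \<sigma>: "\<sigma> \<in> Gal" and "rat_sqrt s d" "rat_sqrt t e"
  shows "\<sigma> (s \<otimes>\<^bsub>Qb\<^esub> t) \<noteq> s \<otimes>\<^bsub>Qb\<^esub> t \<longleftrightarrow> (\<sigma> s \<noteq> s) \<noteq> (\<sigma> t \<noteq> t)"
proof -
  interpret Qb: field Qb by (rule Qb_field)
  note s = rat_sqrtD[OF assms(2)] and t = rat_sqrtD[OF assms(3)] and st = rat_sqrtD[OF rat_sqrt_mult[OF assms(2,3)]]
  have m: "\<sigma> (s \<otimes>\<^bsub>Qb\<^esub> t) = \<sigma> s \<otimes>\<^bsub>Qb\<^esub> \<sigma> t" by (rule ring_hom_mult[OF GalD(1)[OF \<sigma>] s(1) t(1)])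
  have neg: "\<ominus>\<^bsub>Qb\<^esub> s \<otimes>\<^bsub>Qb\<^esub> t = \<ominus>\<^bsub>Qb\<^esub> (s \<otimes>\<^bsub>Qb\<^esub> t)" "s \<otimes>\<^bsub>Qb\<^esub> \<ominus>\<^bsub>Qb\<^esub> t = \<ominus>\<^bsub>Qb\<^esub> (s \<otimes>\<^bsub>Qb\<^esub> t)"
    "\<ominus>\<^bsub>Qb\<^esub> s \<otimes>\<^bsub>Qb\<^esub> \<ominus>\<^bsub>Qb\<^esub> t = s \<otimes>\<^bsub>Qb\<^esub> t"
    using s(1) t(1) by (simp_all add: Qb.l_minus Qb.r_minus)
  from Gal_sqrt[OF \<sigma> assms(2)] Gal_sqrt[OF \<sigma> assms(3)] show ?thesis
    by (elim disjE) (simp_all add: m neg s(5)[symmetric] t(5)[symmetric] st(5)[symmetric])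
qed

lemma flip_compose:
  assumes "\<sigma> \<in> Gal" "\<tau> \<in> Gal" "rat_sqrt s d"
  shows "compose (carrier Qb) \<sigma> \<tau> s \<noteq> s \<longleftrightarrow> (\<sigma> s \<noteq> s) \<noteq> (\<tau> s \<noteq> s)"
proof -
  interpret Qb: field Qb by (rule Qb_field)
  note s = rat_sqrtD[OF assms(3)]
  have c: "compose (carrier Qb) \<sigma> \<tau> s = \<sigma> (\<tau> s)" using s(1) by (simp add: compose_def)
  from Gal_sqrt[OF assms(1,3)] Gal_sqrt[OF assms(2,3)] show ?thesis
    by (elim disjE) (simp_all add: c Gal_minus[OF assms(1) s(1)] s(1) s(5)[symmetric])
qed

context split_selmer
begin

lemma Z1_in_E: "\<xi> \<in> Z1 \<Longrightarrow> \<sigma> \<in> Gal \<Longrightarrow> \<xi> \<sigma> \<in> ec_carrier Qb E"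
  by (erule (1) A_cases[OF Z1_value]) (simp only: tor_carrier[OF Qb_field])

lemma localize_coboundary_iff:
  "localize K \<iota> \<xi> \<in> coboundaries K (ec_group (alg_cl K) E) \<longleftrightarrow>
     (\<exists>P\<in>ec_carrier (alg_cl K) E. \<forall>\<sigma>\<in>abs_galois K. map_ec_point \<iota> (\<xi> (galois_restrict \<iota> \<sigma>)) =
        map_ec_point \<sigma> P \<otimes>\<^bsub>ec_group (alg_cl K) E\<^esub> inv\<^bsub>ec_group (alg_cl K) E\<^esub> P)"
proof -
  have restrict_eq: "(\<lambda>x\<in>S. f x) = (\<lambda>x\<in>S. g x) \<longleftrightarrow> (\<forall>x\<in>S. f x = g x)"
    for S :: "'x set" and f g :: "'x \<Rightarrow> 'y"
    by (auto simp: restrict_def fun_eq_iff)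
  show ?thesis unfolding coboundaries_def EQ_simps(1) localize_def mem_Collect_eq restrict_eq by (rule Bex_def[symmetric, simplified conj_commute])
qed

context
  fixes v assumes v: "v \<in> rat_places"
begin

abbreviation (input) K where "K \<equiv> rat_completion v"
abbreviation (input) Kb where "Kb \<equiv> alg_cl (rat_completion v)"

lemma K_field: "field K" and K_char_zero: "char_zero K" and Kb_field: "field Kb" and Kb_char_zero: "char_zero Kb"
proof -
  interpret V: abs_value v by (rule abs_value_place[OF v])
  show "field K" "char_zero K" by (rule V.field_completion, rule V.char_zero_completion)
  then show "field Kb" "char_zero Kb" using alg_cl_field alg_cl_char_zero by blast+
qed

text \<open>Points that split two cocycles add up to a point that splits their product.\<close>

lemma locally_trivial_mult:
  assumes \<xi>: "\<xi> \<in> Z1" "locally_trivial v \<xi>" and \<eta>: "\<eta> \<in> Z1" "locally_trivial v \<eta>"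
  shows "locally_trivial v (\<xi> \<oslash> \<eta>)"
  unfolding locally_trivial_def
proof
  fix \<iota> assume \<iota>: "\<iota> \<in> ring_hom Qb Kb"
  interpret EK: comm_group "ec_group Kb E" by (rule comm_group_E[OF Kb_field Kb_char_zero])
  obtain P where P: "P \<in> ec_carrier Kb E" "\<And>\<sigma>. \<sigma> \<in> abs_galois K \<Longrightarrow> map_ec_point \<iota> (\<xi> (galois_restrict \<iota> \<sigma>)) =
        map_ec_point \<sigma> P \<otimes>\<^bsub>ec_group Kb E\<^esub> inv\<^bsub>ec_group Kb E\<^esub> P"
    using \<xi>(2) \<iota> unfolding locally_trivial_def localize_coboundary_iff by blast
  obtain Q where Q: "Q \<in> ec_carrier Kb E" "\<And>\<sigma>. \<sigma> \<in> abs_galois K \<Longrightarrow> map_ec_point \<iota> (\<eta> (galois_restrict \<iota> \<sigma>)) =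
        map_ec_point \<sigma> Q \<otimes>\<^bsub>ec_group Kb E\<^esub> inv\<^bsub>ec_group Kb E\<^esub> Q"
    using \<eta>(2) \<iota> unfolding locally_trivial_def localize_coboundary_iff by blast
  have PQ: "P \<in> carrier (ec_group Kb E)" "Q \<in> carrier (ec_group Kb E)" using P Q by (simp_all add: EQ_simps)
  show "localize K \<iota> (\<xi> \<oslash> \<eta>) \<in> coboundaries K (ec_group Kb E)"
    unfolding localize_coboundary_iff
  proof (intro bexI ballI)
    show "P \<otimes>\<^bsub>ec_group Kb E\<^esub> Q \<in> ec_carrier Kb E" using EK.m_closed[OF PQ] by (simp only: EQ_simps(1))
    fix \<sigma> assume \<sigma>: "\<sigma> \<in> abs_galois K"
    let ?r = "galois_restrict \<iota> \<sigma>"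
    have r: "?r \<in> Gal" by (rule galois_restrict_Gal[OF K_field K_char_zero \<iota> \<sigma>])
    have \<sigma>PQ: "map_ec_point \<sigma> P \<in> carrier (ec_group Kb E)" "map_ec_point \<sigma> Q \<in> carrier (ec_group Kb E)"
      using ec_carrier_hom[OF GalD(1)[OF \<sigma>] Kb_field Kb_field] P(1) Q(1) by (simp_all add: EQ_simps)
    have "map_ec_point \<iota> ((\<xi> \<oslash> \<eta>) ?r) = map_ec_point \<iota> (ec_add Qb E (\<xi> ?r) (\<eta> ?r))"
      using r by (simp add: cocycle_ops A_ops)
    also have "\<dots> = map_ec_point \<iota> (\<xi> ?r) \<otimes>\<^bsub>ec_group Kb E\<^esub> map_ec_point \<iota> (\<eta> ?r)"
      unfolding EQ_simps(2)
      by (rule ec_add_hom[OF \<iota> Qb_field Kb_field Qb_char_zero Z1_in_E[OF \<xi>(1) r] Z1_in_E[OF \<eta>(1) r]])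
    also have "\<dots> = (map_ec_point \<sigma> P \<otimes>\<^bsub>ec_group Kb E\<^esub> map_ec_point \<sigma> Q) \<otimes>\<^bsub>ec_group Kb E\<^esub>
        inv\<^bsub>ec_group Kb E\<^esub> (P \<otimes>\<^bsub>ec_group Kb E\<^esub> Q)"
      unfolding P(2)[OF \<sigma>] Q(2)[OF \<sigma>] EK.inv_mult[OF PQ]
      using PQ \<sigma>PQ by (simp add: EK.m_ac)
    also have "map_ec_point \<sigma> P \<otimes>\<^bsub>ec_group Kb E\<^esub> map_ec_point \<sigma> Q = map_ec_point \<sigma> (P \<otimes>\<^bsub>ec_group Kb E\<^esub> Q)"
      unfolding EQ_simps(2)
      by (rule ec_add_hom[OF GalD(1)[OF \<sigma>] Kb_field Kb_field Kb_char_zero P(1) Q(1), symmetric])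
    finally show "map_ec_point \<iota> ((\<xi> \<oslash> \<eta>) ?r) = map_ec_point \<sigma> (P \<otimes>\<^bsub>ec_group Kb E\<^esub> Q) \<otimes>\<^bsub>ec_group Kb E\<^esub>
        inv\<^bsub>ec_group Kb E\<^esub> (P \<otimes>\<^bsub>ec_group Kb E\<^esub> Q)" .
  qed
qed

lemma coboundary_Infinity:
  "map_ec_point \<sigma> Infinity \<otimes>\<^bsub>ec_group Kb E\<^esub> inv\<^bsub>ec_group Kb E\<^esub> Infinity = Infinity"
proof -
  interpret EK: comm_group "ec_group Kb E" by (rule comm_group_E[OF Kb_field Kb_char_zero])
  show ?thesis using EK.inv_one EK.r_one[OF EK.one_closed] by (simp add: EQ_simps)
qed

lemma locally_trivial_one: "locally_trivial v cocycle_one"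
  unfolding locally_trivial_def localize_coboundary_iff
proof (intro ballI bexI)
  fix \<iota> \<sigma> assume \<iota>: "\<iota> \<in> ring_hom Qb Kb" and \<sigma>: "\<sigma> \<in> abs_galois K"
  have "galois_restrict \<iota> \<sigma> \<in> Gal" by (rule galois_restrict_Gal[OF K_field K_char_zero \<iota> \<sigma>])
  then show "map_ec_point \<iota> (cocycle_one (galois_restrict \<iota> \<sigma>)) =
      map_ec_point \<sigma> Infinity \<otimes>\<^bsub>ec_group Kb E\<^esub> inv\<^bsub>ec_group Kb E\<^esub> Infinity"
    unfolding coboundary_Infinity by (simp add: cocycle_ops)
qed (simp add: ec_carrier_def)

end

definition kummer where
  "kummer s1 s2 = (\<lambda>\<sigma>\<in>Gal. tor Qb (\<sigma> s1 \<noteq> s1) (\<sigma> s2 \<noteq> s2))"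

lemma kummer_Z1:
  assumes "rat_sqrt s1 d1" "rat_sqrt s2 d2"
  shows "kummer s1 s2 \<in> Z1"
  unfolding Z1_iff
proof (intro conjI ballI)
  show "kummer s1 s2 \<in> Gal \<rightarrow>\<^sub>E carrier A" unfolding kummer_def using tor_in_A by (intro restrict_PiE_iff[THEN iffD2] ballI)
  show "krull_continuous rat_field (kummer s1 s2)"
    unfolding krull_continuous_def kummer_def
    by (rule exI[of _ "{s1, s2}"]) (use rat_sqrtD(1) assms in auto)
  fix \<sigma> \<tau> assume "\<sigma> \<in> Gal" "\<tau> \<in> Gal"
  then show "kummer s1 s2 (compose (carrier Qb) \<sigma> \<tau>) = kummer s1 s2 \<sigma> \<otimes>\<^bsub>A\<^esub> kummer s1 s2 \<tau>"
    by (simp only: kummer_def restrict_apply' compose_Gal A_ops tor_Qb_add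
        flip_compose[OF _ _ assms(1)] flip_compose[OF _ _ assms(2)])
qed

lemma kummer_mult:
  assumes "rat_sqrt s1 d1" "rat_sqrt s2 d2" "rat_sqrt t1 f1" "rat_sqrt t2 f2"
  shows "kummer (s1 \<otimes>\<^bsub>Qb\<^esub> t1) (s2 \<otimes>\<^bsub>Qb\<^esub> t2) = kummer s1 s2 \<oslash> kummer t1 t2"
  unfolding cocycle_ops
proof (subst kummer_def, rule restrict_ext)
  fix \<sigma> assume \<sigma>: "\<sigma> \<in> Gal"
  show "tor Qb (\<sigma> (s1 \<otimes>\<^bsub>Qb\<^esub> t1) \<noteq> s1 \<otimes>\<^bsub>Qb\<^esub> t1) (\<sigma> (s2 \<otimes>\<^bsub>Qb\<^esub> t2) \<noteq> s2 \<otimes>\<^bsub>Qb\<^esub> t2) =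
      kummer s1 s2 \<sigma> \<otimes>\<^bsub>A\<^esub> kummer t1 t2 \<sigma>"
    by (simp only: kummer_def restrict_apply' \<sigma> A_ops tor_Qb_add flip_mult[OF \<sigma> assms(1,3)] flip_mult[OF \<sigma> assms(2,4)])
qed

text \<open>For a finite witness x, let t_i be a root of d_i (x - e_i) in the completion and a_i =
  t_i / \<iota> s_i. An automorphism over the completion fixes t_i, so it negates a_i exactly when
  its restriction negates s_i. Hence it translates the half point built from the a_i by the value of
  the cocycle. If instead the d_i themselves are squares, the restrictions fix s1 and s2, and
  \<open>Infinity\<close> splits the cocycle.\<close>

lemma kummer_locally_trivial:
  fixes d1 d2 d3 r :: int
  assumes v: "v \<in> rat_places"
    and s1: "rat_sqrt s1 (of_int d1)" and s2: "rat_sqrt s2 (of_int d2)"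
    and r: "d1 * d2 * d3 = r * r" "r \<noteq> 0"
    and solvable: "locally_solvable v e1 e2 e3 d1 d2 d3"
  shows "locally_trivial v (kummer s1 s2)"
  unfolding locally_trivial_def localize_coboundary_iff
proof
  let ?K = "rat_completion v" and ?Kb = "alg_cl (rat_completion v)"
  fix \<iota> assume \<iota>: "\<iota> \<in> ring_hom Qb ?Kb"
  interpret V: abs_value v by (rule abs_value_place[OF v])
  interpret K: field ?K by (rule K_field[OF v])
  interpret Kb: field ?Kb by (rule Kb_field[OF v])
  interpret Qb: field Qb by (rule Qb_field)
  interpret EK: comm_group "ec_group ?Kb E" by (rule comm_group_E[OF Kb_field[OF v] Kb_char_zero[OF v]])
  interpret iota: ring_hom_ring Qb ?Kb \<iota> by (rule ring_hom_ringI2[OF Qb.ring_axioms Kb.ring_axioms \<iota>])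
  define cK :: "(nat \<Rightarrow> rat) set \<Rightarrow> (nat \<Rightarrow> rat) set closure_elem" where "cK = ring.indexed_const ?K"
  have cK: "cK \<in> ring_hom ?K ?Kb" unfolding cK_def by (rule field.alg_closureE(2)[OF K_field[OF v]])
  define h where "h = cK \<circ> V.emb"
  have h: "h \<in> ring_hom rat_field ?Kb" unfolding h_def by (rule ring_hom_trans[OF V.emb_hom cK])
  have h_const: "\<iota> (const q) = h q" for q
    using hom_rat_unique[OF ring_hom_trans[OF const_hom \<iota>] h Kb_field[OF v], of q] by simp
  have h_closed: "h q \<in> carrier ?Kb" for q using ring_hom_closed[OF h] by simp
  note restrict = galois_restrict_eq[OF K_field[OF v] K_char_zero[OF v] \<iota>]
  have rG: "galois_restrict \<iota> \<sigma> \<in> Gal" if "\<sigma> \<in> abs_galois ?K" for \<sigma>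
    by (rule galois_restrict_Gal[OF K_field[OF v] K_char_zero[OF v] \<iota> that])
  have fixed: "\<sigma> (cK t) = cK t" if "\<sigma> \<in> abs_galois ?K" "t \<in> carrier ?K" for \<sigma> t
    unfolding cK_def by (rule GalD(5)[OF that])
  have cK_closed: "cK t \<in> carrier ?Kb" if "t \<in> carrier ?K" for t by (rule ring_hom_closed[OF cK that])
  have inj: "x = y" if "\<iota> x = \<iota> y" "x \<in> carrier Qb" "y \<in> carrier Qb" for x y
    using field_char_zero_inj[OF \<iota> Qb_field Kb_field[OF v]] that by (auto dest: inj_onD)
  show "\<exists>P\<in>ec_carrier ?Kb E. \<forall>\<sigma>\<in>abs_galois ?K. map_ec_point \<iota> (kummer s1 s2 (galois_restrict \<iota> \<sigma>)) =
      map_ec_point \<sigma> P \<otimes>\<^bsub>ec_group ?Kb E\<^esub> inv\<^bsub>ec_group ?Kb E\<^esub> P"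
    using solvable unfolding locally_solvable_def
  proof (elim disjE)
    assume sq: "V.is_sq (of_int d1) \<and> V.is_sq (of_int d2) \<and> V.is_sq (of_int d3)"
    have noflip: "galois_restrict \<iota> \<sigma> s = s" if \<sigma>: "\<sigma> \<in> abs_galois ?K" and s: "rat_sqrt s d" "V.is_sq d" for \<sigma> s d
    proof -
      obtain t where t: "t \<in> carrier ?K" "t \<otimes>\<^bsub>?K\<^esub> t = V.emb d" using s(2) unfolding V.is_sq_def by blast
      note sD = rat_sqrtD[OF s(1)]
      have \<iota>s: "\<iota> s \<in> carrier ?Kb" using sD(1) by simp
      have "\<iota> s \<otimes>\<^bsub>?Kb\<^esub> \<iota> s = h d" using h_const[of d] sD(1,2) by (simp flip: iota.hom_mult)
      also have "\<dots> = cK t \<otimes>\<^bsub>?Kb\<^esub> cK t" using ring_hom_mult[OF cK t(1,1)] t(2) by (simp add: h_def)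
      finally have "\<iota> s = cK t \<or> \<iota> s = \<ominus>\<^bsub>?Kb\<^esub> cK t"
        by (rule field_square_eq[OF Kb_field[OF v] \<iota>s cK_closed[OF t(1)]])
      moreover interpret sig: ring_hom_ring ?Kb ?Kb \<sigma>
        by (rule ring_hom_ringI2[OF Kb.ring_axioms Kb.ring_axioms GalD(1)[OF \<sigma>]])
      have "\<sigma> (\<ominus>\<^bsub>?Kb\<^esub> cK t) = \<ominus>\<^bsub>?Kb\<^esub> cK t" using fixed[OF \<sigma> t(1)] cK_closed[OF t(1)] by simp
      ultimately have "\<sigma> (\<iota> s) = \<iota> s" using fixed[OF \<sigma> t(1)] by metis
      then show ?thesis using inj restrict[OF \<sigma> sD(1)] sD(1) by simp
    qed
    show ?thesis
    proof (intro bexI ballI)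
      fix \<sigma> assume \<sigma>: "\<sigma> \<in> abs_galois ?K"
      have "kummer s1 s2 (galois_restrict \<iota> \<sigma>) = Infinity"
        using rG[OF \<sigma>] noflip[OF \<sigma> s1] noflip[OF \<sigma> s2] sq by (simp add: kummer_def tor_def)
      then show "map_ec_point \<iota> (kummer s1 s2 (galois_restrict \<iota> \<sigma>)) =
          map_ec_point \<sigma> Infinity \<otimes>\<^bsub>ec_group ?Kb E\<^esub> inv\<^bsub>ec_group ?Kb E\<^esub> Infinity"
        unfolding coboundary_Infinity[OF v] by simp
    qed (simp add: ec_carrier_def)
  next
    assume "\<exists>x. V.is_sq (of_int d1 * (x - of_int e1)) \<and> V.is_sq (of_int d2 * (x - of_int e2)) \<and> V.is_sq (of_int d3 * (x - of_int e3))"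
    then obtain x where x: "V.is_sq (of_int d1 * (x - of_int e1))" "V.is_sq (of_int d2 * (x - of_int e2))"
      "V.is_sq (of_int d3 * (x - of_int e3))" by blast
    define q where "q = s1 \<otimes>\<^bsub>Qb\<^esub> s2"
    have q: "rat_sqrt q (of_int d1 * of_int d2)" unfolding q_def by (rule rat_sqrt_mult[OF s1 s2])
    note qD = rat_sqrtD[OF q]
    have qU: "q \<in> Units Qb" using qD Qb.field_Units by auto
    \<comment> \<open>With s3 = r / (s1 s2), a square root of d3, the sign change of s3 is the
      exclusive or of the other two, because r is rational and so fixed.\<close>
    define s3 where "s3 = const (of_int r) \<otimes>\<^bsub>Qb\<^esub> inv\<^bsub>Qb\<^esub> q"
    have s3c: "s3 \<in> carrier Qb" using qU by (simp add: s3_def)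
    have s3q: "s3 \<otimes>\<^bsub>Qb\<^esub> q = const (of_int r)" using qU qD(1) by (simp add: s3_def Qb.m_assoc)
    have d3: "d3 \<noteq> 0" using r by auto
    have s3: "rat_sqrt s3 (of_int d3)"
    proof -
      have "(s3 \<otimes>\<^bsub>Qb\<^esub> s3) \<otimes>\<^bsub>Qb\<^esub> (q \<otimes>\<^bsub>Qb\<^esub> q) = (s3 \<otimes>\<^bsub>Qb\<^esub> q) \<otimes>\<^bsub>Qb\<^esub> (s3 \<otimes>\<^bsub>Qb\<^esub> q)"
        using s3c qD(1) by (simp add: Qb.m_ac)
      also have "\<dots> = const (of_int d3 * (of_int d1 * of_int d2))"
        unfolding s3q const_mult[symmetric] using r(1) by (metis mult.commute of_int_mult)
      also have "\<dots> = const (of_int d3) \<otimes>\<^bsub>Qb\<^esub> (q \<otimes>\<^bsub>Qb\<^esub> q)" unfolding qD(2) by (rule const_mult)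
      finally have "(s3 \<otimes>\<^bsub>Qb\<^esub> s3) \<otimes>\<^bsub>Qb\<^esub> (q \<otimes>\<^bsub>Qb\<^esub> q) = const (of_int d3) \<otimes>\<^bsub>Qb\<^esub> (q \<otimes>\<^bsub>Qb\<^esub> q)" .
      moreover have "q \<otimes>\<^bsub>Qb\<^esub> q \<noteq> \<zero>\<^bsub>Qb\<^esub>" using qD(1,3) Qb.integral by blast
      ultimately have "s3 \<otimes>\<^bsub>Qb\<^esub> s3 = const (of_int d3)"
        using Qb.m_rcancel[of "q \<otimes>\<^bsub>Qb\<^esub> q" "s3 \<otimes>\<^bsub>Qb\<^esub> s3" "const (of_int d3)"] s3c qD(1) by simp
      then show ?thesis using s3c d3 by (simp add: rat_sqrt_def)
    qed
    have flip3: "(\<sigma> s3 \<noteq> s3) = ((\<sigma> s1 \<noteq> s1) \<noteq> (\<sigma> s2 \<noteq> s2))" if \<sigma>: "\<sigma> \<in> Gal" for \<sigma>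
    proof -
      have "\<sigma> (s3 \<otimes>\<^bsub>Qb\<^esub> q) = s3 \<otimes>\<^bsub>Qb\<^esub> q" unfolding s3q using GalD(5)[OF \<sigma>] by simp
      then have "(\<sigma> s3 \<noteq> s3) = (\<sigma> q \<noteq> q)" using flip_mult[OF \<sigma> s3 q] by blast
      then show ?thesis unfolding q_def using flip_mult[OF \<sigma> s1 s2] by blast
    qed
    have root: "\<exists>a\<in>carrier ?Kb. a \<otimes>\<^bsub>?Kb\<^esub> a = h x \<ominus>\<^bsub>?Kb\<^esub> int_in ?Kb e \<and>
        (\<forall>\<sigma>\<in>abs_galois ?K. \<sigma> a = (if galois_restrict \<iota> \<sigma> s \<noteq> s then \<ominus>\<^bsub>?Kb\<^esub> a else a))"
      if s: "rat_sqrt s d" and sq: "V.is_sq (d * (x - of_int e))" for s d e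
    proof -
      obtain t where t: "t \<in> carrier ?K" "t \<otimes>\<^bsub>?K\<^esub> t = V.emb (d * (x - of_int e))" using sq unfolding V.is_sq_def by blast
      note sD = rat_sqrtD[OF s]
      define u where "u = \<iota> s"
      have u: "u \<in> carrier ?Kb" using sD(1) by (simp add: u_def)
      have unz: "u \<noteq> \<zero>\<^bsub>?Kb\<^esub>" unfolding u_def by (rule field_hom_inv(2)[OF \<iota> Qb_field Kb_field[OF v] sD(1,3)])
      then have uU: "u \<in> Units ?Kb" using u Kb.field_Units by auto
      have uu: "u \<otimes>\<^bsub>?Kb\<^esub> u = h d" unfolding u_def using h_const[of d] sD(1,2) by (simp flip: iota.hom_mult)
      have uunz: "u \<otimes>\<^bsub>?Kb\<^esub> u \<noteq> \<zero>\<^bsub>?Kb\<^esub>" using u unz Kb.integral by blast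
      define a where "a = cK t \<otimes>\<^bsub>?Kb\<^esub> inv\<^bsub>?Kb\<^esub> u"
      have ac: "a \<in> carrier ?Kb" using uU cK_closed[OF t(1)] by (simp add: a_def)
      have au: "a \<otimes>\<^bsub>?Kb\<^esub> u = cK t" using uU u cK_closed[OF t(1)] by (simp add: a_def Kb.m_assoc)
      have hx: "h x \<ominus>\<^bsub>?Kb\<^esub> int_in ?Kb e = h (x - of_int e)"
      proof -
        interpret H: ring_hom_ring rat_field ?Kb h
          by (rule ring_hom_ringI2[OF field.is_ring[OF type_ring_field] Kb.ring_axioms h])
        have "h (x - of_int e) = h (x \<ominus>\<^bsub>rat_field\<^esub> int_in rat_field e)" by simp
        also have "\<dots> = h x \<ominus>\<^bsub>?Kb\<^esub> h (int_in rat_field e)"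
          unfolding a_minus_def by (simp only: H.hom_add H.hom_a_inv type_ring_simps(1) UNIV_I)
        also have "h (int_in rat_field e) = int_in ?Kb e"
          by (rule int_in_hom[OF h field.is_ring[OF type_ring_field] Kb.ring_axioms])
        finally show ?thesis by simp
      qed
      have "(a \<otimes>\<^bsub>?Kb\<^esub> a) \<otimes>\<^bsub>?Kb\<^esub> (u \<otimes>\<^bsub>?Kb\<^esub> u) = (a \<otimes>\<^bsub>?Kb\<^esub> u) \<otimes>\<^bsub>?Kb\<^esub> (a \<otimes>\<^bsub>?Kb\<^esub> u)"
        using ac u by (simp add: Kb.m_ac)
      also have "\<dots> = h ((x - of_int e) * d)"
        unfolding au using ring_hom_mult[OF cK t(1,1)] t(2) by (simp add: h_def mult.commute)
      also have "\<dots> = h (x - of_int e) \<otimes>\<^bsub>?Kb\<^esub> (u \<otimes>\<^bsub>?Kb\<^esub> u)"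
        unfolding uu using ring_hom_mult[OF h, of "x - of_int e" d] by simp
      finally have "a \<otimes>\<^bsub>?Kb\<^esub> a = h (x - of_int e)"
        using Kb.m_rcancel[of "u \<otimes>\<^bsub>?Kb\<^esub> u" "a \<otimes>\<^bsub>?Kb\<^esub> a" "h (x - of_int e)"] uunz ac u h_closed by simp
      moreover have "\<sigma> a = (if galois_restrict \<iota> \<sigma> s \<noteq> s then \<ominus>\<^bsub>?Kb\<^esub> a else a)" if \<sigma>: "\<sigma> \<in> abs_galois ?K" for \<sigma>
      proof -
        interpret sig: ring_hom_ring ?Kb ?Kb \<sigma>
          by (rule ring_hom_ringI2[OF Kb.ring_axioms Kb.ring_axioms GalD(1)[OF \<sigma>]])
        have \<sigma>au: "\<sigma> a \<otimes>\<^bsub>?Kb\<^esub> \<sigma> u = a \<otimes>\<^bsub>?Kb\<^esub> u"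
          using fixed[OF \<sigma> t(1)] ac u by (simp add: au flip: sig.hom_mult)
        have \<sigma>a: "\<sigma> a \<in> carrier ?Kb" using ac by simp
        have su: "\<sigma> u = \<iota> (galois_restrict \<iota> \<sigma> s)" unfolding u_def using restrict(2)[OF \<sigma> sD(1)] by simp
        show ?thesis
        proof (cases "galois_restrict \<iota> \<sigma> s = s")
          case True
          then have "\<sigma> u = u" using su by (simp add: u_def)
          then show ?thesis using \<sigma>au Kb.m_rcancel[of u "\<sigma> a" a] unz u ac \<sigma>a True by simp
        next
          case False
          then have "galois_restrict \<iota> \<sigma> s = \<ominus>\<^bsub>Qb\<^esub> s" using Gal_sqrt[OF rG[OF \<sigma>] s] by blast
          then have "\<sigma> u = \<ominus>\<^bsub>?Kb\<^esub> u" using su sD(1) by (simp add: u_def)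
          then have "\<ominus>\<^bsub>?Kb\<^esub> \<sigma> a \<otimes>\<^bsub>?Kb\<^esub> u = a \<otimes>\<^bsub>?Kb\<^esub> u" using \<sigma>au \<sigma>a u by (simp add: Kb.l_minus Kb.r_minus)
          then have "\<ominus>\<^bsub>?Kb\<^esub> \<sigma> a = a" using Kb.m_rcancel[of u "\<ominus>\<^bsub>?Kb\<^esub> \<sigma> a" a] unz u ac \<sigma>a by simp
          then have "\<sigma> a = \<ominus>\<^bsub>?Kb\<^esub> a" using \<sigma>a Kb.minus_minus by metis
          then show ?thesis using False by simp
        qed
      qed
      ultimately show ?thesis using ac hx by auto
    qed
    obtain a1 where a1: "a1 \<in> carrier ?Kb" "a1 \<otimes>\<^bsub>?Kb\<^esub> a1 = h x \<ominus>\<^bsub>?Kb\<^esub> int_in ?Kb e1"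
      "\<And>\<sigma>. \<sigma> \<in> abs_galois ?K \<Longrightarrow> \<sigma> a1 = (if galois_restrict \<iota> \<sigma> s1 \<noteq> s1 then \<ominus>\<^bsub>?Kb\<^esub> a1 else a1)"
      using root[OF s1 x(1)] by (elim bexE conjE) (rule that; blast)
    obtain a2 where a2: "a2 \<in> carrier ?Kb" "a2 \<otimes>\<^bsub>?Kb\<^esub> a2 = h x \<ominus>\<^bsub>?Kb\<^esub> int_in ?Kb e2"
      "\<And>\<sigma>. \<sigma> \<in> abs_galois ?K \<Longrightarrow> \<sigma> a2 = (if galois_restrict \<iota> \<sigma> s2 \<noteq> s2 then \<ominus>\<^bsub>?Kb\<^esub> a2 else a2)"
      using root[OF s2 x(2)] by (elim bexE conjE) (rule that; blast)
    obtain a3 where a3: "a3 \<in> carrier ?Kb" "a3 \<otimes>\<^bsub>?Kb\<^esub> a3 = h x \<ominus>\<^bsub>?Kb\<^esub> int_in ?Kb e3"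
      "\<And>\<sigma>. \<sigma> \<in> abs_galois ?K \<Longrightarrow> \<sigma> a3 = (if galois_restrict \<iota> \<sigma> s3 \<noteq> s3 then \<ominus>\<^bsub>?Kb\<^esub> a3 else a3)"
      using root[OF s3 x(3)] by (elim bexE conjE) (rule that; blast)
    define P where "P = half_point ?Kb (h x) a1 a2 a3"
    have "halving ?Kb e1 e2 e3"
      using char_zero_facts[OF Kb_field[OF v] Kb_char_zero[OF v]] distinct by (simp add: char_zero_facts_def)
    from this[unfolded halving_def, rule_format, OF h_closed a1(1) a2(1) a3(1) a1(2) a2(2) a3(2)]
    have half: "P \<in> ec_carrier ?Kb E"
        "ec_add ?Kb E (Affine (int_in ?Kb e1) \<zero>\<^bsub>?Kb\<^esub>) P = half_point ?Kb (h x) a1 (\<ominus>\<^bsub>?Kb\<^esub> a2) (\<ominus>\<^bsub>?Kb\<^esub> a3)"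
        "ec_add ?Kb E (Affine (int_in ?Kb e2) \<zero>\<^bsub>?Kb\<^esub>) P = half_point ?Kb (h x) (\<ominus>\<^bsub>?Kb\<^esub> a1) a2 (\<ominus>\<^bsub>?Kb\<^esub> a3)"
        "ec_add ?Kb E (Affine (int_in ?Kb e3) \<zero>\<^bsub>?Kb\<^esub>) P = half_point ?Kb (h x) (\<ominus>\<^bsub>?Kb\<^esub> a1) (\<ominus>\<^bsub>?Kb\<^esub> a2) a3"
      unfolding Let_def P_def by blast+
    have Pc: "P \<in> carrier (ec_group ?Kb E)" using half(1) by (simp add: EQ_simps)
    show ?thesis
    proof (intro bexI ballI)
      show "P \<in> ec_carrier ?Kb E" by (rule half(1))
      fix \<sigma> assume \<sigma>: "\<sigma> \<in> abs_galois ?K"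
      let ?r = "galois_restrict \<iota> \<sigma>"
      let ?T = "tor ?Kb (?r s1 \<noteq> s1) (?r s2 \<noteq> s2)"
      have Tc: "?T \<in> carrier (ec_group ?Kb E)" using tor_carrier[OF Kb_field[OF v]] by (simp only: EQ_simps(1))
      have fix_x: "\<sigma> (h x) = h x"
        using fixed[OF \<sigma>, of "V.emb x"] ring_hom_closed[OF V.emb_hom, of x] by (simp add: h_def)
      have "map_ec_point \<sigma> P = half_point ?Kb (h x) (\<sigma> a1) (\<sigma> a2) (\<sigma> a3)"
        unfolding P_def using half_point_hom[OF GalD(1)[OF \<sigma>] Kb.ring_axioms Kb.ring_axioms h_closed a1(1) a2(1) a3(1)] fix_x
        by simp
      \<comment> \<open>Signs change in pairs or not at all, so the three sums in
        \<open>halving\<close> and the unchanged point cover all automorphisms.\<close>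
      also have "\<dots> = ec_add ?Kb E ?T P"
        unfolding a1(3)[OF \<sigma>] a2(3)[OF \<sigma>] a3(3)[OF \<sigma>] using flip3[OF rG[OF \<sigma>]] half(2-4)
        by (cases "?r s1 = s1"; cases "?r s2 = s2") (simp_all add: tor_def P_def)
      finally have \<sigma>P: "map_ec_point \<sigma> P = ?T \<otimes>\<^bsub>ec_group ?Kb E\<^esub> P" by (simp only: EQ_simps(2))
      have "map_ec_point \<iota> (kummer s1 s2 ?r) = ?T"
        using rG[OF \<sigma>] by (simp only: kummer_def restrict_apply' tor_hom[OF \<iota> Qb_field Kb_field[OF v]])
      also have "\<dots> = map_ec_point \<sigma> P \<otimes>\<^bsub>ec_group ?Kb E\<^esub> inv\<^bsub>ec_group ?Kb E\<^esub> P"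
        unfolding \<sigma>P using Tc Pc by (simp add: EK.m_assoc)
      finally show "map_ec_point \<iota> (kummer s1 s2 ?r) = map_ec_point \<sigma> P \<otimes>\<^bsub>ec_group ?Kb E\<^esub> inv\<^bsub>ec_group ?Kb E\<^esub> P" .
    qed
  qed
qed

end

subsection \<open>Independent Selmer classes\<close>

text \<open>An odd prime p dividing the order would, by Sylow, be the order of a subgroup, hence
  give x different from the unit with x^p and x^2 both trivial. The result is needed because
  \<open>selmer_rank2\<close> describes the rank by an exact power of two.\<close>

lemma elementary_2_group_order:
  assumes "group G" "finite (carrier G)" "\<And>x. x \<in> carrier G \<Longrightarrow> x \<otimes>\<^bsub>G\<^esub> x = \<one>\<^bsub>G\<^esub>"
  shows "\<exists>k. card (carrier G) = 2 ^ k"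
proof -
  interpret G: group G by fact
  have nz: "Coset.order G \<noteq> 0" using assms(2) G.order_gt_0_iff_finite by simp
  have only_2: "p = 2" if p: "Factorial_Ring.prime p" "p dvd Coset.order G" for p
  proof (rule ccontr)
    assume "p \<noteq> 2"
    then obtain j where j: "p = Suc (2 * j)" using prime_odd_nat[OF p(1)] prime_ge_2_nat[OF p(1)] by (auto elim: oddE)
    obtain m where m: "Coset.order G = p ^ 1 * m" using p(2) by auto
    obtain H where H: "subgroup H G" "card H = p ^ 1" using sylow_thm[OF p(1) assms(1) m assms(2)] by blast
    interpret H: group "G\<lparr>carrier := H\<rparr>" by (rule G.subgroup_imp_group[OF H(1)])
    have "H \<noteq> {\<one>\<^bsub>G\<^esub>}" using prime_gt_1_nat[OF p(1)] H(2) by auto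
    moreover have "\<one>\<^bsub>G\<^esub> \<in> H" by (rule subgroup.one_closed[OF H(1)])
    ultimately obtain x where x: "x \<in> H" "x \<noteq> \<one>\<^bsub>G\<^esub>" by blast
    have xG: "x \<in> carrier G" using subgroup.subset[OF H(1)] x(1) by blast
    have "x [^]\<^bsub>G\<^esub> p = \<one>\<^bsub>G\<^esub>"
      using H.pow_order_eq_1[of x] x(1) H(2) G.nat_pow_consistent[of x p H] by (simp add: Coset.order_def)
    moreover have "x [^]\<^bsub>G\<^esub> (2 * j) = \<one>\<^bsub>G\<^esub>"
      using G.nat_pow_pow[OF xG, of 2 j] assms(3)[OF xG] xG by (simp add: numeral_2_eq_2)
    ultimately show False using x(2) xG by (simp add: j)
  qed
  obtain m where m: "Coset.order G = 2 ^ multiplicity 2 (Coset.order G) * m" "\<not> 2 dvd m"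
    using multiplicity_decompose'[OF nz, of 2] by (auto simp: mult.commute)
  have "m = 1"
  proof (rule ccontr)
    assume "m \<noteq> 1"
    then obtain p where "Factorial_Ring.prime p" "p dvd m" using prime_factor_nat by blast
    moreover have "p dvd Coset.order G" using \<open>p dvd m\<close> by (subst m(1)) simp
    ultimately show False using only_2 m(2) by blast
  qed
  then show ?thesis using m(1) by (auto simp: Coset.order_def)
qed

lemma int_square_factor:
  assumes "r * r * z = x * (x::int)" "r \<noteq> 0"
  shows "\<exists>s. z = s * s"
proof (rule rat_square_int)
  have "rat_of_int (r * r * z) = of_int (x * x)" using assms(1) by (simp only:)
  then show "of_int z = (of_int x / of_int r) * (of_int x / rat_of_int r)"
    using assms(2) by (simp add: field_simps)
qed

lemma prime_times_nonsquare:
  assumes "Factorial_Ring.prime (p::int)" "\<not> p dvd k"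
  shows "p * k \<noteq> s * s"
proof
  assume e: "p * k = s * s"
  then have "p dvd s * s" by (metis dvd_triv_left)
  then have "p dvd s" using assms(1) prime_dvd_multD by blast
  then obtain t where "s = p * t" by blast
  then have "p * k = p * (p * (t * t))" using e by (simp add: algebra_simps)
  then have "k = p * (t * t)" using assms(1) by auto
  then show False using assms(2) by simp
qed

context split_selmer
begin

lemma sel_Z1: "\<xi> \<in> sel \<Longrightarrow> \<xi> \<in> Z1"
  unfolding sel_def by (elim CollectE conjE)

lemma sel_mult: "\<xi> \<in> sel \<Longrightarrow> \<eta> \<in> sel \<Longrightarrow> \<xi> \<oslash> \<eta> \<in> sel"
  unfolding sel_def mem_Collect_eq using Z1_mult locally_trivial_mult by meson

lemma sel_one: "cocycle_one \<in> sel"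
  unfolding sel_def mem_Collect_eq using Z1_one locally_trivial_one by meson

lemma Z1_assoc:
  assumes "\<xi> \<in> Z1" "\<eta> \<in> Z1" "\<zeta> \<in> Z1"
  shows "(\<xi> \<oslash> \<eta>) \<oslash> \<zeta> = \<xi> \<oslash> (\<eta> \<oslash> \<zeta>)"
  unfolding cocycle_ops
  by (rule restrict_ext) (simp only: restrict_apply' A_assoc[OF assms[THEN Z1_value]])

lemma Z1_self:
  assumes "\<xi> \<in> Z1"
  shows "\<xi> \<oslash> \<xi> = cocycle_one"
  unfolding cocycle_ops by (rule restrict_ext) (simp only: A_self[OF Z1_value[OF assms]])

lemma card_sel:
  assumes "finite sel"
  shows "\<exists>k. card sel = 2 ^ k"
proof -
  let ?S = "\<lparr>carrier = sel, monoid.mult = (\<lambda>\<xi> \<eta>. \<xi> \<oslash> \<eta>), one = cocycle_one\<rparr>"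
  have "group ?S"
  proof (rule groupI)
    fix x assume "x \<in> carrier ?S"
    then have x: "x \<in> sel" by simp
    show "\<one>\<^bsub>?S\<^esub> \<otimes>\<^bsub>?S\<^esub> x = x" using cocycle_one_left[OF sel_Z1[OF x]] by simp
    show "\<exists>y\<in>carrier ?S. y \<otimes>\<^bsub>?S\<^esub> x = \<one>\<^bsub>?S\<^esub>"
      by (rule bexI[of _ x]) (use x Z1_self[OF sel_Z1[OF x]] in simp_all)
  qed (simp_all add: sel_mult sel_one Z1_assoc sel_Z1)
  from elementary_2_group_order[OF this] show ?thesis using assms Z1_self sel_Z1 by simp
qed

lemma tor_inj: "tor Qb f1 f2 = tor Qb g1 g2 \<longleftrightarrow> f1 = g1 \<and> f2 = g2"
proof -
  have ne: "int_in Qb a \<noteq> int_in Qb b" if "a \<noteq> b" for a b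
  proof
    assume "int_in Qb a = int_in Qb b"
    then have "const (of_int a) = const (of_int b)"
      using int_in_hom[OF const_hom field.is_ring[OF type_ring_field] Qb_ring] by simp
    then show False using that const_inj by simp
  qed
  show ?thesis using ne[OF distinct(1)] ne[OF distinct(2)] ne[OF distinct(3)]
    by (cases f1; cases f2; cases g1; cases g2) (simp_all add: tor_def)
qed

text \<open>Any choice of the two square roots is allowed. Products of chosen roots then serve for
  product pairs, without fixing a coherent system of roots.\<close>

definition selmer_pair :: "int \<Rightarrow> int \<Rightarrow> bool" where
  "selmer_pair d1 d2 \<longleftrightarrow> (\<exists>s1 s2. rat_sqrt s1 (of_int d1) \<and> rat_sqrt s2 (of_int d2) \<and> kummer s1 s2 \<in> sel)"

lemma selmer_pairI:
  assumes "\<And>v. v \<in> rat_places \<Longrightarrow> locally_solvable v e1 e2 e3 d1 d2 d3"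
    and r: "d1 * d2 * d3 = r * r" "r \<noteq> 0"
  shows "selmer_pair d1 d2"
proof -
  have nz: "rat_of_int d1 \<noteq> 0" "rat_of_int d2 \<noteq> 0" using r by auto
  obtain s1 s2 where s: "rat_sqrt s1 (of_int d1)" "rat_sqrt s2 (of_int d2)"
    using rat_sqrt_exists[OF nz(1)] rat_sqrt_exists[OF nz(2)] by blast
  have "kummer s1 s2 \<in> sel"
    unfolding sel_def mem_Collect_eq
    using kummer_Z1[OF s] kummer_locally_trivial[OF _ s r assms(1)] by blast
  then show ?thesis unfolding selmer_pair_def using s by blast
qed

lemma selmer_pair_mult:
  assumes "selmer_pair d1 d2" "selmer_pair f1 f2"
  shows "selmer_pair (d1 * f1) (d2 * f2)"
proof -
  obtain s1 s2 where s: "rat_sqrt s1 (of_int d1)" "rat_sqrt s2 (of_int d2)" "kummer s1 s2 \<in> sel"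
    using assms(1) unfolding selmer_pair_def by blast
  obtain t1 t2 where t: "rat_sqrt t1 (of_int f1)" "rat_sqrt t2 (of_int f2)" "kummer t1 t2 \<in> sel"
    using assms(2) unfolding selmer_pair_def by blast
  have "kummer (s1 \<otimes>\<^bsub>Qb\<^esub> t1) (s2 \<otimes>\<^bsub>Qb\<^esub> t2) \<in> sel"
    unfolding kummer_mult[OF s(1,2) t(1,2)] by (rule sel_mult[OF s(3) t(3)])
  moreover have "rat_sqrt (s1 \<otimes>\<^bsub>Qb\<^esub> t1) (of_int (d1 * f1))" "rat_sqrt (s2 \<otimes>\<^bsub>Qb\<^esub> t2) (of_int (d2 * f2))"
    using rat_sqrt_mult[OF s(1) t(1)] rat_sqrt_mult[OF s(2) t(2)] by simp_all
  ultimately show ?thesis unfolding selmer_pair_def by blast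
qed

lemma selmer_pair_one: "selmer_pair 1 1"
  by (rule selmer_pairI[where r = 1 and ?d3.0 = 1])
    (auto simp: locally_solvable_def dest: is_sq_int_square[where k = 1])

lemma selmer_pair_prod:
  "finite U \<Longrightarrow> (\<And>p. p \<in> U \<Longrightarrow> selmer_pair (f p) (g p)) \<Longrightarrow> selmer_pair (prod f U) (prod g U)"
  by (induction U rule: finite_induct) (simp_all add: selmer_pair_one selmer_pair_mult)

text \<open>If d e were not a square, some automorphism would negate s t, and so negate exactly one
  of s and t.\<close>

lemma same_flips_square:
  assumes s: "rat_sqrt s (of_int d)" and t: "rat_sqrt t (of_int e)"
    and same: "\<And>\<sigma>. \<sigma> \<in> Gal \<Longrightarrow> (\<sigma> s \<noteq> s) = (\<sigma> t \<noteq> t)"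
  shows "\<exists>a. d * e = a * a"
proof -
  have st: "rat_sqrt (s \<otimes>\<^bsub>Qb\<^esub> t) (of_int (d * e))" using rat_sqrt_mult[OF s t] by simp
  note stD = rat_sqrtD[OF st]
  have "\<exists>q. q * q = rat_of_int (d * e)"
  proof (rule ccontr)
    assume "\<nexists>q. q * q = rat_of_int (d * e)"
    then obtain \<sigma> where \<sigma>: "\<sigma> \<in> Gal" "\<sigma> (s \<otimes>\<^bsub>Qb\<^esub> t) = \<ominus>\<^bsub>Qb\<^esub> (s \<otimes>\<^bsub>Qb\<^esub> t)"
      by (rule exists_galois_neg_sqrt[OF stD(1,2)])
    then have "\<sigma> (s \<otimes>\<^bsub>Qb\<^esub> t) \<noteq> s \<otimes>\<^bsub>Qb\<^esub> t" using stD(5) by metis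
    then show False using flip_mult[OF \<sigma>(1) s t] same[OF \<sigma>(1)] by blast
  qed
  then show ?thesis using rat_square_int by metis
qed

lemma kummer_eq_square:
  assumes "rat_sqrt s1 (of_int d1)" "rat_sqrt s2 (of_int d2)" "rat_sqrt t1 (of_int f1)" "rat_sqrt t2 (of_int f2)"
    and eq: "kummer s1 s2 = kummer t1 t2"
  shows "\<exists>a. d1 * f1 = a * a" "\<exists>a. d2 * f2 = a * a"
proof -
  have "(\<sigma> s1 \<noteq> s1) = (\<sigma> t1 \<noteq> t1) \<and> (\<sigma> s2 \<noteq> s2) = (\<sigma> t2 \<noteq> t2)" if "\<sigma> \<in> Gal" for \<sigma>
    using fun_cong[OF eq, of \<sigma>] unfolding kummer_def restrict_apply'[OF that] tor_inj .
  then show "\<exists>a. d1 * f1 = a * a" "\<exists>a. d2 * f2 = a * a"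
    using same_flips_square assms(1-4) by meson+
qed

text \<open>In the infinite case the rank is infinite by definition. Otherwise the order is 2^k, and
  the 2^(2 + w) distinct cocycles give k \<ge> 2 + w; in particular k \<ge> 2, so the description in
  \<open>selmer_rank2\<close> denotes k - 2.\<close>

lemma selmer_rank2_ge:
  assumes I: "finite I" "card I = 2 ^ (2 + w)"
    and pair: "\<And>i. i \<in> I \<Longrightarrow> selmer_pair (f i) (g i)"
    and indep: "\<And>i j a b. i \<in> I \<Longrightarrow> j \<in> I \<Longrightarrow> f i * f j = a * a \<Longrightarrow> g i * g j = b * b \<Longrightarrow> i = j"
  shows "selmer_rank2 E \<ge> enat w"
proof (cases "finite sel")
  case False
  have "inj_on (\<lambda>\<xi>. {\<xi>}) sel" by (rule inj_onI) simp
  then have "infinite (selmer 2 E)" unfolding selmer_eq using finite_imageD False by blast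
  then show ?thesis by (simp add: selmer_rank2_def)
next
  case True
  have "\<forall>i\<in>I. \<exists>\<xi>. \<xi> \<in> sel \<and>
      (\<exists>s1 s2. rat_sqrt s1 (of_int (f i)) \<and> rat_sqrt s2 (of_int (g i)) \<and> kummer s1 s2 = \<xi>)"
    using pair unfolding selmer_pair_def by blast
  from bchoice[OF this] obtain c where c:
    "\<forall>i\<in>I. \<exists>s1 s2. rat_sqrt s1 (of_int (f i)) \<and> rat_sqrt s2 (of_int (g i)) \<and> kummer s1 s2 = c i"
    "\<forall>i\<in>I. c i \<in> sel" by blast
  have "inj_on c I"
  proof (rule inj_onI)
    fix i j assume ij: "i \<in> I" "j \<in> I" "c i = c j"
    obtain s1 s2 where s: "rat_sqrt s1 (of_int (f i))" "rat_sqrt s2 (of_int (g i))" "kummer s1 s2 = c i"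
      using c(1) ij(1) by blast
    obtain t1 t2 where t: "rat_sqrt t1 (of_int (f j))" "rat_sqrt t2 (of_int (g j))" "kummer t1 t2 = c j"
      using c(1) ij(2) by blast
    have "kummer s1 s2 = kummer t1 t2" using s(3) t(3) ij(3) by (simp only:)
    from kummer_eq_square[OF s(1,2) t(1,2) this] show "i = j" using indep[OF ij(1,2)] by blast
  qed
  then have le: "2 ^ (2 + w) \<le> card sel"
    using card_inj_on_le[of c I sel] c(2) True I(2) by auto
  obtain k where k: "card sel = 2 ^ k" using card_sel[OF True] by blast
  have "2 + w \<le> k" using le unfolding k by (rule power_le_imp_le_exp[rotated]) simp
  moreover have "card (selmer 2 E) = card sel" unfolding selmer_eq by (rule card_image) (rule inj_onI, simp)
  moreover obtain t where t: "k = 2 + t" using \<open>2 + w \<le> k\<close> le_Suc_ex add_leD1 by blast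
  moreover have "(THE s. (2 :: nat) ^ (2 + t) = 2 ^ (2 + s)) = t"
    by (intro the_equality refl) (simp only: power_inject_exp one_less_numeral_iff semiring_norm add_left_cancel)
  moreover have "finite (selmer 2 E)" unfolding selmer_eq using True by simp
  ultimately show ?thesis using k by (simp only: selmer_rank2_def if_True) simp
qed

end

section \<open>Independence of the classes and the lower bound for the Selmer rank\<close>

context twin_primes
begin

text \<open>The first two numbers are 3 modulo 4. Since M^4 = 16 (N + 1), the product is N^2 - 16 N
  - 16, slightly less than (N - 8)^2.\<close>

lemma nonsquares:
  "N - M * M \<noteq> s * s" "N + M * M \<noteq> s * s" "(N - M * M) * (N + M * M) \<noteq> s * s"
proof -
  have n: "N mod 4 = 3" using cong_dvd_modulus[OF N_mod_16, of 4] by (simp add: cong_def)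
  have "4 dvd M * M" by (simp add: M_square)
  then obtain k where k: "M * M = 4 * k" by blast
  have "(N - 4 * k) mod 4 = 3" "(N + 4 * k) mod 4 = 3" using n by presburger+
  then show "N - M * M \<noteq> s * s" "N + M * M \<noteq> s * s" using square_mod_4(1)[of s] k by metis+
  have sq: "M * M * (M * M) = 16 * (N + 1)" by (simp add: power4_eq_xxxx)
  have "m * m \<ge> 4 * 4" using m_ge_4 by (intro mult_mono) auto
  then have "(m * m) * (m * m) \<ge> 16 * 16" by (intro mult_mono) auto
  then have N: "N \<ge> 255" by (simp add: power4_eq_xxxx)
  have e: "(N - M * M) * (N + M * M) = N * N - 16 * (N + 1)"
    using sq by (simp only: algebra_simps)
  have "s * s \<noteq> n * n - 16 * (n + 1)" if n: "n \<ge> 255" for n :: int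
    \<comment> \<open>(n - 9)^2 < n^2 - 16 n - 16 needs 2 n > 97, which n \<ge> 255
      provides.\<close>
    by (rule between_squares[of "n - 9"]) (use n in \<open>simp_all add: algebra_simps\<close>)
  from this[OF N] show "(N - M * M) * (N + M * M) \<noteq> s * s" unfolding e by metis
qed

sublocale S: split_selmer N "- N" "M * M"
proof (unfold_locales)
  show "N \<noteq> - N" using N_pos by linarith
  show "N \<noteq> M * M" "- N \<noteq> M * M" using N_gt_M by linarith+
qed

definition exceptional :: "int set" where "exceptional = {p. good_prime p}"

text \<open>An index selects a product of generators: a set of counted primes, and one bit for each
  of the images of (N, 0) and (- N, 0). The two bits account for the exponent 2 in the definition of
  the Selmer rank.\<close>

abbreviation index :: "(int set \<times> bool \<times> bool) set" where "index \<equiv> Pow exceptional \<times> UNIV"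

definition comp1 :: "int set \<times> bool \<times> bool \<Rightarrow> int" where
  "comp1 i = (\<Prod>p\<in>fst i. sgn4 p * p) * ((if fst (snd i) then 2 * N * (N - M * M) else 1) * (if snd (snd i) then - (2 * N) else 1))"

definition comp2 :: "int set \<times> bool \<times> bool \<Rightarrow> int" where
  "comp2 i = (\<Prod>p\<in>fst i. p) * ((if fst (snd i) then 2 * N else 1) * (if snd (snd i) then 2 * N * (N + M * M) else 1))"

lemma finite_exceptional: "finite exceptional"
proof (rule finite_subset)
  show "exceptional \<subseteq> {p. p dvd N}" by (auto simp: exceptional_def good_prime_def)
  show "finite {p. p dvd N}" using N_pos by (intro finite_divisors_int) linarith
qed

lemma selmer_pair_index:
  assumes "i \<in> index"
  shows "S.selmer_pair (comp1 i) (comp2 i)"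
  unfolding comp1_def comp2_def
proof (intro S.selmer_pair_mult S.selmer_pair_prod)
  show "finite (fst i)" using assms finite_subset[OF _ finite_exceptional] by auto
  fix p assume "p \<in> fst i"
  then have p: "good_prime p" using assms by (auto simp: exceptional_def)
  show "S.selmer_pair (sgn4 p * p) p"
  proof (rule S.selmer_pairI[OF solvable_good_prime[OF p]])
    show "sgn4 p * p * p * sgn4 p = p * p" by (simp add: sgn4_def)
    show "p \<noteq> 0" using p by (auto simp: good_prime_def)
  qed
next
  show "S.selmer_pair (if fst (snd i) then 2 * N * (N - M * M) else 1) (if fst (snd i) then 2 * N else 1)"
  proof (cases "fst (snd i)")
    case True
    have "S.selmer_pair (2 * N * (N - M * M)) (2 * N)"
    proof (rule S.selmer_pairI[OF solvable_T1])
      show "2 * N * (N - M * M) * (2 * N) * (N - M * M) = (2 * N * (N - M * M)) * (2 * N * (N - M * M))"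
        by (simp only: ac_simps)
      show "2 * N * (N - M * M) \<noteq> 0" using N_pos N_gt_M(1) by (metis mult_eq_0_iff less_irrefl zero_neq_numeral)
    qed
    then show ?thesis by (simp only: True if_True)
  next
    case False
    then show ?thesis using S.selmer_pair_one by (simp only: if_False)
  qed
  show "S.selmer_pair (if snd (snd i) then - (2 * N) else 1) (if snd (snd i) then 2 * N * (N + M * M) else 1)"
  proof (cases "snd (snd i)")
    case True
    have "S.selmer_pair (- (2 * N)) (2 * N * (N + M * M))"
    proof (rule S.selmer_pairI[OF solvable_T2])
      show "- (2 * N) * (2 * N * (N + M * M)) * - (N + M * M) = (2 * N * (N + M * M)) * (2 * N * (N + M * M))"
        by (simp only: ac_simps minus_mult_left[symmetric] minus_mult_right[symmetric] minus_minus)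
      show "2 * N * (N + M * M) \<noteq> 0" using N_pos N_gt_M(2) by (metis mult_eq_0_iff less_irrefl zero_neq_numeral)
    qed
    then show ?thesis by (simp only: True if_True)
  next
    case False
    then show ?thesis using S.selmer_pair_one by (simp only: if_False)
  qed
qed

text \<open>A prime in U but not in V would divide the product exactly once.\<close>

lemma prod_primes_square:
  assumes U: "U \<subseteq> exceptional" "V \<subseteq> exceptional" and e: "\<Prod>U * \<Prod>V = s * (s :: int)"
  shows "U \<subseteq> V"
proof
  fix p assume p: "p \<in> U"
  have fin: "finite U" "finite V" using U finite_subset finite_exceptional by auto
  have pr: "Factorial_Ring.prime q" if "q \<in> U \<union> V" for q using that U by (auto simp: exceptional_def good_prime_def)
  show "p \<in> V"
  proof (rule ccontr)
    assume pV: "p \<notin> V"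
    have nd: "\<not> p dvd \<Prod>W" if W: "finite W" "W \<subseteq> U \<union> V" "p \<notin> W" for W
    proof
      assume "p dvd \<Prod>W"
      then obtain q where "q \<in> W" "p dvd q" using prime_dvd_prod_iff[OF W(1) pr[of p]] p by auto
      then show False using primes_dvd_imp_eq[OF pr[of p] pr[of q]] p W by auto
    qed
    have "\<not> p dvd \<Prod>(U - {p}) * \<Prod>V"
      using nd[of "U - {p}"] nd[of V] fin pV prime_dvd_multD[OF pr[of p]] p by auto
    moreover have "p * (\<Prod>(U - {p}) * \<Prod>V) = s * s"
      using e prod.remove[OF fin(1) p, of "\<lambda>x. x"] by (simp add: mult.assoc)
    ultimately show False using prime_times_nonsquare[OF pr[of p]] p by blast
  qed
qed

text \<open>In the product of both components the primes enter only through the square of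
  \<open>Q\<close> and a sign. If the bits differ, what is left modulo squares is d1, d2 or d1 d2 up
  to sign; the sign must be positive, and by \<open>nonsquares\<close> none of these is a square.
  Once the bits agree, the second component alone makes \<open>Q\<close> a square, and the two sets
  of primes coincide.\<close>

lemma index_independent:
  assumes i: "i \<in> index" "i' \<in> index" and a: "comp1 i * comp1 i' = a * a" and b: "comp2 i * comp2 i' = b * b"
  shows "i = i'"
proof -
  obtain U j k where ijk: "i = (U, j, k)" by (cases i) auto
  obtain U' j' k' where ijk': "i' = (U', j', k')" by (cases i') auto
  have U: "U \<subseteq> exceptional" "U' \<subseteq> exceptional" using i ijk ijk' by auto
  have fin: "finite U" "finite U'" using U finite_subset finite_exceptional by auto
  define \<epsilon> where "\<epsilon> = (\<Prod>p\<in>U. sgn4 p) * (\<Prod>p\<in>U'. sgn4 p)"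
  have pm: "(\<Prod>p\<in>W. sgn4 p) = 1 \<or> (\<Prod>p\<in>W. sgn4 p) = - 1" for W
    by (induction W rule: infinite_finite_induct) (auto simp: sgn4_def)
  have \<epsilon>: "\<epsilon> = 1 \<or> \<epsilon> = - 1" using pm[of U] pm[of U'] by (auto simp: \<epsilon>_def)
  define Q where "Q = \<Prod>U * \<Prod>U'"
  have Q: "Q \<noteq> 0" using U fin by (auto simp: Q_def exceptional_def good_prime_def)
  define n d1 d2 where "n = 2 * N" and "d1 = N - M * M" and "d2 = N + M * M"
  have pos: "n > 0" "d1 > 0" "d2 > 0" unfolding n_def d1_def d2_def
    by (rule mult_pos_pos[OF zero_less_numeral N_pos], rule N_gt_M(1), rule N_gt_M(2))
  have ns: "d1 \<noteq> s * s" "d2 \<noteq> s * s" "d1 * d2 \<noteq> s * s" for s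
    unfolding d1_def d2_def by (rule nonsquares)+
  have c1: "comp1 i * comp1 i' = \<epsilon> * Q * ((if j then n * d1 else 1) * (if k then - n else 1) * ((if j' then n * d1 else 1) * (if k' then - n else 1)))"
    unfolding comp1_def ijk ijk' fst_conv snd_conv prod.distrib n_def[symmetric] d1_def[symmetric] \<epsilon>_def Q_def by (simp only: ac_simps)
  have c2: "comp2 i * comp2 i' = Q * ((if j then n else 1) * (if k then n * d2 else 1) * ((if j' then n else 1) * (if k' then n * d2 else 1)))"
    unfolding comp2_def ijk ijk' fst_conv snd_conv n_def[symmetric] d2_def[symmetric] Q_def by (simp only: ac_simps)
  have square: False if z: "comp1 i * comp1 i' * (comp2 i * comp2 i') = r * r * (\<epsilon>' * z)" "r \<noteq> 0" "\<epsilon>' = 1 \<or> \<epsilon>' = - 1" "z > 0" "\<And>s. z \<noteq> s * s" for r z \<epsilon>'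
  proof -
    have "r * r * (\<epsilon>' * z) = (a * b) * (a * b)" unfolding z(1)[symmetric] a b by (simp only: ac_simps)
    then obtain s where s: "\<epsilon>' * z = s * s" using int_square_factor z(2) by blast
    then have "\<epsilon>' * z \<ge> 0" by simp
    then have "\<epsilon>' = 1" using z(3,4) by auto
    then show False using s z(5)[of s] by simp
  qed
  have e: "- \<epsilon> = 1 \<or> - \<epsilon> = - 1" using \<epsilon> by auto
  have "j = j'"
  proof (rule ccontr)
    assume j: "j \<noteq> j'"
    show False
    proof (cases "k = k'")
      case True
      show ?thesis
        by (rule square[of "Q * n * (if k then n * n * d2 else 1)" \<epsilon> d1])
          (use j True Q pos ns \<epsilon> in \<open>auto simp: c1 c2 algebra_simps\<close>)
    next
      case False
      show ?thesis
        by (rule square[of "Q * n * n" "- \<epsilon>" "d1 * d2"])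
          (use j False Q pos ns \<epsilon> in \<open>auto simp: c1 c2 algebra_simps\<close>)
    qed
  qed
  moreover have "k = k'"
  proof (rule ccontr)
    assume k: "k \<noteq> k'"
    show False
      by (rule square[of "Q * n * (if j then n * n * d1 else 1)" "- \<epsilon>" d2])
        (use k \<open>j = j'\<close> Q pos ns \<epsilon> in \<open>auto simp: c1 c2 algebra_simps\<close>)
  qed
  moreover have "U = U'"
  proof -
    define r where "r = (if j then n else 1) * (if k then n * d2 else 1)"
    have "r * r * Q = b * b" using c2 b unfolding r_def \<open>j = j'\<close> \<open>k = k'\<close> by (simp only: ac_simps)
    moreover have "r \<noteq> 0" using pos by (simp add: r_def)
    ultimately obtain s where "Q = s * s" using int_square_factor by blast
    then have "\<Prod>U * \<Prod>U' = s * s" "\<Prod>U' * \<Prod>U = s * s" by (simp_all add: Q_def mult.commute)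
    then show ?thesis using prod_primes_square U by blast
  qed
  ultimately show ?thesis by (simp add: ijk ijk')
qed

theorem selmer_rank2_lower: "selmer_rank2 (split_curve N (- N) (M * M)) \<ge> enat (card exceptional)"
proof (rule S.selmer_rank2_ge[OF _ _ selmer_pair_index index_independent])
  show "finite index" using finite_exceptional by simp
  have "card (UNIV :: (bool \<times> bool) set) = 4" by (simp add: card_UNIV_bool flip: UNIV_Times_UNIV)
  then show "card index = 2 ^ (2 + card exceptional)"
    by (simp only: card_cartesian_product card_Pow[OF finite_exceptional]) (simp add: power_add)
qed

lemma exceptional_eq: "exceptional = {p::int. Factorial_Ring.prime p \<and> p dvd m^4 - 1
           \<and> ([p = 1] (mod 4) \<longrightarrow>
                (\<forall>q. Factorial_Ring.prime q \<and> q dvd m^4 - 1 - 4 * m^2 \<longrightarrow> Legendre p q = 1) \<and>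
                (\<forall>r. Factorial_Ring.prime r \<and> r dvd m^4 - 1 + 4 * m^2 \<longrightarrow> Legendre p r = 1))
           \<and> ([p = 3] (mod 4) \<longrightarrow>
                (\<forall>q. Factorial_Ring.prime q \<and> q dvd m^4 - 1 - 4 * m^2 \<longrightarrow> Legendre p q = 1) \<and>
                (\<forall>r. Factorial_Ring.prime r \<and> r dvd m^4 - 1 + 4 * m^2 \<longrightarrow> Legendre (- p) r = 1))}"
proof -
  have "good_prime p \<longleftrightarrow> Factorial_Ring.prime p \<and> p dvd N
           \<and> ([p = 1] (mod 4) \<longrightarrow>
                (\<forall>q. Factorial_Ring.prime q \<and> q dvd N - M * M \<longrightarrow> Legendre p q = 1) \<and>
                (\<forall>r. Factorial_Ring.prime r \<and> r dvd N + M * M \<longrightarrow> Legendre p r = 1))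
           \<and> ([p = 3] (mod 4) \<longrightarrow>
                (\<forall>q. Factorial_Ring.prime q \<and> q dvd N - M * M \<longrightarrow> Legendre p q = 1) \<and>
                (\<forall>r. Factorial_Ring.prime r \<and> r dvd N + M * M \<longrightarrow> Legendre (- p) r = 1))" for p
  proof (cases "Factorial_Ring.prime p \<and> p dvd N")
    case True
    then have "p > 2" using prime_dvd_N_odd by blast
    then have "odd p" using True prime_odd_int by blast
    then have "p mod 4 = 1 \<or> p mod 4 = 3" by presburger
    then consider "[p = 1] (mod 4)" "\<not> [p = 3] (mod 4)" "sgn4 p * p = p"
      | "[p = 3] (mod 4)" "\<not> [p = 1] (mod 4)" "sgn4 p * p = - p"
      unfolding sgn4_def cong_def by fastforce
    then show ?thesis unfolding good_prime_def by cases (simp_all only: True simp_thms)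
  next
    case False then show ?thesis unfolding good_prime_def by blast
  qed
  then show ?thesis unfolding exceptional_def M_square by (rule Collect_cong)
qed

end

theorem theorem1p2:
  fixes m :: int
  assumes "m > 0" and "even m"
    and "Factorial_Ring.prime (m - 1)" and "Factorial_Ring.prime (m + 1)"
    and "squarefree (m^2 + 1)"
  shows "torsion_part (ec_group rat_field (E_curve m))
           \<cong> integer_mod_group 2 \<times>\<times> integer_mod_group 2
       \<and> group_rank (ec_group rat_field (E_curve m)) \<ge> 2
       \<and> selmer_rank2 (E_curve m) \<ge> enat (card {p::int. Factorial_Ring.prime p \<and> p dvd m^4 - 1
           \<and> ([p = 1] (mod 4) \<longrightarrow>
                (\<forall>q. Factorial_Ring.prime q \<and> q dvd m^4 - 1 - 4 * m^2 \<longrightarrow> Legendre p q = 1) \<and>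
                (\<forall>r. Factorial_Ring.prime r \<and> r dvd m^4 - 1 + 4 * m^2 \<longrightarrow> Legendre p r = 1))
           \<and> ([p = 3] (mod 4) \<longrightarrow>
                (\<forall>q. Factorial_Ring.prime q \<and> q dvd m^4 - 1 - 4 * m^2 \<longrightarrow> Legendre p q = 1) \<and>
                (\<forall>r. Factorial_Ring.prime r \<and> r dvd m^4 - 1 + 4 * m^2 \<longrightarrow> Legendre (- p) r = 1))})"
proof -
  interpret twin_primes m using assms by (rule twin_primes.intro)
  have "m * m * (m * m) = m ^ 4" by (simp add: power4_eq_xxxx)
  then have "N = (m * m - 1) * (m * m + 1)" by (simp add: algebra_simps)
  then interpret R: rank_curve N M m
    by unfold_locales (use N_mod_16 M_square_mod_16 N_gt_M m_ge_4 m_even in auto)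
  show ?thesis
    unfolding E_curve_split exceptional_eq[symmetric]
    using R.torsion_iso R.rank_ge_2 selmer_rank2_lower by blast
qed

end
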